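(* Let $\nu\ge0$, $\gamma\in[0,3/2)$, $\kappa>0$, $0<\alpha<1-3\kappa$, $2\le p<\infty$, $\eta>1/2$, and $\zeta=\Lambda^\alpha\xi$ with $\xi$ a mean-zero spatial white noise on $\mathbb{T}^2$ on a probability space $(\Omega,\mathcal F,\mathbf P)$. Let $S\ge4$, let $\theta_0$ be $\mathcal F$-measurable with zero mean and such that $\mathbf{E}[\|\theta_0\|^m_{C^\eta}]<\infty$ for any $m\ge1$, and let $\theta$ be a solution to $$\partial_t\theta+u\cdot\nabla\theta=-\nu\Lambda^\gamma\theta+\zeta,\qquad u=\nabla^\perp\Lambda^{-1}\theta,\qquad(\ast)$$ starting from $\theta_0$ at time $-S$, of the class described in the context and regarded as a trajectory on $\mathbb{R}$ as explained there. Then there exist a sequence $T_n\to\infty$ and a stationary solution $((\tilde\Omega,\tilde{\mathcal F},\tilde{\mathbf P}),\tilde\theta,\tilde\zeta)$ to $(\ast)$ such that for some $\tau\ge0$ $$\frac1{T_n}\int_0^{T_n}\mathcal{L}[S_{t+\tau}(\theta,\zeta)]\,dt\to\mathcal{L}[\tilde\theta,\tilde\zeta]$$ weakly in the sense of probability measures on $\mathcal{T}$ as $n\to\infty$. Moreover, for some $m\in\mathbb{N}$ and some $\delta\in(0,1)$, $$\tilde{\mathbf{E}}\Big[\|\tilde\theta\|_{C_b(\mathbb{R};B^{-1/2+\delta}_{\infty,1})}+\|\tilde\theta\|_{C_b^{1-\delta}(\mathbb{R};B^{-3/2-\delta}_{\infty,1})}\Big]\lesssim1+\mathbf{E}[\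|\theta_0\|^m_{C^\eta}].$$
   Context: Notation: $\Lambda=(-\Delta)^{1/2}$; $\nabla^\perp=(-\partial_2,\partial_1)$; $\mathcal{R}_j=\partial_j\Lambda^{-1}$ are the Riesz transforms, so $u=\mathcal{R}^\perp\theta=(-\mathcal{R}_2\theta,\mathcal{R}_1\theta)$. $B^s_{p,q}$ is the completion of $C^\infty(\mathbb{T}^2)$ in the usual Littlewood--Paley Besov norm; $C^s=B^s_{\infty,\infty}$; $\dot H^s$ has norm $(\sum_{0\ne k}|k|^{2s}|\hat f(k)|^2)^{1/2}$. $C_b(I;E)$, $C_b^\beta(I;E)$ denote bounded continuous, respectively bounded globally $\beta$-Hölder continuous functions with their usual norms. $a\lesssim b$ means $a\le cb$ for a constant $c>0$. White noise: $(\hat\xi(k))_k$ is a complex-valued centered Gaussian family with $\mathbf{E}[\hat\xi(k)\hat\xi(k')]=\frac1{(2\pi)^2}1_{k=-k'}$, $\overline{\hat\xi(k)}=\hat\xi(-k)$ ($k,k'\ne0$), $\hat\xi(0)=0$. Weak formulation between times $s\le t$: for all $\psi\in C^\infty(\mathbb{T}^2)$, $$\langle\theta(t),\psi\rangle+\int_s^t\tfrac12\langle\Lambda^{-1/2}\theta,\Lambda^{1/2}[\mathcal{R}^\perp\cdot,\nabla\psi]\theta\rangle\,dr=\langle\theta(s),\psi\rangle+\int_s^t\langle\zeta-\nu\Lambda^\gamma\theta,\psi\rangle\,dr,\qquad(W)$$ with $[\mathcal{R}^\perp\cdot,\nabla\psi]=-[\mathcal{R}_2,\partial_1\psi]+[\mathcal{R}_1,\partial_2\psi]$.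 Trajectory space: $\mathcal{T}=C(\mathbb{R};B^{-1/2}_{p,1})\times C(\mathbb{R};B^{-2+\kappa}_{p,p})$ (locally uniform convergence); shifts $S_t(\theta,\zeta)(\cdot)=(\theta,\zeta)(\cdot+t)$, $t\in\mathbb{R}$. Class of solutions considered: $\mathcal F$-measurable solutions obtained by the convex integration construction for the initial value problem, started at time $-S$: they satisfy $\theta(-S)=\theta_0$ and (W) for all $t\ge s\ge-S$, and, after redefining $(\theta,\zeta)(t)=(\theta,\zeta)(-S+4)$ for $t\le-S+4$ so that $(\theta,\zeta)$ is a trajectory in $\mathcal{T}$, they satisfy, for some $\delta\in(0,1)$ and $m\in\mathbb{N}$, $$\mathbf{E}\big[\|\theta\|_{C_b(\mathbb{R};B^{-1/2+\delta}_{\infty,1})}+\|\theta\|_{C^{1-\delta}_b(\mathbb{R};B^{-3/2-\delta}_{\infty,1})}\big]\lesssim1+\mathbf{E}[\|\theta_0\|^m_{C^\eta}].$$ Stationary solution: a triple $((\Omega,\mathcal F,\mathbf P),\theta,\zeta)$, with $\zeta$ having the law of $\Lambda^\alpha\xi$ (constant in time), satisfying (W) for all $t\ge s$ in $\mathbb{R}$ and all $\psi\in C^\infty(\mathbb{T}^2)$, and such that $\mathcal{L}[S_t(\theta,\zeta)]=\mathcal{L}[\theta,\zeta]$ on $\mathcal{T}$ for all $t\in\mathbb{R}$. *)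

theory Defs
  imports "HOL-Probability.Probability"
begin

section \<open>Functions and distributions on the torus\<close>

text \<open>
  The torus is \<open>(\<real> / 2\<pi>\<int>)\<^sup>2\<close>; functions on it are \<open>2\<pi>\<close>-periodic functions on the plane.  A distribution
  \<open>f\<close> on the torus is identified with its family of Fourier coefficients, normalised such that
  \<open>f(x) = (\<Sum>k. f k * exp (\<i> k \<bullet> x))\<close>.  With this normalisation the covariance of white noise
  is \<open>1 / (2\<pi>)\<^sup>2\<close>.
\<close>

type_synonym point = "real \<times> real"
type_synonym freq = "int \<times> int"
type_synonym coeffs = "freq \<Rightarrow> complex"
type_synonym trajectory = "real \<Rightarrow> coeffs"

definition wavevec :: "freq \<Rightarrow> point" where
  "wavevec k = (real_of_int (fst k), real_of_int (snd k))"

definition torus :: "point measure" where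
  "torus = restrict_space lborel ({0..<2 * pi} \<times> {0..<2 * pi})"

primrec ck :: "nat \<Rightarrow> (point \<Rightarrow> real) \<Rightarrow> bool" where
  "ck 0 f \<longleftrightarrow> continuous_on UNIV f"
| "ck (Suc n) f \<longleftrightarrow> (\<exists>f1 f2. ck n f1 \<and> ck n f2 \<and>
     (\<forall>x. (f has_derivative (\<lambda>h. fst h * f1 x + snd h * f2 x)) (at x)))"

definition smooth :: "(point \<Rightarrow> real) \<Rightarrow> bool" where
  "smooth f \<longleftrightarrow> (\<forall>n. ck n f)"

definition smooth_torus :: "(point \<Rightarrow> real) set" where
  "smooth_torus = {f. smooth f \<and> (\<forall>x y. f (x + 2 * pi, y) = f (x, y) \<and> f (x, y + 2 * pi) = f (x, y))}"

definition fourier :: "(point \<Rightarrow> real) \<Rightarrow> coeffs" where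
  "fourier f k = (\<integral>x. of_real (f x) * cis (- (wavevec k \<bullet> x)) \<partial>torus) / of_real ((2 * pi)\<^sup>2)"

text \<open>Real-valued distributions: coefficients of polynomial growth with Hermitian symmetry.\<close>

definition distributions :: "coeffs set" where
  "distributions = {f. (\<forall>k. f (- k) = cnj (f k)) \<and> (\<exists>C N. \<forall>k. norm (f k) \<le> C * (1 + norm (wavevec k)) ^ N)}"

text \<open>The (bilinear, real) duality bracket \<open>\<langle>f, g\<rangle> = \<integral> f g\<close>, by Parseval's identity.\<close>

definition pairing :: "coeffs \<Rightarrow> coeffs \<Rightarrow> complex" where
  "pairing f g = of_real ((2 * pi)\<^sup>2) * (\<Sum>\<^sub>\<infinity>k. f k * g (- k))"

text \<open>The product of a smooth function \<open>g\<close> with a distribution \<open>f\<close> is a convolution of coefficients.\<close>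

definition mult :: "coeffs \<Rightarrow> coeffs \<Rightarrow> coeffs" where
  "mult g f k = (\<Sum>\<^sub>\<infinity>m. g (k - m) * f m)"

text \<open>
  \<open>\<Lambda>\<^sup>s\<close>.  The zero mode is annihilated for \<open>s \<noteq> 0\<close> (also for \<open>s < 0\<close>), whereas \<open>\<Lambda>\<^sup>0\<close> is the identity;
  the case distinction is needed because \<open>0 powr 0 = 0\<close>.
\<close>

definition Lam :: "real \<Rightarrow> coeffs \<Rightarrow> coeffs" where
  "Lam s f k = of_real (if s = 0 then 1 else norm (wavevec k) powr s) * f k"

text \<open>In \<open>partial\<close> and \<open>riesz\<close> the argument \<open>fst\<close> or \<open>snd\<close> selects the coordinate direction 1 or 2.\<close>

definition partial :: "(freq \<Rightarrow> int) \<Rightarrow> coeffs \<Rightarrow> coeffs" where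
  "partial j f k = \<i> * of_int (j k) * f k"

definition riesz :: "(freq \<Rightarrow> int) \<Rightarrow> coeffs \<Rightarrow> coeffs" where
  "riesz j f = partial j (Lam (-1) f)"

definition riesz_comm :: "(freq \<Rightarrow> int) \<Rightarrow> coeffs \<Rightarrow> coeffs \<Rightarrow> coeffs" where
  "riesz_comm j g f k = riesz j (mult g f) k - mult g (riesz j f) k"

text \<open>\<open>[\<R>\<^sup>\<bottom> \<cdot>, \<nabla>\<psi>] f = - [\<R>\<^sub>2, \<partial>\<^sub>1 \<psi>] f + [\<R>\<^sub>1, \<partial>\<^sub>2 \<psi>] f\<close>\<close>

definition sqg_comm :: "(point \<Rightarrow> real) \<Rightarrow> coeffs \<Rightarrow> coeffs" where
  "sqg_comm \<psi> f k =
     - riesz_comm snd (partial fst (fourier \<psi>)) f k + riesz_comm fst (partial snd (fourier \<psi>)) f k"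

definition hdot :: "real \<Rightarrow> coeffs set" where
  "hdot s = {f. (\<lambda>k. norm (wavevec k) powr (2 * s) * (norm (f k))\<^sup>2) summable_on (- {0})}"

section \<open>Besov spaces\<close>

definition supp :: "(point \<Rightarrow> real) \<Rightarrow> point set" where
  "supp f = closure {x. f x \<noteq> 0}"

text \<open>
  A dyadic partition of unity \<open>\<phi>0 = \<rho> 0\<close>, \<open>\<phi>(2\<^sup>-\<^sup>j \<cdot>) = \<rho> (Suc j)\<close>.  The index is shifted by one with
  respect to the usual numbering \<open>j \<ge> -1\<close> of Littlewood--Paley blocks.
\<close>

definition dyadic_partition :: "(nat \<Rightarrow> point \<Rightarrow> real) \<Rightarrow> bool" where
  "dyadic_partition \<rho> \<longleftrightarrow> (\<exists>\<phi>0 \<phi>.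
     smooth \<phi>0 \<and> smooth \<phi> \<and> (\<forall>x. 0 \<le> \<phi>0 x \<and> 0 \<le> \<phi> x) \<and>
     (\<forall>x y. norm x = norm y \<longrightarrow> \<phi>0 x = \<phi>0 y \<and> \<phi> x = \<phi> y) \<and>
     (\<exists>r. supp \<phi>0 \<subseteq> cball 0 r) \<and>
     (\<exists>a b. 0 < a \<and> a < b \<and> supp \<phi> \<subseteq> cball 0 b - ball 0 a) \<and>
     \<rho> 0 = \<phi>0 \<and> (\<forall>j. \<rho> (Suc j) = (\<lambda>x. \<phi> (x /\<^sub>R 2 ^ j)))) \<and>
     (\<forall>x. (\<lambda>j. \<rho> j x) sums 1) \<and>
     (\<forall>i j. i + 1 < j \<longrightarrow> supp (\<rho> i) \<inter> supp (\<rho> j) = {})"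

definition lp_block :: "(nat \<Rightarrow> point \<Rightarrow> real) \<Rightarrow> nat \<Rightarrow> coeffs \<Rightarrow> point \<Rightarrow> complex" where
  "lp_block \<rho> j f x = (\<Sum>k | \<rho> j (wavevec k) \<noteq> 0. of_real (\<rho> j (wavevec k)) * f k * cis (wavevec k \<bullet> x))"

definition ennpowr :: "ennreal \<Rightarrow> real \<Rightarrow> ennreal" where
  "ennpowr x a = (if x = \<infinity> then \<infinity> else ennreal (enn2real x powr a))"

definition Lp_norm :: "ennreal \<Rightarrow> (point \<Rightarrow> complex) \<Rightarrow> ennreal" where
  "Lp_norm p g =
     (if p = \<infinity> then esssup torus (\<lambda>x. ennreal (norm (g x)))
      else ennpowr (\<integral>\<^sup>+x. ennreal (norm (g x) powr enn2real p) \<partial>torus) (1 / enn2real p))"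

definition lq_norm :: "ennreal \<Rightarrow> (nat \<Rightarrow> ennreal) \<Rightarrow> ennreal" where
  "lq_norm q a =
     (if q = \<infinity> then (SUP j. a j) else ennpowr (\<Sum>j. ennpowr (a j) (enn2real q)) (1 / enn2real q))"

text \<open>The norm of \<open>B\<^sup>s\<^sub>p\<^sub>,\<^sub>q\<close>, with value \<open>\<infinity>\<close> allowed.  The weight is \<open>2 powr (s * (real j - 1))\<close> because of
  the index shift.\<close>

definition besov_norm ::
    "(nat \<Rightarrow> point \<Rightarrow> real) \<Rightarrow> real \<Rightarrow> ennreal \<Rightarrow> ennreal \<Rightarrow> coeffs \<Rightarrow> ennreal" where
  "besov_norm \<rho> s p q f =
     lq_norm q (\<lambda>j. ennreal (2 powr (s * (real j - 1))) * Lp_norm p (lp_block \<rho> j f))"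

text \<open>The completion of the smooth functions, realised as a space of distributions.\<close>

definition besov ::
    "(nat \<Rightarrow> point \<Rightarrow> real) \<Rightarrow> real \<Rightarrow> ennreal \<Rightarrow> ennreal \<Rightarrow> coeffs set" where
  "besov \<rho> s p q = {f. \<forall>\<epsilon>>0. \<exists>g\<in>smooth_torus. besov_norm \<rho> s p q (\<lambda>k. f k - fourier g k) < \<epsilon>}"

text \<open>The norms of \<open>C\<^sub>b(\<real>; E)\<close> and \<open>C\<^sub>b\<^sup>\<beta>(\<real>; E)\<close>, where \<open>N\<close> is the norm of \<open>E\<close>.\<close>

definition Cb_norm :: "(coeffs \<Rightarrow> ennreal) \<Rightarrow> trajectory \<Rightarrow> ennreal" where
  "Cb_norm N f = (SUP t. N (f t))"

definition Cb_holder_norm :: "real \<Rightarrow> (coeffs \<Rightarrow> ennreal) \<Rightarrow> trajectory \<Rightarrow> ennreal" where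
  "Cb_holder_norm \<beta> N f = Cb_norm N f +
     (SUP (s, t)\<in>{(s, t). s < t}. N (\<lambda>k. f t k - f s k) / ennreal ((t - s) powr \<beta>))"

definition path_norm :: "(nat \<Rightarrow> point \<Rightarrow> real) \<Rightarrow> real \<Rightarrow> trajectory \<Rightarrow> ennreal" where
  "path_norm \<rho> \<delta> f = Cb_norm (besov_norm \<rho> (- 1 / 2 + \<delta>) \<infinity> 1) f
     + Cb_holder_norm (1 - \<delta>) (besov_norm \<rho> (- 3 / 2 - \<delta>) \<infinity> 1) f"

section \<open>Trajectory space\<close>

definition besov_paths ::
    "(nat \<Rightarrow> point \<Rightarrow> real) \<Rightarrow> real \<Rightarrow> ennreal \<Rightarrow> ennreal \<Rightarrow> trajectory set" where
  "besov_paths \<rho> s p q = {f. (\<forall>t. f t \<in> besov \<rho> s p q) \<and>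
     (\<forall>t. ((\<lambda>r. besov_norm \<rho> s p q (\<lambda>k. f r k - f t k)) \<longlongrightarrow> 0) (at t))}"

text \<open>\<open>C(\<real>; B\<^sup>s\<^sub>p\<^sub>,\<^sub>q)\<close> with the topology of locally uniform convergence.\<close>

definition path_topology ::
    "(nat \<Rightarrow> point \<Rightarrow> real) \<Rightarrow> real \<Rightarrow> ennreal \<Rightarrow> ennreal \<Rightarrow> trajectory topology" where
  "path_topology \<rho> s p q = topology_generated_by
     {{g \<in> besov_paths \<rho> s p q. \<forall>t\<in>{-R..R}. besov_norm \<rho> s p q (\<lambda>k. g t k - f t k) < ennreal \<epsilon>}
      | f R \<epsilon>. f \<in> besov_paths \<rho> s p q \<and> 0 < \<epsilon>}"

definition trajectory_space ::
    "(nat \<Rightarrow> point \<Rightarrow> real) \<Rightarrow> real \<Rightarrow> real \<Rightarrow> (trajectory \<times> trajectory) topology" where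
  "trajectory_space \<rho> \<kappa> p = prod_topology
     (path_topology \<rho> (- 1 / 2) (ennreal p) 1)
     (path_topology \<rho> (- 2 + \<kappa>) (ennreal p) (ennreal p))"

definition borel_of :: "'a topology \<Rightarrow> 'a measure" where
  "borel_of X = sigma (topspace X) {U. openin X U}"

definition time_shift :: "real \<Rightarrow> trajectory \<times> trajectory \<Rightarrow> trajectory \<times> trajectory" where
  "time_shift t w = ((\<lambda>r. fst w (r + t)), (\<lambda>r. snd w (r + t)))"

text \<open>The measure \<open>A \<mapsto> 1/T * \<integral>\<^sub>0\<^sup>T L\<^sub>t(A) dt\<close> on \<open>B\<close>.\<close>

definition time_average :: "'a measure \<Rightarrow> real \<Rightarrow> (real \<Rightarrow> 'a measure) \<Rightarrow> 'a measure" where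
  "time_average B T L = measure_of (space B) (sets B)
     (\<lambda>A. (\<integral>\<^sup>+t\<in>{0..T}. emeasure (L t) A \<partial>lborel) / ennreal T)"

definition weakly_converges :: "'a topology \<Rightarrow> (nat \<Rightarrow> 'a measure) \<Rightarrow> 'a measure \<Rightarrow> bool" where
  "weakly_converges X \<mu> \<mu>' \<longleftrightarrow>
     (\<forall>h :: 'a \<Rightarrow> real. continuous_map X euclideanreal h \<and> bounded (h ` topspace X) \<longrightarrow>
        (\<lambda>n. \<integral>x. h x \<partial>\<mu> n) \<longlonglongrightarrow> (\<integral>x. h x \<partial>\<mu>'))"

section \<open>White noise\<close>

text \<open>Degenerate normal distributions are included.\<close>

definition gaussian_rv :: "'a measure \<Rightarrow> ('a \<Rightarrow> real) \<Rightarrow> bool" where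
  "gaussian_rv M X \<longleftrightarrow> X \<in> borel_measurable M \<and>
     ((\<exists>\<mu>. AE \<omega> in M. X \<omega> = \<mu>) \<or>
      (\<exists>\<mu> \<sigma>. 0 < \<sigma> \<and> distributed M lborel X (\<lambda>x. ennreal (normal_density \<mu> \<sigma> x))))"

text \<open>A complex family is Gaussian if all finite real-linear combinations of the real and imaginary
  parts are, i.e. if all real parts of finite complex-linear combinations are.\<close>

definition gaussian_family :: "'a measure \<Rightarrow> ('a \<Rightarrow> coeffs) \<Rightarrow> bool" where
  "gaussian_family M \<xi> \<longleftrightarrow>
     (\<forall>F a. finite F \<longrightarrow> gaussian_rv M (\<lambda>\<omega>. Re (\<Sum>k\<in>F. a k * \<xi> \<omega> k)))"

definition white_noise :: "'a measure \<Rightarrow> ('a \<Rightarrow> coeffs) \<Rightarrow> bool" where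
  "white_noise M \<xi> \<longleftrightarrow>
     (\<forall>k. (\<lambda>\<omega>. \<xi> \<omega> k) \<in> borel_measurable M) \<and> gaussian_family M \<xi> \<and>
     (\<forall>k. (\<integral>\<omega>. \<xi> \<omega> k \<partial>M) = 0) \<and>
     (\<forall>k k'. k \<noteq> 0 \<and> k' \<noteq> 0 \<longrightarrow>
        (\<integral>\<omega>. \<xi> \<omega> k * \<xi> \<omega> k' \<partial>M) = (if k = - k' then 1 / of_real ((2 * pi)\<^sup>2) else 0)) \<and>
     (AE \<omega> in M. \<xi> \<omega> 0 = 0 \<and> (\<forall>k. k \<noteq> 0 \<longrightarrow> cnj (\<xi> \<omega> k) = \<xi> \<omega> (- k)))"

text \<open>The law of a random distribution, on the product \<open>\<sigma>\<close>-algebra generated by the Fourier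
  coefficients.  It avoids choosing a version of \<open>\<Lambda>\<^sup>\<alpha>\<xi>\<close>, which lies in \<open>B\<^sup>-\<^sup>2\<^sup>+\<^sup>\<kappa>\<^sub>p\<^sub>,\<^sub>p\<close> only almost surely.\<close>

definition coeff_law :: "'a measure \<Rightarrow> ('a \<Rightarrow> coeffs) \<Rightarrow> coeffs measure" where
  "coeff_law M X = distr M (Pi\<^sub>M UNIV (\<lambda>_. borel)) X"

section \<open>Solutions\<close>

text \<open>
  The weak formulation between times \<open>s\<close> and \<open>t\<close>.  The first three conjuncts say that the terms in
  the equation are well defined; they hold automatically on \<open>trajectory_space\<close>.
\<close>

definition weak_form ::
    "real \<Rightarrow> real \<Rightarrow> trajectory \<Rightarrow> trajectory \<Rightarrow> real \<Rightarrow> real \<Rightarrow> (point \<Rightarrow> real) \<Rightarrow> bool" where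
  "weak_form \<nu> \<gamma> \<theta> \<zeta> s t \<psi> \<longleftrightarrow>
     (let N = (\<lambda>r. 1 / 2 * pairing (Lam (- 1 / 2) (\<theta> r)) (Lam (1 / 2) (sqg_comm \<psi> (\<theta> r))));
          F = (\<lambda>r. pairing (\<lambda>k. \<zeta> r k - of_real \<nu> * Lam \<gamma> (\<theta> r) k) (fourier \<psi>))
      in (AE r in lborel. r \<in> {s..t} \<longrightarrow> \<theta> r \<in> hdot (- 1 / 2)) \<and>
         set_integrable lborel {s..t} N \<and> set_integrable lborel {s..t} F \<and>
         pairing (\<theta> t) (fourier \<psi>) + (LINT r:{s..t}|lborel. N r)
           = pairing (\<theta> s) (fourier \<psi>) + (LINT r:{s..t}|lborel. F r))"

text \<open>
  The class of solutions of the initial value problem considered.  \<open>\<theta>\<close> is the solution on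
  \<open>{-S..}\<close> with forcing \<open>\<Lambda>\<^sup>\<alpha>\<xi>\<close>, and \<open>X\<close> is the associated random trajectory on the whole real line,
  frozen before time \<open>-S + 4\<close>.
\<close>

definition solution_class ::
    "(nat \<Rightarrow> point \<Rightarrow> real) \<Rightarrow> real \<Rightarrow> real \<Rightarrow> real \<Rightarrow> real \<Rightarrow> real \<Rightarrow> real \<Rightarrow>
     real \<Rightarrow> real \<Rightarrow> nat \<Rightarrow> 'a measure \<Rightarrow> ('a \<Rightarrow> coeffs) \<Rightarrow> real \<Rightarrow> ('a \<Rightarrow> coeffs) \<Rightarrow>
     ('a \<Rightarrow> trajectory) \<Rightarrow> ('a \<Rightarrow> trajectory \<times> trajectory) \<Rightarrow> bool" where
  "solution_class \<rho> \<nu> \<gamma> \<kappa> \<alpha> p \<eta> c \<delta> m M \<xi> S \<theta>\<^sub>0 \<theta> X \<longleftrightarrow>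
     (\<forall>t\<ge>-S. \<forall>k. (\<lambda>\<omega>. \<theta> \<omega> t k) \<in> borel_measurable M) \<and>
     (AE \<omega> in M. \<theta> \<omega> (- S) = \<theta>\<^sub>0 \<omega> \<and> (\<forall>t\<ge>-S. \<theta> \<omega> t \<in> distributions) \<and>
        (\<forall>s t. -S \<le> s \<and> s \<le> t \<longrightarrow>
          (\<forall>\<psi>\<in>smooth_torus. weak_form \<nu> \<gamma> (\<theta> \<omega>) (\<lambda>_. Lam \<alpha> (\<xi> \<omega>)) s t \<psi>))) \<and>
     X \<in> measurable M (borel_of (trajectory_space \<rho> \<kappa> p)) \<and>
     (AE \<omega> in M. X \<omega> = ((\<lambda>t. \<theta> \<omega> (max t (- S + 4))), (\<lambda>_. Lam \<alpha> (\<xi> \<omega>)))) \<and>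
     (\<integral>\<^sup>+\<omega>. path_norm \<rho> \<delta> (fst (X \<omega>)) \<partial>M)
       \<le> ennreal c * (1 + (\<integral>\<^sup>+\<omega>. (besov_norm \<rho> \<eta> \<infinity> \<infinity> (\<theta>\<^sub>0 \<omega>)) ^ m \<partial>M))"

text \<open>Stationary solutions, where \<open>L\<close> is the law of the forcing.\<close>

definition stationary_solution ::
    "(nat \<Rightarrow> point \<Rightarrow> real) \<Rightarrow> real \<Rightarrow> real \<Rightarrow> real \<Rightarrow> real \<Rightarrow> coeffs measure \<Rightarrow>
     'b measure \<Rightarrow> ('b \<Rightarrow> trajectory) \<Rightarrow> ('b \<Rightarrow> trajectory) \<Rightarrow> bool" where
  "stationary_solution \<rho> \<nu> \<gamma> \<kappa> p L M \<theta> \<zeta> \<longleftrightarrow>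
     (let B = borel_of (trajectory_space \<rho> \<kappa> p) in
      prob_space M \<and> (\<lambda>\<omega>. (\<theta> \<omega>, \<zeta> \<omega>)) \<in> measurable M B \<and>
      (AE \<omega> in M. \<forall>t. \<zeta> \<omega> t = \<zeta> \<omega> 0) \<and> coeff_law M (\<lambda>\<omega>. \<zeta> \<omega> 0) = L \<and>
      (AE \<omega> in M. \<forall>s t. s \<le> t \<longrightarrow> (\<forall>\<psi>\<in>smooth_torus. weak_form \<nu> \<gamma> (\<theta> \<omega>) (\<zeta> \<omega>) s t \<psi>)) \<and>
      (\<forall>t. distr M B (\<lambda>\<omega>. time_shift t (\<theta> \<omega>, \<zeta> \<omega>)) = distr M B (\<lambda>\<omega>. (\<theta> \<omega>, \<zeta> \<omega>))))"

end

theory Submission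
  imports Defs "HOL-Complex_Analysis.Great_Picard"
begin

text \<open>
  This is the Krylov--Bogoliubov argument.  Time averages of the laws of the shifted trajectories are
  shift invariant up to an error of order \<open>1 / T\<close>, so their weak limits are stationary, and the
  point is compactness.  The path norm is shift invariant, hence its first moment bounds the averages
  uniformly, and its sublevel sets are compact by an Arzela--Ascoli argument.  The forcing is constant
  in time, and outside an event of small probability the tails of its Besov series are uniformly small
  (Egorov), which makes its values range in a compact set.

  Instead of a Polish structure on the trajectory space, the Fourier coefficients at rational times are
  used: they are countably many continuous functions separating points, and they code each compact set as
  a closed set of real numbers, so that Prokhorov's theorem reduces to Helly's theorem on the line.

  The weak formulation passes to the limit because the commutator gains one derivative, so that the
  nonlinearity is continuous on \<open>H\<^sup>-\<^sup>1\<^sup>/\<^sup>2\<close>, which contains \<open>B\<^sup>-\<^sup>1\<^sup>/\<^sup>2\<^sub>p\<^sub>,\<^sub>1\<close>.  The trajectories solving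
  the equation from time \<open>-R\<close> on are closed in each compact set and have mass at least
  \<open>1 - R / T\<close> under the averages, hence full mass under the limit.
\<close>

text \<open>The code of a point is only a Borel function of the point, so a limit found on the line
  has to be compared with test functions on each compact set separately. What survives this
  comparison is one robust fact: an upper bound, along the subsequence, for the mass of any set
  whose trace on every compact set of the exhaustion is again compact. The weak formulation, the
  full mass of the exhaustion and the moment bound are all read off from it; shift invariance and
  the law of the forcing are tested with continuous functions.

  The compact sets are chosen invariant under time shifts. Their mass under a time average is then
  the probability that the original random trajectory lies in them, whatever the averaging time, and
  tightness of the averages becomes a statement about a single law. For the solution, the margin
  \<delta> in the regularity of the path norm gives a geometric rate for the tails of the Besov
  series. For the forcing only membership in its Besov space is used, which gives no rate; the tails
  allowed in the compact sets are therefore read off from its law.\<close>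

section \<open>Weak limits on spaces exhausted by compact sets\<close>

text \<open>Digits 0 and 1 in base 3, so that nearby codes agree in their first digits.\<close>

definition code :: "(nat \<Rightarrow> bool) \<Rightarrow> real" where
  "code b = (\<Sum>k. of_bool (b k) * (1 / 3) ^ k)"

lemma code_summable: "summable (\<lambda>k. of_bool (b k) * (1 / 3 :: real) ^ k)"
  by (rule summable_comparison_test'[where g = "\<lambda>k. (1 / 3 :: real) ^ k" and N = 0]) auto

text \<open>After the first differing digit the remaining digits contribute at most the geometric
  tail, which is half of the place value of that digit; a sign change is therefore
  impossible.\<close>

lemma code_diff:
  assumes "\<And>i. i < k \<Longrightarrow> b i = b' i"
  shows "\<exists>t. \<bar>t\<bar> \<le> (1 / 3) ^ k / 2 \<and> code b - code b' = (of_bool (b k) - of_bool (b' k)) * (1 / 3) ^ k + t"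
proof -
  let ?d = "\<lambda>i. (of_bool (b i) - of_bool (b' i)) * (1 / 3 :: real) ^ i"
  have sd: "summable ?d"
    using summable_diff[OF code_summable[of b] code_summable[of b']] by (simp add: left_diff_distrib)
  have "code b - code b' = (\<Sum>i. ?d i)"
    unfolding code_def by (subst suminf_diff) (auto intro: code_summable simp: left_diff_distrib)
  also have "\<dots> = (\<Sum>i. ?d (i + Suc k)) + (\<Sum>i<Suc k. ?d i)"
    by (rule suminf_split_initial_segment[OF sd])
  also have "(\<Sum>i<Suc k. ?d i) = ?d k"
    using assms by simp
  finally have 1: "code b - code b' = ?d k + (\<Sum>i. ?d (i + Suc k))" by simp
  have g: "(\<lambda>i. (1 / 3 :: real) ^ (i + Suc k)) sums ((1 / 3) ^ k / 2)"
    using sums_mult2[OF geometric_sums[of "1 / 3 :: real"], of "(1 / 3) ^ Suc k"]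
    by (simp add: power_add field_simps)
  have le: "norm (?d (i + Suc k)) \<le> (1 / 3) ^ (i + Suc k)" for i
    by (auto simp: of_bool_def)
  have "norm (\<Sum>i. ?d (i + Suc k)) \<le> (\<Sum>i. (1 / 3) ^ (i + Suc k))"
    by (rule norm_suminf_le[OF le sums_summable[OF g]])
  also have "\<dots> = (1 / 3) ^ k / 2"
    using g by (rule sums_unique[symmetric])
  finally show ?thesis using 1 by auto
qed

text \<open>A first disagreement at \<open>i \<le> k\<close> moves the code by
  \<open>(1 / 3) ^ i\<close> up to an error of half that size, so the codes would be at least
  \<open>(1 / 3) ^ k / 2\<close> apart. In base 2 the error could cancel the digit
  completely.\<close>

lemma code_sep:
  assumes "\<bar>code b - code b'\<bar> < (1 / 3) ^ k / 2" "i \<le> k"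
  shows "b i = b' i"
  using assms
proof (induction i rule: less_induct)
  case (less i)
  then have eq: "\<And>j. j < i \<Longrightarrow> b j = b' j" by auto
  obtain t where t: "\<bar>t\<bar> \<le> (1 / 3) ^ i / 2"
      "code b - code b' = (of_bool (b i) - of_bool (b' i)) * (1 / 3) ^ i + t"
    using code_diff[of i b b'] eq by blast
  have p: "(1 / 3 :: real) ^ k \<le> (1 / 3) ^ i"
    using less.prems by (intro power_decreasing) auto
  show ?case
  proof (rule ccontr)
    assume "b i \<noteq> b' i"
    then have "of_bool (b i) - of_bool (b' i) = (1 :: real) \<or> of_bool (b i) - of_bool (b' i) = (-1 :: real)"
      by (cases "b i"; cases "b' i") auto
    then have "code b - code b' = (1 / 3) ^ i + t \<or> code b - code b' = - ((1 / 3) ^ i) + t"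
      using t(2) by (cases "b i"; cases "b' i") auto
    then show False using t(1) less.prems(1) p by linarith
  qed
qed

lemma code_inj: "code b = code b' \<Longrightarrow> b = b'"
  by (rule ext, rule code_sep[of _ _ n n for n]) auto

text \<open>The set of codes is a Cantor set, hence closed: along a convergent sequence each digit
  is eventually constant, and the eventual digits form the code of the limit.\<close>

lemma code_lim:
  assumes "(\<lambda>n. code (b n)) \<longlonglongrightarrow> c"
  obtains b' where "c = code b'" "\<And>k. eventually (\<lambda>n. \<forall>i\<le>k. b n i = b' i) sequentially"
proof -
  have "\<exists>N. \<forall>n\<ge>N. \<bar>code (b n) - code (b N)\<bar> < (1 / 3) ^ k / 2" for k
  proof -
    have "Cauchy (\<lambda>n. code (b n))" using assms by (rule LIMSEQ_imp_Cauchy)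
    from metric_CauchyD[OF this, of "(1 / 3) ^ k / 2"]
    show ?thesis by (auto simp: dist_real_def)
  qed
  then obtain N where N: "\<And>k n. n \<ge> N k \<Longrightarrow> \<bar>code (b n) - code (b (N k))\<bar> < (1 / 3) ^ k / 2"
    by metis
  \<comment> \<open>From the index \<open>N k\<close> on, the codes are so close that their digits
    up to position \<open>k\<close> no longer change, so the diagonal entry is the final
    value.\<close>
  define b' where "b' k = b (N k) k" for k
  have ev: "eventually (\<lambda>n. \<forall>i\<le>k. b n i = b' i) sequentially" for k
  proof -
    have "eventually (\<lambda>n. b n i = b' i) sequentially" for i
      using eventually_ge_at_top[of "N i"] by eventually_elim (metis b'_def code_sep N order_refl)
    then have "eventually (\<lambda>n. \<forall>i\<in>{..k}. b n i = b' i) sequentially"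
      by (intro eventually_ball_finite) auto
    then show ?thesis by (auto elim: eventually_mono)
  qed
  have "(\<lambda>n. code (b n)) \<longlonglongrightarrow> code b'"
  proof (rule tendstoI)
    fix \<epsilon> :: real assume "\<epsilon> > 0"
    then obtain k where k: "(1 / 3 :: real) ^ k < \<epsilon>"
      using real_arch_pow_inv[of \<epsilon> "1 / 3"] by auto
    show "eventually (\<lambda>n. dist (code (b n)) (code b') < \<epsilon>) sequentially"
      using ev[of k]
    proof eventually_elim
      case (elim n)
      then have "\<And>i. i < k \<Longrightarrow> b n i = b' i" by auto
      from code_diff[of k "b n" b', OF this] elim
      have "\<bar>code (b n) - code b'\<bar> \<le> (1 / 3) ^ k / 2" by auto
      moreover have "(1 / 3 :: real) ^ k > 0" by simp
      ultimately show ?case using k unfolding dist_real_def by linarith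
    qed
  qed
  with assms have "c = code b'" by (rule LIMSEQ_unique)
  with ev show ?thesis by (intro that)
qed

section \<open>Sequences of real numbers as bit sequences\<close>

text \<open>The partial sums telescope to the dyadic approximations
  \<open>of_int \<lfloor>2 ^ n * y\<rfloor> / 2 ^ n\<close>, which lie within
  \<open>(1 / 2) ^ n\<close> below \<open>y\<close>.\<close>

lemma binary_digits:
  assumes "0 \<le> y" "y < (1 :: real)"
  shows "(\<lambda>j. of_bool (odd \<lfloor>2 ^ Suc j * y\<rfloor>) * (1 / 2) ^ Suc j) sums y"
proof -
  have p: "(\<Sum>j<n. of_bool (odd \<lfloor>2 ^ Suc j * y\<rfloor>) * (1 / 2) ^ Suc j) = of_int \<lfloor>2 ^ n * y\<rfloor> / (2 :: real) ^ n" for n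
  proof (induction n)
    case 0
    then show ?case using assms by (simp add: floor_eq_iff)
  next
    case (Suc n)
    define z where "z = 2 ^ n * y"
    have "\<lfloor>2 * z\<rfloor> = 2 * \<lfloor>z\<rfloor> \<or> \<lfloor>2 * z\<rfloor> = 2 * \<lfloor>z\<rfloor> + 1" by linarith
    then have "of_int \<lfloor>2 * z\<rfloor> = 2 * of_int \<lfloor>z\<rfloor> + (of_bool (odd \<lfloor>2 * z\<rfloor>) :: real)" by auto
    then have "of_int \<lfloor>2 * z\<rfloor> / 2 ^ Suc n = of_int \<lfloor>z\<rfloor> / 2 ^ n + of_bool (odd \<lfloor>2 * z\<rfloor>) * (1 / 2 :: real) ^ Suc n"
      by (simp add: field_simps)
    moreover have "2 ^ Suc n * y = 2 * z" by (simp add: z_def)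
    ultimately show ?case using Suc.IH unfolding sum.lessThan_Suc by (metis z_def)
  qed
  have "(\<lambda>n. of_int \<lfloor>2 ^ n * y\<rfloor> / (2 :: real) ^ n) \<longlonglongrightarrow> y"
  proof (rule real_tendsto_sandwich)
    show "eventually (\<lambda>n. y - (1 / 2) ^ n \<le> of_int \<lfloor>2 ^ n * y\<rfloor> / (2 :: real) ^ n) sequentially"
    proof (rule always_eventually, rule allI)
      fix n
      have "2 ^ n * y - 1 \<le> of_int \<lfloor>2 ^ n * y\<rfloor>" by linarith
      then have "(2 ^ n * y - 1) / 2 ^ n \<le> of_int \<lfloor>2 ^ n * y\<rfloor> / (2 :: real) ^ n"
        by (rule divide_right_mono) auto
      then show "y - (1 / 2) ^ n \<le> of_int \<lfloor>2 ^ n * y\<rfloor> / (2 :: real) ^ n" by (simp add: field_simps)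
    qed
    show "eventually (\<lambda>n. of_int \<lfloor>2 ^ n * y\<rfloor> / (2 :: real) ^ n \<le> y) sequentially"
      by (rule always_eventually, rule allI) (simp add: pos_divide_le_eq mult.commute)
    show "(\<lambda>n. y - (1 / 2) ^ n) \<longlonglongrightarrow> y"
      using tendsto_diff[OF tendsto_const LIMSEQ_power_zero[of "1 / 2 :: real"], of y] by simp
  qed auto
  then show ?thesis unfolding sums_def p .
qed

text \<open>Decoding is continuous in the bits, whereas its right inverse \<open>enc\<close> jumps
  at dyadic rationals. Limits are therefore always taken through \<open>dec\<close>, and
  \<open>enc\<close> only has to be Borel measurable.\<close>

definition dec :: "(nat \<Rightarrow> bool) \<Rightarrow> nat \<Rightarrow> real" where
  "dec b i = (\<Sum>j. of_bool (b (prod_encode (i, j))) * (1 / 2) ^ Suc j)"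

definition enc :: "(nat \<Rightarrow> real) \<Rightarrow> nat \<Rightarrow> bool" where
  "enc y k = (case prod_decode k of (i, j) \<Rightarrow> odd \<lfloor>2 ^ Suc j * y i\<rfloor>)"

lemma dec_enc: "(\<And>i. 0 \<le> y i \<and> y i < 1) \<Longrightarrow> dec (enc y) = y"
  unfolding dec_def enc_def by (rule ext) (simp add: sums_unique[OF binary_digits, symmetric] del: power_Suc)

text \<open>Agreement of the first \<open>J\<close> digits of the coordinate leaves an error of at
  most \<open>(1 / 2) ^ J\<close>, and these digits occupy finitely many positions of the bit
  sequence.\<close>

lemma dec_lim:
  assumes "\<And>k. eventually (\<lambda>n. \<forall>i\<le>k. b n i = b' i) sequentially"
  shows "(\<lambda>n. dec (b n) i) \<longlonglongrightarrow> dec b' i"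
  unfolding dec_def
proof (rule tendstoI)
  fix \<epsilon> :: real assume "\<epsilon> > 0"
  then obtain J where J: "(1 / 2 :: real) ^ J < \<epsilon>"
    using real_arch_pow_inv[of \<epsilon> "1 / 2"] by auto
  let ?t = "\<lambda>b j. of_bool (b (prod_encode (i, j))) * (1 / 2 :: real) ^ Suc j"
  have gs: "summable (\<lambda>j. (1 / 2 :: real) ^ Suc j)" by (simp add: summable_Suc_iff)
  have st: "summable (?t b)" for b :: "nat \<Rightarrow> bool"
    by (rule summable_comparison_test'[OF gs, of 0]) auto
  have "eventually (\<lambda>n. \<forall>j\<in>{..<J}. b n (prod_encode (i, j)) = b' (prod_encode (i, j))) sequentially"
    by (intro eventually_ball_finite ballI, simp) (rule eventually_mono[OF assms], auto)
  then show "eventually (\<lambda>n. dist (\<Sum>j. ?t (b n) j) (\<Sum>j. ?t b' j) < \<epsilon>) sequentially"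
  proof eventually_elim
    case (elim n)
    have "(\<Sum>j. ?t (b n) j) - (\<Sum>j. ?t b' j) = (\<Sum>j. ?t (b n) j - ?t b' j)"
      by (rule suminf_diff[OF st st])
    also have "\<dots> = (\<Sum>j. ?t (b n) (j + J) - ?t b' (j + J)) + (\<Sum>j<J. ?t (b n) j - ?t b' j)"
      by (rule suminf_split_initial_segment[OF summable_diff[OF st st]])
    also have "(\<Sum>j<J. ?t (b n) j - ?t b' j) = 0"
      using elim by (intro sum.neutral) auto
    finally have "norm ((\<Sum>j. ?t (b n) j) - (\<Sum>j. ?t b' j)) = norm (\<Sum>j. ?t (b n) (j + J) - ?t b' (j + J))"
      by simp
    also have "\<dots> \<le> (\<Sum>j. (1 / 2) ^ Suc (j + J))"
      using gs by (intro norm_suminf_le) (auto simp: summable_iff_shift[of "\<lambda>j. (1 / 2 :: real) ^ Suc j"])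
    also have "\<dots> = (1 / 2) ^ J"
      using sums_mult2[OF geometric_sums[of "1 / 2 :: real"], of "(1 / 2) ^ Suc J"]
      by (intro sums_unique[symmetric]) (simp add: power_add field_simps)
    finally show ?case using J by (simp add: dist_norm)
  qed
qed

section \<open>Sequential compactness and Borel sets of a topology\<close>

text \<open>The sequential form is the convenient one at both ends: Arzela--Ascoli produces
  subsequences, and closedness of a coded set in the line is tested by sequences.\<close>

definition seq_compactin :: "'a topology \<Rightarrow> 'a set \<Rightarrow> bool" where
  "seq_compactin X Y \<longleftrightarrow> Y \<subseteq> topspace X \<and>
     (\<forall>\<sigma> :: nat \<Rightarrow> 'a. (\<forall>n. \<sigma> n \<in> Y) \<longrightarrow> (\<exists>l\<in>Y. \<exists>r. strict_mono r \<and> limitin X (\<sigma> \<circ> r) l sequentially))"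

lemma seq_compactin_closedin:
  assumes "seq_compactin X Y" "closedin X F"
  shows "seq_compactin X (Y \<inter> F)"
  unfolding seq_compactin_def
proof (intro conjI allI impI)
  show "Y \<inter> F \<subseteq> topspace X" using assms by (auto simp: seq_compactin_def)
  fix \<sigma> assume \<sigma>: "\<forall>n :: nat. \<sigma> n \<in> Y \<inter> F"
  then obtain l r where l: "l \<in> Y" "strict_mono r" "limitin X (\<sigma> \<circ> r) l sequentially"
    using assms(1) unfolding seq_compactin_def by blast
  have "l \<in> F"
    by (rule limitin_closedin[OF l(3) assms(2)]) (use \<sigma> in \<open>auto intro: always_eventually\<close>)
  with l show "\<exists>l\<in>Y \<inter> F. \<exists>r. strict_mono r \<and> limitin X (\<sigma> \<circ> r) l sequentially" by blast
qed

lemma borel_of_simps [simp]: "space (borel_of X) = topspace X"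
  and sets_borel_of: "sets (borel_of X) = sigma_sets (topspace X) {U. openin X U}"
  using openin_subset[of X] by (auto simp: borel_of_def space_measure_of_conv intro!: sets_measure_of)

lemma openin_borel_of: "openin X U \<Longrightarrow> U \<in> sets (borel_of X)"
  by (simp add: sets_borel_of)

lemma closedin_borel_of: "closedin X U \<Longrightarrow> U \<in> sets (borel_of X)"
  by (metis borel_of_simps closedin_def closedin_topspace double_diff openin_borel_of order_refl
      sets.Diff sets.top)

lemma measurable_into_borel_of:
  assumes "f \<in> space M \<rightarrow> topspace X" "\<And>U. openin X U \<Longrightarrow> f -` U \<inter> space M \<in> sets M"
  shows "f \<in> measurable M (borel_of X)"
  unfolding borel_of_def
  by (rule measurable_measure_of) (use assms openin_subset[of X] in auto)

lemma continuous_map_measurable: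
  assumes "continuous_map X Y f"
  shows "f \<in> measurable (borel_of X) (borel_of Y)"
proof (rule measurable_into_borel_of)
  show "f \<in> space (borel_of X) \<rightarrow> topspace Y" using assms by (auto simp: continuous_map_def)
  fix U assume "openin Y U"
  then have "openin X {x \<in> topspace X. f x \<in> U}" using assms by (auto simp: continuous_map_def)
  moreover have "f -` U \<inter> space (borel_of X) = {x \<in> topspace X. f x \<in> U}" by auto
  ultimately show "f -` U \<inter> space (borel_of X) \<in> sets (borel_of X)" by (simp add: openin_borel_of)
qed

lemma borel_of_euclidean: "sets (borel_of euclidean) = sets borel"
  by (simp add: sets_borel_of borel_def)

lemma continuous_map_borel_measurable:
  assumes "continuous_map X euclidean f"
  shows "f \<in> borel_measurable (borel_of X)"
  using continuous_map_measurable[OF assms] measurable_cong_sets[OF refl borel_of_euclidean] by blast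

section \<open>Closed sets under weak convergence on the line\<close>

text \<open>The bounded continuous functions \<open>max 0 (1 - real k * infdist x F)\<close>
  dominate the indicator of \<open>F\<close> and decrease to it; one whose limit integral is within
  \<epsilon> of the measure of \<open>F\<close> controls all late measures.\<close>

lemma weak_conv_m_closed:
  assumes \<nu>: "\<And>n. real_distribution (\<nu> n)" "real_distribution \<nu>'" "weak_conv_m \<nu> \<nu>'"
    and F: "closed F" and \<epsilon>: "\<epsilon> > 0"
  shows "eventually (\<lambda>n. measure (\<nu> n) F \<le> measure \<nu>' F + \<epsilon>) sequentially"
proof (cases "F = {}")
  case True
  then show ?thesis using \<epsilon> by simp
next
  case False
  interpret \<nu>': real_distribution \<nu>' by fact
  define f where "f k x = max 0 (1 - real k * infdist x F)" for k and x :: real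
  have f1: "isCont (f k) x" "norm (f k x) \<le> 1" for k x
    unfolding f_def by (intro continuous_intros) (auto simp: infdist_nonneg)
  have fm: "f k \<in> borel_measurable borel" for k
    using f1(1) by (intro borel_measurable_continuous_onI continuous_at_imp_continuous_on) auto
  have FM: "F \<in> sets borel" using F by simp
  have "(\<lambda>k. f k x) \<longlonglongrightarrow> indicator F x" for x
  proof (cases "x \<in> F")
    case True
    then show ?thesis by (simp add: f_def)
  next
    case False
    then have "infdist x F > 0"
      using F \<open>F \<noteq> {}\<close> by (metis in_closed_iff_infdist_zero infdist_nonneg less_eq_real_def)
    then obtain K where K: "real K * infdist x F > 1" using reals_Archimedean3 by blast
    have "eventually (\<lambda>k. f k x = 0) sequentially"
      using eventually_ge_at_top[of K]
    proof eventually_elim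
      case (elim k)
      then have "real K * infdist x F \<le> real k * infdist x F"
        by (intro mult_right_mono) (auto simp: infdist_nonneg)
      then show ?case using K by (simp add: f_def)
    qed
    then show ?thesis using False by (simp add: tendsto_eventually)
  qed
  then have "(\<lambda>k. \<integral>x. f k x \<partial>\<nu>') \<longlonglongrightarrow> (\<integral>x. indicator F x \<partial>\<nu>')"
    using FM fm f1(2) by (intro integral_dominated_convergence[where w = "\<lambda>_. 1"]) auto
  then have "(\<lambda>k. \<integral>x. f k x \<partial>\<nu>') \<longlonglongrightarrow> measure \<nu>' F" using FM by simp
  from order_tendstoD(2)[OF this, of "measure \<nu>' F + \<epsilon>"] \<epsilon>
  obtain k where k: "(\<integral>x. f k x \<partial>\<nu>') < measure \<nu>' F + \<epsilon>"
    by (auto simp: eventually_sequentially)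
  have "(\<lambda>n. \<integral>x. f k x \<partial>\<nu> n) \<longlonglongrightarrow> (\<integral>x. f k x \<partial>\<nu>')"
    by (rule weak_conv_imp_integral_bdd_continuous_conv[OF \<nu> f1])
  from order_tendstoD(2)[OF this k] show ?thesis
  proof eventually_elim
    case (elim n)
    interpret \<nu>: real_distribution "\<nu> n" by fact
    have fn: "f k \<in> borel_measurable (\<nu> n)"
      using fm by simp
    have "measure (\<nu> n) F = (\<integral>x. indicator F x \<partial>\<nu> n)" using FM by simp
    also have "\<dots> \<le> (\<integral>x. f k x \<partial>\<nu> n)"
      using FM fn f1(2)[of k]
      by (intro integral_mono \<nu>.integrable_const_bound[where B = 1] AE_I2)
         (auto, auto simp: f_def infdist_nonneg split: split_indicator)
    finally show ?case using elim by simp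
  qed
qed

text \<open>Because codes stay in a bounded interval, laws of codes are automatically tight on the
  line, so a Helly limit is a probability measure. The tightness assumption of
  \<open>prokhorov\<close> has a different task: it keeps the limit on codes of actual
  points.\<close>

lemma code_bounds: "0 \<le> code b" "code b \<le> 3 / 2"
proof -
  show "0 \<le> code b" unfolding code_def by (intro suminf_nonneg code_summable) auto
  have "code b \<le> (\<Sum>k. (1 / 3) ^ k)"
    unfolding code_def by (intro suminf_le code_summable summable_geometric) auto
  then show "code b \<le> 3 / 2" by (simp add: suminf_geometric)
qed

lemma code_enc_measurable [measurable]: "(\<lambda>y. code (enc y)) \<in> borel_measurable (Pi\<^sub>M UNIV (\<lambda>_. borel))"
proof -
  have "(\<lambda>y. of_bool (enc y k) * (1 / 3 :: real) ^ k) \<in> borel_measurable (Pi\<^sub>M UNIV (\<lambda>_. borel))" for k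
  proof -
    obtain i j where ij: "prod_decode k = (i, j)" by fastforce
    have "(\<lambda>y :: nat \<Rightarrow> real. \<lfloor>2 ^ Suc j * y i\<rfloor>) \<in> measurable (Pi\<^sub>M UNIV (\<lambda>_. borel)) (count_space UNIV)"
      by measurable
    moreover have "(\<lambda>z. of_bool (odd z) * (1 / 3 :: real) ^ k) \<in> borel_measurable (count_space (UNIV :: int set))"
      by simp
    ultimately show ?thesis
      unfolding enc_def ij prod.case by (rule measurable_compose)
  qed
  then show ?thesis unfolding code_def by measurable
qed

lemma (in prob_space) integral_bound_off:
  fixes f :: "'a \<Rightarrow> real"
  assumes "f \<in> borel_measurable M" "\<And>x. x \<in> space M \<Longrightarrow> \<bar>f x\<bar> \<le> B" "A \<in> events" "\<And>x. x \<in> A \<Longrightarrow> f x = 0"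
  shows "\<bar>\<integral>x. f x \<partial>M\<bar> \<le> B * (1 - prob A)"
proof -
  have B: "0 \<le> B" using assms(2) not_empty by fastforce
  have "\<bar>\<integral>x. f x \<partial>M\<bar> \<le> (\<integral>x. \<bar>f x\<bar> \<partial>M)" by (rule integral_abs_bound)
  also have "\<dots> \<le> (\<integral>x. B * indicator (space M - A) x \<partial>M)"
    using assms B
    by (intro integral_mono integrable_const_bound[where B = B] integrable_mult_right)
       (auto split: split_indicator intro!: AE_I2)
  also have "\<dots> = B * (1 - prob A)" using assms by (simp add: prob_compl)
  finally show ?thesis .
qed

section \<open>Laws of families of real random variables\<close>

text \<open>Continuous functions increasing to the indicator of \<open>y < a\<close> as
  \<open>k\<close> grows. Their finite products are the test functions from which joint distribution
  functions are recovered.\<close>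

definition ramp :: "nat \<Rightarrow> real \<Rightarrow> real \<Rightarrow> real" where
  "ramp k a y = min 1 (max 0 (real k * (a - y)))"

lemma ramp_bounds: "0 \<le> ramp k a y" "ramp k a y \<le> 1"
  by (auto simp: ramp_def)

lemma ramp_prod_bounds: "0 \<le> (\<Prod>i\<in>J. ramp k (a i) (y i))" "(\<Prod>i\<in>J. ramp k (a i) (y i)) \<le> 1"
  by (auto intro!: prod_nonneg prod_le_1 simp: ramp_bounds)

lemma ramp_prod_abs: "\<bar>\<Prod>i\<in>J. ramp k (a i) (y i)\<bar> \<le> 1"
  using ramp_prod_bounds(1)[of k a y J] ramp_prod_bounds(2)[of k a y J] by linarith

lemma ramp_measurable [measurable]: "ramp k a \<in> borel_measurable borel"
  unfolding ramp_def by measurable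

lemma ramp_lim: "(\<lambda>k. ramp k a y) \<longlonglongrightarrow> of_bool (y < a)"
proof (cases "y < a")
  case True
  then obtain K where K: "real K * (a - y) > 1"
    using reals_Archimedean3[of "a - y"] by auto
  have "eventually (\<lambda>k. ramp k a y = 1) sequentially"
    using eventually_ge_at_top[of K]
  proof eventually_elim
    case (elim k)
    then have "real K * (a - y) \<le> real k * (a - y)"
      using True by (intro mult_right_mono) auto
    then show ?case using K by (simp add: ramp_def)
  qed
  then show ?thesis using True by (simp add: tendsto_eventually)
next
  case False
  then have "ramp k a y = 0" for k by (simp add: ramp_def mult_nonneg_nonpos)
  then show ?thesis using False by simp
qed

lemma sets_PiM_less:
  "sets (Pi\<^sub>M (UNIV :: 'i set) (\<lambda>_. borel :: real measure)) =
     sigma_sets UNIV {{f. \<forall>i\<in>J. f i < a i} | J a. finite J}" (is "_ = sigma_sets UNIV ?E")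
proof
  let ?S = "sigma UNIV ?E"
  have S: "sets ?S = sigma_sets UNIV ?E" "space ?S = UNIV" by (auto intro: sets_measure_of)
  have "(\<lambda>f. f i) \<in> borel_measurable ?S" for i
  proof (rule borel_measurableI_less)
    fix y :: real
    have "{f. f i < y} \<in> ?E" by (intro CollectI exI[of _ "{i}"] exI[of _ "\<lambda>_. y"]) auto
    then have "{f. f i < y} \<in> sigma_sets UNIV ?E" by blast
    then show "{f \<in> space ?S. f i < y} \<in> sets ?S" unfolding S by simp
  qed
  then have "(\<lambda>f i. f i) \<in> measurable ?S (Pi\<^sub>M UNIV (\<lambda>_. borel))"
    by (intro measurable_PiM_single') auto
  from measurable_sets[OF this] show "sets (Pi\<^sub>M UNIV (\<lambda>_. borel)) \<subseteq> sigma_sets UNIV ?E"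
    unfolding S by auto
  show "sigma_sets UNIV ?E \<subseteq> sets (Pi\<^sub>M (UNIV :: 'i set) (\<lambda>_. borel :: real measure))"
  proof -
    have "?E \<subseteq> sets (Pi\<^sub>M (UNIV :: 'i set) (\<lambda>_. borel :: real measure))"
    proof clarify
      fix J :: "'i set" and a :: "'i \<Rightarrow> real" assume "finite J"
      then have "{f \<in> space (Pi\<^sub>M UNIV (\<lambda>_. borel)). \<forall>i\<in>J. f i < a i} \<in> sets (Pi\<^sub>M (UNIV :: 'i set) (\<lambda>_. borel :: real measure))"
        by measurable
      then show "{f. \<forall>i\<in>J. f i < a i} \<in> sets (Pi\<^sub>M (UNIV :: 'i set) (\<lambda>_. borel :: real measure))"
        by (simp add: space_PiM)
    qed
    from sets.sigma_sets_subset[OF this] show ?thesis by (simp add: space_PiM)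
  qed
qed

lemma (in prob_space) ramp_integral_lim:
  assumes [measurable]: "\<And>i. e i \<in> borel_measurable M" and J: "finite J"
  shows "(\<lambda>k. \<integral>x. (\<Prod>i\<in>J. ramp k (a i) (e i x)) \<partial>M) \<longlonglongrightarrow> prob {x \<in> space M. \<forall>i\<in>J. e i x < a i}"
proof -
  have [measurable]: "{x \<in> space M. \<forall>i\<in>J. e i x < a i} \<in> events" using J by measurable
  have "(\<lambda>k. \<integral>x. (\<Prod>i\<in>J. ramp k (a i) (e i x)) \<partial>M)
      \<longlonglongrightarrow> (\<integral>x. (\<Prod>i\<in>J. of_bool (e i x < a i) :: real) \<partial>M)"
    using J by (intro integral_dominated_convergence[where w = "\<lambda>_. 1"] AE_I2 tendsto_prod ramp_lim) (auto simp: ramp_prod_abs)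
  also have "(\<integral>x. (\<Prod>i\<in>J. of_bool (e i x < a i) :: real) \<partial>M) = (\<integral>x. indicator {x \<in> space M. \<forall>i\<in>J. e i x < a i} x \<partial>M)"
  proof (intro Bochner_Integration.integral_cong refl)
    fix x assume "x \<in> space M"
    then show "(\<Prod>i\<in>J. of_bool (e i x < a i)) = (indicator {x \<in> space M. \<forall>i\<in>J. e i x < a i} x :: real)"
      using J by (auto simp: indicator_def intro!: prod.neutral)
  qed
  finally show ?thesis by simp
qed

text \<open>By dominated convergence the integrals of the ramp products determine the probabilities
  of boxes unbounded below. These boxes are stable under intersection and generate the product
  \<sigma>-algebra, so the laws agree.\<close>

lemma law_eqI:
  fixes e :: "'i \<Rightarrow> 'x \<Rightarrow> real" and e' :: "'i \<Rightarrow> 'y \<Rightarrow> real"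
  assumes P: "prob_space P" "prob_space Q"
    and m [measurable]: "\<And>i. e i \<in> borel_measurable P" "\<And>i. e' i \<in> borel_measurable Q"
    and eq: "\<And>J a k. finite J \<Longrightarrow>
      (\<integral>x. (\<Prod>i\<in>J. ramp k (a i) (e i x)) \<partial>P) = (\<integral>x. (\<Prod>i\<in>J. ramp k (a i) (e' i x)) \<partial>Q)"
  shows "distr P (Pi\<^sub>M UNIV (\<lambda>_. borel)) (\<lambda>x i. e i x) = distr Q (Pi\<^sub>M UNIV (\<lambda>_. borel)) (\<lambda>x i. e' i x)"
    (is "?P = ?Q")
proof -
  interpret P: prob_space P by fact
  interpret Q: prob_space Q by fact
  have mP: "(\<lambda>x i. e i x) \<in> measurable P (Pi\<^sub>M UNIV (\<lambda>_. borel))"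
    and mQ: "(\<lambda>x i. e' i x) \<in> measurable Q (Pi\<^sub>M UNIV (\<lambda>_. borel))"
    by (auto intro!: measurable_PiM_single')
  interpret P': prob_space ?P by (rule P.prob_space_distr[OF mP])
  interpret Q': prob_space ?Q by (rule Q.prob_space_distr[OF mQ])
  let ?E = "{{f :: 'i \<Rightarrow> real. \<forall>i\<in>J. f i < a i} | J a. finite J}"
  have "Int_stable ?E"
  proof (rule Int_stableI)
    fix A B assume "A \<in> ?E" "B \<in> ?E"
    obtain J a where A: "A = {f. \<forall>i\<in>J. f i < a i}" "finite J" using \<open>A \<in> ?E\<close> by (elim CollectE exE conjE)
    obtain J' a' where B: "B = {f. \<forall>i\<in>J'. f i < a' i}" "finite J'" using \<open>B \<in> ?E\<close> by (elim CollectE exE conjE)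
    note AB = A B
    define a'' where "a'' i = (if i \<in> J then if i \<in> J' then min (a i) (a' i) else a i else a' i)" for i
    have "A \<inter> B = {f. \<forall>i\<in>J \<union> J'. f i < a'' i}"
      unfolding AB a''_def by (auto split: if_splits)
    moreover have "finite (J \<union> J')" using AB by simp
    ultimately show "A \<inter> B \<in> ?E" by (intro CollectI exI[of _ "J \<union> J'"] exI[of _ a''] conjI)
  qed
  moreover have "?E \<subseteq> Pow UNIV" by simp
  moreover have "emeasure ?P A = emeasure ?Q A" if "A \<in> ?E" for A
  proof -
    have "\<exists>J a. A = {f. \<forall>i\<in>J. f i < a i} \<and> finite J" using that by (rule CollectD)
    then obtain J a where A: "A = {f. \<forall>i\<in>J. f i < a i}" and J: "finite J" by (elim exE conjE)
    have As: "A \<in> sets (Pi\<^sub>M UNIV (\<lambda>_. borel))"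
      unfolding sets_PiM_less by (rule sigma_sets.Basic[OF that])
    have "(\<lambda>k. \<integral>x. (\<Prod>i\<in>J. ramp k (a i) (e i x)) \<partial>P) \<longlonglongrightarrow> P.prob {x \<in> space P. \<forall>i\<in>J. e i x < a i}"
      by (rule P.ramp_integral_lim[OF m(1) J])
    moreover have "(\<lambda>k. \<integral>x. (\<Prod>i\<in>J. ramp k (a i) (e i x)) \<partial>P) \<longlonglongrightarrow> Q.prob {x \<in> space Q. \<forall>i\<in>J. e' i x < a i}"
      unfolding eq[OF J] by (rule Q.ramp_integral_lim[OF m(2) J])
    ultimately have "P.prob {x \<in> space P. \<forall>i\<in>J. e i x < a i} = Q.prob {x \<in> space Q. \<forall>i\<in>J. e' i x < a i}"
      by (rule LIMSEQ_unique)
    moreover have "(\<lambda>x i. e i x) -` A \<inter> space P = {x \<in> space P. \<forall>i\<in>J. e i x < a i}"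
        "(\<lambda>x i. e' i x) -` A \<inter> space Q = {x \<in> space Q. \<forall>i\<in>J. e' i x < a i}"
      unfolding A by auto
    ultimately show ?thesis
      using As by (simp add: emeasure_distr mP mQ P.emeasure_eq_measure Q.emeasure_eq_measure)
  qed
  moreover have "sets ?P = sigma_sets UNIV ?E" "sets ?Q = sigma_sets UNIV ?E"
    by (simp_all add: sets_PiM_less)
  moreover have "range (\<lambda>_ :: nat. UNIV) \<subseteq> ?E"
    by (auto intro!: exI[of _ "{}"])
  moreover have "(\<Union>i :: nat. UNIV) = (UNIV :: ('i \<Rightarrow> real) set)" by simp
  moreover have "emeasure ?P UNIV \<noteq> \<infinity>" by simp
  ultimately show ?thesis by (rule measure_eqI_generator_eq[where A = "\<lambda>_. UNIV"])
qed

text \<open>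
  The topological space need not be metrizable; the functions \<open>e i\<close> separate its points and hence
  determine convergence in each of the sequentially compact sets \<open>K m\<close>.
\<close>

locale coded_space =
  fixes X :: "'x topology" and e :: "nat \<Rightarrow> 'x \<Rightarrow> real" and K :: "nat \<Rightarrow> 'x set"
  assumes e_range: "x \<in> topspace X \<Longrightarrow> 0 \<le> e i x \<and> e i x < 1"
    and e_cont: "continuous_map X euclideanreal (e i)"
    and e_inj: "x \<in> topspace X \<Longrightarrow> y \<in> topspace X \<Longrightarrow> (\<And>i. e i x = e i y) \<Longrightarrow> x = y"
    and K_comp: "seq_compactin X (K m)"
begin

definition "\<Phi> x = code (enc (\<lambda>i. e i x))"

definition "cset Y = {c. \<exists>b. c = code b \<and> (\<exists>x\<in>Y. \<forall>i. e i x = dec b i)}"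

text \<open>\<open>\<Phi>\<close> is injective but not continuous; on each \<open>cset (K m)\<close> its left inverse \<open>G\<close> is continuous.\<close>

definition "G c = (if c \<in> (\<Union>m. cset (K m))
   then (THE x. x \<in> (\<Union>m. K m) \<and> (\<exists>b. c = code b \<and> (\<forall>i. e i x = dec b i)))
   else (SOME x. x \<in> topspace X))"

lemma K_topspace: "K m \<subseteq> topspace X"
  using K_comp by (auto simp: seq_compactin_def)

lemma G_eq:
  assumes "x \<in> K m" "\<And>i. e i x = dec b i"
  shows "G (code b) = x"
proof -
  have "code b \<in> (\<Union>m. cset (K m))" using assms by (auto simp: cset_def)
  moreover have "(THE x. x \<in> (\<Union>m. K m) \<and> (\<exists>b'. code b = code b' \<and> (\<forall>i. e i x = dec b' i))) = x"
  proof (rule the_equality)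
    show "x \<in> (\<Union>m. K m) \<and> (\<exists>b'. code b = code b' \<and> (\<forall>i. e i x = dec b' i))" using assms by blast
    fix y assume "y \<in> (\<Union>m. K m) \<and> (\<exists>b'. code b = code b' \<and> (\<forall>i. e i y = dec b' i))"
    then show "y = x" using assms K_topspace by (intro e_inj) (auto dest!: code_inj)
  qed
  ultimately show ?thesis by (simp add: G_def)
qed

lemma dec_e: "x \<in> topspace X \<Longrightarrow> dec (enc (\<lambda>i. e i x)) i = e i x"
  by (subst dec_enc) (auto simp: e_range)

lemma G_\<Phi>: "x \<in> K m \<Longrightarrow> G (\<Phi> x) = x"
  unfolding \<Phi>_def using K_topspace[of m] by (intro G_eq[of _ m]) (auto simp: dec_e subset_iff)

lemma \<Phi>_cset: "x \<in> topspace X \<Longrightarrow> Y \<subseteq> topspace X \<Longrightarrow> \<Phi> x \<in> cset Y \<longleftrightarrow> x \<in> Y"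
proof
  assume x: "x \<in> topspace X" and Y: "Y \<subseteq> topspace X" and "\<Phi> x \<in> cset Y"
  then obtain y where y: "y \<in> Y" "\<And>i. e i y = dec (enc (\<lambda>i. e i x)) i"
    by (auto simp: cset_def \<Phi>_def dest!: code_inj)
  then have "x = y" using x Y by (intro e_inj) (auto simp: dec_e)
  then show "x \<in> Y" using y by simp
next
  assume "x \<in> topspace X" "x \<in> Y"
  then show "\<Phi> x \<in> cset Y"
    unfolding cset_def \<Phi>_def by (intro CollectI exI[of _ "enc (\<lambda>i. e i x)"] conjI bexI[of _ x]) (auto simp: dec_e)
qed

lemma cset_G:
  assumes Y: "Y \<subseteq> K m"
  shows "c \<in> cset Y \<longleftrightarrow> c \<in> cset (K m) \<and> G c \<in> Y"
proof
  assume "c \<in> cset Y"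
  then obtain b x where bx: "c = code b" "x \<in> Y" "\<forall>i. e i x = dec b i" by (auto simp: cset_def)
  then have "G c = x" using Y G_eq[of x m b] by auto
  then show "c \<in> cset (K m) \<and> G c \<in> Y" using bx Y by (auto simp: cset_def)
next
  assume c: "c \<in> cset (K m) \<and> G c \<in> Y"
  then obtain b x where bx: "c = code b" "x \<in> K m" "\<forall>i. e i x = dec b i" by (auto simp: cset_def)
  then have "G c = x" using G_eq[of x m b] by auto
  then show "c \<in> cset Y" using bx c by (auto simp: cset_def)
qed

text \<open>A limit of codes is again a code, with the eventual digits. Compactness supplies a
  subsequence of the coded points with limit \<open>y\<close> in \<open>Y\<close>, and continuity of
  both \<open>e i\<close> and \<open>dec\<close> shows that the limiting digits decode to
  \<open>y\<close>.\<close>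

lemma cset_closed:
  assumes "seq_compactin X Y"
  shows "closed (cset Y)"
  unfolding closed_sequential_limits
proof clarify
  fix c l assume c: "\<forall>n. c n \<in> cset Y" "c \<longlonglongrightarrow> l"
  then obtain b x where b: "\<And>n. c n = code (b n)" and x: "\<And>n. x n \<in> Y" "\<And>n i. e i (x n) = dec (b n) i"
    unfolding cset_def by (simp, metis)
  obtain b' where b': "l = code b'" "\<And>k. eventually (\<lambda>n. \<forall>i\<le>k. b n i = b' i) sequentially"
    using code_lim[of b l] c(2) unfolding b[abs_def] by blast
  obtain y r where y: "y \<in> Y" "strict_mono r" "limitin X (x \<circ> r) y sequentially"
    using assms x(1) unfolding seq_compactin_def by blast
  have "e i y = dec b' i" for i
  proof -
    have "limitin euclideanreal (e i \<circ> (x \<circ> r)) (e i y) sequentially"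
      by (rule continuous_map_limit[OF e_cont y(3)])
    then have "(\<lambda>n. dec (b (r n)) i) \<longlonglongrightarrow> e i y" by (simp add: o_def x)
    moreover have "(\<lambda>n. dec (b (r n)) i) \<longlonglongrightarrow> dec b' i"
      using LIMSEQ_subseq_LIMSEQ[OF dec_lim[OF b'(2)] y(2)] by (simp add: o_def)
    ultimately show ?thesis by (rule LIMSEQ_unique)
  qed
  then show "l \<in> cset Y" using y b' by (auto simp: cset_def)
qed

lemma G_topspace: "topspace X \<noteq> {} \<Longrightarrow> G c \<in> topspace X"
proof (cases "c \<in> (\<Union>m. cset (K m))")
  case True
  then show ?thesis using K_topspace by (auto simp: cset_def G_eq intro: subsetD[OF K_topspace])
next
  case False
  then show "topspace X \<noteq> {} \<Longrightarrow> G c \<in> topspace X" by (simp add: G_def some_in_eq)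
qed

text \<open>Within \<open>cset (K m)\<close> the preimage of an open \<open>U\<close> is the
  difference of the closed sets \<open>cset (K m)\<close> and \<open>cset (K m - U)\<close>, as
  \<open>K m - U\<close> is compact. Outside all of them \<open>G\<close> is constant.\<close>

lemma G_measurable:
  assumes "topspace X \<noteq> {}"
  shows "G \<in> measurable borel (borel_of X)"
proof (rule measurable_into_borel_of)
  show "G \<in> space borel \<rightarrow> topspace X" using G_topspace[OF assms] by simp
  fix U assume U: "openin X U"
  let ?D = "\<Union>m. cset (K m)"
  have K: "closed (cset (K m))" for m by (rule cset_closed[OF K_comp])
  have "K m - U = K m \<inter> (topspace X - U)" for m using K_topspace by auto
  then have KU: "closed (cset (K m - U))" for m
    using U by (auto intro!: cset_closed seq_compactin_closedin[OF K_comp])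
  have "G -` U = (\<Union>m. cset (K m) - cset (K m - U)) \<union> (if (SOME x. x \<in> topspace X) \<in> U then - ?D else {})"
  proof (rule set_eqI)
    fix c
    show "c \<in> G -` U \<longleftrightarrow> c \<in> (\<Union>m. cset (K m) - cset (K m - U)) \<union> (if (SOME x. x \<in> topspace X) \<in> U then - ?D else {})"
    proof (cases "c \<in> ?D")
      case True
      have "c \<in> cset (K m) - cset (K m - U) \<longleftrightarrow> c \<in> cset (K m) \<and> G c \<in> U" for m
        using cset_G[of "K m - U" m c] cset_G[of "K m" m c] by auto
      then show ?thesis using True by auto
    next
      case False
      then show ?thesis by (simp add: G_def)
    qed
  qed
  also have "\<dots> \<in> sets borel" using K KU by auto
  finally show "G -` U \<inter> space borel \<in> sets borel" by simp
qed

lemma e_measurable: "sets P = sets (borel_of X) \<Longrightarrow> e i \<in> borel_measurable P"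
  using continuous_map_borel_measurable[OF e_cont] measurable_cong_sets by blast

lemma \<Phi>_measurable_compose:
  assumes "\<And>i. (\<lambda>y. e i (J y)) \<in> borel_measurable N"
  shows "(\<lambda>y. \<Phi> (J y)) \<in> borel_measurable N"
proof -
  have "(\<lambda>y i. e i (J y)) \<in> measurable N (Pi\<^sub>M UNIV (\<lambda>_. borel))"
    using assms by (auto intro!: measurable_PiM_single')
  from measurable_compose[OF this code_enc_measurable] show ?thesis by (simp add: \<Phi>_def)
qed

text \<open>A map into the union of the compact sets equals \<open>G\<close> after
  \<open>\<Phi>\<close> after itself. Its measurability for the full Borel \<sigma>-algebra thus
  reduces to that of countably many real coordinates.\<close>

lemma measurable_into_K:
  assumes "\<And>y. y \<in> space N \<Longrightarrow> J y \<in> (\<Union>m. K m)" "\<And>i. (\<lambda>y. e i (J y)) \<in> borel_measurable N"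
  shows "J \<in> measurable N (borel_of X)"
proof (cases "topspace X = {}")
  case True
  then have "space N = {}" using assms(1) K_topspace by fastforce
  then show ?thesis by (simp add: measurable_empty_iff True)
next
  case False
  have "(\<lambda>y. G (\<Phi> (J y))) \<in> measurable N (borel_of X)"
    by (rule measurable_compose[OF \<Phi>_measurable_compose[OF assms(2)] G_measurable[OF False]])
  moreover have "G (\<Phi> (J y)) = J y" if "y \<in> space N" for y using assms(1)[OF that] G_\<Phi> by blast
  ultimately show ?thesis by (simp cong: measurable_cong)
qed

lemma \<Phi>_measurable: "sets P = sets (borel_of X) \<Longrightarrow> \<Phi> \<in> borel_measurable P"
  using \<Phi>_measurable_compose[of "\<lambda>x. x" P] e_measurable by simp

text \<open>\<open>Y\<close> is the preimage under the measurable map \<open>\<Phi>\<close> of the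
  closed set \<open>cset Y\<close>.\<close>

lemma seq_compactin_sets:
  assumes "seq_compactin X Y"
  shows "Y \<in> sets (borel_of X)"
proof -
  have "\<Phi> -` cset Y \<inter> space (borel_of X) \<in> sets (borel_of X)"
    by (rule measurable_sets[OF \<Phi>_measurable[OF refl] borel_closed[OF cset_closed[OF assms]]])
  moreover have "\<Phi> -` cset Y \<inter> space (borel_of X) = Y"
    using assms \<Phi>_cset[of _ Y] unfolding seq_compactin_def by auto
  ultimately show ?thesis by simp
qed

lemma sigma_compact_sets:
  assumes "Y \<subseteq> (\<Union>m. K m)" "\<And>m. seq_compactin X (Y \<inter> K m)"
  shows "Y \<in> sets (borel_of X)"
proof -
  have "Y = (\<Union>m. Y \<inter> K m)" using assms by auto
  also have "\<dots> \<in> sets (borel_of X)"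
    using assms(2) by (intro sets.countable_UN image_subsetI seq_compactin_sets)
  finally show ?thesis .
qed

text \<open>Ramp products of the coordinates are bounded continuous, so both measures give the
  sequence of coordinates the same law. Each measure is the image of that law under decoding,
  because \<open>G\<close> inverts \<open>\<Phi>\<close> on the sets \<open>K m\<close>, which carry
  full mass.\<close>

lemma prob_eqI:
  assumes P: "prob_space P" "sets P = sets (borel_of X)" "AE x in P. x \<in> (\<Union>m. K m)"
    and Q: "prob_space Q" "sets Q = sets (borel_of X)" "AE x in Q. x \<in> (\<Union>m. K m)"
    and eq: "\<And>h. continuous_map X euclideanreal h \<Longrightarrow> bounded (h ` topspace X) \<Longrightarrow>
      (\<integral>x. h x \<partial>P) = (\<integral>x. h x \<partial>Q)"
  shows "P = Q"
proof -
  interpret P: prob_space P by fact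
  have ne: "topspace X \<noteq> {}" using P.not_empty sets_eq_imp_space_eq[OF P(2)] by simp
  let ?S = "Pi\<^sub>M UNIV (\<lambda>_. borel) :: (nat \<Rightarrow> real) measure"
  have "distr P ?S (\<lambda>x i. e i x) = distr Q ?S (\<lambda>x i. e i x)"
  proof (rule law_eqI[OF P(1) Q(1) e_measurable[OF P(2)] e_measurable[OF Q(2)]])
    fix J :: "nat set" and a k assume "finite J"
    then have "continuous_map X euclideanreal (\<lambda>x. \<Prod>i\<in>J. ramp k (a i) (e i x))"
      unfolding ramp_def
      by (intro continuous_map_prod continuous_map_real_min continuous_map_real_max
          continuous_map_real_mult_left continuous_map_diff e_cont) auto
    moreover have "bounded ((\<lambda>x. \<Prod>i\<in>J. ramp k (a i) (e i x)) ` topspace X)"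
      unfolding bounded_iff by (intro exI[of _ 1]) (auto simp: ramp_prod_abs)
    ultimately show "(\<integral>x. (\<Prod>i\<in>J. ramp k (a i) (e i x)) \<partial>P) = (\<integral>x. (\<Prod>i\<in>J. ramp k (a i) (e i x)) \<partial>Q)"
      by (rule eq)
  qed
  moreover have "R = distr (distr R ?S (\<lambda>x i. e i x)) (borel_of X) (\<lambda>y. G (code (enc y)))"
    if R: "sets R = sets (borel_of X)" "AE x in R. x \<in> (\<Union>m. K m)" for R
  proof -
    have em: "(\<lambda>x i. e i x) \<in> measurable R ?S"
      using e_measurable[OF R(1)] by (auto intro!: measurable_PiM_single')
    have Gm: "(\<lambda>y. G (code (enc y))) \<in> measurable ?S (borel_of X)"
      by (rule measurable_compose[OF code_enc_measurable G_measurable[OF ne]])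
    have "distr (distr R ?S (\<lambda>x i. e i x)) (borel_of X) (\<lambda>y. G (code (enc y))) = distr R (borel_of X) (\<lambda>x. G (\<Phi> x))"
      by (subst distr_distr[OF Gm em]) (simp add: o_def \<Phi>_def)
    also have "\<dots> = distr R (borel_of X) (\<lambda>x. x)"
    proof (rule distr_cong_AE)
      show "AE x in R. G (\<Phi> x) = x" using R(2) by eventually_elim (auto simp: G_\<Phi>)
      show "(\<lambda>x. G (\<Phi> x)) \<in> measurable R (borel_of X)"
        by (rule measurable_compose[OF \<Phi>_measurable[OF R(1)] G_measurable[OF ne]])
      show "(\<lambda>x. x) \<in> measurable R (borel_of X)" using R(1) by (rule measurable_ident_sets)
    qed auto
    also have "\<dots> = R" using R(1) by (simp add: distr_id2)
    finally show ?thesis by simp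
  qed
  ultimately show ?thesis using P Q by metis
qed

text \<open>The preimage of a closed set is \<open>cset\<close> of a closed part of the compact set
  \<open>K m\<close>, hence closed.\<close>

lemma hG_continuous:
  assumes "continuous_map X euclideanreal h"
  shows "continuous_on (cset (K m)) (\<lambda>c. h (G c))"
proof -
  have "closed ((\<lambda>c. h (G c)) -` B \<inter> cset (K m))" if "closed B" for B
  proof -
    have "closedin X {x \<in> topspace X. h x \<in> B}"
      using assms that by (simp add: closedin_continuous_map_preimage)
    then have "closed (cset (K m \<inter> {x \<in> topspace X. h x \<in> B}))"
      by (intro cset_closed seq_compactin_closedin K_comp)
    also have "cset (K m \<inter> {x \<in> topspace X. h x \<in> B}) = (\<lambda>c. h (G c)) -` B \<inter> cset (K m)"
      using cset_G[of "K m \<inter> {x \<in> topspace X. h x \<in> B}" m] cset_G[of "K m" m] K_topspace by blast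
    finally show ?thesis .
  qed
  then show ?thesis
    by (subst continuous_on_closed_vimage) (auto intro: cset_closed K_comp)
qed

section \<open>Prokhorov's theorem by coding\<close>

text \<open>The laws of the codes have a weak limit on the line, and \<open>G\<close> carries it
  back. Since \<open>\<Phi>\<close> is not continuous, a test function \<open>h\<close> is replaced
  by a continuous extension of \<open>h\<close> after \<open>G\<close> from a closed set
  \<open>cset (K m)\<close> of nearly full mass. The last conclusion is a portmanteau bound for sets
  that are only closed within each \<open>K m\<close>.\<close>

theorem prokhorov:
  fixes \<mu> :: "nat \<Rightarrow> 'x measure"
  assumes P: "\<And>n. prob_space (\<mu> n)" and S: "\<And>n. sets (\<mu> n) = sets (borel_of X)"
    and tight: "\<And>\<epsilon> :: real. \<epsilon> > 0 \<Longrightarrow> \<exists>m. \<forall>n. 1 - \<epsilon> \<le> measure (\<mu> n) (K m)"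
  obtains r \<mu>' where "strict_mono r" "prob_space \<mu>'" "sets \<mu>' = sets (borel_of X)"
    "weakly_converges X (\<lambda>n. \<mu> (r n)) \<mu>'"
    "\<And>Y \<epsilon>. Y \<subseteq> (\<Union>m. K m) \<Longrightarrow> (\<And>m. seq_compactin X (Y \<inter> K m)) \<Longrightarrow> \<epsilon> > 0 \<Longrightarrow>
       eventually (\<lambda>n. measure (\<mu> (r n)) Y \<le> measure \<mu>' Y + \<epsilon>) sequentially"
proof -
  interpret P: prob_space "\<mu> n" for n by (rule P)
  have sp: "space (\<mu> n) = topspace X" for n using sets_eq_imp_space_eq[OF S] by simp
  have ne: "topspace X \<noteq> {}" using P.not_empty sp by blast
  note Gm = G_measurable[OF ne]
  define \<nu> where "\<nu> n = distr (\<mu> n) borel \<Phi>" for n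
  have \<Phi>m: "\<Phi> \<in> borel_measurable (\<mu> n)" for n by (rule \<Phi>_measurable[OF S])
  have rd: "real_distribution (\<nu> n)" for n
    unfolding \<nu>_def using P.prob_space_distr[OF \<Phi>m]
    by (auto simp: real_distribution_def real_distribution_axioms_def)
  have "tight \<nu>"
    unfolding tight_def
  proof (intro conjI allI impI rd)
    fix \<epsilon> :: real assume "\<epsilon> > 0"
    have "measure (\<nu> n) {-1<..2} = 1" for n
    proof -
      have "\<Phi> x \<in> {-1<..2}" for x using code_bounds[of "enc (\<lambda>i. e i x)"] by (simp add: \<Phi>_def)
      then have "\<Phi> -` {-1<..2} \<inter> space (\<mu> n) = space (\<mu> n)" by auto
      then show ?thesis unfolding \<nu>_def by (subst measure_distr) (auto simp: \<Phi>m P.prob_space)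
    qed
    then show "\<exists>a b. a < b \<and> (\<forall>n. 1 - \<epsilon> < measure (\<nu> n) {a<..b})"
      using \<open>\<epsilon> > 0\<close> by (intro exI[of _ "-1"] exI[of _ 2]) auto
  qed
  from tight_imp_convergent_subsubsequence[OF this strict_mono_id]
  obtain r \<nu>' where r: "strict_mono r" and rd': "real_distribution \<nu>'"
    and wc: "weak_conv_m (\<lambda>n. \<nu> (r n)) \<nu>'" by (auto simp: o_def)
  interpret \<nu>': real_distribution \<nu>' by fact
  have Gm': "G \<in> measurable \<nu>' (borel_of X)" using Gm by simp
  define \<mu>' where "\<mu>' = distr \<nu>' (borel_of X) G"
  have sets': "sets \<mu>' = sets (borel_of X)" by (simp add: \<mu>'_def)
  interpret \<mu>': prob_space \<mu>' unfolding \<mu>'_def by (rule \<nu>'.prob_space_distr[OF Gm'])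
  have \<nu>_cset: "measure (\<nu> n) (cset Y) = measure (\<mu> n) Y" if "seq_compactin X Y" for n Y
  proof -
    have "\<Phi> -` cset Y \<inter> space (\<mu> n) = Y"
      using that \<Phi>_cset[of _ Y] unfolding seq_compactin_def by (auto simp: sp)
    then show ?thesis
      unfolding \<nu>_def using cset_closed[OF that] by (subst measure_distr) (auto simp: \<Phi>m)
  qed
  have cl: "eventually (\<lambda>n. measure (\<mu> (r n)) Y \<le> measure \<nu>' (cset Y) + \<epsilon>) sequentially"
    if "seq_compactin X Y" "\<epsilon> > 0" for Y \<epsilon>
    using weak_conv_m_closed[OF rd rd' wc cset_closed[OF that(1)] that(2)] \<nu>_cset[OF that(1)] by simp
  have cl': "eventually (\<lambda>n. measure (\<mu> (r n)) Y \<le> measure \<mu>' Y + \<epsilon>) sequentially"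
    if Y: "Y \<subseteq> (\<Union>m. K m)" "\<And>m. seq_compactin X (Y \<inter> K m)" and \<epsilon>: "\<epsilon> > 0" for Y \<epsilon>
  proof -
    have Ys: "Y \<in> sets (borel_of X)" by (rule sigma_compact_sets[OF Y])
    \<comment> \<open>Half of \<epsilon> pays for the mass outside one compact set, the other half
      for the portmanteau bound on the compact trace of \<open>Y\<close>.\<close>
    obtain m where m: "\<And>n. 1 - \<epsilon> / 2 \<le> measure (\<mu> n) (K m)" using tight[of "\<epsilon> / 2"] \<epsilon> by auto
    have "cset (Y \<inter> K m) \<subseteq> G -` Y \<inter> space \<nu>'"
      using cset_G[of "Y \<inter> K m" m] by auto
    then have "measure \<nu>' (cset (Y \<inter> K m)) \<le> measure \<nu>' (G -` Y \<inter> space \<nu>')"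
      using measurable_sets[OF Gm' Ys] by (intro \<nu>'.finite_measure_mono)
    also have "\<dots> = measure \<mu>' Y" unfolding \<mu>'_def using Ys by (simp add: measure_distr[OF Gm'])
    finally have 1: "measure \<nu>' (cset (Y \<inter> K m)) \<le> measure \<mu>' Y" .
    have "eventually (\<lambda>n. measure (\<mu> (r n)) (Y \<inter> K m) \<le> measure \<nu>' (cset (Y \<inter> K m)) + \<epsilon> / 2) sequentially"
      using cl[OF Y(2)[of m], of "\<epsilon> / 2"] \<epsilon> by simp
    then show ?thesis
    proof eventually_elim
      case (elim n)
      have Ks: "K m \<in> sets (\<mu> (r n))" "Y \<in> sets (\<mu> (r n))" using Ys seq_compactin_sets[OF K_comp] S by auto
      have "measure (\<mu> (r n)) Y \<le> measure (\<mu> (r n)) ((Y \<inter> K m) \<union> (space (\<mu> (r n)) - K m))"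
        using Ks by (intro P.finite_measure_mono) (auto dest: sets.sets_into_space)
      also have "\<dots> \<le> measure (\<mu> (r n)) (Y \<inter> K m) + measure (\<mu> (r n)) (space (\<mu> (r n)) - K m)"
        using Ks by (intro measure_Un_le) auto
      also have "measure (\<mu> (r n)) (space (\<mu> (r n)) - K m) \<le> \<epsilon> / 2"
        using m[of "r n"] Ks by (simp add: P.prob_compl)
      finally show ?case using elim 1 by simp
    qed
  qed
  have wcv: "weakly_converges X (\<lambda>n. \<mu> (r n)) \<mu>'"
    unfolding weakly_converges_def
  proof (intro allI impI, elim conjE)
    fix h :: "'x \<Rightarrow> real"
    assume h: "continuous_map X euclideanreal h" "bounded (h ` topspace X)"
    obtain H where H: "H > 0" "\<And>x. x \<in> topspace X \<Longrightarrow> \<bar>h x\<bar> \<le> H"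
      using h(2) unfolding bounded_pos by auto
    have hm: "h \<in> borel_measurable (borel_of X)" by (rule continuous_map_borel_measurable[OF h(1)])
    have hm': "h \<in> borel_measurable (\<mu> n)" for n
      using hm measurable_cong_sets[OF S refl] by blast
    have hG: "(\<lambda>c. h (G c)) \<in> borel_measurable \<nu>'" using measurable_compose[OF Gm' hm] .
    show "(\<lambda>n. \<integral>x. h x \<partial>\<mu> (r n)) \<longlonglongrightarrow> (\<integral>x. h x \<partial>\<mu>')"
    proof (rule tendstoI)
      fix \<epsilon> :: real assume \<epsilon>: "\<epsilon> > 0"
      \<comment> \<open>Three errors are to be absorbed: \<open>2 * H * d\<close> before the limit,
        \<open>4 * H * d\<close> in the limit and \<open>2 * H * d\<close> for the convergence on
        the line.\<close>
      define d where "d = \<epsilon> / (8 * H)"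
      have d: "d > 0" using \<epsilon> H by (simp add: d_def)
      obtain m where m: "\<And>n. 1 - d \<le> measure (\<mu> n) (K m)" using tight[OF d] by auto
      \<comment> \<open>The limit may lose a further \<open>d\<close> of mass, hence the factor
        2.\<close>
      from cl[OF K_comp[of m] d] have "eventually (\<lambda>n. 1 - 2 * d \<le> measure \<nu>' (cset (K m))) sequentially"
        by eventually_elim (use m in \<open>smt (verit)\<close>)
      then have m': "1 - 2 * d \<le> measure \<nu>' (cset (K m))" by simp
      \<comment> \<open>The Tietze extension keeps the bound \<open>H\<close>, so that outside the
        compact set the two integrands differ by at most \<open>2 * H\<close>.\<close>
      obtain g where g: "continuous_on UNIV g" "\<And>c. c \<in> cset (K m) \<Longrightarrow> g c = h (G c)" "\<And>c. \<bar>g c\<bar> \<le> H"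
        using Tietze[OF hG_continuous[OF h(1), of m], of UNIV H] cset_closed[OF K_comp[of m]]
          G_topspace[OF ne] H by auto
      have gm [measurable]: "g \<in> borel_measurable borel" using g(1) by (rule borel_measurable_continuous_onI)
      have gi: "integrable \<nu>' g" using g(3) by (intro \<nu>'.integrable_const_bound[of _ H]) auto
      have A: "\<bar>(\<integral>x. h x \<partial>\<mu> n) - (\<integral>c. g c \<partial>\<nu> n)\<bar> \<le> 2 * H * d" for n
      proof -
        have g\<Phi>: "(\<lambda>x. g (\<Phi> x)) \<in> borel_measurable (\<mu> n)" using \<Phi>m gm by (rule measurable_compose)
        have "(\<integral>c. g c \<partial>\<nu> n) = (\<integral>x. g (\<Phi> x) \<partial>\<mu> n)"
          unfolding \<nu>_def by (rule integral_distr[OF \<Phi>m gm])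
        then have "(\<integral>x. h x \<partial>\<mu> n) - (\<integral>c. g c \<partial>\<nu> n) = (\<integral>x. h x - g (\<Phi> x) \<partial>\<mu> n)"
          using hm' g\<Phi> H g(3)
          by (subst Bochner_Integration.integral_diff)
             (auto intro!: P.integrable_const_bound[of _ H] simp: sp)
        also have "\<bar>\<dots>\<bar> \<le> 2 * H * (1 - measure (\<mu> n) (K m))"
        proof (rule P.integral_bound_off)
          show "\<bar>h x - g (\<Phi> x)\<bar> \<le> 2 * H" if "x \<in> space (\<mu> n)" for x
            using H(2)[of x] g(3)[of "\<Phi> x"] that by (auto simp: sp)
          show "h x - g (\<Phi> x) = 0" if "x \<in> K m" for x
            using that \<Phi>_cset[of x "K m"] K_topspace[of m] by (subst g(2)) (auto simp: G_\<Phi>)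
        qed (use hm' g\<Phi> S seq_compactin_sets[OF K_comp] in auto)
        also have "\<dots> \<le> 2 * H * d" using m[of n] H by (intro mult_left_mono) auto
        finally show ?thesis .
      qed
      have B: "\<bar>(\<integral>x. h x \<partial>\<mu>') - (\<integral>c. g c \<partial>\<nu>')\<bar> \<le> 4 * H * d"
      proof -
        have "(\<integral>x. h x \<partial>\<mu>') = (\<integral>c. h (G c) \<partial>\<nu>')" unfolding \<mu>'_def by (rule integral_distr[OF Gm' hm])
        then have "(\<integral>x. h x \<partial>\<mu>') - (\<integral>c. g c \<partial>\<nu>') = (\<integral>c. h (G c) - g c \<partial>\<nu>')"
          using hG gi H G_topspace[OF ne]
          by (subst Bochner_Integration.integral_diff) (auto intro!: \<nu>'.integrable_const_bound[of _ H])
        also have "\<bar>\<dots>\<bar> \<le> 2 * H * (1 - \<nu>'.prob (cset (K m)))"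
        proof (rule \<nu>'.integral_bound_off)
          show "\<bar>h (G c) - g c\<bar> \<le> 2 * H" for c
            using H(2)[OF G_topspace[OF ne, of c]] g(3)[of c] by auto
        qed (use hG g(2) cset_closed[OF K_comp] in auto)
        also have "\<dots> \<le> 2 * H * (2 * d)" using m' H by (intro mult_left_mono) auto
        finally show ?thesis by simp
      qed
      have "(\<lambda>n. \<integral>c. g c \<partial>\<nu> (r n)) \<longlonglongrightarrow> (\<integral>c. g c \<partial>\<nu>')"
        using g by (intro weak_conv_imp_integral_bdd_continuous_conv[OF rd rd' wc, of _ H])
          (auto simp: continuous_on_eq_continuous_at)
      from tendstoD[OF this, of "2 * H * d"] d H
      have "eventually (\<lambda>n. \<bar>(\<integral>c. g c \<partial>\<nu> (r n)) - (\<integral>c. g c \<partial>\<nu>')\<bar> < 2 * H * d) sequentially"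
        by (simp add: dist_real_def)
      then show "eventually (\<lambda>n. dist (\<integral>x. h x \<partial>\<mu> (r n)) (\<integral>x. h x \<partial>\<mu>') < \<epsilon>) sequentially"
      proof eventually_elim
        case (elim n)
        have "8 * H * d = \<epsilon>" using H by (simp add: d_def)
        then show ?case using elim A[of "r n"] B unfolding dist_real_def by linarith
      qed
    qed
  qed
  show ?thesis by (rule that[OF r \<mu>'.prob_space_axioms sets' wcv cl'])
qed

end

section \<open>Fourier series on the torus\<close>

lemma sets_torus_box: "{0..<2 * pi} \<times> {0..<2 * pi} \<in> sets (lborel :: point measure)"
  by (simp add: borel_Times)

lemma space_torus: "space torus = {0..<2 * pi} \<times> {0..<2 * pi}"
  by (simp add: torus_def space_restrict_space)

lemma emeasure_torus: "emeasure torus (space torus) = ennreal (4 * pi\<^sup>2)"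
proof -
  have "emeasure torus (space torus) = emeasure (lborel \<Otimes>\<^sub>M lborel) ({0..<2 * pi} \<times> {0..<2 * pi} :: point set)"
    unfolding space_torus unfolding torus_def lborel_prod
    by (rule emeasure_restrict_space) (auto simp: borel_Times)
  also have "\<dots> = ennreal (2 * pi) * ennreal (2 * pi)"
    by (subst lborel.emeasure_pair_measure_Times) auto
  also have "\<dots> = ennreal (4 * pi\<^sup>2)" by (simp add: ennreal_mult[symmetric] power2_eq_square)
  finally show ?thesis .
qed

interpretation torus: finite_measure torus
  by (rule finite_measureI) (simp add: emeasure_torus)

text \<open>The torus is modelled by a half-open box, while compactness and the fundamental theorem
  of calculus call for the closed box; the additional edges are null sets.\<close>

lemma torus_closed_box_AE:
  "AE z in (lborel :: point measure). indicator ({0..2 * pi} \<times> {0..2 * pi}) z = (indicator ({0..<2 * pi} \<times> {0..<2 * pi}) z :: real)"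
proof -
  have "{2 * pi} \<times> UNIV \<in> null_sets (lborel \<Otimes>\<^sub>M lborel :: point measure)"
    "UNIV \<times> {2 * pi} \<in> null_sets (lborel \<Otimes>\<^sub>M lborel :: point measure)"
    by (auto intro!: null_setsI simp: lborel.emeasure_pair_measure_Times)
  then have "AE z in (lborel :: point measure). z \<notin> {2 * pi} \<times> UNIV \<and> z \<notin> UNIV \<times> {2 * pi}"
    unfolding lborel_prod by (auto intro: AE_not_in)
  then show ?thesis by eventually_elim (auto simp: indicator_def)
qed

lemma
  fixes f :: "point \<Rightarrow> 'b :: {banach, second_countable_topology}"
  assumes f: "continuous_on UNIV f"
  shows torus_integrable: "integrable torus f"
    and torus_iterated1: "(\<integral>z. f z \<partial>torus) = (LINT x:{0..2 * pi}|lborel. LINT y:{0..2 * pi}|lborel. f (x, y))"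
    and torus_iterated2: "(\<integral>z. f z \<partial>torus) = (LINT y:{0..2 * pi}|lborel. LINT x:{0..2 * pi}|lborel. f (x, y))"
proof -
  let ?Q = "{0..<2 * pi} \<times> {0..<2 * pi} :: point set" and ?R = "{0..2 * pi} \<times> {0..2 * pi} :: point set"
  have fm: "f \<in> borel_measurable borel" using f by (rule borel_measurable_continuous_onI)
  have R: "integrable lborel (\<lambda>z. indicator ?R z *\<^sub>R f z)"
    by (intro borel_integrable_compact compact_Times compact_Icc continuous_on_subset[OF f]) auto
  have ae: "AE z in lborel. indicator ?Q z *\<^sub>R f z = indicator ?R z *\<^sub>R f z"
    using torus_closed_box_AE by eventually_elim simp
  have Rs: "?R \<in> sets borel" "?Q \<in> sets borel" by (simp_all add: borel_Times)
  have Q: "integrable lborel (\<lambda>z. indicator ?Q z *\<^sub>R f z)"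
    by (rule integrable_cong_AE_imp[OF R _ ]) (use ae fm Rs in auto)
  show "integrable torus f" unfolding torus_def
    by (subst integrable_restrict_space) (use Q sets_torus_box in auto)
  have "(\<integral>z. f z \<partial>torus) = (\<integral>z. indicator ?Q z *\<^sub>R f z \<partial>lborel)"
    unfolding torus_def by (rule integral_restrict_space) (use sets_torus_box in auto)
  also have "\<dots> = (\<integral>z. indicator ?R z *\<^sub>R f z \<partial>lborel)"
    by (rule integral_cong_AE) (use ae fm Rs in auto)
  also have "\<dots> = (\<integral>z. indicator ?R z *\<^sub>R f z \<partial>(lborel \<Otimes>\<^sub>M lborel))" by (simp add: lborel_prod)
  finally have 1: "(\<integral>z. f z \<partial>torus) = (\<integral>z. indicator ?R z *\<^sub>R f z \<partial>(lborel \<Otimes>\<^sub>M lborel))" .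
  have R': "integrable (lborel \<Otimes>\<^sub>M lborel) (\<lambda>z. indicator ?R z *\<^sub>R f z)"
    using R by (simp add: lborel_prod)
  have i: "indicator ?R (x, y) = (indicator {0..2 * pi} x * indicator {0..2 * pi} y :: real)" for x y
    by (auto simp: indicator_def)
  show "(\<integral>z. f z \<partial>torus) = (LINT x:{0..2 * pi}|lborel. LINT y:{0..2 * pi}|lborel. f (x, y))"
    unfolding 1 lborel_pair.integral_fst'[OF R', symmetric] set_lebesgue_integral_def i
    by (simp flip: scaleR_scaleR)
  have R'': "integrable (lborel \<Otimes>\<^sub>M lborel) (case_prod (\<lambda>x y. indicator ?R (x, y) *\<^sub>R f (x, y)))"
    using R' by (simp add: case_prod_beta')
  have "(\<integral>z. indicator ?R z *\<^sub>R f z \<partial>(lborel \<Otimes>\<^sub>M lborel)) =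
      (\<integral>y. (\<integral>x. indicator ?R (x, y) *\<^sub>R f (x, y) \<partial>lborel) \<partial>lborel)"
    using lborel_pair.integral_snd[OF R''] by (simp add: case_prod_beta')
  also have "\<dots> = (\<integral>y. (\<integral>x. indicator {0..2 * pi} y *\<^sub>R (indicator {0..2 * pi} x *\<^sub>R f (x, y)) \<partial>lborel) \<partial>lborel)"
    unfolding i scaleR_scaleR by (simp only: mult.commute)
  finally show "(\<integral>z. f z \<partial>torus) = (LINT y:{0..2 * pi}|lborel. LINT x:{0..2 * pi}|lborel. f (x, y))"
    unfolding 1 set_lebesgue_integral_def by (simp del: scaleR_scaleR)
qed

lemma wavevec_inner: "wavevec k \<bullet> (x, y) = of_int (fst k) * x + of_int (snd k) * y"
  by (simp add: wavevec_def inner_prod_def)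

lemma wavevec_diff: "wavevec (k - m) = wavevec k - wavevec m"
  and wavevec_minus: "wavevec (- k) = - wavevec k"
  and wavevec_add: "wavevec (k + m) = wavevec k + wavevec m"
  by (simp_all add: wavevec_def)

lemma wavevec_0 [simp]: "wavevec k = 0 \<longleftrightarrow> k = 0" "wavevec 0 = 0"
  by (auto simp: wavevec_def prod_eq_iff)

lemma continuous_on_cis_wave [continuous_intros]:
  "continuous_on S g \<Longrightarrow> continuous_on S (\<lambda>x. cis (wavevec k \<bullet> g x))"
  by (intro continuous_on_cis continuous_intros)

lemma cis_has_vector_derivative:
  "((\<lambda>x. cis (a * x + b)) has_vector_derivative (\<i> * of_real a * cis (a * x + b))) (at x within S)"
proof -
  have "((\<lambda>x. exp (\<i> * of_real (a * x + b))) has_vector_derivative (\<i> * of_real a * exp (\<i> * of_real (a * x + b)))) (at x within S)"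
    by (auto intro!: derivative_eq_intros has_vector_derivative_real_field simp: algebra_simps)
  then show ?thesis by (simp add: cis_conv_exp)
qed

lemma cis_integral: "(LINT y:{0..2 * pi}|lborel. cis (of_int n * y)) = (if n = 0 then 2 * of_real pi else 0)"
proof (cases "n = 0")
  case True
  have "(LINT y:{0..2 * pi}|lborel. (1 :: complex)) = of_real (2 * pi)"
    by (subst set_integral_const) (auto simp: scaleR_conv_of_real)
  then show ?thesis using True by simp
next
  case False
  have "(LINT y:{0..2 * pi}|lborel. \<i> * of_int n * cis (of_int n * y)) = cis (of_int n * (2 * pi)) - cis (of_int n * 0)"
    unfolding set_lebesgue_integral_def
    using cis_has_vector_derivative[of "of_int n" 0]
    by (intro integral_FTC_atLeastAtMost) (auto intro!: continuous_intros continuous_on_cis)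
  moreover have "cis (of_int n * (2 * pi)) = 1"
    by (metis cis_multiple_2pi Ints_of_int mult.commute mult.assoc)
  ultimately have "\<i> * of_int n * (LINT y:{0..2 * pi}|lborel. cis (of_int n * y)) = 0"
    by (subst (asm) set_integral_mult_right) auto
  then show ?thesis using False by simp
qed

lemma torus_orthogonality:
  "(\<integral>z. cis (wavevec k \<bullet> z) \<partial>torus) = (if k = 0 then of_real (4 * pi\<^sup>2) else 0)"
proof -
  have "(\<integral>z. cis (wavevec k \<bullet> z) \<partial>torus) =
      (LINT x:{0..2 * pi}|lborel. LINT y:{0..2 * pi}|lborel. cis (of_int (fst k) * x) * cis (of_int (snd k) * y))"
    by (subst torus_iterated1) (auto intro!: continuous_intros simp: wavevec_inner cis_mult)
  also have "\<dots> = (LINT x:{0..2 * pi}|lborel. cis (of_int (fst k) * x)) * (LINT y:{0..2 * pi}|lborel. cis (of_int (snd k) * y))"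
    by simp
  also have "\<dots> = (if k = 0 then of_real (4 * pi\<^sup>2) else 0)"
    unfolding cis_integral by (auto simp: prod_eq_iff power2_eq_square)
  finally show ?thesis .
qed

lemma torus_parseval:
  assumes "finite S"
  shows "(\<integral>z. (norm (\<Sum>k\<in>S. c k * cis (wavevec k \<bullet> z)))\<^sup>2 \<partial>torus) = 4 * pi\<^sup>2 * (\<Sum>k\<in>S. (norm (c k))\<^sup>2)"
proof -
  let ?g = "\<lambda>z. \<Sum>k\<in>S. c k * cis (wavevec k \<bullet> z)"
  have "of_real (\<integral>z. (norm (?g z))\<^sup>2 \<partial>torus) = (\<integral>z. complex_of_real ((norm (?g z))\<^sup>2) \<partial>torus)"
    by (rule integral_of_real[symmetric]) (intro torus_integrable continuous_intros)
  also have "\<dots> = (\<integral>z. (\<Sum>k\<in>S. \<Sum>l\<in>S. c k * cnj (c l) * cis (wavevec (k - l) \<bullet> z)) \<partial>torus)"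
  proof (intro Bochner_Integration.integral_cong refl)
    fix z
    have "complex_of_real ((norm (?g z))\<^sup>2) = ?g z * cnj (?g z)" by (simp only: complex_norm_square)
    also have "\<dots> = (\<Sum>k\<in>S. \<Sum>l\<in>S. c k * cis (wavevec k \<bullet> z) * (cnj (c l) * cis (- (wavevec l \<bullet> z))))"
      by (simp add: sum_product cis_cnj)
    also have "\<dots> = (\<Sum>k\<in>S. \<Sum>l\<in>S. c k * cnj (c l) * cis (wavevec (k - l) \<bullet> z))"
    proof (intro sum.cong refl)
      fix k l
      have "cis (wavevec (k - l) \<bullet> z) = cis (wavevec k \<bullet> z) * cis (- (wavevec l \<bullet> z))"
        by (simp add: wavevec_diff inner_diff_left cis_mult)
      then show "c k * cis (wavevec k \<bullet> z) * (cnj (c l) * cis (- (wavevec l \<bullet> z))) = c k * cnj (c l) * cis (wavevec (k - l) \<bullet> z)"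
        by simp
    qed
    finally show "complex_of_real ((norm (?g z))\<^sup>2) = (\<Sum>k\<in>S. \<Sum>l\<in>S. c k * cnj (c l) * cis (wavevec (k - l) \<bullet> z))" .
  qed
  also have "\<dots> = (\<Sum>k\<in>S. \<Sum>l\<in>S. c k * cnj (c l) * (\<integral>z. cis (wavevec (k - l) \<bullet> z) \<partial>torus))"
    by (subst Bochner_Integration.integral_sum, intro torus_integrable continuous_intros,
        intro sum.cong refl, subst Bochner_Integration.integral_sum, intro torus_integrable continuous_intros, simp)
  also have "\<dots> = (\<Sum>k\<in>S. \<Sum>l\<in>S. if l = k then c k * cnj (c k) * of_real (4 * pi\<^sup>2) else 0)"
    by (intro sum.cong refl) (auto simp: torus_orthogonality)
  also have "\<dots> = of_real (4 * pi\<^sup>2 * (\<Sum>k\<in>S. (norm (c k))\<^sup>2))"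
    using assms by (simp add: sum_distrib_left complex_norm_square[symmetric] mult_ac)
  finally show ?thesis by (simp only: of_real_eq_iff)
qed

section \<open>Decay of Fourier coefficients\<close>

lemma derivative_continuous: "(\<And>x. (f has_derivative D x) (at x)) \<Longrightarrow> continuous_on UNIV f"
  by (meson continuous_at_imp_continuous_on has_derivative_continuous)

lemma ck_continuous: "ck n f \<Longrightarrow> continuous_on UNIV f"
proof (cases n)
  case (Suc m)
  moreover assume "ck n f"
  ultimately obtain f1 f2 where "\<And>x. (f has_derivative (\<lambda>h. fst h * f1 x + snd h * f2 x)) (at x)"
    by auto
  then show ?thesis by (rule derivative_continuous)
qed simp

definition periodic :: "(point \<Rightarrow> real) \<Rightarrow> bool" where
  "periodic f \<longleftrightarrow> (\<forall>x y. f (x + 2 * pi, y) = f (x, y) \<and> f (x, y + 2 * pi) = f (x, y))"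

text \<open>A translate by a period is the same function, so uniqueness of the derivative makes both
  partial derivatives invariant under the same translation.\<close>

lemma periodic_derivative:
  assumes "periodic f" "\<And>x. (f has_derivative (\<lambda>h. fst h * f1 x + snd h * f2 x)) (at x)"
  shows "periodic f1" "periodic f2"
proof -
  have shift: "f1 (z + v) = f1 z \<and> f2 (z + v) = f2 z" if "\<And>z. f (z + v) = f z" for v z
  proof -
    have "((\<lambda>z. f (z + v)) has_derivative (\<lambda>h. fst h * f1 (z + v) + snd h * f2 (z + v))) (at z)"
      by (rule has_derivative_compose[of "\<lambda>z. z + v" "\<lambda>h. h" z UNIV f, OF _ assms(2)[of "z + v"]])
         (auto intro!: derivative_eq_intros)
    then have "(f has_derivative (\<lambda>h. fst h * f1 (z + v) + snd h * f2 (z + v))) (at z)"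
      using that by simp
    from has_derivative_unique[OF this assms(2)[of z]]
    have *: "fst h * f1 (z + v) + snd h * f2 (z + v) = fst h * f1 z + snd h * f2 z" for h
      by metis
    show ?thesis using *[of "(1, 0)"] *[of "(0, 1)"] by simp
  qed
  have "f1 (z + v) = f1 z \<and> f2 (z + v) = f2 z" if "v = (2 * pi, 0) \<or> v = (0, 2 * pi)" for v z
  proof (rule shift)
    show "f (z + v) = f z" for z
      using assms(1) that by (cases z) (auto simp: periodic_def)
  qed
  from this[of "(2 * pi, 0)"] this[of "(0, 2 * pi)"] show "periodic f1" "periodic f2"
    by (auto simp: periodic_def)
qed

text \<open>Integration by parts: the difference of the two integrands is the derivative, in one
  variable, of a periodic function, so its integral over a period vanishes. The order of the
  iterated integral is chosen to make this variable the inner one.\<close>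

lemma fourier_derivative:
  assumes f: "periodic f" "\<And>x. (f has_derivative (\<lambda>h. fst h * f1 x + snd h * f2 x)) (at x)"
    and c: "continuous_on UNIV f1" "continuous_on UNIV f2"
  shows "fourier f1 k = \<i> * of_int (fst k) * fourier f k"
    and "fourier f2 k = \<i> * of_int (snd k) * fourier f k"
proof -
  have cf: "continuous_on UNIV f"
    using f(2) by (rule derivative_continuous)
  let ?e = "\<lambda>z. cis (- (wavevec k \<bullet> z))"
  note ci = continuous_intros continuous_on_cis
  have cint: "integrable torus (\<lambda>z. of_real (g z) * ?e z)" if "continuous_on UNIV g" for g :: "point \<Rightarrow> real"
    by (intro torus_integrable ci that)
  have main: "(\<integral>z. of_real (g z) * ?e z - \<i> * of_int n * (of_real (f z) * ?e z) \<partial>torus) = 0 \<Longrightarrow>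
      continuous_on UNIV g \<Longrightarrow> fourier g k = \<i> * of_int n * fourier f k" for g n
    unfolding fourier_def
    by (subst (asm) Bochner_Integration.integral_diff) (auto intro!: cint cf integrable_mult_right)
  have d1: "((\<lambda>x. f (x, y)) has_real_derivative f1 (x, y)) (at x within S)" for x y S
  proof -
    have "((\<lambda>x. f (x, y)) has_derivative (\<lambda>h. h * f1 (x, y))) (at x within S)"
      using has_derivative_compose[of "\<lambda>x. (x, y)" "\<lambda>h. (h, 0)" x S f, OF _ f(2)[of "(x, y)"]]
      by (simp add: has_derivative_Pair)
    then show ?thesis by (simp add: has_field_derivative_def mult_commute_abs)
  qed
  have d2: "((\<lambda>y. f (x, y)) has_real_derivative f2 (x, y)) (at y within S)" for x y S
  proof -
    have "((\<lambda>y. f (x, y)) has_derivative (\<lambda>h. h * f2 (x, y))) (at y within S)"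
      using has_derivative_compose[of "\<lambda>y. (x, y)" "\<lambda>h. (0, h)" y S f, OF _ f(2)[of "(x, y)"]]
      by (simp add: has_derivative_Pair)
    then show ?thesis by (simp add: has_field_derivative_def mult_commute_abs)
  qed
  have e2pi: "cis (- (of_int n * (2 * pi)) + b) = cis b" for n :: int and b
  proof -
    have "cis (- (of_int n * (2 * pi))) = 1"
      using cis_multiple_2pi[of "of_int (- n)"] by (simp add: mult_ac)
    then show ?thesis by (metis cis_mult mult_1)
  qed
  have cpair: "continuous_on S (\<lambda>x. g (x, y))" "continuous_on S (\<lambda>x. g (y, x))"
    if "continuous_on UNIV g" for g :: "point \<Rightarrow> real" and y and S :: "real set"
    by (rule continuous_on_compose2[OF that], auto intro!: continuous_intros)+
  show "fourier f1 k = \<i> * of_int (fst k) * fourier f k"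
  proof (rule main[OF _ c(1)])
    let ?h = "\<lambda>z. of_real (f1 z) * ?e z - \<i> * of_int (fst k) * (of_real (f z) * ?e z)"
    have "(LINT x:{0..2 * pi}|lborel. ?h (x, y)) = 0" for y
    proof -
      let ?F = "\<lambda>x. of_real (f (x, y)) * cis (- of_int (fst k) * x + - (of_int (snd k) * y))"
      have F: "(?F has_vector_derivative ?h (x, y)) (at x within S)" for x S
        by (rule has_vector_derivative_eq_rhs,
            rule has_vector_derivative_mult[OF has_vector_derivative_of_real[OF d1] cis_has_vector_derivative])
          (simp add: wavevec_inner algebra_simps)
      have "(LINT x:{0..2 * pi}|lborel. ?h (x, y)) = ?F (2 * pi) - ?F 0"
        unfolding set_lebesgue_integral_def
        by (intro integral_FTC_atLeastAtMost F)
           (auto simp: wavevec_inner intro!: ci cpair c cf)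
      also have "\<dots> = 0"
        using f(1) e2pi[of "fst k" "- (of_int (snd k) * y)"] by (simp add: periodic_def) (metis add_0)
      finally show ?thesis .
    qed
    then show "(\<integral>z. ?h z \<partial>torus) = 0"
      by (subst torus_iterated2) (auto intro!: ci c cf simp: set_lebesgue_integral_def)
  qed
  show "fourier f2 k = \<i> * of_int (snd k) * fourier f k"
  proof (rule main[OF _ c(2)])
    let ?h = "\<lambda>z. of_real (f2 z) * ?e z - \<i> * of_int (snd k) * (of_real (f z) * ?e z)"
    have "(LINT y:{0..2 * pi}|lborel. ?h (x, y)) = 0" for x
    proof -
      let ?F = "\<lambda>y. of_real (f (x, y)) * cis (- of_int (snd k) * y + - (of_int (fst k) * x))"
      have F: "(?F has_vector_derivative ?h (x, y)) (at y within S)" for y S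
        by (rule has_vector_derivative_eq_rhs,
            rule has_vector_derivative_mult[OF has_vector_derivative_of_real[OF d2] cis_has_vector_derivative])
          (simp add: wavevec_inner algebra_simps)
      have "(LINT y:{0..2 * pi}|lborel. ?h (x, y)) = ?F (2 * pi) - ?F 0"
        unfolding set_lebesgue_integral_def
        by (intro integral_FTC_atLeastAtMost F)
           (auto simp: wavevec_inner intro!: ci cpair c cf)
      also have "\<dots> = 0"
        using f(1) e2pi[of "snd k" "- (of_int (fst k) * x)"] by (simp add: periodic_def) (metis add_0)
      finally show ?thesis .
    qed
    then show "(\<integral>z. ?h z \<partial>torus) = 0"
      by (subst torus_iterated1) (auto intro!: ci c cf simp: set_lebesgue_integral_def)
  qed
qed

text \<open>Equals |k| at every nonzero frequency, since integer vectors other than 0 have norm at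
  least 1. The value 1 at \<open>k = 0\<close> permits division and keeps the mean in the weighted
  sums.\<close>

definition freqw :: "freq \<Rightarrow> real" where
  "freqw k = max 1 (norm (wavevec k))"

lemma freqw_ge_1: "1 \<le> freqw k" and freqw_pos: "0 < freqw k" and norm_le_freqw: "norm (wavevec k) \<le> freqw k"
  by (auto simp: freqw_def)

lemma freqw_minus [simp]: "freqw (- k) = freqw k"
  by (simp add: freqw_def wavevec_minus)

lemma fourier_bounded:
  assumes "continuous_on UNIV f"
  shows "\<exists>C. \<forall>k. norm (fourier f k) \<le> C"
proof -
  have "bounded (f ` ({0..2 * pi} \<times> {0..2 * pi}))"
    by (intro compact_imp_bounded compact_continuous_image compact_Times compact_Icc continuous_on_subset[OF assms]) auto
  then obtain B where B: "B > 0" "\<And>z. z \<in> {0..2 * pi} \<times> {0..2 * pi} \<Longrightarrow> \<bar>f z\<bar> \<le> B"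
    unfolding bounded_pos by auto
  have "norm (fourier f k) \<le> B" for k
  proof -
    have "norm (\<integral>z. of_real (f z) * cis (- (wavevec k \<bullet> z)) \<partial>torus) \<le> (\<integral>z. norm (of_real (f z) * cis (- (wavevec k \<bullet> z))) \<partial>torus)"
      by (rule integral_norm_bound)
    also have "\<dots> \<le> (\<integral>z. B \<partial>torus)"
      by (intro integral_mono torus_integrable continuous_intros continuous_on_cis assms)
         (auto simp: norm_mult space_torus intro!: B(2))
    also have "\<dots> = B * (2 * pi)\<^sup>2"
      using emeasure_torus by (simp add: measure_def power_mult_distrib)
    finally show ?thesis
      unfolding fourier_def by (simp add: norm_divide norm_power power_mult_distrib pos_divide_le_eq)
  qed
  then show ?thesis by blast
qed

lemma fourier_decay_aux:
  "ck n f \<Longrightarrow> periodic f \<Longrightarrow> \<exists>C. \<forall>k. \<bar>of_int (fst k)\<bar> ^ n * norm (fourier f k) \<le> C \<and> \<bar>of_int (snd k)\<bar> ^ n * norm (fourier f k) \<le> C"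
proof (induction n arbitrary: f)
  case 0
  then show ?case using fourier_bounded[of f] by auto
next
  case (Suc n)
  then obtain f1 f2 where f: "ck n f1" "ck n f2" "\<And>x. (f has_derivative (\<lambda>h. fst h * f1 x + snd h * f2 x)) (at x)"
    by auto
  note p = periodic_derivative[OF Suc.prems(2) f(3)]
  note d = fourier_derivative[OF Suc.prems(2) f(3) ck_continuous[OF f(1)] ck_continuous[OF f(2)]]
  obtain C1 where C1: "\<And>k. \<bar>of_int (fst k)\<bar> ^ n * norm (fourier f1 k) \<le> C1" using Suc.IH[OF f(1) p(1)] by blast
  obtain C2 where C2: "\<And>k. \<bar>of_int (snd k)\<bar> ^ n * norm (fourier f2 k) \<le> C2" using Suc.IH[OF f(2) p(2)] by blast
  have "\<bar>of_int (fst k)\<bar> ^ Suc n * norm (fourier f k) \<le> max C1 C2 \<and> \<bar>of_int (snd k)\<bar> ^ Suc n * norm (fourier f k) \<le> max C1 C2" for k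
    using C1[of k] C2[of k] by (simp add: d norm_mult mult_ac le_max_iff_disj)
  then show ?case by blast
qed

lemma fourier_decay:
  assumes "\<psi> \<in> smooth_torus"
  shows "\<exists>C\<ge>0. \<forall>k. freqw k ^ n * norm (fourier \<psi> k) \<le> C"
proof -
  have p: "periodic \<psi>" and s: "\<And>n. ck n \<psi>"
    using assms by (auto simp: smooth_torus_def smooth_def periodic_def)
  obtain C0 where C0: "\<And>k. norm (fourier \<psi> k) \<le> C0" using fourier_bounded[OF ck_continuous[OF s]] by blast
  obtain C1 where C1: "\<And>k. \<bar>of_int (fst k)\<bar> ^ n * norm (fourier \<psi> k) \<le> C1 \<and> \<bar>of_int (snd k)\<bar> ^ n * norm (fourier \<psi> k) \<le> C1"
    using fourier_decay_aux[OF s p] by blast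
  have "freqw k ^ n * norm (fourier \<psi> k) \<le> C0 + 2 ^ n * (C1 + C1)" for k
  proof -
    let ?a = "\<bar>of_int (fst k)\<bar> :: real" and ?b = "\<bar>of_int (snd k)\<bar> :: real"
    have "norm (wavevec k) \<le> ?a + ?b"
      using norm_Pair_le[of "of_int (fst k) :: real" "of_int (snd k) :: real"] by (simp add: wavevec_def)
    \<comment> \<open>The larger of the two coordinates is at least half of the norm, so decay in
      each coordinate separately is enough.\<close>
    then have "freqw k = 1 \<or> freqw k \<le> 2 * ?a \<or> freqw k \<le> 2 * ?b"
      by (auto simp: freqw_def max_def)
    then have "freqw k ^ n \<le> 1 ^ n \<or> freqw k ^ n \<le> (2 * ?a) ^ n \<or> freqw k ^ n \<le> (2 * ?b) ^ n"
      by (elim disjE)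
         (rule disjI1, simp, (rule disjI2, rule disjI1, rule power_mono, assumption, rule less_imp_le, rule freqw_pos),
          (rule disjI2, rule disjI2, rule power_mono, assumption, rule less_imp_le, rule freqw_pos))
    then have "freqw k ^ n \<le> 1 + 2 ^ n * (?a ^ n + ?b ^ n)"
      by (auto simp: power_mult_distrib algebra_simps intro: order_trans add_increasing add_increasing2)
    then have "freqw k ^ n * norm (fourier \<psi> k) \<le> (1 + 2 ^ n * (?a ^ n + ?b ^ n)) * norm (fourier \<psi> k)"
      by (intro mult_right_mono) auto
    also have "\<dots> = norm (fourier \<psi> k) + 2 ^ n * (?a ^ n * norm (fourier \<psi> k) + ?b ^ n * norm (fourier \<psi> k))"
      by (simp add: algebra_simps)
    also have "\<dots> \<le> C0 + 2 ^ n * (C1 + C1)"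
      using C0[of k] C1[of k] by (intro add_mono mult_left_mono) auto
    finally show ?thesis .
  qed
  moreover have "0 \<le> freqw 0 ^ n * norm (fourier \<psi> 0)" using freqw_pos[of 0] by simp
  ultimately show ?thesis by (meson order_trans)
qed

text \<open>Since \<open>(1 + a\<^sup>2) * (1 + b\<^sup>2)\<close> is at most four times the fourth
  power of the weight of the frequency (a, b), the lattice sum is dominated by a product of two
  convergent one-dimensional sums.\<close>

lemma freq_weight_summable: "(\<lambda>k :: freq. 1 / freqw k ^ 4) summable_on UNIV"
proof -
  define g where "g i = 1 / (1 + (of_int i)\<^sup>2 :: real)" for i :: int
  have g0: "0 \<le> g i" for i by (simp add: g_def)
  have gb: "sum g F \<le> 2 * (\<Sum>n. 1 / (1 + real n ^ 2))" if fin: "finite F" for F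
  proof -
    have sm: "summable (\<lambda>n. 1 / (1 + real n ^ 2))"
      by (rule summable_comparison_test'[OF inverse_power_summable[of 2, where 'a = real], of 1])
         (auto intro!: divide_left_mono simp: inverse_eq_divide add_pos_nonneg)
    obtain N where N: "\<And>i. i \<in> F \<Longrightarrow> nat \<bar>i\<bar> \<le> N"
    proof -
      have "finite ((\<lambda>i. nat \<bar>i\<bar>) ` F)" using fin by simp
      then show thesis using that unfolding finite_nat_set_iff_bounded_le by blast
    qed
    have "F \<subseteq> int ` {..N} \<union> (\<lambda>n. - int n) ` {..N}"
    proof
      fix i assume "i \<in> F"
      then have "i = int (nat \<bar>i\<bar>) \<or> i = - int (nat \<bar>i\<bar>)" "nat \<bar>i\<bar> \<in> {..N}" using N by auto
      then show "i \<in> int ` {..N} \<union> (\<lambda>n. - int n) ` {..N}" by blast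
    qed
    then have "sum g F \<le> sum g (int ` {..N} \<union> (\<lambda>n. - int n) ` {..N})"
      by (intro sum_mono2) (auto simp: g0)
    also have "\<dots> \<le> sum g (int ` {..N}) + sum g ((\<lambda>n. - int n) ` {..N})"
      by (subst sum.union_inter[symmetric]) (auto simp: g0 intro!: sum_nonneg)
    also have "\<dots> = 2 * (\<Sum>n\<le>N. 1 / (1 + real n ^ 2))"
      by (subst (1 2) sum.reindex) (auto simp: inj_on_def g_def)
    also have "\<dots> \<le> 2 * (\<Sum>n. 1 / (1 + real n ^ 2))"
      by (intro mult_left_mono sum_le_suminf sm) auto
    finally show ?thesis .
  qed
  define A where "A = 2 * (\<Sum>n. 1 / (1 + real n ^ 2))"
  show ?thesis
  proof (rule nonneg_bdd_above_summable_on)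
    show "bdd_above (sum (\<lambda>k. 1 / freqw k ^ 4) ` {F. F \<subseteq> UNIV \<and> finite F})"
    proof (rule bdd_aboveI2)
      fix F :: "freq set" assume "F \<in> {F. F \<subseteq> UNIV \<and> finite F}"
      then have F: "finite F" by simp
      have "1 / freqw k ^ 4 \<le> 4 * (g (fst k) * g (snd k))" for k
      proof -
        have c: "(of_int (fst k))\<^sup>2 \<le> (norm (wavevec k))\<^sup>2" "(of_int (snd k))\<^sup>2 \<le> (norm (wavevec k))\<^sup>2"
          by (auto simp: wavevec_def norm_Pair)
        have n: "(norm (wavevec k))\<^sup>2 \<le> (freqw k)\<^sup>2" "1 \<le> (freqw k)\<^sup>2"
          using norm_le_freqw[of k] freqw_ge_1[of k] by (auto intro!: power_mono simp: one_le_power)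
        have "(1 + (of_int (fst k))\<^sup>2) * (1 + (of_int (snd k))\<^sup>2) \<le> (2 * (freqw k)\<^sup>2) * (2 * (freqw k)\<^sup>2)"
          using c n by (intro mult_mono) auto
        also have "\<dots> = 4 * freqw k ^ 4" by (simp add: power2_eq_square power4_eq_xxxx)
        finally show ?thesis
          using freqw_pos[of k] unfolding g_def
          by (simp add: field_simps add_pos_nonneg)
      qed
      then have "(\<Sum>k\<in>F. 1 / freqw k ^ 4) \<le> (\<Sum>k\<in>F. 4 * (g (fst k) * g (snd k)))" by (intro sum_mono)
      also have "\<dots> \<le> (\<Sum>k\<in>fst ` F \<times> snd ` F. 4 * (g (fst k) * g (snd k)))"
        using F by (intro sum_mono2) (auto simp: g0 intro: rev_image_eqI)
      also have "\<dots> = 4 * (sum g (fst ` F) * sum g (snd ` F))"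
        unfolding sum_product sum.cartesian_product by (simp add: case_prod_beta' sum_distrib_left)
      also have "\<dots> \<le> 4 * (A * A)"
        using gb[of "fst ` F"] gb[of "snd ` F"] gb[of "{}"] F
        unfolding A_def[symmetric] by (intro mult_left_mono mult_mono) (auto intro!: sum_nonneg g0)
      finally show "(\<Sum>k\<in>F. 1 / freqw k ^ 4) \<le> 4 * (A * A)" .
    qed
  qed (use freqw_pos in \<open>auto simp: less_imp_le\<close>)
qed

lemma fourier_summable:
  assumes "\<psi> \<in> smooth_torus"
  shows "(\<lambda>k. freqw k ^ n * norm (fourier \<psi> k)) summable_on UNIV"
proof -
  obtain C where C: "\<And>k. freqw k ^ (n + 4) * norm (fourier \<psi> k) \<le> C" using fourier_decay[OF assms] by blast
  have "(\<lambda>k. C * (1 / freqw k ^ 4)) summable_on UNIV"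
    by (intro summable_on_cmult_right freq_weight_summable)
  then show ?thesis
  proof (rule summable_on_comparison_test)
    fix k
    show "freqw k ^ n * norm (fourier \<psi> k) \<le> C * (1 / freqw k ^ 4)"
      using C[of k] freqw_pos[of k] by (simp add: field_simps power_add)
    show "0 \<le> freqw k ^ n * norm (fourier \<psi> k)" using freqw_pos[of k] by simp
  qed
qed

section \<open>Integral norms\<close>

lemma ennpowr_ennreal: "0 \<le> x \<Longrightarrow> ennpowr (ennreal x) a = ennreal (x powr a)"
  by (simp add: ennpowr_def)

lemma ennpowr_top [simp]: "ennpowr top a = top"
  by (simp add: ennpowr_def)

lemma ennpowr_0 [simp]: "ennpowr 0 a = 0"
  by (simp add: ennpowr_def)

lemma ennpowr_1 [simp]: "ennpowr x 1 = x"
  by (cases x) (auto simp: ennpowr_ennreal)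

lemma ennpowr_mono: "0 \<le> a \<Longrightarrow> x \<le> y \<Longrightarrow> ennpowr x a \<le> ennpowr y a"
  by (cases x; cases y) (auto simp: ennpowr_ennreal top_unique intro!: ennreal_leI powr_mono2)

lemma ennpowr_ennpowr: "ennpowr (ennpowr x a) b = ennpowr x (a * b)"
  by (cases x) (auto simp: ennpowr_ennreal powr_powr)

lemma ennpowr_mult: "ennpowr (x * y) a = ennpowr x a * ennpowr y a"
proof -
  have *: "ennpowr (ennreal r * top) a = ennpowr (ennreal r) a * top" if "r \<ge> 0" for r
    using that by (cases "r = 0") (auto simp: ennpowr_ennreal ennreal_mult_top)
  show ?thesis
  proof (cases x; cases y)
    fix r t assume "x = ennreal r" "0 \<le> r" "y = ennreal t" "0 \<le> t"
    then show ?thesis by (simp add: ennpowr_ennreal powr_mult flip: ennreal_mult)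
  next
    fix r assume "x = ennreal r" "0 \<le> r" "y = top"
    then show ?thesis by (simp add: *)
  next
    fix r assume "x = top" "y = ennreal r" "0 \<le> r"
    then show ?thesis using *[of r] by (simp add: mult.commute)
  qed simp
qed

lemma ennpowr_measurable [measurable]: "(\<lambda>x. ennpowr x a) \<in> borel_measurable borel"
  unfolding ennpowr_def by measurable

lemma ennpowr_tendsto_0:
  assumes "(f \<longlongrightarrow> 0) F" "a > 0"
  shows "((\<lambda>x. ennpowr (f x) a) \<longlongrightarrow> 0) F"
proof (rule order_tendstoI)
  fix y :: ennreal assume y: "0 < y"
  have "eventually (\<lambda>x. f x < ennpowr (min y 1) (1 / a)) F"
  proof (rule order_tendstoD[OF assms(1)])
    obtain r where r: "min y 1 = ennreal r" "0 \<le> r" by (cases "min y 1") (auto simp: min_def top_unique split: if_splits)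
    then have "r > 0" using y by (auto simp: min_def split: if_splits)
    then show "0 < ennpowr (min y 1) (1 / a)" by (simp add: r ennpowr_ennreal)
  qed
  then show "eventually (\<lambda>x. ennpowr (f x) a < y) F"
  proof eventually_elim
    case (elim x)
    have "ennpowr (f x) a < y"
    proof (rule ccontr)
      assume "\<not> ennpowr (f x) a < y"
      then have "min y 1 \<le> ennpowr (f x) a" by (auto simp: min_le_iff_disj not_less)
      then have "ennpowr (min y 1) (1 / a) \<le> ennpowr (ennpowr (f x) a) (1 / a)"
        using assms by (intro ennpowr_mono) auto
      then show False using elim assms by (simp add: ennpowr_ennpowr)
    qed
    then show ?case .
  qed
qed simp

text \<open>Used with the torus for L^p norms of blocks and with the counting measure for the l^q
  sum over blocks, so that Minkowski's inequality needs only one proof.\<close>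

definition lnorm :: "real \<Rightarrow> 'a measure \<Rightarrow> ('a \<Rightarrow> ennreal) \<Rightarrow> ennreal" where
  "lnorm p M f = ennpowr (\<integral>\<^sup>+x. ennpowr (f x) p \<partial>M) (1 / p)"

lemma ennpowr_lnorm: "p \<noteq> 0 \<Longrightarrow> ennpowr (lnorm p M f) p = (\<integral>\<^sup>+x. ennpowr (f x) p \<partial>M)"
  by (simp add: lnorm_def ennpowr_ennpowr)

lemma lnorm_mono: "0 < p \<Longrightarrow> (\<And>x. x \<in> space M \<Longrightarrow> f x \<le> g x) \<Longrightarrow> lnorm p M f \<le> lnorm p M g"
  unfolding lnorm_def by (intro ennpowr_mono nn_integral_mono) auto

lemma lnorm_cong_AE: "AE x in M. f x = g x \<Longrightarrow> lnorm p M f = lnorm p M g"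
  unfolding lnorm_def by (auto intro!: arg_cong[where f = "\<lambda>x. ennpowr x _"] nn_integral_cong_AE)

lemma lnorm_eq_0:
  assumes "p \<noteq> 0" "f \<in> borel_measurable M" "lnorm p M f = 0"
  shows "AE x in M. f x = 0"
proof -
  have "(\<integral>\<^sup>+x. ennpowr (f x) p \<partial>M) = 0"
    using ennpowr_lnorm[OF assms(1), of M f] assms(3) by simp
  then have "AE x in M. ennpowr (f x) p = 0"
    using assms(2) by (subst (asm) nn_integral_0_iff_AE) auto
  then show ?thesis
  proof eventually_elim
    case (elim x)
    then have "ennpowr (ennpowr (f x) p) (1 / p) = 0" by simp
    then show ?case using assms(1) by (simp only: ennpowr_ennpowr) simp
  qed
qed

text \<open>Convexity of the p-th power, applied to \<open>x + y\<close> as the mean of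
  \<open>x * (a + b) / a\<close> and \<open>y * (a + b) / b\<close> with weights
  \<open>a / (a + b)\<close> and \<open>b / (a + b)\<close>. Integrated with \<open>a\<close> and
  \<open>b\<close> equal to the two norms it yields Minkowski's inequality with constant 1.\<close>

lemma powr_sum_le:
  fixes a b x y :: real
  assumes "0 < a" "0 < b" "0 \<le> x" "0 \<le> y" "1 \<le> p"
  shows "(x + y) powr p \<le> (a + b) powr (p - 1) * a powr (1 - p) * x powr p + (a + b) powr (p - 1) * b powr (1 - p) * y powr p"
proof -
  have pos: "(x + y) powr p \<le> (a + b) powr (p - 1) * a powr (1 - p) * x powr p + (a + b) powr (p - 1) * b powr (1 - p) * y powr p"
    if xy: "0 < x" "0 < y" for x y
  proof -
    let ?t = "a / (a + b)" and ?u = "b / (a + b)"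
    have "?t + ?u = (a + b) / (a + b)" by (rule add_divide_distrib[symmetric])
    then have tu: "?t + ?u = 1" using assms by simp
    have tp: "0 < ?t" "0 < ?u" using assms by auto
    have "v / D * (z / (v / D)) powr p = D powr (p - 1) * v powr (1 - p) * z powr p"
      if "D > 0" "v > 0" "z > 0" for D v z :: real
      using that by (simp add: powr_divide powr_mult powr_diff field_simps)
    then have c: "?t * (x / ?t) powr p = (a + b) powr (p - 1) * a powr (1 - p) * x powr p"
            "?u * (y / ?u) powr p = (a + b) powr (p - 1) * b powr (1 - p) * y powr p"
      using assms xy by simp_all
    have t_eq: "1 - ?u = ?t" using tu by linarith
    have u: "0 \<le> ?u" "?u \<le> 1" using tu tp by linarith+
    have "((1 - ?u) *\<^sub>R (x / ?t) + ?u *\<^sub>R (y / ?u)) powr p \<le> (1 - ?u) * (x / ?t) powr p + ?u * (y / ?u) powr p"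
      by (rule convex_onD[OF powr_convex[OF assms(5)] u]) (use tp xy in \<open>auto simp del: divide_divide_eq_right\<close>)
    then have "(?t * (x / ?t) + ?u * (y / ?u)) powr p \<le> ?t * (x / ?t) powr p + ?u * (y / ?u) powr p"
      by (simp only: t_eq real_scaleR_def)
    then have "(x + y) powr p \<le> ?t * (x / ?t) powr p + ?u * (y / ?u) powr p"
      using tp by (simp only: nonzero_mult_div_cancel_left times_divide_eq_right)
    then show ?thesis unfolding c .
  qed
  have ge1: "1 \<le> (a + b) powr (p - 1) * a powr (1 - p)" "1 \<le> (a + b) powr (p - 1) * b powr (1 - p)"
  proof -
    have "1 \<le> D powr (p - 1) * v powr (1 - p)" if "0 < v" "v \<le> D" for D v :: real
    proof -
      have "1 = v powr (p - 1) * v powr (1 - p)" using that by (simp flip: powr_add)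
      also have "\<dots> \<le> D powr (p - 1) * v powr (1 - p)"
        using that assms by (intro mult_right_mono powr_mono2) auto
      finally show ?thesis .
    qed
    then show "1 \<le> (a + b) powr (p - 1) * a powr (1 - p)" "1 \<le> (a + b) powr (p - 1) * b powr (1 - p)"
      using assms by auto
  qed
  show ?thesis
  proof (cases "x = 0 \<or> y = 0")
    case True
    then show ?thesis
    proof
      assume "x = 0"
      then show ?thesis using mult_right_mono[OF ge1(2), of "y powr p"] by simp
    next
      assume "y = 0"
      then show ?thesis using mult_right_mono[OF ge1(1), of "x powr p"] by simp
    qed
  next
    case False
    then show ?thesis using assms by (intro pos) auto
  qed
qed

lemma lnorm_triangle:
  assumes p: "1 \<le> p" and [measurable]: "f \<in> borel_measurable M" "g \<in> borel_measurable M"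
  shows "lnorm p M (\<lambda>x. f x + g x) \<le> lnorm p M f + lnorm p M g"
proof (cases "lnorm p M f = 0 \<or> lnorm p M g = 0 \<or> lnorm p M f = top \<or> lnorm p M g = top")
  case True
  have "lnorm p M (\<lambda>x. f x + g x) = lnorm p M g" if "lnorm p M f = 0"
  proof (rule lnorm_cong_AE)
    have "AE x in M. f x = 0" using p that by (intro lnorm_eq_0[of p]) auto
    then show "AE x in M. f x + g x = g x" by eventually_elim simp
  qed
  moreover have "lnorm p M (\<lambda>x. f x + g x) = lnorm p M f" if "lnorm p M g = 0"
  proof (rule lnorm_cong_AE)
    have "AE x in M. g x = 0" using p that by (intro lnorm_eq_0[of p]) auto
    then show "AE x in M. f x + g x = f x" by eventually_elim simp
  qed
  ultimately show ?thesis using True by auto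
next
  case False
  then obtain a b where ab: "lnorm p M f = ennreal a" "a > 0" "lnorm p M g = ennreal b" "b > 0"
    by (cases "lnorm p M f"; cases "lnorm p M g") (auto simp: less_le)
  \<comment> \<open>The coefficients of \<open>powr_sum_le\<close> with the norms as parameters;
    after integration they combine to exactly the p-th power of \<open>a + b\<close>.\<close>
  define c d where "c = (a + b) powr (p - 1) * a powr (1 - p)" "d = (a + b) powr (p - 1) * b powr (1 - p)"
  have cd: "c > 0" "d > 0" using ab by (auto simp: c_d_def)
  have pw: "ennpowr (u + v) p \<le> ennreal c * ennpowr u p + ennreal d * ennpowr v p" for u v
  proof (cases "u = top \<or> v = top")
    case True
    then show ?thesis using cd by (auto simp: ennreal_mult_top)
  next
    case False
    then obtain x y where "u = ennreal x" "v = ennreal y" "x \<ge> 0" "y \<ge> 0"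
      by (cases u; cases v) auto
    then show ?thesis
      using powr_sum_le[of a b x y p] ab p cd unfolding c_d_def[symmetric]
      by (simp add: ennpowr_ennreal less_imp_le flip: ennreal_plus ennreal_mult)
  qed
  have If: "(\<integral>\<^sup>+x. ennpowr (f x) p \<partial>M) = ennreal (a powr p)" "(\<integral>\<^sup>+x. ennpowr (g x) p \<partial>M) = ennreal (b powr p)"
    using ennpowr_lnorm[of p M f] ennpowr_lnorm[of p M g] ab p by (auto simp: ennpowr_ennreal)
  have "(\<integral>\<^sup>+x. ennpowr (f x + g x) p \<partial>M) \<le> (\<integral>\<^sup>+x. ennreal c * ennpowr (f x) p + ennreal d * ennpowr (g x) p \<partial>M)"
    by (intro nn_integral_mono pw)
  also have "\<dots> = ennreal (c * a powr p + d * b powr p)"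
    using cd by (simp add: nn_integral_add nn_integral_cmult If ennreal_mult)
  also have "c * a powr p + d * b powr p = (a + b) powr p"
  proof -
    have "a powr (1 - p) * a powr p = a" "b powr (1 - p) * b powr p = b"
      using ab by (simp_all flip: powr_add)
    moreover have "c * a powr p = (a + b) powr (p - 1) * (a powr (1 - p) * a powr p)"
        "d * b powr p = (a + b) powr (p - 1) * (b powr (1 - p) * b powr p)"
      by (simp_all add: c_d_def mult_ac)
    ultimately have "c * a powr p + d * b powr p = (a + b) powr (p - 1) * (a + b)"
      by (simp only: distrib_left)
    also have "\<dots> = (a + b) powr p" using ab by (simp add: powr_mult_base mult.commute)
    finally show ?thesis .
  qed
  finally have "lnorm p M (\<lambda>x. f x + g x) \<le> ennpowr (ennreal ((a + b) powr p)) (1 / p)"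
    unfolding lnorm_def using p by (intro ennpowr_mono) auto
  also have "\<dots> = ennreal a + ennreal b" using p ab by (simp add: ennpowr_ennreal powr_powr)
  finally show ?thesis by (simp add: ab)
qed

lemma le_lnorm_count:
  assumes "0 < q"
  shows "a j \<le> lnorm q (count_space UNIV) (a :: nat \<Rightarrow> ennreal)"
proof -
  have "ennpowr (a j) q = (\<Sum>i\<in>{j}. ennpowr (a i) q)" by simp
  also have "\<dots> \<le> (\<Sum>i. ennpowr (a i) q)" by (intro sum_le_suminf) auto
  finally have "ennpowr (ennpowr (a j) q) (1 / q) \<le> ennpowr (\<Sum>i. ennpowr (a i) q) (1 / q)"
    using assms by (intro ennpowr_mono) auto
  then show ?thesis using assms by (simp add: lnorm_def ennpowr_ennpowr nn_integral_count_space_nat)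
qed

lemma Lp_norm_lnorm: "0 < p \<Longrightarrow> Lp_norm (ennreal p) g = lnorm p torus (\<lambda>x. ennreal (norm (g x)))"
  by (simp add: Lp_norm_def lnorm_def ennpowr_ennreal)

lemma lq_norm_lnorm: "0 < q \<Longrightarrow> lq_norm (ennreal q) a = lnorm q (count_space UNIV) a"
  by (simp add: lq_norm_def lnorm_def nn_integral_count_space_nat)

text \<open>With \<open>a\<close> the L^p norm,
  \<open>x\<^sup>2 \<le> a\<^sup>2 + a powr (2 - p) * x powr p\<close> by distinguishing
  \<open>x \<le> a\<close> and \<open>x > a\<close>. Integration gives \<open>a\<^sup>2\<close>
  times the measure of the torus plus one more \<open>a\<^sup>2\<close>.\<close>

lemma L2_le_Lp:
  fixes g :: "point \<Rightarrow> complex"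
  assumes [measurable]: "g \<in> borel_measurable torus" and p: "2 \<le> p"
  shows "(\<integral>\<^sup>+x. ennreal ((norm (g x))\<^sup>2) \<partial>torus) \<le> ennreal (4 * pi\<^sup>2 + 1) * (lnorm p torus (\<lambda>x. ennreal (norm (g x))))\<^sup>2"
proof -
  have c0: "0 < 4 * pi\<^sup>2 + 1" by (simp add: add_nonneg_pos)
  consider "lnorm p torus (\<lambda>x. ennreal (norm (g x))) = 0" | "lnorm p torus (\<lambda>x. ennreal (norm (g x))) = top"
    | a where "lnorm p torus (\<lambda>x. ennreal (norm (g x))) = ennreal a" "a > 0"
    by (cases "lnorm p torus (\<lambda>x. ennreal (norm (g x)))") (auto simp: less_le)
  then show ?thesis
  proof cases
    case 1
    then have "AE x in torus. ennreal (norm (g x)) = 0" using p by (intro lnorm_eq_0[of p]) auto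
    then have "(\<integral>\<^sup>+x. ennreal ((norm (g x))\<^sup>2) \<partial>torus) = 0"
      by (subst nn_integral_0_iff_AE) (auto simp: ennreal_eq_0_iff)
    then show ?thesis by simp
  next
    case 2
    then show ?thesis using c0 by (simp add: ennreal_mult_top power_eq_top_ennreal)
  next
    case (3 a)
    have pt: "x\<^sup>2 \<le> a\<^sup>2 + a powr (2 - p) * x powr p" if "x \<ge> 0" for x
    proof (cases "x \<le> a")
      case True
      then have "x\<^sup>2 \<le> a\<^sup>2" using that by (intro power_mono) auto
      then show ?thesis by (simp add: add_increasing2)
    next
      case False
      then have "x\<^sup>2 = x powr (2 - p) * x powr p" using 3 by (simp flip: powr_add powr_numeral)
      also have "\<dots> \<le> a powr (2 - p) * x powr p"
        using False 3 p by (intro mult_right_mono powr_mono2') auto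
      finally show ?thesis by (simp add: add_increasing)
    qed
    have I: "(\<integral>\<^sup>+x. ennreal (norm (g x) powr p) \<partial>torus) = ennreal (a powr p)"
      using ennpowr_lnorm[of p torus "\<lambda>x. ennreal (norm (g x))"] 3 p by (simp add: ennpowr_ennreal)
    have J: "(\<integral>\<^sup>+x. ennreal (a powr (2 - p)) * ennreal (norm (g x) powr p) \<partial>torus) = ennreal (a powr (2 - p) * a powr p)"
      by (subst nn_integral_cmult) (auto simp: I ennreal_mult)
    have "(\<integral>\<^sup>+x. ennreal ((norm (g x))\<^sup>2) \<partial>torus) \<le> (\<integral>\<^sup>+x. ennreal (a\<^sup>2) + ennreal (a powr (2 - p)) * ennreal (norm (g x) powr p) \<partial>torus)"
      using pt by (intro nn_integral_mono) (simp flip: ennreal_plus ennreal_mult)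
    also have "\<dots> = ennreal (a\<^sup>2 * (4 * pi\<^sup>2) + a powr (2 - p) * a powr p)"
      by (subst nn_integral_add, simp, simp, subst J)
         (simp add: emeasure_torus flip: ennreal_mult ennreal_plus)
    also have "a powr (2 - p) * a powr p = a\<^sup>2" using 3 by (simp flip: powr_add)
    also have "ennreal (a\<^sup>2 * (4 * pi\<^sup>2) + a\<^sup>2) = ennreal (4 * pi\<^sup>2 + 1) * (ennreal a)\<^sup>2"
      using 3 c0 by (simp add: ennreal_power algebra_simps flip: ennreal_mult)
    finally show ?thesis by (simp add: 3)
  qed
qed

section \<open>Littlewood--Paley blocks\<close>

lemma lp_block_add: "lp_block \<rho> j (\<lambda>k. f k + g k) x = lp_block \<rho> j f x + lp_block \<rho> j g x"
  by (simp add: lp_block_def sum.distrib algebra_simps)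

lemma lp_block_minus: "lp_block \<rho> j (\<lambda>k. - f k) x = - lp_block \<rho> j f x"
  by (simp add: lp_block_def sum_negf)

lemma lp_block_0: "lp_block \<rho> j (\<lambda>k. 0) x = 0"
  by (simp add: lp_block_def)

lemma continuous_measurable_torus:
  fixes f :: "point \<Rightarrow> 'b :: topological_space"
  assumes "continuous_on UNIV f"
  shows "f \<in> borel_measurable torus"
  unfolding torus_def using borel_measurable_continuous_onI[OF assms] by (intro measurable_restrict_space1) simp

lemma cis_wave_measurable [measurable]: "(\<lambda>x. cis (wavevec k \<bullet> x)) \<in> borel_measurable torus"
  by (intro continuous_measurable_torus continuous_intros)

lemma lp_block_measurable [measurable]: "lp_block \<rho> j f \<in> borel_measurable torus"
  unfolding lp_block_def[abs_def] by measurable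

definition wt :: "real \<Rightarrow> nat \<Rightarrow> real" where
  "wt s j = 2 powr (s * (real j - 1))"

lemma wt_pos: "0 < wt s j" by (simp add: wt_def)

abbreviation blk :: "(nat \<Rightarrow> point \<Rightarrow> real) \<Rightarrow> real \<Rightarrow> nat \<Rightarrow> coeffs \<Rightarrow> ennreal" where
  "blk \<rho> p j f \<equiv> lnorm p torus (\<lambda>x. ennreal (norm (lp_block \<rho> j f x)))"

lemma blk_triangle:
  assumes "1 \<le> p"
  shows "blk \<rho> p j (\<lambda>k. f k + g k) \<le> blk \<rho> p j f + blk \<rho> p j g"
proof -
  have "blk \<rho> p j (\<lambda>k. f k + g k) \<le> lnorm p torus (\<lambda>x. ennreal (norm (lp_block \<rho> j f x)) + ennreal (norm (lp_block \<rho> j g x)))"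
    using assms by (intro lnorm_mono) (auto simp: lp_block_add norm_triangle_ineq simp flip: ennreal_plus)
  also have "\<dots> \<le> blk \<rho> p j f + blk \<rho> p j g"
    using assms by (intro lnorm_triangle) auto
  finally show ?thesis .
qed

lemma blk_minus: "blk \<rho> p j (\<lambda>k. - f k) = blk \<rho> p j f"
  by (simp add: lp_block_minus)

lemma besov_norm_eq:
  assumes "0 < p" "0 < q"
  shows "besov_norm \<rho> s (ennreal p) (ennreal q) f = lnorm q (count_space UNIV) (\<lambda>j. ennreal (wt s j) * blk \<rho> p j f)"
  unfolding besov_norm_def wt_def using assms by (simp add: lq_norm_lnorm Lp_norm_lnorm)

lemma besov_norm_triangle:
  assumes "1 \<le> p" "1 \<le> q"
  shows "besov_norm \<rho> s (ennreal p) (ennreal q) (\<lambda>k. f k + g k) \<le>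
    besov_norm \<rho> s (ennreal p) (ennreal q) f + besov_norm \<rho> s (ennreal p) (ennreal q) g"
proof -
  have "besov_norm \<rho> s (ennreal p) (ennreal q) (\<lambda>k. f k + g k) \<le>
      lnorm q (count_space UNIV) (\<lambda>j. ennreal (wt s j) * blk \<rho> p j f + ennreal (wt s j) * blk \<rho> p j g)"
    using assms by (subst besov_norm_eq)
      (auto intro!: lnorm_mono mult_left_mono blk_triangle simp flip: distrib_left)
  also have "\<dots> \<le> besov_norm \<rho> s (ennreal p) (ennreal q) f + besov_norm \<rho> s (ennreal p) (ennreal q) g"
    using assms by (subst (1 2) besov_norm_eq) (auto intro!: lnorm_triangle)
  finally show ?thesis .
qed

lemma besov_norm_minus:
  assumes "0 < p" "0 < q"
  shows "besov_norm \<rho> s (ennreal p) (ennreal q) (\<lambda>k. - f k) = besov_norm \<rho> s (ennreal p) (ennreal q) f"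
  using assms by (simp add: besov_norm_eq blk_minus)

lemma besov_norm_0:
  assumes "0 < p" "0 < q"
  shows "besov_norm \<rho> s (ennreal p) (ennreal q) (\<lambda>k. 0) = 0"
  using assms by (simp add: besov_norm_eq lp_block_0 lnorm_def)

lemma le_besov_norm:
  assumes "0 < p" "0 < q"
  shows "ennreal (wt s j) * blk \<rho> p j f \<le> besov_norm \<rho> s (ennreal p) (ennreal q) f"
  using assms le_lnorm_count[of q "\<lambda>j. ennreal (wt s j) * blk \<rho> p j f" j] by (simp add: besov_norm_eq)

text \<open>The Besov norm is the root of order \<open>q\<close> of the series of these terms.
  Compactness and convergence are expressed through the tails of that series, which add up without
  roots.\<close>

definition bpow :: "(nat \<Rightarrow> point \<Rightarrow> real) \<Rightarrow> real \<Rightarrow> real \<Rightarrow> real \<Rightarrow> nat \<Rightarrow> coeffs \<Rightarrow> ennreal" where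
  "bpow \<rho> s p q j f = ennpowr (ennreal (wt s j) * blk \<rho> p j f) q"

lemma besov_norm_bpow:
  assumes "0 < p" "0 < q"
  shows "besov_norm \<rho> s (ennreal p) (ennreal q) f = ennpowr (\<Sum>j. bpow \<rho> s p q j f) (1 / q)"
  unfolding besov_norm_eq[OF assms] by (simp add: lnorm_def bpow_def nn_integral_count_space_nat)

lemma ennpowr_add_le:
  assumes "0 \<le> q"
  shows "ennpowr (x + y) q \<le> ennreal (2 powr q) * (ennpowr x q + ennpowr y q)"
proof -
  have "x + y \<le> ennreal 2 * max x y"
    by (metis add_mono ennreal_numeral max.cobounded1 max.cobounded2 mult_2 zero_le_numeral)
  then have "ennpowr (x + y) q \<le> ennreal (2 powr q) * ennpowr (max x y) q"
    using ennpowr_mono[OF assms, of "x + y" "ennreal 2 * max x y"]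
    by (simp only: ennpowr_mult ennpowr_ennreal zero_le_numeral)
  also have "\<dots> \<le> ennreal (2 powr q) * (ennpowr x q + ennpowr y q)"
    by (intro mult_left_mono) (auto simp: max_def add_increasing add_increasing2)
  finally show ?thesis .
qed

lemma bpow_diff_le:
  assumes "1 \<le> p" "0 < q"
  shows "bpow \<rho> s p q j (\<lambda>k. f k - g k) \<le> ennreal (2 powr q) * (bpow \<rho> s p q j f + bpow \<rho> s p q j g)"
proof -
  have "blk \<rho> p j (\<lambda>k. f k - g k) \<le> blk \<rho> p j f + blk \<rho> p j g"
    using blk_triangle[OF assms(1), of \<rho> j f "\<lambda>k. - g k"] by (simp add: blk_minus)
  then have "bpow \<rho> s p q j (\<lambda>k. f k - g k) \<le> ennpowr (ennreal (wt s j) * blk \<rho> p j f + ennreal (wt s j) * blk \<rho> p j g) q"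
    unfolding bpow_def using assms by (intro ennpowr_mono) (auto simp flip: distrib_left intro!: mult_left_mono)
  also have "\<dots> \<le> ennreal (2 powr q) * (bpow \<rho> s p q j f + bpow \<rho> s p q j g)"
    unfolding bpow_def using assms by (intro ennpowr_add_le) auto
  finally show ?thesis .
qed

text \<open>For \<open>q = p\<close> the outer power cancels the root in the L^p norm. What remains
  is a plain integral, to which Fatou's lemma applies.\<close>

lemma bpow_p:
  assumes "0 < p"
  shows "bpow \<rho> s p p j f = (\<integral>\<^sup>+x. ennreal (wt s j powr p * norm (lp_block \<rho> j f x) powr p) \<partial>torus)"
  using assms less_imp_le[OF wt_pos[of s j]]
  by (simp add: bpow_def ennpowr_mult ennpowr_lnorm ennpowr_ennreal nn_integral_cmult ennreal_mult)

lemma bpow_measurable [measurable]: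
  assumes [measurable]: "\<And>k. (\<lambda>\<omega>. z \<omega> k) \<in> borel_measurable M"
  shows "(\<lambda>\<omega>. bpow \<rho> s p p j (z \<omega>)) \<in> borel_measurable M"
proof -
  have [measurable]: "(\<lambda>x. lp_block \<rho> j (z (fst x)) (snd x)) \<in> borel_measurable (M \<Otimes>\<^sub>M torus)"
    unfolding lp_block_def by measurable
  have [measurable]: "(\<lambda>\<omega>. blk \<rho> p j (z \<omega>)) \<in> borel_measurable M"
    unfolding lnorm_def
    by (intro measurable_compose[OF _ ennpowr_measurable] torus.borel_measurable_nn_integral) (simp add: case_prod_beta')
  show ?thesis unfolding bpow_def by measurable
qed

section \<open>Lower semicontinuity of the norms\<close>

text \<open>Fatou's lemma on a space with two points.\<close>

lemma liminf_add_le_ennreal: "liminf a + liminf b \<le> liminf (\<lambda>n. a n + b n :: ennreal)"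
proof -
  have "(\<integral>\<^sup>+i. liminf (\<lambda>n. if i then a n else b n) \<partial>count_space UNIV) \<le> liminf (\<lambda>n. \<integral>\<^sup>+i. (if i then a n else b n) \<partial>count_space UNIV)"
    by (intro nn_integral_liminf) auto
  then show ?thesis by (simp add: nn_integral_count_space_finite UNIV_bool add.commute)
qed

lemma suminf_liminf_le: "(\<Sum>j. liminf (\<lambda>n. a n j)) \<le> liminf (\<lambda>n. \<Sum>j. a n j :: ennreal)"
  unfolding nn_integral_count_space_nat[symmetric] by (intro nn_integral_liminf) auto

lemma cmult_liminf: "ennreal c * liminf a = liminf (\<lambda>n. ennreal c * a n)"
  by (intro Liminf_compose_continuous_mono[symmetric] ennreal_continuous_on_cmult continuous_on_id)
     (auto simp: mono_def intro: mult_left_mono)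

lemma liminf_const_le: "(\<And>n. a n \<le> B) \<Longrightarrow> liminf a \<le> (B :: ennreal)"
  by (metis (mono_tags, lifting) Liminf_le trivial_limit_sequentially always_eventually)

text \<open>Countably many exceptional null sets form a null set, off which every \<open>g n\<close>
  lies below its essential supremum.\<close>

lemma esssup_liminf:
  fixes g :: "nat \<Rightarrow> point \<Rightarrow> ennreal"
  assumes "\<And>x. (\<lambda>n. g n x) \<longlonglongrightarrow> h x" "h \<in> borel_measurable torus"
  shows "esssup torus h \<le> liminf (\<lambda>n. esssup torus (g n))"
proof (rule esssup_I[OF assms(2)])
  have "AE x in torus. \<forall>n. g n x \<le> esssup torus (g n)"
    unfolding AE_all_countable by (intro allI esssup_AE)
  then show "AE x in torus. h x \<le> liminf (\<lambda>n. esssup torus (g n))"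
  proof eventually_elim
    case (elim x)
    have "h x = liminf (\<lambda>n. g n x)" using assms(1)[of x] by (intro lim_imp_Liminf[symmetric]) auto
    also have "\<dots> \<le> liminf (\<lambda>n. esssup torus (g n))" using elim by (intro Liminf_mono) auto
    finally show ?case .
  qed
qed

lemma lp_block_lim: "(\<And>k. ((\<lambda>n. f n k) \<longlongrightarrow> g k) F) \<Longrightarrow> ((\<lambda>n. lp_block \<rho> j (f n) x) \<longlongrightarrow> lp_block \<rho> j g x) F"
  unfolding lp_block_def by (intro tendsto_intros)

lemma besov_norm_inf_eq: "besov_norm \<rho> s \<infinity> 1 f = (\<Sum>j. ennreal (wt s j) * esssup torus (\<lambda>x. ennreal (norm (lp_block \<rho> j f x))))"
  by (simp add: besov_norm_def lq_norm_def Lp_norm_def wt_def)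

text \<open>Convergence of the coefficients gives pointwise convergence of each block; essential
  suprema and nonnegative series can only drop in the limit.\<close>

lemma besov_norm_inf_lsc:
  assumes "\<And>k. (\<lambda>n. f n k) \<longlonglongrightarrow> g k"
  shows "besov_norm \<rho> s \<infinity> 1 g \<le> liminf (\<lambda>n. besov_norm \<rho> s \<infinity> 1 (f n))"
proof -
  have "besov_norm \<rho> s \<infinity> 1 g \<le> (\<Sum>j. liminf (\<lambda>n. ennreal (wt s j) * esssup torus (\<lambda>x. ennreal (norm (lp_block \<rho> j (f n) x)))))"
    unfolding besov_norm_inf_eq cmult_liminf[symmetric]
    by (intro suminf_le mult_left_mono esssup_liminf tendsto_ennrealI tendsto_norm lp_block_lim assms) auto
  also have "\<dots> \<le> liminf (\<lambda>n. besov_norm \<rho> s \<infinity> 1 (f n))"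
    unfolding besov_norm_inf_eq by (rule suminf_liminf_le)
  finally show ?thesis .
qed

lemma bpow_tail_lsc:
  assumes "0 < p" "\<And>k. (\<lambda>n. f n k) \<longlonglongrightarrow> g k"
  shows "(\<Sum>j. bpow \<rho> s p p (j + J) g) \<le> liminf (\<lambda>n. \<Sum>j. bpow \<rho> s p p (j + J) (f n))"
proof -
  have "bpow \<rho> s p p j g \<le> liminf (\<lambda>n. bpow \<rho> s p p j (f n))" for j
  proof -
    have "ennreal (wt s j powr p * norm (lp_block \<rho> j g x) powr p) = liminf (\<lambda>n. ennreal (wt s j powr p * norm (lp_block \<rho> j (f n) x) powr p))" for x
      using assms by (intro lim_imp_Liminf[symmetric] tendsto_ennrealI tendsto_mult tendsto_const tendsto_powr' tendsto_norm lp_block_lim) auto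
    then show ?thesis unfolding bpow_p[OF assms(1)]
      by (simp only:) (intro nn_integral_liminf, measurable)
  qed
  then have "(\<Sum>j. bpow \<rho> s p p (j + J) g) \<le> (\<Sum>j. liminf (\<lambda>n. bpow \<rho> s p p (j + J) (f n)))"
    by (intro suminf_le) auto
  also have "\<dots> \<le> liminf (\<lambda>n. \<Sum>j. bpow \<rho> s p p (j + J) (f n))"
    by (rule suminf_liminf_le)
  finally show ?thesis .
qed

text \<open>The constant of the embedding of bounded functions into L^p on a torus of measure
  \<open>4 * pi\<^sup>2\<close>.\<close>

definition Cinf :: "real \<Rightarrow> real" where
  "Cinf p = (4 * pi\<^sup>2) powr (1 / p)"

lemma Cinf_pos: "0 < Cinf p" by (simp add: Cinf_def)

lemma lnorm_torus_bound:
  assumes "0 < p" "AE x in torus. g x \<le> B"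
  shows "lnorm p torus g \<le> ennreal (Cinf p) * B"
proof -
  have "lnorm p torus g \<le> ennpowr (\<integral>\<^sup>+x. ennpowr B p \<partial>torus) (1 / p)"
    unfolding lnorm_def using assms(1)
    by (intro ennpowr_mono nn_integral_mono_AE) (use assms(2) in \<open>auto elim!: eventually_mono intro: ennpowr_mono\<close>)
  also have "\<dots> = ennreal (Cinf p) * B"
    using assms(1) by (simp add: emeasure_torus ennpowr_mult ennpowr_ennpowr ennpowr_ennreal Cinf_def mult.commute)
  finally show ?thesis .
qed

lemma blk_le_esssup: "0 < p \<Longrightarrow> blk \<rho> p j f \<le> ennreal (Cinf p) * esssup torus (\<lambda>x. ennreal (norm (lp_block \<rho> j f x)))"
  by (intro lnorm_torus_bound esssup_AE)

text \<open>Giving up \<delta> of regularity gains a factor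
  \<open>2 powr (- \<delta> * (real j - 1))\<close> on block \<open>j\<close>, which decreases from
  \<open>J\<close> on. This is the source of the uniformly small tails on sublevel sets of the path
  norm; the \<open>- 1\<close> comes from the shifted numbering of the blocks.\<close>

lemma besov_tail_bound:
  assumes p: "0 < p" and d: "0 < \<delta>"
  shows "(\<Sum>j. bpow \<rho> s p 1 (j + J) f) \<le> ennreal (Cinf p * 2 powr (- \<delta> * (real J - 1))) * besov_norm \<rho> (s + \<delta>) \<infinity> 1 f"
proof -
  let ?E = "\<lambda>j. esssup torus (\<lambda>x. ennreal (norm (lp_block \<rho> j f x)))"
  have "bpow \<rho> s p 1 (j + J) f \<le> ennreal (Cinf p * 2 powr (- \<delta> * (real J - 1))) * (ennreal (wt (s + \<delta>) (j + J)) * ?E (j + J))" for j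
  proof -
    have "wt s (j + J) = wt (s + \<delta>) (j + J) * 2 powr (- \<delta> * (real (j + J) - 1))"
      unfolding wt_def by (simp add: algebra_simps flip: powr_add)
    also have "\<dots> \<le> wt (s + \<delta>) (j + J) * 2 powr (- \<delta> * (real J - 1))"
      using d less_imp_le[OF wt_pos] by (intro mult_left_mono powr_mono mult_left_mono_neg) auto
    finally have "ennreal (wt s (j + J)) * blk \<rho> p (j + J) f \<le>
        ennreal (wt (s + \<delta>) (j + J) * 2 powr (- \<delta> * (real J - 1))) * (ennreal (Cinf p) * ?E (j + J))"
      using p by (intro mult_mono ennreal_leI blk_le_esssup) auto
    then show ?thesis
      using wt_pos[of "s + \<delta>" "j + J"] Cinf_pos[of p] by (simp add: bpow_def ennreal_mult less_imp_le mult_ac)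
  qed
  then have "(\<Sum>j. bpow \<rho> s p 1 (j + J) f) \<le> (\<Sum>j. ennreal (Cinf p * 2 powr (- \<delta> * (real J - 1))) * (ennreal (wt (s + \<delta>) (j + J)) * ?E (j + J)))"
    by (intro suminf_le) auto
  also have "\<dots> = ennreal (Cinf p * 2 powr (- \<delta> * (real J - 1))) * (\<Sum>j. ennreal (wt (s + \<delta>) (j + J)) * ?E (j + J))"
    by simp
  also have "\<dots> \<le> ennreal (Cinf p * 2 powr (- \<delta> * (real J - 1))) * besov_norm \<rho> (s + \<delta>) \<infinity> 1 f"
    unfolding besov_norm_inf_eq
    by (intro mult_left_mono, subst (2) suminf_offset[where i = J]) (auto intro: add_increasing2)
  finally show ?thesis .
qed

lemma besov_norm_le_inf:
  assumes "0 < p"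
  shows "besov_norm \<rho> s (ennreal p) (ennreal 1) f \<le> ennreal (Cinf p) * besov_norm \<rho> s \<infinity> 1 f"
proof -
  have "besov_norm \<rho> s (ennreal p) (ennreal 1) f = (\<Sum>j. ennreal (wt s j) * blk \<rho> p j f)"
    using assms by (subst besov_norm_bpow) (auto simp: bpow_def)
  also have "\<dots> \<le> (\<Sum>j. ennreal (Cinf p) * (ennreal (wt s j) * esssup torus (\<lambda>x. ennreal (norm (lp_block \<rho> j f x)))))"
    unfolding mult.left_commute[of "ennreal (Cinf p)"]
    using assms by (intro suminf_le mult_left_mono blk_le_esssup) auto
  also have "\<dots> = ennreal (Cinf p) * besov_norm \<rho> s \<infinity> 1 f"
    unfolding besov_norm_inf_eq by (rule ennreal_suminf_cmult)
  finally show ?thesis .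
qed

section \<open>Blocks of a dyadic partition of unity\<close>

locale dyadic =
  fixes \<rho> :: "nat \<Rightarrow> point \<Rightarrow> real"
  assumes dyadic: "dyadic_partition \<rho>"
begin

lemma rho_sums: "(\<lambda>j. \<rho> j x) sums 1"
  using dyadic unfolding dyadic_partition_def by blast

lemma rho_disjoint: "i + 1 < j \<Longrightarrow> supp (\<rho> i) \<inter> supp (\<rho> j) = {}"
  using dyadic unfolding dyadic_partition_def by blast

lemma rho_nonneg: "0 \<le> \<rho> j x"
proof -
  obtain \<phi>0 \<phi> where "\<forall>x. 0 \<le> \<phi>0 x \<and> 0 \<le> \<phi> x" "\<rho> 0 = \<phi>0" "\<forall>j. \<rho> (Suc j) = (\<lambda>x. \<phi> (x /\<^sub>R 2 ^ j))"
    using dyadic unfolding dyadic_partition_def by (elim conjE exE)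
  then show ?thesis by (cases j) (simp_all del: split_paired_All)
qed

lemma rho_le_1: "\<rho> j x \<le> 1"
  using sum_le_suminf[of "\<lambda>j. \<rho> j x" "{j}"] rho_sums[of x] rho_nonneg
  by (auto simp: sums_iff)

lemma rho_support: "\<rho> j x \<noteq> 0 \<Longrightarrow> x \<in> supp (\<rho> j)"
  using closure_subset[of "{x. \<rho> j x \<noteq> 0}"] by (auto simp: supp_def)

text \<open>Beyond the first index \<open>j\<close> with a nonzero value only \<open>Suc j\<close>
  can contribute, because supports two apart are disjoint; the two values add up to 1. A coefficient
  can thus be recovered from a single block at the cost of a factor 2.\<close>

lemma rho_half: "\<exists>j. 1 / 2 \<le> \<rho> j x"
proof -
  have "\<exists>j. \<rho> j x \<noteq> 0"
  proof (rule ccontr)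
    assume "\<nexists>j. \<rho> j x \<noteq> 0"
    then show False using rho_sums[of x] by (simp add: sums_iff)
  qed
  then obtain j where j: "\<rho> j x \<noteq> 0" "\<And>i. i < j \<Longrightarrow> \<rho> i x = 0"
    using exists_least_iff[of "\<lambda>j. \<rho> j x \<noteq> 0"] by auto
  have "\<rho> i x = 0" if "i \<notin> {j, Suc j}" for i
  proof (cases "i < j")
    case False
    then have "j + 1 < i" using that by auto
    then have "supp (\<rho> j) \<inter> supp (\<rho> i) = {}" by (rule rho_disjoint)
    then show ?thesis using rho_support j(1) by blast
  qed (use j in auto)
  then have "(\<lambda>i. \<rho> i x) sums (\<Sum>i\<in>{j, Suc j}. \<rho> i x)" by (intro sums_finite) auto
  then have "\<rho> j x + \<rho> (Suc j) x = 1" using rho_sums[of x] sums_unique2 by fastforce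
  then have "1 / 2 \<le> \<rho> j x \<or> 1 / 2 \<le> \<rho> (Suc j) x" by linarith
  then show ?thesis by blast
qed

lemma rho_scale: "\<exists>c\<ge>1. \<forall>j k. \<rho> j (wavevec k) \<noteq> 0 \<longrightarrow> 2 ^ j \<le> c * freqw k"
proof -
  obtain \<phi>0 \<phi> a b where \<phi>: "\<forall>j. \<rho> (Suc j) = (\<lambda>x. \<phi> (x /\<^sub>R 2 ^ j))" "0 < a" "supp \<phi> \<subseteq> cball 0 b - ball 0 a"
    using dyadic unfolding dyadic_partition_def by (elim conjE exE)
  \<comment> \<open>The inner radius \<open>a\<close> of the annulus gives
    \<open>a * 2 ^ i \<le> norm (wavevec k)\<close> for block \<open>Suc i\<close>, hence the 2 in
    the quotient; the maximum with 1 covers block 0.\<close>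
  define c where "c = max 1 (2 / a)"
  have "2 ^ j \<le> c * freqw k" if "\<rho> j (wavevec k) \<noteq> 0" for j k
  proof (cases j)
    case 0
    have "1 * 1 \<le> c * freqw k" using freqw_ge_1[of k] by (intro mult_mono) (auto simp: c_def)
    then show ?thesis by (simp add: 0)
  next
    case (Suc i)
    have "\<phi> (wavevec k /\<^sub>R 2 ^ i) \<noteq> 0" using that \<phi>(1) Suc by simp
    then have "wavevec k /\<^sub>R 2 ^ i \<in> supp \<phi>"
      using closure_subset[of "{x. \<phi> x \<noteq> 0}"] by (auto simp: supp_def)
    then have "a \<le> norm (wavevec k /\<^sub>R 2 ^ i)" using \<phi>(3) by fastforce
    then have "a * 2 ^ i \<le> norm (wavevec k)" by (simp add: field_simps)
    also have "\<dots> \<le> freqw k" by (rule norm_le_freqw)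
    finally have "2 ^ i \<le> freqw k / a" using \<phi>(2) by (simp add: field_simps)
    then have "2 * 2 ^ i \<le> 2 * (freqw k / a)" by linarith
    then have "2 ^ j \<le> 2 / a * freqw k" using Suc by simp
    also have "\<dots> \<le> c * freqw k" using freqw_pos[of k] by (intro mult_right_mono) (auto simp: c_def)
    finally show ?thesis .
  qed
  then show ?thesis by (intro exI[of _ c]) (auto simp: c_def)
qed

lemma finite_block: "finite {k. \<rho> j (wavevec k) \<noteq> 0}"
proof -
  obtain \<phi>0 \<phi> r a b where \<phi>: "supp \<phi>0 \<subseteq> cball 0 r" "\<rho> 0 = \<phi>0" "\<forall>j. \<rho> (Suc j) = (\<lambda>x. \<phi> (x /\<^sub>R 2 ^ j))"
      "supp \<phi> \<subseteq> cball 0 b - ball 0 a"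
    using dyadic unfolding dyadic_partition_def by (elim conjE exE)
  have "\<exists>R. \<forall>x. \<rho> j x \<noteq> 0 \<longrightarrow> norm x \<le> R"
  proof (cases j)
    case 0
    then show ?thesis using \<phi> rho_support[of 0] by (intro exI[of _ r]) fastforce
  next
    case (Suc i)
    have "norm x \<le> 2 ^ i * b" if "\<rho> j x \<noteq> 0" for x
    proof -
      have "\<phi> (x /\<^sub>R 2 ^ i) \<noteq> 0" using that \<phi>(3) Suc by simp
      then have "x /\<^sub>R 2 ^ i \<in> supp \<phi>"
        using closure_subset[of "{x. \<phi> x \<noteq> 0}"] by (auto simp: supp_def)
      then have "norm (x /\<^sub>R 2 ^ i) \<le> b" using \<phi>(4) by fastforce
      then show ?thesis by (simp add: field_simps)
    qed
    then show ?thesis by blast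
  qed
  then obtain R where R: "\<And>x. \<rho> j x \<noteq> 0 \<Longrightarrow> norm x \<le> R" by blast
  have "{k. \<rho> j (wavevec k) \<noteq> 0} \<subseteq> {- \<lceil>R\<rceil>..\<lceil>R\<rceil>} \<times> {- \<lceil>R\<rceil>..\<lceil>R\<rceil>}"
  proof
    fix k assume "k \<in> {k. \<rho> j (wavevec k) \<noteq> 0}"
    then have "norm (wavevec k) \<le> R" using R by auto
    then have "\<bar>of_int (fst k)\<bar> \<le> R" "\<bar>of_int (snd k)\<bar> \<le> R"
      using norm_fst_le[where x = "of_int (fst k) :: real" and y = "of_int (snd k) :: real"]
        norm_snd_le[where x = "of_int (fst k) :: real" and y = "of_int (snd k) :: real"]
      by (auto simp: wavevec_def)
    then have "\<bar>fst k\<bar> \<le> \<lceil>R\<rceil>" "\<bar>snd k\<bar> \<le> \<lceil>R\<rceil>"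
      by (metis le_of_int_ceiling of_int_abs of_int_le_iff order_trans)+
    then show "k \<in> {- \<lceil>R\<rceil>..\<lceil>R\<rceil>} \<times> {- \<lceil>R\<rceil>..\<lceil>R\<rceil>}" by (cases k) auto
  qed
  then show ?thesis by (rule finite_subset) auto
qed

abbreviation "S j \<equiv> {k. \<rho> j (wavevec k) \<noteq> 0}"

lemma norm_lp_block_le: "norm (lp_block \<rho> j f x) \<le> (\<Sum>k\<in>S j. norm (f k))"
  unfolding lp_block_def
proof (rule sum_norm_le)
  fix k
  have "\<rho> j (wavevec k) * norm (f k) \<le> 1 * norm (f k)"
    using rho_le_1 by (intro mult_right_mono) auto
  then show "norm (of_real (\<rho> j (wavevec k)) * f k * cis (wavevec k \<bullet> x)) \<le> norm (f k)"
    using rho_nonneg[of j "wavevec k"] by (simp add: norm_mult)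
qed

lemma blk_le_sum: "0 < p \<Longrightarrow> blk \<rho> p j f \<le> ennreal (Cinf p * (\<Sum>k\<in>S j. norm (f k)))"
  using lnorm_torus_bound[of p "\<lambda>x. ennreal (norm (lp_block \<rho> j f x))" "ennreal (\<Sum>k\<in>S j. norm (f k))"]
    norm_lp_block_le[of j f] Cinf_pos[of p] by (simp add: ennreal_mult sum_nonneg less_imp_le ennreal_leI)

text \<open>The constant of \<open>L2_le_Lp\<close>.\<close>

definition C2 :: real where "C2 = 4 * pi\<^sup>2 + 1"

lemma C2_ge_1: "1 \<le> C2" by (simp add: C2_def)

text \<open>Parseval's identity for the finite block, followed by the comparison of L^2 with L^p on
  the torus; the factor \<open>4 * pi\<^sup>2\<close> of Parseval is at least 1 and is
  dropped.\<close>

lemma block_L2: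
  assumes "2 \<le> p"
  shows "ennreal (\<Sum>k\<in>S j. (\<rho> j (wavevec k) * norm (f k))\<^sup>2) \<le> ennreal C2 * (blk \<rho> p j f)\<^sup>2"
proof -
  let ?a = "\<Sum>k\<in>S j. (\<rho> j (wavevec k) * norm (f k))\<^sup>2"
  have c: "continuous_on UNIV (\<lambda>x. (norm (lp_block \<rho> j f x))\<^sup>2)"
    unfolding lp_block_def by (intro continuous_intros)
  have "4 * pi\<^sup>2 * ?a = (\<integral>x. (norm (lp_block \<rho> j f x))\<^sup>2 \<partial>torus)"
    unfolding lp_block_def
    by (subst torus_parseval[OF finite_block]) (auto simp: norm_mult rho_nonneg intro!: sum.cong)
  then have "ennreal (4 * pi\<^sup>2 * ?a) = (\<integral>\<^sup>+x. ennreal ((norm (lp_block \<rho> j f x))\<^sup>2) \<partial>torus)"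
    using torus_integrable[OF c] by (subst nn_integral_eq_integral) auto
  also have "\<dots> \<le> ennreal C2 * (blk \<rho> p j f)\<^sup>2"
    unfolding C2_def using assms by (intro L2_le_Lp) auto
  finally have *: "ennreal (4 * pi\<^sup>2 * ?a) \<le> ennreal C2 * (blk \<rho> p j f)\<^sup>2" .
  have "1 * ?a \<le> 4 * pi\<^sup>2 * ?a"
  proof (rule mult_right_mono)
    have "1 * 1 \<le> pi * pi" using pi_gt3 by (intro mult_mono) auto
    then show "1 \<le> 4 * pi\<^sup>2" by (simp add: power2_eq_square)
  qed (auto intro: sum_nonneg)
  then have "ennreal ?a \<le> ennreal (4 * pi\<^sup>2 * ?a)" by (intro ennreal_leI) simp
  then show ?thesis using * by (rule order_trans)
qed

lemma block_coeff:
  assumes "2 \<le> p"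
  shows "ennreal (\<rho> j (wavevec k) * norm (f k)) \<le> ennreal C2 * blk \<rho> p j f"
proof (cases "blk \<rho> p j f")
  case top
  then show ?thesis using C2_ge_1 by (simp add: ennreal_mult_top)
next
  case (real l)
  let ?x = "\<rho> j (wavevec k) * norm (f k)"
  have "?x\<^sup>2 \<le> (\<Sum>k\<in>S j. (\<rho> j (wavevec k) * norm (f k))\<^sup>2)"
    by (cases "k \<in> S j") (auto intro!: member_le_sum finite_block sum_nonneg)
  then have "ennreal (?x\<^sup>2) \<le> ennreal C2 * (ennreal l)\<^sup>2"
    using block_L2[OF assms, of j f] by (simp add: real order_trans[OF ennreal_leI])
  also have "\<dots> = ennreal (C2 * l\<^sup>2)" using real C2_ge_1 by (simp add: ennreal_power ennreal_mult)
  finally have "?x\<^sup>2 \<le> C2 * l\<^sup>2" using C2_ge_1 by simp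
  also have "\<dots> \<le> C2 * C2 * l\<^sup>2" using C2_ge_1 by (intro mult_right_mono) auto
  finally have "?x\<^sup>2 \<le> (C2 * l)\<^sup>2" by (simp add: power2_eq_square mult_ac)
  then have "?x \<le> C2 * l" by (rule power2_le_imp_le) (use C2_ge_1 real in auto)
  then show ?thesis using real C2_ge_1 by (simp add: ennreal_leI flip: ennreal_mult)
qed

lemma coeff_le_blk:
  assumes "2 \<le> p" "1 / 2 \<le> \<rho> j (wavevec k)"
  shows "ennreal (norm (f k)) \<le> ennreal (2 * C2) * blk \<rho> p j f"
proof -
  have "norm (f k) * 1 \<le> norm (f k) * (2 * \<rho> j (wavevec k))" using assms by (intro mult_left_mono) auto
  then have "ennreal (norm (f k)) \<le> ennreal 2 * ennreal (\<rho> j (wavevec k) * norm (f k))"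
    by (subst ennreal_mult[symmetric]) (auto simp: rho_nonneg mult_ac intro!: ennreal_leI)
  also have "\<dots> \<le> ennreal 2 * (ennreal C2 * blk \<rho> p j f)"
    using assms by (intro mult_left_mono block_coeff) auto
  finally show ?thesis using C2_ge_1 by (simp add: ennreal_mult mult.assoc)
qed

text \<open>The coefficient is read off from a block in which its frequency has weight at least 1/2;
  the weight of that block enters the constant, which therefore depends on \<open>k\<close>.\<close>

lemma coeff_bound:
  assumes "2 \<le> p" "0 < q"
  shows "\<exists>C\<ge>0. \<forall>f. ennreal (norm (f k)) \<le> ennreal C * besov_norm \<rho> s (ennreal p) (ennreal q) f"
proof -
  obtain j where j: "1 / 2 \<le> \<rho> j (wavevec k)" using rho_half by blast
  have "ennreal (norm (f k)) \<le> ennreal (2 * C2 / wt s j) * besov_norm \<rho> s (ennreal p) (ennreal q) f" for f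
  proof -
    have "ennreal (norm (f k)) \<le> ennreal (2 * C2) * blk \<rho> p j f" by (rule coeff_le_blk[OF assms(1) j])
    also have "\<dots> = ennreal (2 * C2 / wt s j) * (ennreal (wt s j) * blk \<rho> p j f)"
      using wt_pos[of s j] C2_ge_1 by (simp add: mult.assoc[symmetric] flip: ennreal_mult)
    also have "\<dots> \<le> ennreal (2 * C2 / wt s j) * besov_norm \<rho> s (ennreal p) (ennreal q) f"
      using assms by (intro mult_left_mono le_besov_norm) auto
    finally show ?thesis .
  qed
  then show ?thesis using C2_ge_1 wt_pos[of s j] by (intro exI[of _ "2 * C2 / wt s j"]) auto
qed

text \<open>The version of \<open>coeff_bound\<close> that is uniform in the frequency: for
  \<open>-2 \<le> s\<close> undoing the weight of block \<open>j\<close> costs at most the square of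
  \<open>2 ^ j\<close>, and \<open>rho_scale\<close> turns this into the square of the frequency. It
  makes pairings with smooth functions converge absolutely.\<close>

lemma coeff_growth:
  assumes "2 \<le> p" "0 < q" "-2 \<le> s" "s \<le> 0"
  shows "\<exists>C\<ge>0. \<forall>f k. ennreal (norm (f k)) \<le> ennreal (C * (freqw k)\<^sup>2) * besov_norm \<rho> s (ennreal p) (ennreal q) f"
proof -
  obtain c where c: "c \<ge> 1" "\<And>j k. \<rho> j (wavevec k) \<noteq> 0 \<Longrightarrow> 2 ^ j \<le> c * freqw k" using rho_scale by blast
  have "ennreal (norm (f k)) \<le> ennreal (2 * C2 * c\<^sup>2 * (freqw k)\<^sup>2) * besov_norm \<rho> s (ennreal p) (ennreal q) f" for f k
  proof -
    obtain j where j: "1 / 2 \<le> \<rho> j (wavevec k)" using rho_half by blast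
    have "1 / wt s j = 2 powr (- s * (real j - 1))" by (simp add: wt_def powr_minus_divide)
    also have "\<dots> \<le> 2 powr (2 * real j)"
    proof (rule powr_mono)
      show "- s * (real j - 1) \<le> 2 * real j"
      proof (cases j)
        case 0
        then show ?thesis using assms by simp
      next
        case (Suc i)
        have "- s * real i \<le> 2 * real i" using assms by (intro mult_right_mono) auto
        then show ?thesis using Suc by simp
      qed
    qed simp
    also have "2 powr (2 * real j) = (2 ^ j)\<^sup>2"
      by (simp add: powr_realpow[symmetric] powr_powr mult.commute flip: powr_numeral)
    also have "(2 ^ j)\<^sup>2 \<le> (c * freqw k)\<^sup>2" using c(2)[of j k] j by (intro power_mono) auto
    finally have w: "1 / wt s j \<le> c\<^sup>2 * (freqw k)\<^sup>2" by (simp add: power_mult_distrib)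
    have "ennreal (norm (f k)) \<le> ennreal (2 * C2) * blk \<rho> p j f" by (rule coeff_le_blk[OF assms(1) j])
    also have "\<dots> = ennreal (2 * C2 * (1 / wt s j)) * (ennreal (wt s j) * blk \<rho> p j f)"
      using wt_pos[of s j] C2_ge_1 by (simp add: mult.assoc[symmetric] flip: ennreal_mult)
    also have "\<dots> \<le> ennreal (2 * C2 * (c\<^sup>2 * (freqw k)\<^sup>2)) * besov_norm \<rho> s (ennreal p) (ennreal q) f"
      using assms w C2_ge_1 less_imp_le[OF wt_pos[of s j]] by (intro mult_mono ennreal_leI le_besov_norm) auto
    finally show ?thesis by (simp add: mult.assoc)
  qed
  then show ?thesis using C2_ge_1 by (intro exI[of _ "2 * C2 * c\<^sup>2"]) auto
qed

text \<open>Absolutely summable coefficients bound all blocks by the same number, and for negative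
  \<open>s\<close> the weights decay geometrically.\<close>

lemma besov_norm_finite:
  assumes "0 < p" "0 < q" "s < 0" and f: "(\<lambda>k. norm (f k)) summable_on UNIV"
  shows "besov_norm \<rho> s (ennreal p) (ennreal q) f < \<infinity>"
proof -
  define A where "A = (\<Sum>\<^sub>\<infinity>k. norm (f k))"
  have A0: "0 \<le> A" unfolding A_def by (intro infsum_nonneg) auto
  have "(\<Sum>k\<in>S j. norm (f k)) \<le> A" for j
    unfolding A_def by (intro finite_sum_le_infsum f finite_block) auto
  then have b: "blk \<rho> p j f \<le> ennreal (Cinf p * A)" for j
    using Cinf_pos[of p] by (intro order_trans[OF blk_le_sum[OF assms(1)]] ennreal_leI mult_left_mono) auto
  define x where "x = (2 :: real) powr (s * q)"
  have x: "0 < x" "x < 1"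
    using assms powr_less_mono[of "s * q" 0 2] by (auto simp: x_def mult_neg_pos)
  define D where "D = (2 powr - s * (Cinf p * A)) powr q"
  have "bpow \<rho> s p q j f \<le> ennreal (D * x ^ j)" for j
  proof -
    have "wt s j = 2 powr - s * 2 powr (s * real j)" by (simp add: wt_def algebra_simps flip: powr_add)
    then have "(wt s j * (Cinf p * A)) powr q = D * (2 powr (s * real j)) powr q"
      using A0 Cinf_pos[of p] unfolding D_def by (simp add: powr_mult mult_ac less_imp_le)
    also have "(2 powr (s * real j)) powr q = x ^ j"
      by (simp add: x_def powr_powr powr_realpow[symmetric] mult_ac)
    finally have "ennpowr (ennreal (wt s j) * ennreal (Cinf p * A)) q = ennreal (D * x ^ j)"
      using A0 Cinf_pos[of p] wt_pos[of s j] by (simp add: ennpowr_ennreal flip: ennreal_mult)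
    moreover have "bpow \<rho> s p q j f \<le> ennpowr (ennreal (wt s j) * ennreal (Cinf p * A)) q"
      unfolding bpow_def using assms b by (intro ennpowr_mono mult_left_mono) auto
    ultimately show ?thesis by simp
  qed
  then have "(\<Sum>j. bpow \<rho> s p q j f) \<le> (\<Sum>j. ennreal (D * x ^ j))" by (intro suminf_le) auto
  also have "\<dots> < top"
    using x by (subst less_top[symmetric], intro ennreal_suminf_neq_top summable_mult summable_geometric) (auto simp: D_def)
  finally obtain r where "(\<Sum>j. bpow \<rho> s p q j f) = ennreal r" "0 \<le> r"
    by (cases "\<Sum>j. bpow \<rho> s p q j f") auto
  then show ?thesis using assms by (simp add: besov_norm_bpow ennpowr_ennreal)
qed

text \<open>Finitely many blocks involve finitely many coefficients, and the other blocks are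
  covered by the tail. An arbitrary filter is allowed because the lemma serves both for continuity
  in time and for convergence uniform over a time interval.\<close>

lemma besov_norm_tendsto_0:
  assumes p: "0 < p" "0 < q"
    and c: "\<And>k. ((\<lambda>i. g i k) \<longlongrightarrow> 0) F"
    and t: "\<And>\<epsilon> :: real. \<epsilon> > 0 \<Longrightarrow> \<exists>J. eventually (\<lambda>i. (\<Sum>j. bpow \<rho> s p q (j + J) (g i)) \<le> ennreal \<epsilon>) F"
  shows "((\<lambda>i. besov_norm \<rho> s (ennreal p) (ennreal q) (g i)) \<longlongrightarrow> 0) F"
proof -
  have b: "((\<lambda>i. bpow \<rho> s p q j (g i)) \<longlongrightarrow> 0) F" for j
  proof (rule tendsto_sandwich[OF always_eventually always_eventually tendsto_const])
    show "\<forall>i. bpow \<rho> s p q j (g i) \<le> ennpowr (ennreal (wt s j * (Cinf p * (\<Sum>k\<in>S j. norm (g i k))))) q"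
      unfolding bpow_def using p less_imp_le[OF wt_pos[of s j]] less_imp_le[OF Cinf_pos[of p]]
      by (simp only: ennreal_mult sum_nonneg norm_ge_zero mult_nonneg_nonneg)
         (auto intro!: ennpowr_mono mult_left_mono blk_le_sum[THEN order_trans] simp: ennreal_mult sum_nonneg)
    have "((\<lambda>i. ennreal (wt s j * (Cinf p * (\<Sum>k\<in>S j. norm (g i k))))) \<longlongrightarrow> ennreal (wt s j * (Cinf p * (\<Sum>k\<in>S j. norm (0 :: complex))))) F"
      by (intro tendsto_intros c)
    then show "((\<lambda>i. ennpowr (ennreal (wt s j * (Cinf p * (\<Sum>k\<in>S j. norm (g i k))))) q) \<longlongrightarrow> 0) F"
      using p by (intro ennpowr_tendsto_0) auto
  qed auto
  have "((\<lambda>i. \<Sum>j. bpow \<rho> s p q j (g i)) \<longlongrightarrow> 0) F"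
  proof (rule order_tendstoI)
    fix y :: ennreal assume y: "0 < y"
    \<comment> \<open>Capping at 1 replaces a possibly infinite \<open>y\<close> by a real number;
      of its three thirds two are spent and one makes the inequality strict.\<close>
    obtain r where r: "min y 1 = ennreal r" "0 \<le> r" by (cases "min y 1") (auto simp: min_def top_unique split: if_splits)
    define \<epsilon> where "\<epsilon> = r / 3"
    have my: "min y 1 = ennreal (3 * \<epsilon>)" "\<epsilon> > 0"
      using y r by (auto simp: \<epsilon>_def min_def split: if_splits)
    obtain J where J: "eventually (\<lambda>i. (\<Sum>j. bpow \<rho> s p q (j + J) (g i)) \<le> ennreal \<epsilon>) F" using t[OF my(2)] by blast
    have "((\<lambda>i. \<Sum>j<J. bpow \<rho> s p q j (g i)) \<longlongrightarrow> (\<Sum>j<J. 0)) F" by (intro tendsto_sum b)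
    then have "eventually (\<lambda>i. (\<Sum>j<J. bpow \<rho> s p q j (g i)) < ennreal \<epsilon>) F"
      using my(2) by (intro order_tendstoD(2)[where y = 0]) auto
    with J show "eventually (\<lambda>i. (\<Sum>j. bpow \<rho> s p q j (g i)) < y) F"
    proof eventually_elim
      case (elim i)
      have "(\<Sum>j. bpow \<rho> s p q j (g i)) = (\<Sum>j. bpow \<rho> s p q (j + J) (g i)) + (\<Sum>j<J. bpow \<rho> s p q j (g i))"
        by (rule suminf_offset) auto
      also have "\<dots> \<le> ennreal \<epsilon> + ennreal \<epsilon>" using elim by (intro add_mono) auto
      also have "\<dots> < ennreal (3 * \<epsilon>)" using my(2) by (simp add: ennreal_less_iff flip: ennreal_plus)
      also have "\<dots> \<le> y" by (simp flip: my(1))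
      finally show ?case .
    qed
  qed simp
  then show ?thesis using p by (simp add: besov_norm_bpow ennpowr_tendsto_0)
qed

text \<open>The embedding of \<open>B^(-1/2)_(p,1)\<close> into H^(-1/2): each block is estimated in
  L^2, its frequencies are at least of order \<open>2 ^ j\<close>, and a summable sequence of block
  norms is square summable.\<close>

lemma besov_embed_hminus:
  assumes "2 \<le> p"
  shows "\<exists>C\<ge>0. \<forall>f. (\<integral>\<^sup>+k. ennreal ((norm (f k))\<^sup>2 / freqw k) \<partial>count_space UNIV) \<le>
    ennreal C * (besov_norm \<rho> (- 1 / 2) (ennreal p) 1 f)\<^sup>2"
proof -
  obtain c where c: "c \<ge> 1" "\<And>j k. \<rho> j (wavevec k) \<noteq> 0 \<Longrightarrow> 2 ^ j \<le> c * freqw k" using rho_scale by blast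
  let ?s = "- 1 / 2 :: real"
  \<comment> \<open>The shifted numbering makes the square of the weight \<open>2 / 2 ^ j\<close>.
    The 4 on the right is the square of the factor 2 lost in passing to a block of weight at least
    1/2.\<close>
  have wt2: "2 * (wt ?s j)\<^sup>2 = 4 / 2 ^ j" for j
  proof -
    have "(wt ?s j)\<^sup>2 = 2 powr (- 1 / 2 * (real j - 1) + - 1 / 2 * (real j - 1))"
      by (simp only: wt_def power2_eq_square powr_add)
    also have "\<dots> = 2 powr (1 - real j)" by (intro arg_cong[where f = "(powr) 2"]) (simp add: field_simps)
    also have "\<dots> = 2 / 2 ^ j" by (simp add: powr_diff powr_realpow)
    finally show ?thesis by simp
  qed
  have "(\<integral>\<^sup>+k. ennreal ((norm (f k))\<^sup>2 / freqw k) \<partial>count_space UNIV) \<le> ennreal (2 * c * C2) * (besov_norm \<rho> ?s (ennreal p) 1 f)\<^sup>2" for f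
  proof -
    let ?r = "\<lambda>j k. ennreal (2 * c * (wt ?s j)\<^sup>2 * (\<rho> j (wavevec k) * norm (f k))\<^sup>2)"
    let ?b = "\<lambda>j. ennreal (wt ?s j) * blk \<rho> p j f"
    have "ennreal ((norm (f k))\<^sup>2 / freqw k) \<le> (\<Sum>j. ?r j k)" for k
    proof -
      obtain j where j: "1 / 2 \<le> \<rho> j (wavevec k)" using rho_half by blast
      have "(norm (f k))\<^sup>2 * 1 \<le> (norm (f k))\<^sup>2 * (2 * \<rho> j (wavevec k))\<^sup>2"
        using j power_mono[of 1 "2 * \<rho> j (wavevec k)" 2] by (intro mult_left_mono) auto
      then have 1: "(norm (f k))\<^sup>2 \<le> 4 * (\<rho> j (wavevec k) * norm (f k))\<^sup>2"
        by (simp add: power_mult_distrib mult_ac)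
      have "2 ^ j \<le> c * freqw k" using c(2)[of j k] j by simp
      then have 2: "1 / freqw k \<le> c * (1 / 2 ^ j)" using freqw_pos[of k] by (simp add: field_simps)
      have "(norm (f k))\<^sup>2 / freqw k \<le> (4 * (\<rho> j (wavevec k) * norm (f k))\<^sup>2) * (c * (1 / 2 ^ j))"
        using mult_mono[OF 1 2] freqw_pos[of k] by (simp add: less_imp_le)
      also have "\<dots> = c * (4 / 2 ^ j) * (\<rho> j (wavevec k) * norm (f k))\<^sup>2" by simp
      also have "\<dots> = 2 * c * (wt ?s j)\<^sup>2 * (\<rho> j (wavevec k) * norm (f k))\<^sup>2" unfolding wt2[symmetric] by simp
      finally have "ennreal ((norm (f k))\<^sup>2 / freqw k) \<le> ?r j k" by (rule ennreal_leI)
      also have "\<dots> = (\<Sum>j\<in>{j}. ?r j k)" by simp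
      also have "\<dots> \<le> (\<Sum>j. ?r j k)" by (intro sum_le_suminf) auto
      finally show ?thesis .
    qed
    then have "(\<integral>\<^sup>+k. ennreal ((norm (f k))\<^sup>2 / freqw k) \<partial>count_space UNIV) \<le> (\<integral>\<^sup>+k. (\<Sum>j. ?r j k) \<partial>count_space UNIV)"
      by (intro nn_integral_mono)
    also have "\<dots> = (\<Sum>j. \<integral>\<^sup>+k. ?r j k \<partial>count_space UNIV)" by (intro nn_integral_suminf) auto
    also have "\<dots> \<le> (\<Sum>j. ennreal (2 * c * C2) * (?b j)\<^sup>2)"
    proof (intro suminf_le allI)
      fix j
      have "(\<integral>\<^sup>+k. ?r j k \<partial>count_space UNIV) = (\<Sum>k\<in>S j. ?r j k)"
        by (rule nn_integral_count_space'[OF finite_block]) auto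
      also have "\<dots> = ennreal (2 * c * (wt ?s j)\<^sup>2 * (\<Sum>k\<in>S j. (\<rho> j (wavevec k) * norm (f k))\<^sup>2))"
        using c by (subst sum_ennreal) (auto simp: sum_distrib_left)
      also have "\<dots> = ennreal (2 * c * (wt ?s j)\<^sup>2) * ennreal (\<Sum>k\<in>S j. (\<rho> j (wavevec k) * norm (f k))\<^sup>2)"
        using c by (intro ennreal_mult) (auto intro: sum_nonneg)
      also have "\<dots> \<le> ennreal (2 * c * (wt ?s j)\<^sup>2) * (ennreal C2 * (blk \<rho> p j f)\<^sup>2)"
        by (intro mult_left_mono block_L2 assms) auto
      also have "\<dots> = ennreal (2 * c * C2) * (?b j)\<^sup>2"
        using c C2_ge_1 wt_pos[of ?s j] by (simp add: ennreal_mult power_mult_distrib ennreal_power mult_ac)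
      finally show "(\<integral>\<^sup>+k. ?r j k \<partial>count_space UNIV) \<le> ennreal (2 * c * C2) * (?b j)\<^sup>2" .
    qed auto
    also have "\<dots> = ennreal (2 * c * C2) * (\<Sum>j. (?b j)\<^sup>2)" by simp
    also have "\<dots> \<le> ennreal (2 * c * C2) * (besov_norm \<rho> ?s (ennreal p) 1 f)\<^sup>2"
    proof (rule mult_left_mono)
      have N: "besov_norm \<rho> ?s (ennreal p) 1 f = (\<Sum>j. ?b j)"
        using assms besov_norm_bpow[of p 1 \<rho> ?s f] by (simp add: bpow_def)
      have bN: "?b j \<le> besov_norm \<rho> ?s (ennreal p) 1 f" for j
        using assms le_besov_norm[of p 1 ?s j \<rho> f] by simp
      have "(\<Sum>j. (?b j)\<^sup>2) \<le> (\<Sum>j. besov_norm \<rho> ?s (ennreal p) 1 f * ?b j)"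
        unfolding power2_eq_square by (intro suminf_le mult_right_mono bN) auto
      also have "\<dots> = (besov_norm \<rho> ?s (ennreal p) 1 f)\<^sup>2"
        unfolding N power2_eq_square by (rule ennreal_suminf_cmult)
      finally show "(\<Sum>j. (?b j)\<^sup>2) \<le> (besov_norm \<rho> ?s (ennreal p) 1 f)\<^sup>2" .
    qed simp
    finally show ?thesis .
  qed
  then show ?thesis using c C2_ge_1 by (intro exI[of _ "2 * c * C2"]) auto
qed

end

section \<open>Spaces of continuous paths\<close>

lemma ennreal_half_pos:
  fixes \<epsilon> :: ennreal
  assumes "0 < \<epsilon>"
  obtains r :: real where "0 < r" "ennreal r + ennreal r \<le> \<epsilon>"
proof (cases \<epsilon>)
  case (real x)
  then show ?thesis using assms by (intro that[of "x / 2"]) (auto simp flip: ennreal_plus)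
next
  case top
  then show ?thesis by (intro that[of 1]) auto
qed

locale besov_space = dyadic +
  fixes s p q :: real
  assumes p: "2 \<le> p" and q: "1 \<le> q" and s: "s < 0"
begin

abbreviation "N f \<equiv> besov_norm \<rho> s (ennreal p) (ennreal q) f"
abbreviation "E \<equiv> besov \<rho> s (ennreal p) (ennreal q)"
abbreviation "paths \<equiv> besov_paths \<rho> s (ennreal p) (ennreal q)"
abbreviation "T \<equiv> path_topology \<rho> s (ennreal p) (ennreal q)"

lemma N_triangle: "N (\<lambda>k. f k - h k) \<le> N (\<lambda>k. f k - g k) + N (\<lambda>k. g k - h k)"
  using besov_norm_triangle[of p q \<rho> s "\<lambda>k. f k - g k" "\<lambda>k. g k - h k"] p q by simp

lemma N_sym: "N (\<lambda>k. f k - g k) = N (\<lambda>k. g k - f k)"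
  using besov_norm_minus[of p q \<rho> s "\<lambda>k. f k - g k"] p q by simp

lemma N_zero [simp]: "N (\<lambda>k. 0) = 0"
  using besov_norm_0[of p q \<rho> s] p q by simp

lemma N_smooth: "g \<in> smooth_torus \<Longrightarrow> N (fourier g) < \<infinity>"
  using fourier_summable[of g 0] p q s by (intro besov_norm_finite) auto

lemma N_finite:
  assumes "f \<in> E"
  shows "N f < \<infinity>"
proof -
  obtain g where g: "g \<in> smooth_torus" "N (\<lambda>k. f k - fourier g k) < 1"
    using assms[unfolded besov_def, THEN CollectD, rule_format, OF zero_less_one] by (elim bexE)
  have "N f \<le> N (\<lambda>k. f k - fourier g k) + N (fourier g)"
    using besov_norm_triangle[of p q \<rho> s "\<lambda>k. f k - fourier g k" "fourier g"] p q by simp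
  also have "\<dots> < \<infinity>" using less_trans[OF g(2) ennreal_one_less_top] N_smooth[OF g(1)] by (simp add: less_top[symmetric])
  finally show ?thesis .
qed

lemma N_diff_finite:
  assumes "f \<in> E" "g \<in> E"
  shows "N (\<lambda>k. f k - g k) < \<infinity>"
proof -
  have "N (\<lambda>k. f k - g k) \<le> N f + N (\<lambda>k. - g k)"
    using besov_norm_triangle[of p q \<rho> s f "\<lambda>k. - g k"] p q by simp
  also have "N (\<lambda>k. - g k) = N g" using p q by (intro besov_norm_minus) auto
  also have "N f + N g < \<infinity>" using N_finite[OF assms(1)] N_finite[OF assms(2)] by (simp add: less_top[symmetric])
  finally show ?thesis .
qed

lemma E_closed:
  assumes "\<And>\<epsilon>. \<epsilon> > 0 \<Longrightarrow> \<exists>g\<in>E. N (\<lambda>k. f k - g k) < ennreal \<epsilon>"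
  shows "f \<in> E"
  unfolding besov_def
proof (intro CollectI allI impI)
  fix \<epsilon> :: ennreal assume "0 < \<epsilon>"
  then obtain r where r: "0 < r" "ennreal r + ennreal r \<le> \<epsilon>" by (rule ennreal_half_pos)
  obtain g where g: "g \<in> E" "N (\<lambda>k. f k - g k) < ennreal r" using assms[OF r(1)] by blast
  have "0 < ennreal r" using r by simp
  then obtain h where h: "h \<in> smooth_torus" "N (\<lambda>k. g k - fourier h k) < ennreal r"
    using g(1)[unfolded besov_def, THEN CollectD, rule_format, OF \<open>0 < ennreal r\<close>] by (elim bexE)
  have "N (\<lambda>k. f k - fourier h k) \<le> N (\<lambda>k. f k - g k) + N (\<lambda>k. g k - fourier h k)" by (rule N_triangle)
  also have "\<dots> < ennreal r + ennreal r" using g h by (intro add_strict_mono) auto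
  also note r(2)
  finally show "\<exists>g\<in>smooth_torus. N (\<lambda>k. f k - fourier g k) < \<epsilon>" using h by blast
qed

text \<open>The Besov norm may be infinite, but differences within \<open>E\<close> have finite
  norm. This real-valued distance makes order and continuity arguments on the reals
  available.\<close>

definition rd :: "coeffs \<Rightarrow> coeffs \<Rightarrow> real" where
  "rd f g = enn2real (N (\<lambda>k. f k - g k))"

lemma N_rd: "f \<in> E \<Longrightarrow> g \<in> E \<Longrightarrow> N (\<lambda>k. f k - g k) = ennreal (rd f g)"
  using N_diff_finite[of f g] by (simp add: rd_def)

lemma rd_nonneg [simp]: "0 \<le> rd f g" by (simp add: rd_def)

lemma rd_triangle: "f \<in> E \<Longrightarrow> g \<in> E \<Longrightarrow> h \<in> E \<Longrightarrow> rd f h \<le> rd f g + rd g h"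
  using N_triangle[of f h g] by (simp add: N_rd flip: ennreal_plus)

lemma rd_sym: "rd f g = rd g f"
  by (simp add: rd_def N_sym[of f g])

lemma pathsD: "f \<in> paths \<Longrightarrow> f t \<in> E" by (simp add: besov_paths_def)

lemma paths_continuous:
  assumes "f \<in> paths"
  shows "((\<lambda>r. rd (f r) (f t)) \<longlongrightarrow> 0) (at t)"
proof -
  have "((\<lambda>r. N (\<lambda>k. f r k - f t k)) \<longlongrightarrow> 0) (at t)" using assms by (simp add: besov_paths_def)
  then have "((\<lambda>r. ennreal (rd (f r) (f t))) \<longlongrightarrow> ennreal 0) (at t)"
    using assms by (simp add: N_rd pathsD)
  then show ?thesis by (subst (asm) tendsto_ennreal_iff) auto
qed

lemma pathsI:
  assumes "\<And>t. f t \<in> E" "\<And>t. ((\<lambda>r. N (\<lambda>k. f r k - f t k)) \<longlongrightarrow> 0) (at t)"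
  shows "f \<in> paths"
  using assms by (simp add: besov_paths_def)

lemma rd_continuous:
  assumes f: "f \<in> paths" and g: "g \<in> paths"
  shows "continuous_on UNIV (\<lambda>t. rd (f t) (g t))"
proof (intro continuous_at_imp_continuous_on ballI)
  fix t
  have lim: "((\<lambda>r. rd (f r) (f t) + rd (g r) (g t)) \<longlongrightarrow> 0) (at t)"
    using tendsto_add[OF paths_continuous[OF f] paths_continuous[OF g]] by simp
  have "norm (rd (f r) (g r) - rd (f t) (g t)) \<le> rd (f r) (f t) + rd (g r) (g t)" for r
  proof -
    have E: "f r \<in> E" "f t \<in> E" "g r \<in> E" "g t \<in> E" using f g by (auto simp: pathsD)
    have "rd (f r) (g r) \<le> rd (f r) (f t) + rd (f t) (g r)" "rd (f t) (g r) \<le> rd (f t) (g t) + rd (g t) (g r)"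
      "rd (f t) (g t) \<le> rd (f t) (f r) + rd (f r) (g t)" "rd (f r) (g t) \<le> rd (f r) (g r) + rd (g r) (g t)"
      by (intro rd_triangle E)+
    then show ?thesis
      using rd_sym[of "f t" "f r"] rd_sym[of "g t" "g r"] unfolding real_norm_def by linarith
  qed
  then have "eventually (\<lambda>r. norm (rd (f r) (g r) - rd (f t) (g t)) \<le> rd (f r) (f t) + rd (g r) (g t)) (at t)"
    by (intro always_eventually allI)
  from Lim_null_comparison[OF this lim]
  have "((\<lambda>r. rd (f r) (g r) - rd (f t) (g t)) \<longlongrightarrow> 0) (at t)" .
  then show "isCont (\<lambda>t. rd (f t) (g t)) t" by (simp add: isCont_def LIM_zero_iff)
qed

definition pball :: "real \<Rightarrow> real \<Rightarrow> trajectory \<Rightarrow> trajectory set" where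
  "pball R \<epsilon> f = {g \<in> paths. \<forall>t\<in>{-R..R}. N (\<lambda>k. g t k - f t k) < ennreal \<epsilon>}"

lemma pball_iff: "f \<in> paths \<Longrightarrow> g \<in> pball R \<epsilon> f \<longleftrightarrow> g \<in> paths \<and> (\<forall>t\<in>{-R..R}. rd (g t) (f t) < \<epsilon>)"
  by (auto simp: pball_def N_rd pathsD ennreal_less_iff)

lemma pball_self: "f \<in> paths \<Longrightarrow> 0 < \<epsilon> \<Longrightarrow> f \<in> pball R \<epsilon> f"
  by (simp add: pball_def)

lemma pball_mono: "R \<le> R' \<Longrightarrow> \<epsilon>' \<le> \<epsilon> \<Longrightarrow> pball R' \<epsilon>' f \<subseteq> pball R \<epsilon> f"
  by (force simp: pball_def intro: less_le_trans ennreal_leI)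

text \<open>On a compact time interval the continuous distance attains its maximum, which is
  strictly below \<epsilon>; the gap is the radius of the smaller ball.\<close>

lemma pball_inner:
  assumes f: "f \<in> paths" and g: "g \<in> pball R \<epsilon> f" and e: "0 < \<epsilon>"
  shows "\<exists>\<epsilon>'>0. pball R \<epsilon>' g \<subseteq> pball R \<epsilon> f"
proof -
  have gp: "g \<in> paths" using g by (simp add: pball_def)
  obtain d where d: "d < \<epsilon>" "\<And>t. t \<in> {-R..R} \<Longrightarrow> rd (g t) (f t) \<le> d"
  \<comment> \<open>For negative \<open>R\<close> no time is tested and the distance bound is
    vacuous.\<close>
  proof (cases "{-R..R} = {}")
    case True
    then show thesis using that[of 0] e by auto
  next
    case False
    obtain x where x: "x \<in> {-R..R}" "\<forall>t\<in>{-R..R}. rd (g t) (f t) \<le> rd (g x) (f x)"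
      using continuous_attains_sup[OF compact_Icc False continuous_on_subset[OF rd_continuous[OF gp f]]] by auto
    then show thesis using that[of "rd (g x) (f x)"] g f by (auto simp: pball_iff)
  qed
  have "pball R (\<epsilon> - d) g \<subseteq> pball R \<epsilon> f"
  proof
    fix h assume "h \<in> pball R (\<epsilon> - d) g"
    then have h: "h \<in> paths" "\<And>t. t \<in> {-R..R} \<Longrightarrow> rd (h t) (g t) < \<epsilon> - d" using gp by (auto simp: pball_iff)
    have "rd (h t) (f t) < \<epsilon>" if "t \<in> {-R..R}" for t
      using rd_triangle[of "h t" "g t" "f t"] h(2)[OF that] d(2)[OF that] h(1) gp f by (simp add: pathsD)
    then show "h \<in> pball R \<epsilon> f" using h f by (auto simp: pball_iff)
  qed
  then show ?thesis using d by (intro exI[of _ "\<epsilon> - d"]) auto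
qed

text \<open>One natural number governs both the time interval and the radius. Every path therefore
  has a countable neighbourhood base, and closedness can be tested on sequences.\<close>

lemma openin_T: "openin T U \<longleftrightarrow> U \<subseteq> paths \<and> (\<forall>f\<in>U. \<exists>n>0. pball (real n) (1 / real n) f \<subseteq> U)"
proof
  let ?P = "\<lambda>U. U \<subseteq> paths \<and> (\<forall>f\<in>U. \<exists>n>0. pball (real n) (1 / real n) f \<subseteq> U)"
  assume "openin T U"
  then have "generate_topology_on {{g \<in> paths. \<forall>t\<in>{-R..R}. N (\<lambda>k. g t k - f t k) < ennreal \<epsilon>} | f R \<epsilon>. f \<in> paths \<and> 0 < \<epsilon>} U"
    by (simp add: path_topology_def openin_topology_generated_by_iff)
  then show "?P U"
  proof induction
    case Empty
    then show ?case by simp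
  next
    case (Int a b)
    show ?case
    proof (intro conjI ballI)
      fix f assume "f \<in> a \<inter> b"
      then obtain n m where nm: "n > 0" "m > 0" "pball (real n) (1 / real n) f \<subseteq> a" "pball (real m) (1 / real m) f \<subseteq> b"
        using Int by blast
      have "pball (real (max n m)) (1 / real (max n m)) f \<subseteq> a \<inter> b"
        using nm pball_mono[of n "max n m" "1 / real (max n m)" "1 / real n" f]
          pball_mono[of m "max n m" "1 / real (max n m)" "1 / real m" f]
        by (auto simp: frac_le)
      then show "\<exists>n>0. pball (real n) (1 / real n) f \<subseteq> a \<inter> b" using nm by (intro exI[of _ "max n m"]) auto
    qed (use Int in auto)
  next
    case (UN K)
    show ?case
    proof (intro conjI ballI)
      fix f assume "f \<in> \<Union>K"
      then obtain k where k: "k \<in> K" "f \<in> k" by blast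
      then obtain n where "n > 0" "pball (real n) (1 / real n) f \<subseteq> k" using UN by blast
      then show "\<exists>n>0. pball (real n) (1 / real n) f \<subseteq> \<Union>K" using k by blast
    qed (use UN in auto)
  next
    case (Basis u)
    then obtain f R \<epsilon> where u: "u = pball R \<epsilon> f" "f \<in> paths" "0 < \<epsilon>" unfolding pball_def by blast
    show ?case
    proof (intro conjI ballI)
      show "u \<subseteq> paths" unfolding u by (auto simp: pball_def)
      fix g assume "g \<in> u"
      then obtain d where d: "0 < d" "pball R d g \<subseteq> u" using pball_inner u by blast
      obtain n where n: "real n > max R (1 / d)" using reals_Archimedean2 by blast
      then have "0 < 1 / d" "1 / d < real n" using d by auto
      then have n1: "0 < real n" "1 / d < real n" by linarith+
      have "1 < real n * d" using n1(2) d(1) by (simp add: pos_divide_less_eq)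
      then have n0: "n > 0" "1 / real n \<le> d" using n1(1) by (simp_all add: pos_divide_le_eq mult.commute)
      then have "pball (real n) (1 / real n) g \<subseteq> pball R d g" using n by (intro pball_mono) auto
      then show "\<exists>n>0. pball (real n) (1 / real n) g \<subseteq> u" using d n0 by blast
    qed
  qed
next
  assume U: "U \<subseteq> paths \<and> (\<forall>f\<in>U. \<exists>n>0. pball (real n) (1 / real n) f \<subseteq> U)"
  then obtain n where n: "\<And>f. f \<in> U \<Longrightarrow> n f > 0 \<and> pball (real (n f)) (1 / real (n f)) f \<subseteq> U" by metis
  have "f \<in> pball (real (n f)) (1 / real (n f)) f" if "f \<in> U" for f
    using n[OF that] U that by (intro pball_self) auto
  then have "U = (\<Union>f\<in>U. pball (real (n f)) (1 / real (n f)) f)"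
    using n by (intro equalityI subsetI UN_I) (assumption, blast, blast)
  moreover have "openin T (pball (real (n f)) (1 / real (n f)) f)" if "f \<in> U" for f
    unfolding path_topology_def pball_def
    using n[OF that] U that by (intro topology_generated_by_Basis CollectI exI conjI refl) auto
  ultimately show "openin T U" by (metis (no_types, lifting) openin_Union imageE)
qed

lemma topspace_T: "topspace T = paths"
proof
  show "topspace T \<subseteq> paths" using openin_T[of "topspace T"] by simp
  have "openin T paths" unfolding openin_T
    by (auto simp: pball_def intro!: exI[of _ 1])
  then show "paths \<subseteq> topspace T" by (rule openin_subset)
qed

lemma openin_pball: "f \<in> paths \<Longrightarrow> 0 < \<epsilon> \<Longrightarrow> openin T (pball R \<epsilon> f)"
  unfolding path_topology_def pball_def
  by (intro topology_generated_by_Basis CollectI exI conjI refl) auto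

lemma limitin_T:
  "limitin T \<sigma> l F \<longleftrightarrow> l \<in> paths \<and> eventually (\<lambda>i. \<sigma> i \<in> paths) F \<and>
     (\<forall>R \<epsilon>. 0 < \<epsilon> \<longrightarrow> eventually (\<lambda>i. \<forall>t\<in>{-R..R}. N (\<lambda>k. \<sigma> i t k - l t k) < ennreal \<epsilon>) F)" (is "?L \<longleftrightarrow> ?R")
proof
  assume L: ?L
  then have l: "l \<in> paths" by (auto simp: limitin_def topspace_T)
  have "eventually (\<lambda>i. \<sigma> i \<in> pball R \<epsilon> l) F" if "0 < \<epsilon>" for R \<epsilon>
    using L openin_pball[OF l that] pball_self[OF l that] by (auto simp: limitin_def)
  then have *: "eventually (\<lambda>i. \<sigma> i \<in> paths \<and> (\<forall>t\<in>{-R..R}. N (\<lambda>k. \<sigma> i t k - l t k) < ennreal \<epsilon>)) F" if "0 < \<epsilon>" for R \<epsilon>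
    using that by (simp add: pball_def)
  show ?R
  proof (intro conjI allI impI l)
    show "eventually (\<lambda>i. \<sigma> i \<in> paths) F" using *[of 1 0] by (auto elim: eventually_mono)
    fix R \<epsilon> :: real assume "0 < \<epsilon>"
    from *[OF this, of R] show "eventually (\<lambda>i. \<forall>t\<in>{-R..R}. N (\<lambda>k. \<sigma> i t k - l t k) < ennreal \<epsilon>) F"
      by (rule eventually_mono) blast
  qed
next
  assume R: ?R
  show ?L unfolding limitin_def topspace_T
  proof (intro conjI allI impI)
    fix U assume U: "openin T U \<and> l \<in> U"
    then obtain n where n: "n > 0" "pball (real n) (1 / real n) l \<subseteq> U" unfolding openin_T by blast
    have "eventually (\<lambda>i. \<sigma> i \<in> paths) F" using R by blast
    moreover have "eventually (\<lambda>i. \<forall>t\<in>{-real n..real n}. N (\<lambda>k. \<sigma> i t k - l t k) < ennreal (1 / real n)) F"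
      using R n by simp
    ultimately show "eventually (\<lambda>i. \<sigma> i \<in> U) F"
      by eventually_elim (use n in \<open>auto simp: pball_def\<close>)
  qed (use R in auto)
qed

lemma coeff_N: "\<exists>C>0. \<forall>f. ennreal (norm (f k)) \<le> ennreal C * N f"
proof -
  obtain C where C: "C \<ge> 0" "\<And>f. ennreal (norm (f k)) \<le> ennreal C * N f"
    using coeff_bound[of p q k s] p q by auto
  have "ennreal (norm (f k)) \<le> ennreal (C + 1) * N f" for f
    by (rule order_trans[OF C(2)]) (intro mult_right_mono ennreal_leI, auto)
  then show ?thesis using C by (intro exI[of _ "C + 1"]) auto
qed

lemma coeff_rd: "\<exists>C>0. \<forall>f\<in>E. \<forall>g\<in>E. norm (f k - g k) \<le> C * rd f g"
proof -
  obtain C where C: "C > 0" "\<And>f. ennreal (norm (f k)) \<le> ennreal C * N f" using coeff_N by blast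
  have "norm (f k - g k) \<le> C * rd f g" if "f \<in> E" "g \<in> E" for f g
    using C(2)[of "\<lambda>k. f k - g k"] C(1) that by (simp add: N_rd flip: ennreal_mult)
  then show ?thesis using C by blast
qed

lemma paths_coeff_continuous:
  assumes "f \<in> paths"
  shows "continuous_on UNIV (\<lambda>t. f t k)"
proof (intro continuous_at_imp_continuous_on ballI)
  fix t
  obtain C where C: "C > 0" "\<And>f g. f \<in> E \<Longrightarrow> g \<in> E \<Longrightarrow> norm (f k - g k) \<le> C * rd f g" using coeff_rd by blast
  have "((\<lambda>r. f r k - f t k) \<longlongrightarrow> 0) (at t)"
    by (rule tendsto_0_le[OF paths_continuous[OF assms, of t], of _ C])
       (use C assms in \<open>auto simp: pathsD mult.commute\<close>)
  then show "isCont (\<lambda>t. f t k) t" by (simp add: isCont_def LIM_zero_iff)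
qed

lemma coeff_continuous_map: "continuous_map T euclidean (\<lambda>f. f t k)"
  unfolding continuous_map_def
proof (intro conjI allI impI)
  show "(\<lambda>f. f t k) \<in> topspace T \<rightarrow> topspace euclidean" by simp
  fix V :: "complex set" assume V: "openin euclidean V"
  obtain C where C: "C > 0" "\<And>f g. f \<in> E \<Longrightarrow> g \<in> E \<Longrightarrow> norm (f k - g k) \<le> C * rd f g" using coeff_rd by blast
  show "openin T {f \<in> topspace T. f t k \<in> V}"
    unfolding openin_T topspace_T
  proof (intro conjI ballI)
    fix f assume "f \<in> {f \<in> paths. f t k \<in> V}"
    then have f: "f \<in> paths" "f t k \<in> V" by auto
    then obtain e where e: "e > 0" "ball (f t k) e \<subseteq> V" using V by (auto simp: open_contains_ball)
    obtain n where n: "real n > max \<bar>t\<bar> (C / e)" using reals_Archimedean2 by blast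
    have n0: "n > 0" "C / real n < e"
      using n e C by (auto simp: field_simps intro!: Nat.gr0I)
    have "pball (real n) (1 / real n) f \<subseteq> {f \<in> paths. f t k \<in> V}"
    proof
      fix g assume "g \<in> pball (real n) (1 / real n) f"
      then have g: "g \<in> paths" "\<And>t. t \<in> {-real n..real n} \<Longrightarrow> rd (g t) (f t) < 1 / real n" using f by (auto simp: pball_iff)
      have "rd (g t) (f t) < 1 / real n" using n by (intro g) auto
      then have "C * rd (g t) (f t) < C * (1 / real n)" using C(1) by (rule mult_strict_left_mono)
      then have "norm (g t k - f t k) < e" using C(2)[of "g t" "f t"] f g n0 by (simp add: pathsD)
      then show "g \<in> {f \<in> paths. f t k \<in> V}" using e g by (auto simp: dist_norm norm_minus_commute subset_iff)
    qed
    then show "\<exists>n>0. pball (real n) (1 / real n) f \<subseteq> {f \<in> paths. f t k \<in> V}" using n0 by blast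
  qed auto
qed

lemma limitin_coeff: "limitin T \<sigma> l F \<Longrightarrow> ((\<lambda>i. \<sigma> i t k) \<longlongrightarrow> l t k) F"
  using continuous_map_limit[OF coeff_continuous_map[of t k], of \<sigma> l F] by (simp add: o_def)

lemma shift_paths: "f \<in> paths \<Longrightarrow> (\<lambda>r. f (r + t)) \<in> paths"
proof (rule pathsI)
  assume f: "f \<in> paths"
  then show "f (r + t) \<in> E" for r by (simp add: pathsD)
  show "((\<lambda>r. N (\<lambda>k. f (r + t) k - f (u + t) k)) \<longlongrightarrow> 0) (at u)" for u
  proof -
    have "((\<lambda>r. N (\<lambda>k. f r k - f (u + t) k)) \<longlongrightarrow> 0) (at (u + t))" using f by (simp add: besov_paths_def)
    then show ?thesis by (subst (asm) at_to_0, subst at_to_0) (simp add: filterlim_filtermap add_ac)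
  qed
qed

lemma shift_continuous_map: "continuous_map T T (\<lambda>f r. f (r + t))"
  unfolding continuous_map_def topspace_T
proof (intro conjI allI impI)
  show "(\<lambda>f r. f (r + t)) \<in> paths \<rightarrow> paths" using shift_paths by blast
  fix U assume U: "openin T U"
  show "openin T {f \<in> paths. (\<lambda>r. f (r + t)) \<in> U}"
    unfolding openin_T
  proof (intro conjI ballI)
    fix f assume "f \<in> {f \<in> paths. (\<lambda>r. f (r + t)) \<in> U}"
    then have f: "f \<in> paths" "(\<lambda>r. f (r + t)) \<in> U" by auto
    then obtain n where n: "n > 0" "pball (real n) (1 / real n) (\<lambda>r. f (r + t)) \<subseteq> U" using U unfolding openin_T by blast
    obtain m where m: "real m > real n + \<bar>t\<bar>" using reals_Archimedean2 by blast
    have mn: "ennreal (1 / real m) \<le> ennreal (1 / real n)" using m n by (intro ennreal_leI) (simp add: frac_le)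
    have "pball (real m) (1 / real m) f \<subseteq> {f \<in> paths. (\<lambda>r. f (r + t)) \<in> U}"
    proof
      fix g assume g: "g \<in> pball (real m) (1 / real m) f"
      have "N (\<lambda>k. g (r + t) k - f (r + t) k) < ennreal (1 / real n)" if "r \<in> {-real n..real n}" for r
      proof -
        have "r + t \<in> {-real m..real m}" using that m by auto
        then have "N (\<lambda>k. g (r + t) k - f (r + t) k) < ennreal (1 / real m)" using g by (simp add: pball_def)
        then show ?thesis using mn by (rule less_le_trans)
      qed
      then have "(\<lambda>r. g (r + t)) \<in> pball (real n) (1 / real n) (\<lambda>r. f (r + t))"
        using g by (auto simp: pball_def shift_paths)
      then show "g \<in> {f \<in> paths. (\<lambda>r. f (r + t)) \<in> U}" using n g by (auto simp: pball_def)
    qed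
    then show "\<exists>n>0. pball (real n) (1 / real n) f \<subseteq> {f \<in> paths. (\<lambda>r. f (r + t)) \<in> U}" using m n by (intro exI[of _ m]) auto
  qed auto
qed

lemma closedin_T_seq:
  assumes F: "F \<subseteq> paths" "\<And>\<sigma> l. (\<And>n :: nat. \<sigma> n \<in> F) \<Longrightarrow> limitin T \<sigma> l sequentially \<Longrightarrow> l \<in> F"
  shows "closedin T F"
  unfolding closedin_def topspace_T openin_T
proof (intro conjI ballI F(1))
  fix f assume f: "f \<in> paths - F"
  show "\<exists>n>0. pball (real n) (1 / real n) f \<subseteq> paths - F"
  proof (rule ccontr)
    assume "\<not> ?thesis"
    then have "\<not> pball (real (Suc n)) (1 / real (Suc n)) f \<subseteq> paths - F" for n by blast
    moreover have "pball R \<epsilon> f \<subseteq> paths" for R \<epsilon> by (auto simp: pball_def)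
    ultimately have "\<exists>g. g \<in> pball (real (Suc n)) (1 / real (Suc n)) f \<and> g \<in> F" for n by blast
    then obtain \<sigma> where \<sigma>: "\<And>n. \<sigma> n \<in> pball (real (Suc n)) (1 / real (Suc n)) f" "\<And>n. \<sigma> n \<in> F" by metis
    have "limitin T \<sigma> f sequentially" unfolding limitin_T
    proof (intro conjI allI impI)
      show "f \<in> paths" using f by simp
      show "eventually (\<lambda>n. \<sigma> n \<in> paths) sequentially"
        using \<sigma>(2) F(1) by (intro always_eventually) blast
      fix R \<epsilon> :: real assume e: "0 < \<epsilon>"
      obtain m where m: "real m > max R (1 / \<epsilon>)" using reals_Archimedean2 by blast
      show "eventually (\<lambda>n. \<forall>t\<in>{-R..R}. N (\<lambda>k. \<sigma> n t k - f t k) < ennreal \<epsilon>) sequentially"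
        using eventually_ge_at_top[of m]
      proof eventually_elim
        case (elim n)
        have "1 / real (Suc n) \<le> \<epsilon>" using m elim e by (simp add: field_simps) (smt (verit) mult_left_mono of_nat_mono)
        then have "\<sigma> n \<in> pball R \<epsilon> f"
          using \<sigma>(1)[of n] m elim by (intro subsetD[OF pball_mono \<sigma>(1)[of n]]) auto
        then show ?case by (simp add: pball_def)
      qed
    qed
    then have "f \<in> F" using \<sigma>(2) F(2) by blast
    then show False using f by simp
  qed
qed auto

text \<open>The common last step of both compactness proofs: coefficients converge locally
  uniformly, and uniformly small tails upgrade this to convergence in the Besov norm. That the limit
  takes values in the completion and is continuous there is part of the conclusion.\<close>

lemma limitinI_uniform:
  fixes \<sigma> :: "nat \<Rightarrow> trajectory"
  assumes \<sigma>: "\<And>n. \<sigma> n \<in> paths"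
    and u: "\<And>R k. uniform_limit {-R..R} (\<lambda>n t. \<sigma> n t k) (\<lambda>t. l t k) sequentially"
    and c: "\<And>k. continuous_on UNIV (\<lambda>t. l t k)"
    and tail: "\<And>\<epsilon> :: real. \<epsilon> > 0 \<Longrightarrow> \<exists>J. \<forall>n t. (\<Sum>j. bpow \<rho> s p q (j + J) (\<lambda>k. \<sigma> n t k - l t k)) \<le> ennreal \<epsilon>"
    and tail_l: "\<And>\<epsilon> :: real. \<epsilon> > 0 \<Longrightarrow> \<exists>J. \<forall>r t. (\<Sum>j. bpow \<rho> s p q (j + J) (\<lambda>k. l r k - l t k)) \<le> ennreal \<epsilon>"
  shows "limitin T \<sigma> l sequentially"
proof -
  have ev: "eventually (\<lambda>n. \<forall>t\<in>{-R..R}. N (\<lambda>k. \<sigma> n t k - l t k) < ennreal \<epsilon>) sequentially" if e: "0 < \<epsilon>" for R \<epsilon>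
  proof -
    \<comment> \<open>Eventually along this filter on pairs \<open>(n, t)\<close> means for all late
      \<open>n\<close> and simultaneously all \<open>t\<close> in the interval, so
      \<open>besov_norm_tendsto_0\<close> yields uniformity in time.\<close>
    let ?F = "inf (filtercomap fst sequentially) (principal (UNIV \<times> {-R..R}))"
    have F: "eventually P ?F \<longleftrightarrow> eventually (\<lambda>n. \<forall>t\<in>{-R..R}. P (n, t)) sequentially" for P
    proof -
      have "eventually P ?F \<longleftrightarrow> (\<exists>Q. eventually Q sequentially \<and> (\<forall>x. Q (fst x) \<longrightarrow> x \<in> UNIV \<times> {-R..R} \<longrightarrow> P x))"
        by (simp only: eventually_inf_principal eventually_filtercomap)
      also have "\<dots> \<longleftrightarrow> eventually (\<lambda>n. \<forall>t\<in>{-R..R}. P (n, t)) sequentially"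
        by (auto elim!: eventually_mono)
      finally show ?thesis .
    qed
    have "((\<lambda>x. N (\<lambda>k. \<sigma> (fst x) (snd x) k - l (snd x) k)) \<longlongrightarrow> 0) ?F"
    proof (rule besov_norm_tendsto_0)
      show "((\<lambda>x. \<sigma> (fst x) (snd x) k - l (snd x) k) \<longlongrightarrow> 0) ?F" for k
        unfolding tendsto_iff F using u[where R = R and k = k] by (auto simp: uniform_limit_iff dist_norm)
      show "\<exists>J. eventually (\<lambda>x. (\<Sum>j. bpow \<rho> s p q (j + J) (\<lambda>k. \<sigma> (fst x) (snd x) k - l (snd x) k)) \<le> ennreal \<epsilon>) ?F"
        if e': "\<epsilon> > 0" for \<epsilon> :: real
      proof -
        obtain J where J: "\<And>n t. (\<Sum>j. bpow \<rho> s p q (j + J) (\<lambda>k. \<sigma> n t k - l t k)) \<le> ennreal \<epsilon>"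
          using tail[OF e'] by blast
        show ?thesis unfolding F by (intro exI[of _ J] always_eventually) (simp add: J)
      qed
    qed (use p q in auto)
    then have "eventually (\<lambda>x. N (\<lambda>k. \<sigma> (fst x) (snd x) k - l (snd x) k) < ennreal \<epsilon>) ?F"
      using e by (intro order_tendstoD(2)) auto
    then show ?thesis unfolding F by simp
  qed
  have lE: "l t \<in> E" for t
  proof (rule E_closed)
    fix \<epsilon> :: real assume "0 < \<epsilon>"
    from eventually_happens'[OF _ ev[OF this, of "\<bar>t\<bar>"]]
    obtain n where "\<forall>u\<in>{-\<bar>t\<bar>..\<bar>t\<bar>}. N (\<lambda>k. \<sigma> n u k - l u k) < ennreal \<epsilon>" by auto
    then have "N (\<lambda>k. \<sigma> n t k - l t k) < ennreal \<epsilon>" by (rule bspec) auto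
    then have "N (\<lambda>k. l t k - \<sigma> n t k) < ennreal \<epsilon>" by (subst N_sym)
    then show "\<exists>g\<in>E. N (\<lambda>k. l t k - g k) < ennreal \<epsilon>" using \<sigma> pathsD by blast
  qed
  have "l \<in> paths"
  proof (rule pathsI[OF lE])
    fix t
    show "((\<lambda>r. N (\<lambda>k. l r k - l t k)) \<longlongrightarrow> 0) (at t)"
    proof (rule besov_norm_tendsto_0)
      show "((\<lambda>r. l r k - l t k) \<longlongrightarrow> 0) (at t)" for k
        using c[of k] by (simp add: continuous_on_eq_continuous_at isCont_def LIM_zero_iff)
      fix \<epsilon> :: real assume "\<epsilon> > 0"
      then obtain J where J: "\<And>r t. (\<Sum>j. bpow \<rho> s p q (j + J) (\<lambda>k. l r k - l t k)) \<le> ennreal \<epsilon>"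
        using tail_l by blast
      show "\<exists>J. eventually (\<lambda>r. (\<Sum>j. bpow \<rho> s p q (j + J) (\<lambda>k. l r k - l t k)) \<le> ennreal \<epsilon>) (at t)"
        by (intro exI[of _ J] always_eventually allI J)
    qed (use p q in auto)
  qed
  then show ?thesis unfolding limitin_T using ev \<sigma> by auto
qed

end

section \<open>The path norm\<close>

lemma le_Cb_norm: "M (f t) \<le> Cb_norm M f"
  unfolding Cb_norm_def by (rule SUP_upper) simp

lemma path_norm_shift: "path_norm \<rho> \<delta> (\<lambda>r. f (r + t)) = path_norm \<rho> \<delta> f"
proof -
  have surj: "surj (\<lambda>r. r + t)" for t :: real by (rule surjI[of _ "\<lambda>r. r - t"]) simp
  have Cb: "Cb_norm M (\<lambda>r. f (r + t)) = Cb_norm M f" for M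
  proof -
    have "range (\<lambda>r. M (f (r + t))) = (\<lambda>r. M (f r)) ` range (\<lambda>r. r + t)" by (simp only: image_image)
    then show ?thesis unfolding Cb_norm_def by (simp only: surj)
  qed
  have "(\<lambda>(a, b). G (a + t) (b + t) (b - a)) ` {(s, t). s < t} = (\<lambda>(a, b). G a b (b - a)) ` {(s, t). s < t}"
    for G :: "real \<Rightarrow> real \<Rightarrow> real \<Rightarrow> ennreal"
  proof (intro set_eqI iffI)
    fix x assume "x \<in> (\<lambda>(a, b). G a b (b - a)) ` {(s, t). s < t}"
    then obtain a b where "x = G a b (b - a)" "a < b" by auto
    then show "x \<in> (\<lambda>(a, b). G (a + t) (b + t) (b - a)) ` {(s, t). s < t}"
      by (intro image_eqI[of _ _ "(a - t, b - t)"]) auto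
  next
    fix x assume "x \<in> (\<lambda>(a, b). G (a + t) (b + t) (b - a)) ` {(s, t). s < t}"
    then obtain a b where "x = G (a + t) (b + t) (b - a)" "a < b" by auto
    then show "x \<in> (\<lambda>(a, b). G a b (b - a)) ` {(s, t). s < t}"
      by (intro image_eqI[of _ _ "(a + t, b + t)"]) auto
  qed
  from this[of "\<lambda>a b d. besov_norm \<rho> (- 3 / 2 - \<delta>) \<infinity> 1 (\<lambda>k. f b k - f a k) / ennreal (d powr (1 - \<delta>))"]
  show ?thesis unfolding path_norm_def Cb_holder_norm_def Cb by simp
qed

text \<open>Each norm at a fixed time and each difference quotient is lower semicontinuous under
  convergence of the coefficients, and suprema preserve this. It closes the sublevel sets and bounds
  the limit in Arzela--Ascoli.\<close>

lemma path_norm_lsc: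
  assumes "\<And>t k. (\<lambda>n. \<sigma> n t k) \<longlonglongrightarrow> l t k"
  shows "path_norm \<rho> \<delta> l \<le> liminf (\<lambda>n. path_norm \<rho> \<delta> (\<sigma> n))"
proof -
  have Cb: "Cb_norm (besov_norm \<rho> s \<infinity> 1) l \<le> liminf (\<lambda>n. Cb_norm (besov_norm \<rho> s \<infinity> 1) (\<sigma> n))" for s
    unfolding Cb_norm_def[of _ l]
  proof (rule SUP_least)
    fix t
    have "besov_norm \<rho> s \<infinity> 1 (l t) \<le> liminf (\<lambda>n. besov_norm \<rho> s \<infinity> 1 (\<sigma> n t))"
      by (intro besov_norm_inf_lsc assms)
    also have "\<dots> \<le> liminf (\<lambda>n. Cb_norm (besov_norm \<rho> s \<infinity> 1) (\<sigma> n))"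
      by (intro Liminf_mono always_eventually allI le_Cb_norm)
    finally show "besov_norm \<rho> s \<infinity> 1 (l t) \<le> liminf (\<lambda>n. Cb_norm (besov_norm \<rho> s \<infinity> 1) (\<sigma> n))" .
  qed
  let ?h = "\<lambda>f (s, t). besov_norm \<rho> (- 3 / 2 - \<delta>) \<infinity> 1 (\<lambda>k. f t k - f s k) / ennreal ((t - s) powr (1 - \<delta>))"
  let ?H = "\<lambda>f. (SUP x\<in>{(s, t). s < t}. ?h f x)"
  have H: "?H l \<le> liminf (\<lambda>n. ?H (\<sigma> n))"
  proof (rule SUP_least)
    fix x :: "real \<times> real" assume x: "x \<in> {(s, t). s < t}"
    obtain a b where ab: "x = (a, b)" "a < b" using x by auto
    define c where "c = inverse ((b - a) powr (1 - \<delta>))"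
    have hc: "?h f x = ennreal c * besov_norm \<rho> (- 3 / 2 - \<delta>) \<infinity> 1 (\<lambda>k. f b k - f a k)" for f
      using ab by (simp add: c_def divide_ennreal_def inverse_ennreal mult.commute)
    have "?h l x \<le> ennreal c * liminf (\<lambda>n. besov_norm \<rho> (- 3 / 2 - \<delta>) \<infinity> 1 (\<lambda>k. \<sigma> n b k - \<sigma> n a k))"
      unfolding hc by (intro mult_left_mono besov_norm_inf_lsc tendsto_diff assms) auto
    also have "\<dots> = liminf (\<lambda>n. ?h (\<sigma> n) x)" unfolding hc by (rule cmult_liminf)
    also have "\<dots> \<le> liminf (\<lambda>n. ?H (\<sigma> n))"
      using x by (intro Liminf_mono always_eventually allI SUP_upper)
    finally show "?h l x \<le> liminf (\<lambda>n. ?H (\<sigma> n))" .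
  qed
  have "path_norm \<rho> \<delta> l \<le> liminf (\<lambda>n. Cb_norm (besov_norm \<rho> (- 1 / 2 + \<delta>) \<infinity> 1) (\<sigma> n)) +
      (liminf (\<lambda>n. Cb_norm (besov_norm \<rho> (- 3 / 2 - \<delta>) \<infinity> 1) (\<sigma> n)) + liminf (\<lambda>n. ?H (\<sigma> n)))"
    unfolding path_norm_def Cb_holder_norm_def by (intro add_mono Cb H)
  also have "\<dots> \<le> liminf (\<lambda>n. path_norm \<rho> \<delta> (\<sigma> n))"
    unfolding path_norm_def Cb_holder_norm_def
    by (rule order_trans[OF add_left_mono[OF liminf_add_le_ennreal] liminf_add_le_ennreal])
  finally show ?thesis .
qed

lemma path_norm_bounds:
  assumes "path_norm \<rho> \<delta> f \<le> K"
  shows "besov_norm \<rho> (- 1 / 2 + \<delta>) \<infinity> 1 (f t) \<le> K"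
    and "r < t \<Longrightarrow> besov_norm \<rho> (- 3 / 2 - \<delta>) \<infinity> 1 (\<lambda>k. f t k - f r k) \<le> K * ennreal ((t - r) powr (1 - \<delta>))"
proof -
  have "besov_norm \<rho> (- 1 / 2 + \<delta>) \<infinity> 1 (f t) \<le> path_norm \<rho> \<delta> f"
    unfolding path_norm_def by (rule order_trans[OF le_Cb_norm]) simp
  then show "besov_norm \<rho> (- 1 / 2 + \<delta>) \<infinity> 1 (f t) \<le> K" using assms by simp
  assume rt: "r < t"
  let ?h = "\<lambda>(s, t). besov_norm \<rho> (- 3 / 2 - \<delta>) \<infinity> 1 (\<lambda>k. f t k - f s k) / ennreal ((t - s) powr (1 - \<delta>))"
  have "?h (r, t) \<le> (SUP x\<in>{(s, t). s < t}. ?h x)" using rt by (intro SUP_upper) auto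
  also have "\<dots> \<le> path_norm \<rho> \<delta> f" unfolding path_norm_def Cb_holder_norm_def by (simp add: add_increasing)
  also note assms
  finally have "besov_norm \<rho> (- 3 / 2 - \<delta>) \<infinity> 1 (\<lambda>k. f t k - f r k) / ennreal ((t - r) powr (1 - \<delta>)) \<le> K" by simp
  then have "besov_norm \<rho> (- 3 / 2 - \<delta>) \<infinity> 1 (\<lambda>k. f t k - f r k) / ennreal ((t - r) powr (1 - \<delta>)) * ennreal ((t - r) powr (1 - \<delta>)) \<le> K * ennreal ((t - r) powr (1 - \<delta>))"
    by (rule mult_right_mono) simp
  then show "besov_norm \<rho> (- 3 / 2 - \<delta>) \<infinity> 1 (\<lambda>k. f t k - f r k) \<le> K * ennreal ((t - r) powr (1 - \<delta>))"
    using rt by (simp add: ennreal_divide_times)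
qed

section \<open>Arzela--Ascoli compactness\<close>

text \<open>The common Hoelder bound fixes a mesh \<open>1 / m\<close> on which all functions vary
  by less than a third of the error; on the finitely many rational mesh points near the interval
  convergence is uniform.\<close>

lemma uniformly_Cauchy_of_equicontinuous:
  fixes f :: "nat \<Rightarrow> real \<Rightarrow> complex"
  assumes h: "\<And>n r t. r < t \<Longrightarrow> norm (f n t - f n r) \<le> C * (t - r) powr \<beta>" and \<beta>: "0 < \<beta>" and C: "0 \<le> C"
    and c: "\<And>x :: rat. convergent (\<lambda>n. f n (of_rat x))"
  shows "uniformly_Cauchy_on {-R..R} f"
  unfolding uniformly_Cauchy_on_def
proof (intro allI impI)
  fix e :: real assume e: "0 < e"
  have "((\<lambda>m. C * (1 / real (Suc m)) powr \<beta>) \<longlongrightarrow> C * 0) sequentially"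
    using \<beta> by (intro tendsto_intros tendsto_zero_powrI[where b = \<beta>] LIMSEQ_Suc lim_1_over_n) auto
  then have "eventually (\<lambda>m. C * (1 / real (Suc m)) powr \<beta> < e / 3) sequentially"
    using e by (intro order_tendstoD(2)) auto
  then obtain m0 where m0: "C * (1 / real (Suc m0)) powr \<beta> < e / 3" by (auto simp: eventually_sequentially)
  define m where "m = Suc m0"
  have m: "m > 0" "C * (1 / real m) powr \<beta> < e / 3" using m0 by (auto simp: m_def)
  define A where "A = {-\<lceil>\<bar>R\<bar> * m\<rceil> - 1..\<lceil>\<bar>R\<bar> * m\<rceil> + 1}"
  have "eventually (\<lambda>M. \<forall>i\<in>A. \<forall>n\<ge>M. \<forall>n'\<ge>M. norm (f n (of_int i / real m) - f n' (of_int i / real m)) < e / 3) sequentially"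
  proof (intro eventually_ball_finite ballI)
    show "finite A" by (simp add: A_def)
    fix i assume "i \<in> A"
    have "of_int i / real m = of_rat (of_int i / of_nat m)" by (simp add: of_rat_divide)
    then have "Cauchy (\<lambda>n. f n (of_int i / real m))" using c[of "of_int i / of_nat m"] by (simp add: convergent_Cauchy)
    then obtain M where M: "\<forall>n\<ge>M. \<forall>n'\<ge>M. norm (f n (of_int i / real m) - f n' (of_int i / real m)) < e / 3"
      using e by (auto simp: Cauchy_def dist_norm dest!: spec[of _ "e / 3"])
    show "eventually (\<lambda>M. \<forall>n\<ge>M. \<forall>n'\<ge>M. norm (f n (of_int i / real m) - f n' (of_int i / real m)) < e / 3) sequentially"
      using eventually_ge_at_top[of M] by eventually_elim (use M in auto)
  qed
  from eventually_happens'[OF sequentially_bot this]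
  obtain M where M: "\<And>i n n'. i \<in> A \<Longrightarrow> n \<ge> M \<Longrightarrow> n' \<ge> M \<Longrightarrow> norm (f n (of_int i / real m) - f n' (of_int i / real m)) < e / 3"
    by blast
  show "\<exists>M. \<forall>x\<in>{-R..R}. \<forall>n\<ge>M. \<forall>n'\<ge>M. dist (f n x) (f n' x) < e"
  proof (intro exI[of _ M] ballI allI impI)
    fix t n n' assume t: "t \<in> {-R..R}" and n: "n \<ge> M" "n' \<ge> M"
    define i where "i = \<lfloor>t * m\<rfloor>"
    define x where "x = of_int i / real m"
    have "of_int i \<le> t * m" "t * m < of_int i + 1" unfolding i_def by linarith+
    then have "of_int i / real m \<le> t" "t < (of_int i + 1) / real m"
      using m(1) by (simp_all add: pos_divide_le_eq pos_less_divide_eq)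
    then have x: "x \<le> t" "t - x \<le> 1 / real m" by (simp_all add: x_def add_divide_distrib)
    have "\<bar>t\<bar> \<le> \<bar>R\<bar>" using t by auto
    then have "\<bar>t * m\<bar> \<le> \<bar>R\<bar> * m" by (simp add: abs_mult mult_right_mono)
    then have "i \<in> A" unfolding A_def i_def by (simp add: abs_le_iff) linarith
    have near: "norm (f n t - f n x) < e / 3" for n
    proof (cases "x = t")
      case False
      then have "norm (f n t - f n x) \<le> C * (t - x) powr \<beta>" using x by (intro h) auto
      also have "\<dots> \<le> C * (1 / real m) powr \<beta>" using x C \<beta> by (intro mult_left_mono powr_mono2) auto
      finally show ?thesis using m by simp
    qed (use e in simp)
    have "norm (f n x - f n' x) < e / 3" unfolding x_def by (rule M[OF \<open>i \<in> A\<close> n])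
    moreover have tri: "norm (a + b - c) \<le> norm a + norm b + norm c" for a b c :: complex
      by (rule order_trans[OF norm_triangle_ineq4]) (simp add: norm_triangle_ineq)
    have "norm (f n t - f n' t) \<le> norm (f n t - f n x) + norm (f n x - f n' x) + norm (f n' t - f n' x)"
      using tri[of "f n t - f n x" "f n x - f n' x" "f n' t - f n' x"] by simp
    ultimately show "dist (f n t) (f n' t) < e" using near[of n] near[of n'] unfolding dist_norm by linarith
  qed
qed

lemma suminf_cmult_add: "(\<Sum>j. c * (a j + b j)) = c * ((\<Sum>j. a j) + (\<Sum>j. b j) :: ennreal)"
  unfolding ennreal_suminf_cmult by (simp add: suminf_add[OF summableI summableI])

context dyadic
begin

lemma coeff_inf: "\<exists>C>0. \<forall>f. ennreal (norm (f k)) \<le> ennreal C * besov_norm \<rho> s \<infinity> 1 f"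
proof -
  obtain C where C: "C \<ge> 0" "\<And>f. ennreal (norm (f k)) \<le> ennreal C * besov_norm \<rho> s (ennreal 2) (ennreal 1) f"
    using coeff_bound[of 2 1 k s] by auto
  have "ennreal (norm (f k)) \<le> ennreal (C * Cinf 2 + 1) * besov_norm \<rho> s \<infinity> 1 f" for f
  proof -
    have "ennreal (norm (f k)) \<le> ennreal C * (ennreal (Cinf 2) * besov_norm \<rho> s \<infinity> 1 f)"
      by (rule order_trans[OF C(2)]) (intro mult_left_mono besov_norm_le_inf, auto)
    also have "\<dots> = ennreal (C * Cinf 2) * besov_norm \<rho> s \<infinity> 1 f"
      using C Cinf_pos[of 2] by (simp add: ennreal_mult mult.assoc)
    also have "\<dots> \<le> ennreal (C * Cinf 2 + 1) * besov_norm \<rho> s \<infinity> 1 f" by (intro mult_right_mono ennreal_leI) auto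
    finally show ?thesis .
  qed
  moreover have "C * Cinf 2 + 1 > 0" using C Cinf_pos[of 2] by (simp add: add_nonneg_pos)
  ultimately show ?thesis by blast
qed

text \<open>The bound at regularity \<open>- 1 / 2 + \<delta>\<close> controls every coefficient and
  all tails. The Hoelder bound is available only at much lower regularity, but it is used for single
  coefficients only, where it gives equicontinuity. A diagonal subsequence over rational times and
  frequencies then converges.\<close>

lemma theta_compact:
  assumes p: "2 \<le> p" and \<delta>: "0 < \<delta>" "\<delta> < 1" and K: "0 \<le> K"
  shows "seq_compactin (path_topology \<rho> (- 1 / 2) (ennreal p) 1)
    {f \<in> besov_paths \<rho> (- 1 / 2) (ennreal p) 1. path_norm \<rho> \<delta> f \<le> ennreal K}"
proof -
  interpret B: besov_space \<rho> "- 1 / 2" p 1 by unfold_locales (use p in auto)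
  define A where "A = {f \<in> B.paths. path_norm \<rho> \<delta> f \<le> ennreal K}"
  have "\<exists>C. \<forall>k. C k > 0 \<and> (\<forall>f. ennreal (norm (f k)) \<le> ennreal (C k) * besov_norm \<rho> s \<infinity> 1 f)" for s
    using coeff_inf[of _ s] by (intro choice) blast
  then obtain C C' where C: "\<And>k. C k > 0" "\<And>k f. ennreal (norm (f k)) \<le> ennreal (C k) * besov_norm \<rho> (- 1 / 2 + \<delta>) \<infinity> 1 f"
    and C': "\<And>k. C' k > 0" "\<And>k f. ennreal (norm (f k)) \<le> ennreal (C' k) * besov_norm \<rho> (- 3 / 2 - \<delta>) \<infinity> 1 f" by metis
  have bd: "norm (f t k) \<le> C k * K" if "path_norm \<rho> \<delta> f \<le> ennreal K" for f t k
  proof -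
    have "ennreal (norm (f t k)) \<le> ennreal (C k) * ennreal K"
      by (rule order_trans[OF C(2)]) (intro mult_left_mono path_norm_bounds(1)[OF that], auto)
    then show ?thesis using C(1)[of k] K by (simp add: less_imp_le flip: ennreal_mult)
  qed
  have hd: "norm (f t k - f r k) \<le> C' k * K * (t - r) powr (1 - \<delta>)" if "path_norm \<rho> \<delta> f \<le> ennreal K" "r < t" for f r t k
  proof -
    have "ennreal (norm (f t k - f r k)) \<le> ennreal (C' k) * (ennreal K * ennreal ((t - r) powr (1 - \<delta>)))"
      by (rule order_trans[OF C'(2)[of "\<lambda>k. f t k - f r k"]]) (intro mult_left_mono path_norm_bounds(2)[OF that], auto)
    then show ?thesis using C'(1)[of k] K by (simp add: less_imp_le mult.assoc flip: ennreal_mult)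
  qed
  \<comment> \<open>One cut \<open>J\<close> serves all pairs of paths and all times. In the
    constant \<open>4 * K\<close> one factor 2 comes from \<open>bpow_diff_le\<close>, the other
    from having two paths.\<close>
  have tl: "\<exists>J. \<forall>f g. path_norm \<rho> \<delta> f \<le> ennreal K \<longrightarrow> path_norm \<rho> \<delta> g \<le> ennreal K \<longrightarrow>
     (\<forall>r t. (\<Sum>j. bpow \<rho> (- 1 / 2) p 1 (j + J) (\<lambda>k. f r k - g t k)) \<le> ennreal \<epsilon>)" if e: "\<epsilon> > 0" for \<epsilon>
  proof -
    have "((\<lambda>J. 4 * K * Cinf p * 2 powr \<delta> * (2 powr - \<delta>) ^ J) \<longlongrightarrow> 4 * K * Cinf p * 2 powr \<delta> * 0) sequentially"
      using \<delta> powr_less_mono[of "- \<delta>" 0 2] by (intro tendsto_intros LIMSEQ_power_zero) auto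
    then have "eventually (\<lambda>J. 4 * K * Cinf p * 2 powr \<delta> * (2 powr - \<delta>) ^ J < \<epsilon>) sequentially"
      using e by (intro order_tendstoD(2)) auto
    then obtain J where J: "4 * K * Cinf p * 2 powr \<delta> * (2 powr - \<delta>) ^ J < \<epsilon>" by (auto simp: eventually_sequentially)
    have Je: "2 powr (- \<delta> * (real J - 1)) = 2 powr \<delta> * (2 powr - \<delta>) ^ J"
      by (simp add: powr_realpow[symmetric] powr_powr algebra_simps flip: powr_add)
    show ?thesis
    proof (intro exI[of _ J] allI impI)
      fix f g r t assume fg: "path_norm \<rho> \<delta> f \<le> ennreal K" "path_norm \<rho> \<delta> g \<le> ennreal K"
      have t1: "(\<Sum>j. bpow \<rho> (- 1 / 2) p 1 (j + J) (h u)) \<le> ennreal (Cinf p * 2 powr (- \<delta> * (real J - 1))) * ennreal K"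
        if "path_norm \<rho> \<delta> h \<le> ennreal K" for h u
        using p \<delta> by (intro order_trans[OF besov_tail_bound[of p \<delta>]] mult_left_mono path_norm_bounds(1)[OF that]) auto
      have "(\<Sum>j. bpow \<rho> (- 1 / 2) p 1 (j + J) (\<lambda>k. f r k - g t k)) \<le>
          (\<Sum>j. ennreal (2 powr 1) * (bpow \<rho> (- 1 / 2) p 1 (j + J) (f r) + bpow \<rho> (- 1 / 2) p 1 (j + J) (g t)))"
        using p by (intro suminf_le bpow_diff_le) auto
      also have "\<dots> = ennreal 2 * ((\<Sum>j. bpow \<rho> (- 1 / 2) p 1 (j + J) (f r)) + (\<Sum>j. bpow \<rho> (- 1 / 2) p 1 (j + J) (g t)))"
        by (simp add: suminf_add[symmetric] flip: ennreal_suminf_cmult)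
      also have "\<dots> \<le> ennreal 2 * (ennreal (Cinf p * 2 powr (- \<delta> * (real J - 1))) * ennreal K + ennreal (Cinf p * 2 powr (- \<delta> * (real J - 1))) * ennreal K)"
        by (intro mult_left_mono add_mono t1 fg) auto
      also have "\<dots> = ennreal (4 * K * Cinf p * 2 powr (- \<delta> * (real J - 1)))"
        using K Cinf_pos[of p] by (simp only: ennreal_mult[symmetric] ennreal_plus[symmetric] mult_nonneg_nonneg add_nonneg_nonneg less_imp_le powr_ge_zero zero_le_numeral)
           (simp add: algebra_simps)
      also have "\<dots> \<le> ennreal \<epsilon>" using J unfolding Je by (intro ennreal_leI) (simp add: mult.assoc)
      finally show "(\<Sum>j. bpow \<rho> (- 1 / 2) p 1 (j + J) (\<lambda>k. f r k - g t k)) \<le> ennreal \<epsilon>" .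
    qed
  qed
  have "\<exists>l\<in>A. \<exists>r. strict_mono r \<and> limitin B.T (\<sigma> \<circ> r) l sequentially" if \<sigma>: "\<forall>n. \<sigma> n \<in> A" for \<sigma> :: "nat \<Rightarrow> trajectory"
  proof -
    have \<sigma>A: "\<sigma> n \<in> B.paths" "path_norm \<rho> \<delta> (\<sigma> n) \<le> ennreal K" for n using \<sigma> by (auto simp: A_def)
    \<comment> \<open>The bounds on the coefficients depend on the frequency, whereas the diagonal
      extraction asks for a common bound; the rescaling makes it 1.\<close>
    define c where "c k = inverse (C k * K + 1)" for k
    have c: "0 < c k" for k using C(1)[of k] K by (simp add: c_def add_nonneg_pos)
    have cb: "norm (of_real (c k) * \<sigma> n t k) \<le> 1" for n t k
    proof -
      have "norm (\<sigma> n t k) \<le> C k * K + 1" by (rule order_trans[OF bd[OF \<sigma>A(2)]]) simp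
      then have "c k * norm (\<sigma> n t k) \<le> c k * (C k * K + 1)" using c[of k] by (intro mult_left_mono) auto
      also have "\<dots> = 1" using c[of k] by (simp add: c_def)
      finally show ?thesis using c[of k] by (simp add: norm_mult)
    qed
    define g where "g n x = of_real (c (snd x)) * \<sigma> n (of_rat (fst x)) (snd x)" for n and x :: "rat \<times> freq"
    have gb: "norm (g n x) \<le> 1" if "x \<in> UNIV" for n x unfolding g_def by (rule cb)
    obtain r where r: "strict_mono r" "\<And>x. x \<in> UNIV \<Longrightarrow> \<exists>L. (\<lambda>n. g (r n) x) \<longlonglongrightarrow> L"
      using function_convergent_subsequence[where f = g and S = UNIV and M = 1, OF countableI_type gb] by blast
    have conv: "convergent (\<lambda>n. \<sigma> (r n) (of_rat x) k)" for x k
    proof -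
      obtain L where "(\<lambda>n. of_real (c k) * \<sigma> (r n) (of_rat x) k) \<longlonglongrightarrow> L" using r(2)[of "(x, k)"] by (auto simp: g_def)
      from tendsto_mult_left[OF this, of "of_real (inverse (c k))"] c[of k]
      show ?thesis by (auto simp: convergent_def mult.assoc[symmetric] simp flip: of_real_mult)
    qed
    have UC: "uniformly_convergent_on {-R..R} (\<lambda>n t. \<sigma> (r n) t k)" for R k
      unfolding uniformly_convergent_eq_Cauchy
      by (rule uniformly_Cauchy_of_equicontinuous[where C = "C' k * K" and \<beta> = "1 - \<delta>"])
         (use hd[OF \<sigma>A(2)] conv \<delta> C'(1)[of k] K in auto)
    define l where "l t k = lim (\<lambda>n. \<sigma> (r n) t k)" for t k
    have UL: "uniform_limit {-R..R} (\<lambda>n t. \<sigma> (r n) t k) (\<lambda>t. l t k) sequentially" for R k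
      using UC[where R = R and k = k] unfolding uniformly_convergent_uniform_limit_iff l_def .
    have lim: "(\<lambda>n. \<sigma> (r n) t k) \<longlonglongrightarrow> l t k" for t k
      by (rule tendsto_uniform_limitI[OF UL[where R = "\<bar>t\<bar>" and k = k]]) auto
    have lK: "path_norm \<rho> \<delta> l \<le> ennreal K"
      by (rule order_trans[OF path_norm_lsc[OF lim]]) (intro liminf_const_le \<sigma>A)
    have "limitin B.T (\<lambda>n. \<sigma> (r n)) l sequentially"
    proof (rule B.limitinI_uniform)
      show "continuous_on UNIV (\<lambda>t. l t k)" for k
      proof (intro continuous_at_imp_continuous_on ballI)
        fix t :: real
        have "continuous_on {-(\<bar>t\<bar> + 1)..\<bar>t\<bar> + 1} (\<lambda>t. l t k)"
          by (rule uniform_limit_theorem[OF always_eventually UL])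
             (auto intro!: continuous_on_subset[OF B.paths_coeff_continuous] \<sigma>A)
        then show "isCont (\<lambda>t. l t k) t" by (rule continuous_on_interior) auto
      qed
      show "\<exists>J. \<forall>n t. (\<Sum>j. bpow \<rho> (- 1 / 2) p 1 (j + J) (\<lambda>k. \<sigma> (r n) t k - l t k)) \<le> ennreal \<epsilon>" if "\<epsilon> > 0" for \<epsilon>
        using tl[OF that] \<sigma>A lK by metis
      show "\<exists>J. \<forall>r t. (\<Sum>j. bpow \<rho> (- 1 / 2) p 1 (j + J) (\<lambda>k. l r k - l t k)) \<le> ennreal \<epsilon>" if "\<epsilon> > 0" for \<epsilon>
        using tl[OF that] lK by metis
    qed (use \<sigma>A UL in auto)
    moreover from this have "l \<in> A" using lK B.limitin_T by (auto simp: A_def)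
    ultimately show ?thesis using r(1) by (auto simp: o_def)
  qed
  then show ?thesis
    using B.topspace_T unfolding seq_compactin_def A_def by auto
qed

text \<open>Constant paths reduce the claim to compactness in the Besov space itself: bounded
  coefficients and uniformly small tails. The tails are prescribed through cuts \<open>J i\<close>
  and bounds \<open>b i\<close>; as \<open>J 0 = 0\<close>, the condition for \<open>i = 0\<close>
  bounds the whole series.\<close>

lemma zeta_compact:
  assumes p: "2 \<le> p" and s: "s < 0" and J: "J 0 = 0" and b: "\<And>i. 0 \<le> b i" "\<And>\<epsilon>. \<epsilon> > 0 \<Longrightarrow> \<exists>i. b i < \<epsilon>"
  shows "seq_compactin (path_topology \<rho> s (ennreal p) (ennreal p))
    {f \<in> besov_paths \<rho> s (ennreal p) (ennreal p). (\<forall>t. f t = f 0) \<and>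
       (\<forall>i :: nat. (\<Sum>j. bpow \<rho> s p p (j + J i) (f 0)) \<le> ennreal (b i))}"
proof -
  interpret B: besov_space \<rho> s p p by unfold_locales (use p s in auto)
  define A where "A = {f \<in> B.paths. (\<forall>t. f t = f 0) \<and> (\<forall>i. (\<Sum>j. bpow \<rho> s p p (j + J i) (f 0)) \<le> ennreal (b i))}"
  obtain C where C: "\<And>k. C k > 0" "\<And>k f. ennreal (norm (f k)) \<le> ennreal (C k) * B.N f" using B.coeff_N by metis
  define K where "K = b 0 powr (1 / p)"
  have bd: "norm (f 0 k) \<le> C k * K" if "f \<in> A" for f k
  proof -
    have "(\<Sum>j. bpow \<rho> s p p j (f 0)) \<le> ennreal (b 0)" using that J by (auto simp: A_def dest: spec[of _ 0])
    then have "B.N (f 0) \<le> ennpowr (ennreal (b 0)) (1 / p)"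
      using p by (simp add: besov_norm_bpow ennpowr_mono)
    then have "B.N (f 0) \<le> ennreal K" using b by (simp add: ennpowr_ennreal K_def)
    then have "ennreal (norm (f 0 k)) \<le> ennreal (C k) * ennreal K"
      by (intro order_trans[OF C(2)] mult_left_mono) auto
    then show ?thesis using C(1)[of k] by (simp add: K_def less_imp_le flip: ennreal_mult)
  qed
  have "\<exists>l\<in>A. \<exists>r. strict_mono r \<and> limitin B.T (\<sigma> \<circ> r) l sequentially" if \<sigma>: "\<forall>n. \<sigma> n \<in> A" for \<sigma> :: "nat \<Rightarrow> trajectory"
  proof -
    have const: "\<sigma> n t = \<sigma> n 0" for n t using \<sigma> by (auto simp: A_def)
    have \<sigma>P: "\<sigma> n \<in> B.paths" for n using \<sigma> by (auto simp: A_def)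
    have \<sigma>t: "(\<Sum>j. bpow \<rho> s p p (j + J i) (\<sigma> n 0)) \<le> ennreal (b i)" for n i using \<sigma> by (auto simp: A_def)
    define c where "c k = inverse (C k * K + 1)" for k
    have c: "0 < c k" for k using C(1)[of k] by (simp add: c_def add_nonneg_pos K_def)
    have cb: "norm (of_real (c k) * \<sigma> n 0 k) \<le> 1" if "k \<in> UNIV" for n k
    proof -
      have "norm (\<sigma> n 0 k) \<le> C k * K + 1" using bd[of "\<sigma> n" k] \<sigma> by simp
      then have "c k * norm (\<sigma> n 0 k) \<le> c k * (C k * K + 1)" using c[of k] by (intro mult_left_mono) auto
      also have "\<dots> = 1" using c[of k] by (simp add: c_def)
      finally show ?thesis using c[of k] by (simp add: norm_mult)
    qed
    obtain r where r: "strict_mono r" "\<And>k. k \<in> UNIV \<Longrightarrow> \<exists>L. (\<lambda>n. of_real (c k) * \<sigma> (r n) 0 k) \<longlonglongrightarrow> L"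
      using function_convergent_subsequence[where f = "\<lambda>n k. of_real (c k) * \<sigma> n 0 k" and S = UNIV and M = 1, OF countableI_type cb] by blast
    have "\<exists>L. (\<lambda>n. \<sigma> (r n) 0 k) \<longlonglongrightarrow> L" for k
    proof -
      obtain L where "(\<lambda>n. of_real (c k) * \<sigma> (r n) 0 k) \<longlonglongrightarrow> L" using r(2)[of k] by auto
      from tendsto_mult_left[OF this, of "of_real (inverse (c k))"] c[of k]
      show ?thesis by (auto simp: mult.assoc[symmetric] simp flip: of_real_mult)
    qed
    then obtain l where l: "\<And>k. (\<lambda>n. \<sigma> (r n) 0 k) \<longlonglongrightarrow> l k" by metis
    have lt: "(\<Sum>j. bpow \<rho> s p p (j + J i) l) \<le> ennreal (b i)" for i
      using p by (intro order_trans[OF bpow_tail_lsc[OF _ l]] liminf_const_le \<sigma>t) auto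
    have "limitin B.T (\<lambda>n. \<sigma> (r n)) (\<lambda>_. l) sequentially"
    proof (rule B.limitinI_uniform)
      show "uniform_limit {-R..R} (\<lambda>n t. \<sigma> (r n) t k) (\<lambda>t. l k) sequentially" for R k
      proof -
        have "(\<lambda>n t. \<sigma> (r n) t k) = (\<lambda>n t. \<sigma> (r n) 0 k)"
          by (rule ext, rule ext, rule fun_cong[OF const])
        then show ?thesis using l[of k] by (auto simp: uniform_limit_iff tendsto_iff elim: eventually_mono)
      qed
      show "\<exists>J. \<forall>r t. (\<Sum>j. bpow \<rho> s p p (j + J) (\<lambda>k. l k - l k)) \<le> ennreal \<epsilon>" for \<epsilon>
        using p by (simp add: bpow_def lp_block_0 lnorm_def)
      show "\<exists>J. \<forall>n t. (\<Sum>j. bpow \<rho> s p p (j + J) (\<lambda>k. \<sigma> (r n) t k - l k)) \<le> ennreal \<epsilon>" if e: "\<epsilon> > 0" for \<epsilon>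
      proof -
        have "0 < \<epsilon> / (2 powr p * 2)" using e by simp
        from b(2)[OF this] obtain i where i: "b i < \<epsilon> / (2 powr p * 2)" by blast
        have "(\<Sum>j. bpow \<rho> s p p (j + J i) (\<lambda>k. \<sigma> (r n) t k - l k)) \<le> ennreal \<epsilon>" for n t
        proof -
          have "(\<Sum>j. bpow \<rho> s p p (j + J i) (\<lambda>k. \<sigma> (r n) t k - l k)) \<le>
              (\<Sum>j. ennreal (2 powr p) * (bpow \<rho> s p p (j + J i) (\<sigma> (r n) 0) + bpow \<rho> s p p (j + J i) l))"
            using p by (simp only: const[of "r n" t]) (intro suminf_le bpow_diff_le, auto)
          also have "\<dots> = ennreal (2 powr p) * ((\<Sum>j. bpow \<rho> s p p (j + J i) (\<sigma> (r n) 0)) + (\<Sum>j. bpow \<rho> s p p (j + J i) l))"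
            by (rule suminf_cmult_add)
          also have "\<dots> \<le> ennreal (2 powr p) * (ennreal (b i) + ennreal (b i))"
            by (intro mult_left_mono add_mono \<sigma>t lt) auto
          also have "\<dots> = ennreal (2 powr p * 2 * b i)" using b(1)[of i] by (simp flip: ennreal_plus ennreal_mult)
          also have "\<dots> \<le> ennreal \<epsilon>" using i by (intro ennreal_leI) (simp add: field_simps)
          finally show ?thesis .
        qed
        then show ?thesis by blast
      qed
    qed (use \<sigma>P in auto)
    moreover from this have "(\<lambda>_. l) \<in> A" using lt B.limitin_T by (auto simp: A_def)
    ultimately show ?thesis using r(1) by (auto simp: o_def)
  qed
  then show ?thesis
    using B.topspace_T unfolding seq_compactin_def A_def by auto
qed

end

section \<open>Continuity of the terms in the weak formulation\<close>

lemma count_space_bound: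
  fixes f :: "'x \<Rightarrow> 'b :: banach"
  assumes le: "(\<integral>\<^sup>+x. ennreal (norm (f x)) \<partial>count_space UNIV) \<le> ennreal B" and B: "0 \<le> B"
  shows "(\<lambda>x. norm (f x)) summable_on UNIV" and "norm (infsum f UNIV) \<le> B"
proof -
  have fin: "(\<Sum>x\<in>F. norm (f x)) \<le> B" if "finite F" for F
  proof -
    have "ennreal (\<Sum>x\<in>F. norm (f x)) = (\<Sum>x\<in>F. ennreal (norm (f x)) * indicator F x)"
      by (simp add: sum_ennreal)
    also have "\<dots> = (\<integral>\<^sup>+x. ennreal (norm (f x)) * indicator F x \<partial>count_space UNIV)"
      using that by (intro nn_integral_count_space'[symmetric]) auto
    also have "\<dots> \<le> (\<integral>\<^sup>+x. ennreal (norm (f x)) \<partial>count_space UNIV)"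
      by (intro nn_integral_mono) (auto split: split_indicator)
    also note le
    finally show ?thesis using B by simp
  qed
  show s: "(\<lambda>x. norm (f x)) summable_on UNIV"
    by (rule nonneg_bdd_above_summable_on) (auto intro!: bdd_aboveI2 fin)
  have "norm (infsum f UNIV) \<le> infsum (\<lambda>x. norm (f x)) UNIV" by (rule norm_infsum_bound[OF s])
  also have "\<dots> \<le> B" using s fin by (intro infsum_le_finite_sums)
  finally show "norm (infsum f UNIV) \<le> B" .
qed

lemma nn_integral_summable:
  fixes f :: "'x \<Rightarrow> real"
  assumes "f summable_on UNIV" "\<And>x. 0 \<le> f x"
  shows "(\<integral>\<^sup>+x. ennreal (f x) \<partial>count_space UNIV) = ennreal (infsum f UNIV)"
proof -
  have "(\<lambda>x. norm (f x)) summable_on UNIV" using assms by simp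
  then have "Infinite_Set_Sum.abs_summable_on f UNIV" by (simp only: abs_summable_equivalent)
  then have "integrable (count_space UNIV) f" by (simp add: Infinite_Set_Sum.abs_summable_on_def)
  then have "(\<integral>\<^sup>+x. ennreal (f x) \<partial>count_space UNIV) = ennreal (\<integral>x. f x \<partial>count_space UNIV)"
    using assms(2) by (intro nn_integral_eq_integral) auto
  also have "(\<integral>x. f x \<partial>count_space UNIV) = infsum f UNIV"
    using \<open>Infinite_Set_Sum.abs_summable_on f UNIV\<close> by (simp add: infsetsum_infsum[symmetric] infsetsum_def)
  finally show ?thesis .
qed

lemma freqw_add: "freqw (k + m) \<le> 2 * (freqw k * freqw m)"
proof -
  have "norm (wavevec (k + m)) \<le> freqw k + freqw m"
    unfolding wavevec_add using norm_triangle_ineq[of "wavevec k" "wavevec m"] norm_le_freqw[of k] norm_le_freqw[of m] by linarith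
  also have "freqw k + freqw m = freqw k * 1 + 1 * freqw m" by simp
  also have "\<dots> \<le> freqw k * freqw m + freqw k * freqw m"
    using freqw_ge_1[of k] freqw_ge_1[of m] by (intro add_mono mult_mono) auto
  finally have "norm (wavevec (k + m)) \<le> 2 * (freqw k * freqw m)" by simp
  moreover have "1 * 1 \<le> freqw k * freqw m" using freqw_ge_1[of k] freqw_ge_1[of m] by (intro mult_mono) auto
  ultimately show ?thesis by (auto simp: freqw_def[of "k + m"])
qed

section \<open>The commutator as a kernel\<close>

text \<open>The Fourier symbol i k_j / |k| of the Riesz transform, with value 0 at
  \<open>k = 0\<close>.\<close>

definition rsym :: "(freq \<Rightarrow> int) \<Rightarrow> freq \<Rightarrow> complex" where
  "rsym j k = \<i> * of_int (j k) * of_real (norm (wavevec k) powr -1)"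

lemma riesz_rsym: "riesz j f k = rsym j k * f k"
  by (simp add: riesz_def partial_def Lam_def rsym_def)

lemma norm_rsym: "norm (rsym j k) = \<bar>of_int (j k)\<bar> / norm (wavevec k)"
proof -
  have "norm (rsym j k) = \<bar>of_int (j k)\<bar> * (norm (wavevec k) powr -1)"
    unfolding rsym_def by (simp only: norm_mult norm_ii norm_of_int norm_of_real mult_1 abs_of_nonneg[OF powr_ge_zero])
  then show ?thesis by (simp add: powr_minus_divide)
qed

lemma coord_le:
  assumes "j = fst \<or> j = snd"
  shows "\<bar>of_int (j k)\<bar> \<le> norm (wavevec k)"
  using assms norm_fst_le[where x = "of_int (fst k) :: real" and y = "of_int (snd k) :: real"]
    norm_snd_le[where x = "of_int (fst k) :: real" and y = "of_int (snd k) :: real"]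
  by (auto simp: wavevec_def)

text \<open>Over the common denominator the numerator is \<open>(x - y) * b + y * (b - a)\<close>,
  and both summands are at most \<open>d * b\<close>. The bound names only \<open>a\<close>;
  exchanging the two fractions gives the same bound with \<open>b\<close>.\<close>

lemma quotient_diff_le:
  fixes x y a b d :: real
  assumes "\<bar>y\<bar> \<le> b" "\<bar>x - y\<bar> \<le> d" "\<bar>a - b\<bar> \<le> d" "0 < a" "0 < b"
  shows "\<bar>x / a - y / b\<bar> \<le> 2 * d / a"
proof -
  have "x / a - y / b = ((x - y) * b + y * (b - a)) / (a * b)"
    using assms by (simp add: field_simps)
  then have "\<bar>x / a - y / b\<bar> = \<bar>(x - y) * b + y * (b - a)\<bar> / (a * b)"
    using assms by (simp add: abs_mult)
  also have "\<dots> \<le> (d * b + b * d) / (a * b)"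
  proof (rule divide_right_mono)
    have "\<bar>(x - y) * b + y * (b - a)\<bar> \<le> \<bar>x - y\<bar> * b + \<bar>y\<bar> * \<bar>b - a\<bar>"
      using assms by (intro order_trans[OF abs_triangle_ineq]) (simp add: abs_mult)
    also have "\<dots> \<le> d * b + b * d"
      using assms by (intro add_mono mult_mono) auto
    finally show "\<bar>(x - y) * b + y * (b - a)\<bar> \<le> d * b + b * d" .
  qed (use assms in auto)
  also have "\<dots> = 2 * d / a" using assms by (simp add: field_simps)
  finally show ?thesis .
qed

text \<open>The commutator gains one derivative: this makes the nonlinearity continuous on \<open>H\<^sup>-\<^sup>1\<^sup>/\<^sup>2\<close>.\<close>

lemma rsym_diff:
  assumes j: "j = fst \<or> j = snd"
  shows "norm (rsym j k - rsym j m) \<le> 2 * freqw (k - m) / (sqrt (freqw k) * sqrt (freqw m))"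
proof -
  have one: "norm (rsym j n) \<le> 1" for n
    using coord_le[OF j, of n] unfolding norm_rsym by (cases "n = 0") (auto simp: divide_le_eq_1)
  have z: "rsym j 0 = 0" using j by (auto simp: rsym_def)
  have w0: "freqw 0 = 1" by (simp add: freqw_def)
  have s: "1 \<le> 2 * freqw n / sqrt (freqw n)" for n
  proof -
    have "sqrt (freqw n) \<le> 2 * freqw n" using freqw_ge_1[of n] by (intro real_le_lsqrt) (auto simp: power2_eq_square)
    then show ?thesis using freqw_pos[of n] by (simp add: field_simps)
  qed
  consider "k = 0" | "m = 0" | "k \<noteq> 0" "m \<noteq> 0" by blast
  then show ?thesis
  proof cases
    case 1
    then show ?thesis using order_trans[OF one[of m] s[of m]] by (simp add: z w0)
  next
    case 2
    then show ?thesis using order_trans[OF one[of k] s[of k]] by (simp add: z w0)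
  next
    case 3
    let ?a = "norm (wavevec k)" and ?b = "norm (wavevec m)" and ?d = "freqw (k - m)"
    have ge1: "1 \<le> norm (wavevec n)" if "n \<noteq> 0" for n
    proof -
      have "1 \<le> \<bar>fst n\<bar> \<or> 1 \<le> \<bar>snd n\<bar>" using that by (auto simp: prod_eq_iff)
      then have "1 \<le> \<bar>of_int (fst n) :: real\<bar> \<or> 1 \<le> \<bar>of_int (snd n) :: real\<bar>" by linarith
      then show ?thesis using coord_le[of fst n] coord_le[of snd n] by auto
    qed
    have w: "freqw k = ?a" "freqw m = ?b" using ge1 3 by (auto simp: freqw_def max_def)
    have pos: "0 < ?a" "0 < ?b" using 3 by auto
    have dd: "norm (wavevec k - wavevec m) \<le> ?d" using norm_le_freqw[of "k - m"] by (simp add: wavevec_diff)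
    have xy: "\<bar>of_int (j k) - of_int (j m)\<bar> \<le> ?d"
    proof -
      have "of_int (j k) - of_int (j m) = (of_int (j (k - m)) :: real)" using j by auto
      then show ?thesis using coord_le[OF j, of "k - m"] norm_le_freqw[of "k - m"] by simp
    qed
    have ab: "\<bar>?a - ?b\<bar> \<le> ?d" using norm_triangle_ineq3[of "wavevec k" "wavevec m"] dd by linarith
    let ?X = "\<bar>of_int (j k) / ?a - of_int (j m) / ?b\<bar>"
    have X: "norm (rsym j k - rsym j m) = ?X"
    proof -
      have "rsym j k - rsym j m = \<i> * of_real (of_int (j k) / ?a - of_int (j m) / ?b)"
        using pos by (simp add: rsym_def powr_minus_divide algebra_simps)
      then show ?thesis by (simp only: norm_mult norm_ii norm_of_real mult_1)
    qed
    have 1: "?X \<le> 2 * ?d / ?a"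
      by (rule quotient_diff_le) (use coord_le[OF j] xy ab pos in auto)
    have "\<bar>of_int (j m) / ?b - of_int (j k) / ?a\<bar> \<le> 2 * ?d / ?b"
      by (rule quotient_diff_le) (use coord_le[OF j] xy ab pos in \<open>auto simp: abs_minus_commute\<close>)
    then have 2: "?X \<le> 2 * ?d / ?b" by (simp add: abs_minus_commute)
    \<comment> \<open>Multiplying the two one-sided bounds and taking the root distributes the gain
      evenly, half a derivative on each frequency, as the H^(-1/2) estimate requires.\<close>
    have "?X * ?X \<le> (2 * ?d / ?a) * (2 * ?d / ?b)" using 1 2 freqw_pos[of "k - m"] by (intro mult_mono) auto
    also have "\<dots> = (2 * ?d / (sqrt ?a * sqrt ?b))\<^sup>2" using pos by (simp add: power2_eq_square field_simps flip: real_sqrt_mult)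
    finally have "?X\<^sup>2 \<le> (2 * ?d / (sqrt ?a * sqrt ?b))\<^sup>2" by (simp only: power2_eq_square)
    then have "?X \<le> 2 * ?d / (sqrt ?a * sqrt ?b)"
      by (rule power2_le_imp_le) (use pos freqw_pos[of "k - m"] in auto)
    then show ?thesis unfolding X w .
  qed
qed

text \<open>The matrix of the commutator with respect to the Fourier modes, from frequency
  \<open>m\<close> to frequency \<open>k\<close>.\<close>

definition ckern :: "(point \<Rightarrow> real) \<Rightarrow> freq \<Rightarrow> freq \<Rightarrow> complex" where
  "ckern \<psi> k m = - ((rsym snd k - rsym snd m) * partial fst (fourier \<psi>) (k - m))
     + (rsym fst k - rsym fst m) * partial snd (fourier \<psi>) (k - m)"

text \<open>Of the two powers of the frequency one stems from the gradient of the test function and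
  one from \<open>rsym_diff\<close>; the 4 is the 2 of that lemma for each of the two Riesz
  transforms.\<close>

definition cmaj :: "(point \<Rightarrow> real) \<Rightarrow> freq \<Rightarrow> real" where
  "cmaj \<psi> n = 4 * (freqw n ^ 2 * norm (fourier \<psi> n))"

lemma cmaj_nonneg: "0 \<le> cmaj \<psi> n" by (simp add: cmaj_def)

lemma norm_partial: "j = fst \<or> j = snd \<Longrightarrow> norm (partial j g k) \<le> freqw k * norm (g k)"
  using order_trans[OF coord_le[of j k] norm_le_freqw[of k]]
  by (auto simp: partial_def norm_mult intro!: mult_right_mono)

lemma ckern_bound: "norm (ckern \<psi> k m) \<le> cmaj \<psi> (k - m) / (sqrt (freqw k) * sqrt (freqw m))"
proof -
  let ?r = "2 * freqw (k - m) / (sqrt (freqw k) * sqrt (freqw m))" and ?g = "freqw (k - m) * norm (fourier \<psi> (k - m))"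
  have r0: "0 \<le> ?r" using freqw_pos[of k] freqw_pos[of m] freqw_pos[of "k - m"] by simp
  have "norm (ckern \<psi> k m) \<le> norm ((rsym snd k - rsym snd m) * partial fst (fourier \<psi>) (k - m))
     + norm ((rsym fst k - rsym fst m) * partial snd (fourier \<psi>) (k - m))"
    unfolding ckern_def by (rule order_trans[OF norm_triangle_ineq]) simp
  also have "\<dots> \<le> ?r * ?g + ?r * ?g"
    unfolding norm_mult using r0 by (intro add_mono mult_mono rsym_diff norm_partial) auto
  also have "\<dots> = cmaj \<psi> (k - m) / (sqrt (freqw k) * sqrt (freqw m))"
    by (simp add: cmaj_def power2_eq_square field_simps)
  finally show ?thesis .
qed

text \<open>The quadratic growth of \<open>f\<close> at \<open>m\<close> is split between
  \<open>k\<close> and \<open>k - m\<close> by \<open>freqw_add\<close>; the part at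
  \<open>k - m\<close> is absorbed by the decay of the test function.\<close>

lemma growth_conv_summable:
  fixes f g c :: coeffs
  assumes f: "\<And>m. norm (f m) \<le> A * freqw m ^ 2" and g: "\<And>n. norm (g n) \<le> freqw n * norm (fourier \<psi> n)"
    and \<psi>: "\<psi> \<in> smooth_torus" and c: "\<And>m. norm (c m) \<le> 1"
  shows "(\<lambda>m. g (k - m) * (c m * f m)) summable_on UNIV"
proof -
  have A: "0 \<le> A" using f[of 0] norm_ge_zero[of "f 0"] freqw_pos[of 0] by (smt (verit) mult_neg_pos zero_less_power)
  define D where "D = 4 * A * freqw k ^ 2"
  have "(\<lambda>n. D * (freqw n ^ 3 * norm (fourier \<psi> n))) summable_on UNIV"
    by (intro summable_on_cmult_right fourier_summable \<psi>)
  then have "(\<lambda>m. D * (freqw (k - m) ^ 3 * norm (fourier \<psi> (k - m)))) summable_on UNIV"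
    by (subst summable_on_reindex_bij_witness[where i = "\<lambda>m. k - m" and j = "\<lambda>m. k - m" and T = UNIV]) auto
  moreover have "norm (g (k - m) * (c m * f m)) \<le> D * (freqw (k - m) ^ 3 * norm (fourier \<psi> (k - m)))" for m
  proof -
    have "freqw m \<le> 2 * (freqw k * freqw (k - m))"
      using freqw_add[of k "m - k"] freqw_minus[of "k - m"] by simp
    then have "freqw m ^ 2 \<le> (2 * (freqw k * freqw (k - m))) ^ 2"
      using freqw_pos[of m] by (intro power_mono) auto
    then have "A * freqw m ^ 2 \<le> A * (2 * (freqw k * freqw (k - m))) ^ 2"
      using A by (rule mult_left_mono)
    also have "\<dots> = D * freqw (k - m) ^ 2" by (simp add: D_def power_mult_distrib mult_ac)
    finally have "A * freqw m ^ 2 \<le> D * freqw (k - m) ^ 2" .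
    then have "norm (f m) \<le> D * freqw (k - m) ^ 2" using f[of m] by simp
    moreover have "norm (c m * f m) \<le> norm (f m)"
      using mult_right_mono[OF c[of m], of "norm (f m)"] by (simp add: norm_mult)
    ultimately have "norm (g (k - m) * (c m * f m)) \<le> (freqw (k - m) * norm (fourier \<psi> (k - m))) * (D * freqw (k - m) ^ 2)"
      unfolding norm_mult[of "g (k - m)"] using g[of "k - m"] freqw_pos[of "k - m"] by (intro mult_mono) auto
    then show ?thesis
      by (simp add: power3_eq_cube power2_eq_square mult_ac)
  qed
  ultimately show ?thesis by (rule abs_summable_summable[OF Infinite_Sum.abs_summable_on_comparison_test'])
qed

text \<open>The two halves of each commutator are separate infinite sums, and they may be merged
  only if both converge. The growth bound provides this, even though for the merged sum much less
  would be at stake.\<close>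

lemma sqg_comm_kernel:
  assumes f: "\<And>m. norm (f m) \<le> A * freqw m ^ 2" and \<psi>: "\<psi> \<in> smooth_torus"
  shows "sqg_comm \<psi> f k = (\<Sum>\<^sub>\<infinity>m. ckern \<psi> k m * f m)"
proof -
  have one: "norm (rsym j n) \<le> 1" if "j = fst \<or> j = snd" for n j
    using coord_le[OF that, of n] unfolding norm_rsym by (cases "n = 0") (auto simp: divide_le_eq_1)
  have rc: "riesz_comm j (partial j' (fourier \<psi>)) f k =
      (\<Sum>\<^sub>\<infinity>m. (rsym j k - rsym j m) * partial j' (fourier \<psi>) (k - m) * f m)"
    and sm: "(\<lambda>m. (rsym j k - rsym j m) * partial j' (fourier \<psi>) (k - m) * f m) summable_on UNIV"
    if j: "j = fst \<or> j = snd" "j' = fst \<or> j' = snd" for j j'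
  proof -
    let ?g = "partial j' (fourier \<psi>)"
    have s1: "(\<lambda>m. ?g (k - m) * f m) summable_on UNIV"
      using growth_conv_summable[where f = f and g = ?g and c = "\<lambda>_. 1" and k = k, OF f norm_partial[OF j(2)] \<psi>] by simp
    have s2: "(\<lambda>m. ?g (k - m) * (rsym j m * f m)) summable_on UNIV"
      by (rule growth_conv_summable[where f = f and g = ?g and c = "rsym j" and k = k, OF f norm_partial[OF j(2)] \<psi> one[OF j(1)]])
    have s3: "(\<lambda>m. rsym j k * (?g (k - m) * f m)) summable_on UNIV"
      by (rule summable_on_cmult_right[OF s1])
    have s4: "(\<lambda>m. - (?g (k - m) * (rsym j m * f m))) summable_on UNIV"
      using s2 by (simp add: summable_on_uminus)
    have eq: "(rsym j k - rsym j m) * ?g (k - m) * f m = rsym j k * (?g (k - m) * f m) + - (?g (k - m) * (rsym j m * f m))" for m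
      by (simp add: algebra_simps)
    show "(\<lambda>m. (rsym j k - rsym j m) * ?g (k - m) * f m) summable_on UNIV"
      unfolding eq by (rule summable_on_add[OF s3 s4])
    show "riesz_comm j ?g f k = (\<Sum>\<^sub>\<infinity>m. (rsym j k - rsym j m) * ?g (k - m) * f m)"
      unfolding eq infsum_add[OF s3 s4] infsum_cmult_right' infsum_uminus
      by (simp add: riesz_comm_def riesz_rsym mult_def)
  qed
  have eq: "ckern \<psi> k m * f m = - ((rsym snd k - rsym snd m) * partial fst (fourier \<psi>) (k - m) * f m)
      + (rsym fst k - rsym fst m) * partial snd (fourier \<psi>) (k - m) * f m" for m
    by (simp add: ckern_def algebra_simps)
  have s: "(\<lambda>m. - ((rsym snd k - rsym snd m) * partial fst (fourier \<psi>) (k - m) * f m)) summable_on UNIV"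
    using sm[of snd fst] by (simp add: summable_on_uminus)
  show ?thesis
    unfolding eq by (subst infsum_add[OF s sm]) (auto simp: infsum_uminus sqg_comm_def rc)
qed

text \<open>The double series of the nonlinearity with its two arguments kept apart, so that
  differences expand bilinearly. The factor vanishing at \<open>k = 0\<close> is the product of the
  symbols of \<open>Lam (- 1 / 2)\<close> and \<open>Lam (1 / 2)\<close>, which annihilate the
  mean.\<close>

definition hterm :: "(point \<Rightarrow> real) \<Rightarrow> coeffs \<Rightarrow> coeffs \<Rightarrow> freq \<times> freq \<Rightarrow> complex" where
  "hterm \<psi> f h = (\<lambda>(k, m). (if k = 0 then 0 else 1) * f k * (ckern \<psi> (- k) m * h m))"

definition hform :: "(point \<Rightarrow> real) \<Rightarrow> coeffs \<Rightarrow> coeffs \<Rightarrow> complex" where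
  "hform \<psi> f h = (\<Sum>\<^sub>\<infinity>x. hterm \<psi> f h x)"

abbreviation hnorm2 :: "coeffs \<Rightarrow> ennreal" where
  "hnorm2 f \<equiv> \<integral>\<^sup>+k. ennreal ((norm (f k))\<^sup>2 / freqw k) \<partial>count_space UNIV"

definition cmass :: "(point \<Rightarrow> real) \<Rightarrow> real" where
  "cmass \<psi> = (\<Sum>\<^sub>\<infinity>n. cmaj \<psi> n)"

lemma cmass_nonneg: "0 \<le> cmass \<psi>"
  unfolding cmass_def by (intro infsum_nonneg cmaj_nonneg)

lemma cmaj_integral:
  assumes "\<psi> \<in> smooth_torus"
  shows "(\<integral>\<^sup>+n. ennreal (cmaj \<psi> n) \<partial>count_space UNIV) = ennreal (cmass \<psi>)"
  unfolding cmass_def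
proof (rule nn_integral_summable)
  show "cmaj \<psi> summable_on UNIV"
    unfolding cmaj_def[abs_def] by (intro summable_on_cmult_right fourier_summable assms)
qed (rule cmaj_nonneg)

text \<open>After dividing both arguments by the roots of their frequencies, the kernel is dominated
  by the summable \<open>cmaj\<close>, a function of one combination of the frequencies. The
  weighted inequality between arithmetic and geometric mean and Tonelli's theorem then give a Schur
  test.\<close>

lemma hterm_bound:
  assumes \<psi>: "\<psi> \<in> smooth_torus" and f: "hnorm2 f \<le> ennreal (a\<^sup>2)" and h: "hnorm2 h \<le> ennreal (b\<^sup>2)"
    and ab: "0 < a" "0 < b"
  shows "(\<integral>\<^sup>+x. ennreal (norm (hterm \<psi> f h x)) \<partial>count_space UNIV) \<le> ennreal (cmass \<psi> * a * b)"
proof -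
  \<comment> \<open>The weight that balances the inequality: each half then contributes
    \<open>cmass \<psi> * a * b / 2\<close>.\<close>
  define l where "l = b / a"
  have l: "l > 0" using ab by (simp add: l_def)
  let ?u = "\<lambda>k. (norm (f k))\<^sup>2 / freqw k" and ?v = "\<lambda>m. (norm (h m))\<^sup>2 / freqw m"
  have pt: "norm (hterm \<psi> f h (k, m)) \<le> cmaj \<psi> (- k - m) * (l / 2 * ?u k) + cmaj \<psi> (- k - m) * (1 / (2 * l) * ?v m)" for k m
  proof -
    let ?x = "norm (f k) / sqrt (freqw k)" and ?y = "norm (h m) / sqrt (freqw m)"
    have "norm (hterm \<psi> f h (k, m)) \<le> norm (f k) * (norm (ckern \<psi> (- k) m) * norm (h m))"
      by (auto simp: hterm_def norm_mult)
    also have "\<dots> \<le> norm (f k) * (cmaj \<psi> (- k - m) / (sqrt (freqw k) * sqrt (freqw m)) * norm (h m))"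
      using ckern_bound[of \<psi> "- k" m] by (intro mult_left_mono mult_right_mono) auto
    also have "\<dots> = cmaj \<psi> (- k - m) * (?x * ?y)" by (simp add: mult_ac)
    also have "\<dots> \<le> cmaj \<psi> (- k - m) * (l / 2 * ?x\<^sup>2 + 1 / (2 * l) * ?y\<^sup>2)"
    proof (rule mult_left_mono[OF _ cmaj_nonneg])
      have "0 \<le> (l * ?x - ?y)\<^sup>2 / (2 * l)" using l by simp
      also have "\<dots> = l / 2 * ?x\<^sup>2 + 1 / (2 * l) * ?y\<^sup>2 - ?x * ?y"
        using l by (simp add: power2_diff add_divide_distrib diff_divide_distrib) (simp add: power2_eq_square)
      finally show "?x * ?y \<le> l / 2 * ?x\<^sup>2 + 1 / (2 * l) * ?y\<^sup>2" by simp
    qed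
    finally show ?thesis using freqw_pos[of k] freqw_pos[of m] by (simp add: distrib_left power_divide)
  qed
  have I1: "(\<integral>\<^sup>+k. ennreal (cmaj \<psi> (- k - m)) \<partial>count_space UNIV) = ennreal (cmass \<psi>)" for m
    unfolding cmaj_integral[OF \<psi>, symmetric]
    by (rule nn_integral_bij_count_space, rule bij_betw_byWitness[where f' = "\<lambda>k. - k - m"]) auto
  have I2: "(\<integral>\<^sup>+m. ennreal (cmaj \<psi> (- k - m)) \<partial>count_space UNIV) = ennreal (cmass \<psi>)" for k
    unfolding cmaj_integral[OF \<psi>, symmetric]
    by (rule nn_integral_bij_count_space, rule bij_betw_byWitness[where f' = "\<lambda>m. - k - m"]) auto
  let ?A = "\<lambda>(k, m). ennreal (cmaj \<psi> (- k - m)) * (ennreal (l / 2) * ennreal (?u k))"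
  let ?B = "\<lambda>(k, m). ennreal (cmaj \<psi> (- k - m)) * (ennreal (1 / (2 * l)) * ennreal (?v m))"
  have gen: "ennreal (c * (x * u) + c * (y * v)) = ennreal c * (ennreal x * ennreal u) + ennreal c * (ennreal y * ennreal v)"
    if "0 \<le> c" "0 \<le> x" "0 \<le> y" "0 \<le> u" "0 \<le> v" for c x y u v :: real
    using that by (simp flip: ennreal_mult ennreal_plus)
  have u0: "0 \<le> ?u k" "0 \<le> ?v k" for k using freqw_pos[of k] by auto
  have "(\<integral>\<^sup>+x. ennreal (norm (hterm \<psi> f h x)) \<partial>count_space UNIV) \<le> (\<integral>\<^sup>+x. ?A x + ?B x \<partial>count_space UNIV)"
  proof (rule nn_integral_mono)
    fix x :: "freq \<times> freq"
    obtain k m where x: "x = (k, m)" using surj_pair[of x] by blast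
    have "ennreal (norm (hterm \<psi> f h (k, m))) \<le> ennreal (cmaj \<psi> (- k - m) * (l / 2 * ?u k) + cmaj \<psi> (- k - m) * (1 / (2 * l) * ?v m))"
      by (rule ennreal_leI[OF pt])
    also have "\<dots> = ?A (k, m) + ?B (k, m)"
      unfolding prod.case by (rule gen) (use l u0[of k] u0[of m] cmaj_nonneg in auto)
    finally show "ennreal (norm (hterm \<psi> f h x)) \<le> ?A x + ?B x" by (simp only: x)
  qed
  also have "\<dots> = (\<integral>\<^sup>+x. ?A x \<partial>count_space UNIV) + (\<integral>\<^sup>+x. ?B x \<partial>count_space UNIV)"
    by (rule nn_integral_add) auto
  also have "(\<integral>\<^sup>+x. ?A x \<partial>count_space UNIV) = (\<integral>\<^sup>+k. \<integral>\<^sup>+m. ?A (k, m) \<partial>count_space UNIV \<partial>count_space UNIV)"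
    by (rule nn_integral_fst_count_space[symmetric])
  also have "\<dots> = (\<integral>\<^sup>+k. ennreal (cmass \<psi>) * (ennreal (l / 2) * ennreal (?u k)) \<partial>count_space UNIV)"
    unfolding prod.case by (subst nn_integral_multc, simp) (simp only: I2)
  also have "\<dots> = ennreal (cmass \<psi>) * (ennreal (l / 2) * hnorm2 f)"
    by (subst nn_integral_cmult, simp, subst nn_integral_cmult) auto
  also have "(\<integral>\<^sup>+x. ?B x \<partial>count_space UNIV) = (\<integral>\<^sup>+m. \<integral>\<^sup>+k. ?B (k, m) \<partial>count_space UNIV \<partial>count_space UNIV)"
    by (rule nn_integral_snd_count_space[symmetric])
  also have "\<dots> = (\<integral>\<^sup>+m. ennreal (cmass \<psi>) * (ennreal (1 / (2 * l)) * ennreal (?v m)) \<partial>count_space UNIV)"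
    unfolding prod.case by (subst nn_integral_multc, simp) (simp only: I1)
  also have "\<dots> = ennreal (cmass \<psi>) * (ennreal (1 / (2 * l)) * hnorm2 h)"
    by (subst nn_integral_cmult, simp, subst nn_integral_cmult) auto
  also have "ennreal (cmass \<psi>) * (ennreal (l / 2) * hnorm2 f) + ennreal (cmass \<psi>) * (ennreal (1 / (2 * l)) * hnorm2 h)
      \<le> ennreal (cmass \<psi>) * (ennreal (l / 2) * ennreal (a\<^sup>2)) + ennreal (cmass \<psi>) * (ennreal (1 / (2 * l)) * ennreal (b\<^sup>2))"
    using f h by (intro add_mono mult_left_mono) auto
  also have "\<dots> = ennreal (cmass \<psi> * (l / 2 * a\<^sup>2) + cmass \<psi> * (1 / (2 * l) * b\<^sup>2))"
    using l cmass_nonneg[of \<psi>] by (intro gen[symmetric]) auto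
  also have "cmass \<psi> * (l / 2 * a\<^sup>2) + cmass \<psi> * (1 / (2 * l) * b\<^sup>2) = cmass \<psi> * a * b"
    using ab by (simp add: l_def power2_eq_square field_simps)
  finally show ?thesis .
qed

definition nonlin :: "(point \<Rightarrow> real) \<Rightarrow> coeffs \<Rightarrow> complex" where
  "nonlin \<psi> f = 1 / 2 * pairing (Lam (- 1 / 2) f) (Lam (1 / 2) (sqg_comm \<psi> f))"

text \<open>Absolute summability permits summing over \<open>m\<close> first. The constant
  \<open>2 * pi\<^sup>2\<close> is one half times the \<open>(2 * pi)\<^sup>2\<close> of the
  pairing.\<close>

lemma nonlin_hform:
  assumes \<psi>: "\<psi> \<in> smooth_torus" and g: "\<And>m. norm (f m) \<le> A * freqw m ^ 2"
    and s: "(\<lambda>x. norm (hterm \<psi> f f x)) summable_on UNIV"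
  shows "nonlin \<psi> f = 2 * of_real (pi\<^sup>2) * hform \<psi> f f"
proof -
  have "hform \<psi> f f = infsum (hterm \<psi> f f) (UNIV \<times> UNIV)" by (simp add: hform_def)
  also have "\<dots> = (\<Sum>\<^sub>\<infinity>k. \<Sum>\<^sub>\<infinity>m. hterm \<psi> f f (k, m))"
    by (rule infsum_Sigma_banach[symmetric]) (use abs_summable_summable[OF s] in simp)
  also have "\<dots> = (\<Sum>\<^sub>\<infinity>k. Lam (- 1 / 2) f k * Lam (1 / 2) (sqg_comm \<psi> f) (- k))"
  proof (rule infsum_cong)
    fix k :: freq
    have "(\<Sum>\<^sub>\<infinity>m. hterm \<psi> f f (k, m)) = (if k = 0 then 0 else 1) * f k * sqg_comm \<psi> f (- k)"
      unfolding hterm_def prod.case infsum_cmult_right' sqg_comm_kernel[OF g \<psi>, of "- k"] ..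
    also have "(if k = 0 then 0 else 1 :: complex) = of_real (norm (wavevec k) powr (- 1 / 2)) * of_real (norm (wavevec k) powr (1 / 2))"
      by (simp flip: of_real_mult powr_add)
    finally show "(\<Sum>\<^sub>\<infinity>m. hterm \<psi> f f (k, m)) = Lam (- 1 / 2) f k * Lam (1 / 2) (sqg_comm \<psi> f) (- k)"
      by (simp add: Lam_def wavevec_minus mult_ac)
  qed
  finally show ?thesis by (simp add: nonlin_def pairing_def power_mult_distrib)
qed

lemma hform_diff:
  assumes "(\<lambda>x. norm (hterm \<psi> (\<lambda>k. f k - h k) f x)) summable_on UNIV" "(\<lambda>x. norm (hterm \<psi> h (\<lambda>k. f k - h k) x)) summable_on UNIV"
    "(\<lambda>x. norm (hterm \<psi> h h x)) summable_on UNIV"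
  shows "hform \<psi> f f - hform \<psi> h h = hform \<psi> (\<lambda>k. f k - h k) f + hform \<psi> h (\<lambda>k. f k - h k)"
proof -
  have "hterm \<psi> f f = (\<lambda>x. (hterm \<psi> (\<lambda>k. f k - h k) f x + hterm \<psi> h (\<lambda>k. f k - h k) x) + hterm \<psi> h h x)"
    by (auto simp: hterm_def algebra_simps)
  then have "hform \<psi> f f = hform \<psi> (\<lambda>k. f k - h k) f + hform \<psi> h (\<lambda>k. f k - h k) + hform \<psi> h h"
    unfolding hform_def using assms[THEN abs_summable_summable]
    by (simp add: infsum_add summable_on_add)
  then show ?thesis by simp
qed

lemma continuous_nearby:
  fixes F :: "real \<Rightarrow> complex" and g :: "real \<Rightarrow> real \<Rightarrow> real"
  assumes "\<And>t. ((\<lambda>r. g r t) \<longlongrightarrow> 0) (at t)"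
    and "\<And>t. \<exists>K. eventually (\<lambda>r. norm (F r - F t) \<le> K * g r t) (at t)"
  shows "continuous_on UNIV F"
proof (intro continuous_at_imp_continuous_on ballI)
  fix t
  obtain K where K: "eventually (\<lambda>r. norm (F r - F t) \<le> K * g r t) (at t)" using assms(2) by blast
  have "((\<lambda>r. K * g r t) \<longlongrightarrow> K * 0) (at t)" by (intro tendsto_intros assms(1))
  then have "((\<lambda>r. K * g r t) \<longlongrightarrow> 0) (at t)" by simp
  from Lim_null_comparison[OF K this] show "isCont F t" by (simp add: isCont_def LIM_zero_iff)
qed

lemma set_integral_uniform_limit:
  fixes f :: "nat \<Rightarrow> real \<Rightarrow> complex"
  assumes u: "uniform_limit {s..t} f g sequentially"
    and c: "\<And>n. continuous_on {s..t} (f n)" "continuous_on {s..t} g"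
  shows "(\<lambda>n. LINT r:{s..t}|lborel. f n r) \<longlonglongrightarrow> (LINT r:{s..t}|lborel. g r)"
proof -
  have i: "(LINT r:{s..t}|lborel. h r) = integral {s..t} h" if "continuous_on {s..t} h" for h :: "real \<Rightarrow> complex"
    by (rule set_borel_integral_eq_integral(2)[OF borel_integrable_atLeastAtMost'[OF that]])
  obtain I J where IJ: "\<And>n. (f n has_integral I n) {s..t}" "(g has_integral J) {s..t}" "I \<longlonglongrightarrow> J"
    using uniform_limit_integral[OF u c(1)] by auto
  then show ?thesis by (simp add: i c integral_unique[OF IJ(1)] integral_unique[OF IJ(2)])
qed

section \<open>Linear pairings and the nonlinearity on the Besov spaces\<close>

context besov_space
begin

text \<open>The coefficients grow at most quadratically and \<open>Lam \<gamma>\<close> costs at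
  most two further powers, so weighting the test function by the fourth power of the frequency
  suffices. The case \<open>\<gamma> = 0\<close> covers the pairing without the operator.\<close>

lemma pairing_Lam_bound:
  assumes \<psi>: "\<psi> \<in> smooth_torus" and \<gamma>: "0 \<le> \<gamma>" "\<gamma> \<le> 2" and s2: "-2 \<le> s"
  shows "\<exists>K\<ge>0. \<forall>f b. 0 \<le> b \<longrightarrow> N f \<le> ennreal b \<longrightarrow>
     (\<lambda>k. norm (Lam \<gamma> f k * fourier \<psi> (- k))) summable_on UNIV \<and>
     norm (pairing (Lam \<gamma> f) (fourier \<psi>)) \<le> K * b"
proof -
  obtain C where C: "C \<ge> 0" "\<And>f k. ennreal (norm (f k)) \<le> ennreal (C * (freqw k)\<^sup>2) * N f"
    using coeff_growth[of p q s] p q s s2 by auto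
  define W where "W = (\<Sum>\<^sub>\<infinity>k. freqw k ^ 4 * norm (fourier \<psi> (- k)))"
  have sW: "(\<lambda>k. freqw k ^ 4 * norm (fourier \<psi> (- k))) summable_on UNIV"
    using fourier_summable[OF \<psi>, of 4]
    by (subst summable_on_reindex_bij_witness[where i = uminus and j = uminus and T = UNIV and g = "\<lambda>k. freqw k ^ 4 * norm (fourier \<psi> (- k))"
          and h = "\<lambda>k. freqw k ^ 4 * norm (fourier \<psi> k)"]) auto
  have W0: "0 \<le> W" unfolding W_def by (intro infsum_nonneg) (use freqw_pos in \<open>auto simp: less_imp_le\<close>)
  have Lw: "norm (Lam \<gamma> f k) \<le> freqw k ^ 2 * norm (f k)" for f k
  proof -
    have "norm (wavevec k) powr \<gamma> \<le> freqw k powr \<gamma>"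
      using \<gamma> norm_le_freqw[of k] by (intro powr_mono2) auto
    also have "\<dots> \<le> freqw k powr 2" using \<gamma> freqw_ge_1[of k] by (intro powr_mono) auto
    also have "\<dots> = freqw k ^ 2" using freqw_pos[of k] by simp
    finally have "norm (wavevec k) powr \<gamma> \<le> freqw k ^ 2" .
    moreover have "1 \<le> freqw k ^ 2" using freqw_ge_1[of k] by (rule one_le_power)
    ultimately have "norm (of_real (if \<gamma> = 0 then 1 else norm (wavevec k) powr \<gamma>) :: complex) \<le> freqw k ^ 2" by simp
    then show ?thesis unfolding Lam_def norm_mult by (rule mult_right_mono) simp
  qed
  have main: "(\<lambda>k. norm (Lam \<gamma> f k * fourier \<psi> (- k))) summable_on UNIV \<and>
      norm (pairing (Lam \<gamma> f) (fourier \<psi>)) \<le> 4 * pi\<^sup>2 * (C * W) * b" if b: "0 \<le> b" "N f \<le> ennreal b" for f b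
  proof -
    have fk: "norm (f k) \<le> C * (freqw k)\<^sup>2 * b" for k
    proof -
      have "ennreal (norm (f k)) \<le> ennreal (C * (freqw k)\<^sup>2) * ennreal b"
        by (rule order_trans[OF C(2)]) (intro mult_left_mono b, simp)
      then show ?thesis using C(1) b by (simp flip: ennreal_mult)
    qed
    have le: "norm (Lam \<gamma> f k * fourier \<psi> (- k)) \<le> C * b * (freqw k ^ 4 * norm (fourier \<psi> (- k)))" for k
    proof -
      have "norm (Lam \<gamma> f k) \<le> freqw k ^ 2 * (C * (freqw k)\<^sup>2 * b)"
        by (rule order_trans[OF Lw]) (intro mult_left_mono fk, simp)
      then have "norm (Lam \<gamma> f k) * norm (fourier \<psi> (- k)) \<le> freqw k ^ 2 * (C * (freqw k)\<^sup>2 * b) * norm (fourier \<psi> (- k))"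
        by (rule mult_right_mono) simp
      then show ?thesis by (simp add: norm_mult power2_eq_square power4_eq_xxxx mult_ac)
    qed
    have s4: "(\<lambda>k. C * b * (freqw k ^ 4 * norm (fourier \<psi> (- k)))) summable_on UNIV"
      by (rule summable_on_cmult_right[OF sW])
    have sm: "(\<lambda>k. norm (Lam \<gamma> f k * fourier \<psi> (- k))) summable_on UNIV"
      by (rule Infinite_Sum.abs_summable_on_comparison_test'[OF s4]) (rule le)
    have "norm (\<Sum>\<^sub>\<infinity>k. Lam \<gamma> f k * fourier \<psi> (- k)) \<le> (\<Sum>\<^sub>\<infinity>k. norm (Lam \<gamma> f k * fourier \<psi> (- k)))"
      by (rule norm_infsum_bound[OF sm])
    also have "\<dots> \<le> (\<Sum>\<^sub>\<infinity>k. C * b * (freqw k ^ 4 * norm (fourier \<psi> (- k))))"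
      by (rule infsum_mono[OF sm s4 le])
    also have "\<dots> = C * b * W" unfolding W_def by (rule infsum_cmult_right')
    finally have "norm (\<Sum>\<^sub>\<infinity>k. Lam \<gamma> f k * fourier \<psi> (- k)) \<le> C * b * W" .
    then have "4 * pi\<^sup>2 * norm (\<Sum>\<^sub>\<infinity>k. Lam \<gamma> f k * fourier \<psi> (- k)) \<le> 4 * pi\<^sup>2 * (C * b * W)"
      by (intro mult_left_mono) auto
    moreover have "norm (pairing (Lam \<gamma> f) (fourier \<psi>)) = 4 * pi\<^sup>2 * norm (\<Sum>\<^sub>\<infinity>k. Lam \<gamma> f k * fourier \<psi> (- k))"
      by (simp add: pairing_def norm_mult norm_power power_mult_distrib)
    ultimately have "norm (pairing (Lam \<gamma> f) (fourier \<psi>)) \<le> 4 * pi\<^sup>2 * (C * W) * b"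
      by (simp only: mult_ac)
    then show ?thesis using sm by blast
  qed
  show ?thesis
    by (intro exI[of _ "4 * pi\<^sup>2 * (C * W)"] conjI allI impI) (use C W0 main in auto)
qed

lemma Lam_diff: "Lam \<gamma> (\<lambda>k. f k - g k) k = Lam \<gamma> f k - Lam \<gamma> g k"
  by (simp add: Lam_def algebra_simps)

lemma pairing_Lam_summable:
  assumes "\<psi> \<in> smooth_torus" "0 \<le> \<gamma>" "\<gamma> \<le> 2" "-2 \<le> s" "f \<in> E"
  shows "(\<lambda>k. Lam \<gamma> f k * fourier \<psi> (- k)) summable_on UNIV"
proof -
  obtain b where "N f = ennreal b" "0 \<le> b" using N_finite[OF assms(5)] by (cases "N f") auto
  then show ?thesis using pairing_Lam_bound[OF assms(1-4)] by (metis abs_summable_summable order_refl)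
qed

lemma pairing_Lam_Lipschitz:
  assumes \<psi>: "\<psi> \<in> smooth_torus" and \<gamma>: "0 \<le> \<gamma>" "\<gamma> \<le> 2" and s2: "-2 \<le> s"
  shows "\<exists>K\<ge>0. \<forall>f\<in>E. \<forall>g\<in>E. norm (pairing (Lam \<gamma> f) (fourier \<psi>) - pairing (Lam \<gamma> g) (fourier \<psi>)) \<le> K * rd f g"
proof -
  obtain K where K: "K \<ge> 0" "\<And>f b. 0 \<le> b \<Longrightarrow> N f \<le> ennreal b \<Longrightarrow>
     (\<lambda>k. norm (Lam \<gamma> f k * fourier \<psi> (- k))) summable_on UNIV \<and>
     norm (pairing (Lam \<gamma> f) (fourier \<psi>)) \<le> K * b"
    using pairing_Lam_bound[OF assms] by blast
  have "norm (pairing (Lam \<gamma> f) (fourier \<psi>) - pairing (Lam \<gamma> g) (fourier \<psi>)) \<le> K * rd f g"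
    if fg: "f \<in> E" "g \<in> E" for f g
  proof -
    let ?d = "\<lambda>k. f k - g k"
    have d: "(\<lambda>k. norm (Lam \<gamma> ?d k * fourier \<psi> (- k))) summable_on UNIV"
      "norm (pairing (Lam \<gamma> ?d) (fourier \<psi>)) \<le> K * rd f g"
      using K(2)[of "rd f g" ?d] fg by (auto simp: N_rd)
    have "(\<lambda>k. Lam \<gamma> f k * fourier \<psi> (- k)) = (\<lambda>k. Lam \<gamma> ?d k * fourier \<psi> (- k) + Lam \<gamma> g k * fourier \<psi> (- k))"
      by (simp add: Lam_diff algebra_simps)
    then have "pairing (Lam \<gamma> f) (fourier \<psi>) = pairing (Lam \<gamma> ?d) (fourier \<psi>) + pairing (Lam \<gamma> g) (fourier \<psi>)"
      unfolding pairing_def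
      using infsum_add[OF abs_summable_summable[OF d(1)] pairing_Lam_summable[OF assms fg(2)]]
      by (simp add: distrib_left)
    then show ?thesis using d(2) by simp
  qed
  then show ?thesis using K(1) by blast
qed

lemma const_path: "f \<in> E \<Longrightarrow> (\<lambda>_. f) \<in> paths"
  by (rule pathsI) auto

lemma paths_bounded:
  assumes "f \<in> paths"
  shows "\<exists>b>0. \<forall>t\<in>{-R..R}. N (f t) \<le> ennreal b"
proof -
  have "compact ((\<lambda>t. rd (f t) (f 0)) ` {-R..R})"
    by (intro compact_continuous_image continuous_on_subset[OF rd_continuous[OF assms const_path]] pathsD assms) auto
  then obtain B where B: "\<And>t. t \<in> {-R..R} \<Longrightarrow> rd (f t) (f 0) \<le> B"
    using compact_imp_bounded bounded_real by (metis abs_le_D1 imageI)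
  obtain c where c: "N (f 0) = ennreal c" "0 \<le> c" using N_finite[OF pathsD[OF assms, of 0]] by (cases "N (f 0)") auto
  have "N (f t) \<le> ennreal (max 0 B + c + 1)" if "t \<in> {-R..R}" for t
  proof -
    have "N (f t) \<le> N (\<lambda>k. f t k - f 0 k) + N (f 0)"
      using besov_norm_triangle[of p q \<rho> s "\<lambda>k. f t k - f 0 k" "f 0"] p q by simp
    also have "\<dots> = ennreal (rd (f t) (f 0) + c)" using assms c by (simp add: N_rd pathsD)
    also have "\<dots> \<le> ennreal (max 0 B + c + 1)" using B[OF that] by (intro ennreal_leI) linarith
    finally show ?thesis .
  qed
  then show ?thesis using c by (intro exI[of _ "max 0 B + c + 1"]) auto
qed

lemma limitin_uniform_Lipschitz:
  assumes l: "limitin T \<sigma> l sequentially" and \<sigma>: "\<And>n :: nat. \<sigma> n \<in> paths"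
    and F: "\<And>f g. f \<in> E \<Longrightarrow> g \<in> E \<Longrightarrow> norm (F f - F g) \<le> K * rd f g"
  shows "uniform_limit {a..b} (\<lambda>n r. F (\<sigma> n r)) (\<lambda>r. F (l r)) sequentially"
  unfolding uniform_limit_iff
proof (intro allI impI)
  fix e :: real assume e: "e > 0"
  have lp: "l \<in> paths" using l by (simp add: limitin_T)
  define R where "R = max \<bar>a\<bar> \<bar>b\<bar>"
  define d where "d = e / (\<bar>K\<bar> + 1)"
  have d: "d > 0" using e by (simp add: d_def add_nonneg_pos)
  have "eventually (\<lambda>n. \<forall>r\<in>{-R..R}. N (\<lambda>k. \<sigma> n r k - l r k) < ennreal d) sequentially"
    using l d by (simp add: limitin_T)
  then show "eventually (\<lambda>n. \<forall>r\<in>{a..b}. dist (F (\<sigma> n r)) (F (l r)) < e) sequentially"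
  proof eventually_elim
    case (elim n)
    show ?case
    proof
      fix r assume "r \<in> {a..b}"
      then have "r \<in> {-R..R}" by (auto simp: R_def)
      then have "rd (\<sigma> n r) (l r) < d" using elim \<sigma> lp by (simp add: N_rd pathsD ennreal_less_iff)
      have "norm (F (\<sigma> n r) - F (l r)) \<le> K * rd (\<sigma> n r) (l r)" using \<sigma> lp by (intro F pathsD)
      also have "\<dots> \<le> \<bar>K\<bar> * rd (\<sigma> n r) (l r)" by (intro mult_right_mono) auto
      also have "\<dots> \<le> \<bar>K\<bar> * d" using \<open>rd (\<sigma> n r) (l r) < d\<close> by (intro mult_left_mono) auto
      also have "\<dots> < (\<bar>K\<bar> + 1) * d" using d by (simp add: distrib_right)
      also have "\<dots> = e" by (simp add: d_def add_nonneg_pos)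
      finally show "dist (F (\<sigma> n r)) (F (l r)) < e" by (simp add: dist_norm)
    qed
  qed
qed

lemma paths_Lipschitz_continuous:
  assumes f: "f \<in> paths" and F: "\<And>f g. f \<in> E \<Longrightarrow> g \<in> E \<Longrightarrow> norm (F f - F g) \<le> K * rd f g"
  shows "continuous_on A (\<lambda>r. F (f r) :: complex)"
proof (rule continuous_on_subset[OF continuous_nearby])
  show "((\<lambda>r. rd (f r) (f t)) \<longlongrightarrow> 0) (at t)" for t by (rule paths_continuous[OF f])
  show "\<exists>K. eventually (\<lambda>r. norm (F (f r) - F (f t)) \<le> K * rd (f r) (f t)) (at t)" for t
    using f by (intro exI[of _ K] always_eventually allI F pathsD)
qed simp

end

text \<open>The difference of the quadratic terms is the bilinear form at \<open>f - h\<close> and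
  \<open>f\<close> plus the form at \<open>h\<close> and \<open>f - h\<close>. Hence the
  nonlinearity is Lipschitz on bounded sets, with constant proportional to their radius
  \<open>b\<close>.\<close>

lemma (in dyadic) nonlin_Lipschitz:
  assumes p: "2 \<le> p" and \<psi>: "\<psi> \<in> smooth_torus" and s: "s = - 1 / 2" and q: "q = 1"
  shows "\<exists>K\<ge>0. \<forall>f h a b. 0 < a \<longrightarrow> 0 < b \<longrightarrow> besov_norm \<rho> s (ennreal p) (ennreal q) f \<le> ennreal b \<longrightarrow>
    besov_norm \<rho> s (ennreal p) (ennreal q) h \<le> ennreal b \<longrightarrow>
    besov_norm \<rho> s (ennreal p) (ennreal q) (\<lambda>k. f k - h k) \<le> ennreal a \<longrightarrow>
    norm (nonlin \<psi> f - nonlin \<psi> h) \<le> K * b * a"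
proof -
  let ?N = "besov_norm \<rho> s (ennreal p) (ennreal q)"
  obtain C where C: "C \<ge> 0" "\<And>f. hnorm2 f \<le> ennreal C * (?N f)\<^sup>2"
    using besov_embed_hminus[OF p] unfolding s q ennreal_1 by blast
  obtain A where A: "A \<ge> 0" "\<And>f k. ennreal (norm (f k)) \<le> ennreal (A * (freqw k)\<^sup>2) * ?N f"
    using coeff_growth[of p q s] p s q by auto
  \<comment> \<open>Increasing the constant by 1 makes it positive and puts \<open>C\<close> below
    its square, so the squared bound becomes the square of \<open>c * b\<close>.\<close>
  define c where "c = C + 1"
  have c: "c > 0" using C by (simp add: c_def)
  have hn: "hnorm2 f \<le> ennreal ((c * b)\<^sup>2)" if "?N f \<le> ennreal b" "0 < b" for f b
  proof -
    have "hnorm2 f \<le> ennreal C * (ennreal b)\<^sup>2"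
      by (rule order_trans[OF C(2)]) (intro mult_left_mono power_mono that, auto)
    also have "\<dots> = ennreal (C * b\<^sup>2)" using C that by (simp add: ennreal_power ennreal_mult)
    also have "\<dots> \<le> ennreal ((c * b)\<^sup>2)"
    proof (rule ennreal_leI)
      have "C * 1 \<le> (C + 1) * (C + 1)" using C by (intro mult_mono) auto
      then have "C \<le> c\<^sup>2" by (simp add: c_def power2_eq_square)
      then show "C * b\<^sup>2 \<le> (c * b)\<^sup>2" unfolding power_mult_distrib by (intro mult_right_mono) auto
    qed
    finally show ?thesis .
  qed
  have gr: "norm (f k) \<le> (A * b) * (freqw k)\<^sup>2" if "?N f \<le> ennreal b" "0 < b" for f b k
  proof -
    have "ennreal (norm (f k)) \<le> ennreal (A * (freqw k)\<^sup>2) * ennreal b"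
      by (rule order_trans[OF A(2)]) (intro mult_left_mono that, simp)
    then show ?thesis using A(1) that by (simp add: mult_ac flip: ennreal_mult)
  qed
  define K where "K = 4 * pi\<^sup>2 * cmass \<psi> * c\<^sup>2"
  have "norm (nonlin \<psi> f - nonlin \<psi> h) \<le> K * b * a"
    if ab: "0 < a" "0 < b" and f: "?N f \<le> ennreal b" and h: "?N h \<le> ennreal b" and d: "?N (\<lambda>k. f k - h k) \<le> ennreal a" for f h a b
  proof -
    let ?d = "\<lambda>k. f k - h k"
    have b0: "0 < c * b" "0 < c * a" using ab c by auto
    have T: "(\<lambda>x. norm (hterm \<psi> u v x)) summable_on UNIV \<and> norm (hform \<psi> u v) \<le> cmass \<psi> * (c * x) * (c * y)"
      if "?N u \<le> ennreal x" "?N v \<le> ennreal y" "0 < x" "0 < y" for u v x y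
    proof -
      have "(\<integral>\<^sup>+z. ennreal (norm (hterm \<psi> u v z)) \<partial>count_space UNIV) \<le> ennreal (cmass \<psi> * (c * x) * (c * y))"
        using that c by (intro hterm_bound \<psi> hn) auto
      moreover have "0 \<le> cmass \<psi> * (c * x) * (c * y)" using that c cmass_nonneg[of \<psi>] by simp
      ultimately show ?thesis unfolding hform_def by (intro conjI count_space_bound)
    qed
    note ff = T[OF f f ab(2) ab(2)] and hh = T[OF h h ab(2) ab(2)] and df = T[OF d f ab] and hd = T[OF h d ab(2) ab(1)]
    have "nonlin \<psi> f - nonlin \<psi> h = 2 * of_real (pi\<^sup>2) * (hform \<psi> f f - hform \<psi> h h)"
      using nonlin_hform[OF \<psi> gr[OF f ab(2)]] nonlin_hform[OF \<psi> gr[OF h ab(2)]] ff hh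
      by (simp add: right_diff_distrib)
    also have "hform \<psi> f f - hform \<psi> h h = hform \<psi> ?d f + hform \<psi> h ?d"
      using df hd hh by (intro hform_diff) auto
    finally have "norm (nonlin \<psi> f - nonlin \<psi> h) = 2 * pi\<^sup>2 * norm (hform \<psi> ?d f + hform \<psi> h ?d)"
      by (simp add: norm_mult norm_power)
    also have "\<dots> \<le> 2 * pi\<^sup>2 * (cmass \<psi> * (c * a) * (c * b) + cmass \<psi> * (c * b) * (c * a))"
      using df hd by (intro mult_left_mono order_trans[OF norm_triangle_ineq] add_mono) auto
    also have "\<dots> = K * b * a" by (simp add: K_def power2_eq_square)
    finally show ?thesis .
  qed
  moreover have "0 \<le> K" using cmass_nonneg[of \<psi>] by (simp add: K_def)
  ultimately show ?thesis by blast
qed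

section \<open>The weak formulation on trajectories\<close>

text \<open>The exponents of the first space are variables fixed by equations, so that both spaces
  instantiate \<open>besov_space\<close> in the same shape and \<open>ennreal q1\<close> turns into
  1 only where it is rewritten on purpose.\<close>

locale trajectories = dyadic +
  fixes s1 s2 p q1 :: real
  assumes p: "2 \<le> p" and s1: "s1 = - 1 / 2" and q1: "q1 = 1" and s2: "-2 \<le> s2" "s2 < 0"
begin

sublocale T1: besov_space \<rho> s1 p q1 by unfold_locales (use p s1 q1 in auto)
sublocale T2: besov_space \<rho> s2 p p by unfold_locales (use p s2 in auto)

lemma nonlin_continuous:
  assumes \<theta>: "\<theta> \<in> T1.paths" and \<psi>: "\<psi> \<in> smooth_torus"
  shows "continuous_on A (\<lambda>r. nonlin \<psi> (\<theta> r))"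
proof (rule continuous_on_subset[OF continuous_at_imp_continuous_on subset_UNIV], rule ballI)
  fix t :: real
  obtain K where K: "K \<ge> 0" "\<And>f h a b. 0 < a \<Longrightarrow> 0 < b \<Longrightarrow> T1.N f \<le> ennreal b \<Longrightarrow> T1.N h \<le> ennreal b \<Longrightarrow>
      T1.N (\<lambda>k. f k - h k) \<le> ennreal a \<Longrightarrow> norm (nonlin \<psi> f - nonlin \<psi> h) \<le> K * b * a"
    using nonlin_Lipschitz[OF p \<psi> s1 q1] by blast
  define R where "R = \<bar>t\<bar> + 1"
  obtain b where b: "b > 0" "\<And>r. r \<in> {-R..R} \<Longrightarrow> T1.N (\<theta> r) \<le> ennreal b"
    using T1.paths_bounded[OF \<theta>, of R] by blast
  show "isCont (\<lambda>r. nonlin \<psi> (\<theta> r)) t"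
    unfolding isCont_def
  proof (rule tendstoI)
    fix e :: real assume e: "e > 0"
    define d where "d = e / (K * b + 1)"
    have Kb: "0 \<le> K * b" using K b by simp
    have d: "d > 0" using e Kb by (simp add: d_def)
    have "eventually (\<lambda>r. T1.rd (\<theta> r) (\<theta> t) < d) (at t)"
      by (rule order_tendstoD(2)[OF T1.paths_continuous[OF \<theta>] d])
    moreover have "eventually (\<lambda>r. r \<in> {t - 1<..<t + 1}) (at t)"
      by (intro eventually_at_in_open') auto
    ultimately show "eventually (\<lambda>r. dist (nonlin \<psi> (\<theta> r)) (nonlin \<psi> (\<theta> t)) < e) (at t)"
    proof eventually_elim
      case (elim r)
      have r: "r \<in> {-R..R}" "t \<in> {-R..R}" using elim by (auto simp: R_def)
      have "T1.N (\<lambda>k. \<theta> r k - \<theta> t k) \<le> ennreal d"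
        using elim \<theta> by (simp add: T1.N_rd T1.pathsD ennreal_leI)
      then have "norm (nonlin \<psi> (\<theta> r) - nonlin \<psi> (\<theta> t)) \<le> K * b * d"
        using b r d by (intro K(2)) auto
      also have "\<dots> < (K * b + 1) * d" using d by (simp add: distrib_right)
      also have "\<dots> = e" using Kb by (simp add: d_def)
      finally show ?case by (simp add: dist_norm)
    qed
  qed
qed

lemma nonlin_uniform_limit:
  assumes l: "limitin T1.T \<sigma> l sequentially" and \<sigma>: "\<And>n :: nat. \<sigma> n \<in> T1.paths" and \<psi>: "\<psi> \<in> smooth_torus"
  shows "uniform_limit {a..b} (\<lambda>n r. nonlin \<psi> (\<sigma> n r)) (\<lambda>r. nonlin \<psi> (l r)) sequentially"
  unfolding uniform_limit_iff
proof (intro allI impI)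
  fix e :: real assume e: "e > 0"
  obtain K where K: "K \<ge> 0" "\<And>f h a b. 0 < a \<Longrightarrow> 0 < b \<Longrightarrow> T1.N f \<le> ennreal b \<Longrightarrow> T1.N h \<le> ennreal b \<Longrightarrow>
      T1.N (\<lambda>k. f k - h k) \<le> ennreal a \<Longrightarrow> norm (nonlin \<psi> f - nonlin \<psi> h) \<le> K * b * a"
    using nonlin_Lipschitz[OF p \<psi> s1 q1] by blast
  have lp: "l \<in> T1.paths" using l by (simp add: T1.limitin_T)
  define R where "R = max \<bar>a\<bar> \<bar>b\<bar>"
  obtain B where B: "B > 0" "\<And>r. r \<in> {-R..R} \<Longrightarrow> T1.N (l r) \<le> ennreal B"
    using T1.paths_bounded[OF lp, of R] by blast
  define d where "d = min 1 (e / (K * (B + 1) + 1))"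
  have KB: "0 \<le> K * (B + 1)" using K B by simp
  have d: "d > 0" "d \<le> 1" "d \<le> e / (K * (B + 1) + 1)" using e KB by (auto simp: d_def)
  have "eventually (\<lambda>n. \<forall>r\<in>{-R..R}. T1.N (\<lambda>k. \<sigma> n r k - l r k) < ennreal d) sequentially"
    using l d by (simp add: T1.limitin_T)
  then show "eventually (\<lambda>n. \<forall>r\<in>{a..b}. dist (nonlin \<psi> (\<sigma> n r)) (nonlin \<psi> (l r)) < e) sequentially"
  proof eventually_elim
    case (elim n)
    show ?case
    proof
      fix r assume "r \<in> {a..b}"
      then have r: "r \<in> {-R..R}" by (auto simp: R_def)
      have D: "T1.N (\<lambda>k. \<sigma> n r k - l r k) \<le> ennreal d" using elim r by (auto intro: less_imp_le)
      have "T1.N (\<sigma> n r) \<le> T1.N (\<lambda>k. \<sigma> n r k - l r k) + T1.N (l r)"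
        using besov_norm_triangle[of p q1 \<rho> s1 "\<lambda>k. \<sigma> n r k - l r k" "l r"] p q1 by simp
      also have "\<dots> \<le> ennreal d + ennreal B" by (intro add_mono D B r)
      also have "\<dots> \<le> ennreal (B + 1)" using d B by (simp flip: ennreal_plus)
      finally have "norm (nonlin \<psi> (\<sigma> n r) - nonlin \<psi> (l r)) \<le> K * (B + 1) * d"
        using B d r D by (intro K(2)) (auto intro: order_trans[OF B(2)] ennreal_leI)
      also have "\<dots> < (K * (B + 1) + 1) * d" using d by (simp add: distrib_right)
      also have "\<dots> \<le> (K * (B + 1) + 1) * (e / (K * (B + 1) + 1))" using d KB by (intro mult_left_mono) auto
      also have "\<dots> = e" using KB by simp
      finally show "dist (nonlin \<psi> (\<sigma> n r)) (nonlin \<psi> (l r)) < e" by (simp add: dist_norm)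
    qed
  qed
qed

definition linpart :: "real \<Rightarrow> real \<Rightarrow> (point \<Rightarrow> real) \<Rightarrow> coeffs \<Rightarrow> coeffs \<Rightarrow> complex" where
  "linpart \<nu> \<gamma> \<psi> f z = pairing z (fourier \<psi>) - of_real \<nu> * pairing (Lam \<gamma> f) (fourier \<psi>)"

lemma Lam_0: "Lam 0 f = f"
  by (simp add: Lam_def fun_eq_iff)

text \<open>Along a trajectory the linear and nonlinear terms are continuous in time, hence
  integrable, and the embedding into H^(-1/2) settles the regularity clause. Only the integral
  identity remains.\<close>

lemma weak_form_iff:
  assumes \<theta>: "\<theta> \<in> T1.paths" and \<zeta>: "\<zeta> \<in> T2.paths" and \<psi>: "\<psi> \<in> smooth_torus" and \<gamma>: "0 \<le> \<gamma>" "\<gamma> \<le> 2"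
  shows "weak_form \<nu> \<gamma> \<theta> \<zeta> s t \<psi> \<longleftrightarrow>
    pairing (\<theta> t) (fourier \<psi>) + (LINT r:{s..t}|lborel. nonlin \<psi> (\<theta> r)) =
    pairing (\<theta> s) (fourier \<psi>) + (LINT r:{s..t}|lborel. linpart \<nu> \<gamma> \<psi> (\<theta> r) (\<zeta> r))"
    and "continuous_on A (\<lambda>r. linpart \<nu> \<gamma> \<psi> (\<theta> r) (\<zeta> r))"
proof -
  obtain K1 where K1: "\<forall>f\<in>T1.E. \<forall>g\<in>T1.E. norm (pairing (Lam \<gamma> f) (fourier \<psi>) - pairing (Lam \<gamma> g) (fourier \<psi>)) \<le> K1 * T1.rd f g"
    using T1.pairing_Lam_Lipschitz[OF \<psi> \<gamma>] s1 by auto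
  obtain K2 where K2: "\<forall>f\<in>T2.E. \<forall>g\<in>T2.E. norm (pairing f (fourier \<psi>) - pairing g (fourier \<psi>)) \<le> K2 * T2.rd f g"
    using T2.pairing_Lam_Lipschitz[OF \<psi> order_refl] s2 unfolding Lam_0 by auto
  show c: "continuous_on A (\<lambda>r. linpart \<nu> \<gamma> \<psi> (\<theta> r) (\<zeta> r))" for A
    unfolding linpart_def
    by (intro continuous_on_diff continuous_on_mult continuous_on_const
        T1.paths_Lipschitz_continuous[OF \<theta>, where F = "\<lambda>f. pairing (Lam \<gamma> f) (fourier \<psi>)" and K = K1]
        T2.paths_Lipschitz_continuous[OF \<zeta>, where F = "\<lambda>f. pairing f (fourier \<psi>)" and K = K2])
       (use K1 K2 in auto)
  have F: "pairing (\<lambda>k. \<zeta> r k - of_real \<nu> * Lam \<gamma> (\<theta> r) k) (fourier \<psi>) = linpart \<nu> \<gamma> \<psi> (\<theta> r) (\<zeta> r)" for r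
  proof -
    have z: "(\<lambda>k. \<zeta> r k * fourier \<psi> (- k)) summable_on UNIV"
      using T2.pairing_Lam_summable[OF \<psi> order_refl _ s2(1) T2.pathsD[OF \<zeta>, of r]] unfolding Lam_0 by simp
    have "(\<lambda>k. Lam \<gamma> (\<theta> r) k * fourier \<psi> (- k)) summable_on UNIV"
      using s1 by (intro T1.pairing_Lam_summable \<psi> \<gamma> T1.pathsD \<theta>) auto
    then have t: "(\<lambda>k. - of_real \<nu> * (Lam \<gamma> (\<theta> r) k * fourier \<psi> (- k))) summable_on UNIV"
      by (rule summable_on_cmult_right)
    have "(\<Sum>\<^sub>\<infinity>k. (\<zeta> r k - of_real \<nu> * Lam \<gamma> (\<theta> r) k) * fourier \<psi> (- k)) =
        (\<Sum>\<^sub>\<infinity>k. \<zeta> r k * fourier \<psi> (- k) + - of_real \<nu> * (Lam \<gamma> (\<theta> r) k * fourier \<psi> (- k)))"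
      by (intro infsum_cong) (simp add: algebra_simps)
    also have "\<dots> = (\<Sum>\<^sub>\<infinity>k. \<zeta> r k * fourier \<psi> (- k)) + - of_real \<nu> * (\<Sum>\<^sub>\<infinity>k. Lam \<gamma> (\<theta> r) k * fourier \<psi> (- k))"
      unfolding infsum_add[OF z t] infsum_cmult_right' ..
    finally have eq: "(\<Sum>\<^sub>\<infinity>k. (\<zeta> r k - of_real \<nu> * Lam \<gamma> (\<theta> r) k) * fourier \<psi> (- k)) =
        (\<Sum>\<^sub>\<infinity>k. \<zeta> r k * fourier \<psi> (- k)) + - of_real \<nu> * (\<Sum>\<^sub>\<infinity>k. Lam \<gamma> (\<theta> r) k * fourier \<psi> (- k))" .
    show ?thesis unfolding pairing_def linpart_def eq
      by (simp only: distrib_left mult_minus_left mult_minus_right diff_conv_add_uminus mult.left_commute)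
  qed
  have H: "\<theta> r \<in> hdot (- 1 / 2)" for r
  proof -
    obtain C where C: "C \<ge> 0" "\<And>f. hnorm2 f \<le> ennreal C * (T1.N f)\<^sup>2"
      using besov_embed_hminus[OF p] unfolding s1 q1 ennreal_1 by blast
    obtain b where b: "T1.N (\<theta> r) = ennreal b" "0 \<le> b" using T1.N_finite[OF T1.pathsD[OF \<theta>, of r]] by (cases "T1.N (\<theta> r)") auto
    have "hnorm2 (\<theta> r) \<le> ennreal (C * b\<^sup>2)" using C(2)[of "\<theta> r"] C(1) b by (simp add: ennreal_power ennreal_mult)
    then have "(\<lambda>k. norm ((norm (\<theta> r k))\<^sup>2 / freqw k)) summable_on UNIV"
      using C(1) freqw_pos by (intro count_space_bound(1)[where B = "C * b\<^sup>2"]) (auto simp: abs_of_pos)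
    then have "(\<lambda>k. norm ((norm (\<theta> r k))\<^sup>2 / freqw k)) summable_on (- {0})" by (rule summable_on_subset_banach) simp
    moreover have "norm ((norm (\<theta> r k))\<^sup>2 / freqw k) = norm (wavevec k) powr (2 * (- 1 / 2)) * (norm (\<theta> r k))\<^sup>2" if "k \<in> - {0}" for k
    proof -
      have "k \<noteq> 0" using that by simp
      then have "1 \<le> \<bar>fst k\<bar> \<or> 1 \<le> \<bar>snd k\<bar>" by (auto simp: prod_eq_iff)
      then have "1 \<le> \<bar>of_int (fst k) :: real\<bar> \<or> 1 \<le> \<bar>of_int (snd k) :: real\<bar>" by linarith
      then have "1 \<le> norm (wavevec k)" using coord_le[of fst k] coord_le[of snd k] by auto
      then have "freqw k = norm (wavevec k)" by (simp add: freqw_def)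
      then show ?thesis using \<open>k \<noteq> 0\<close> by (simp add: powr_minus_divide)
    qed
    ultimately show ?thesis unfolding hdot_def mem_Collect_eq by (rule summable_on_cong[THEN iffD1, rotated])
  qed
  have "set_integrable lborel {s..t} (\<lambda>r. nonlin \<psi> (\<theta> r))"
    by (intro borel_integrable_atLeastAtMost' nonlin_continuous \<theta> \<psi>)
  moreover have "set_integrable lborel {s..t} (\<lambda>r. linpart \<nu> \<gamma> \<psi> (\<theta> r) (\<zeta> r))"
    by (intro borel_integrable_atLeastAtMost' c)
  ultimately show "weak_form \<nu> \<gamma> \<theta> \<zeta> s t \<psi> \<longleftrightarrow>
    pairing (\<theta> t) (fourier \<psi>) + (LINT r:{s..t}|lborel. nonlin \<psi> (\<theta> r)) =
    pairing (\<theta> s) (fourier \<psi>) + (LINT r:{s..t}|lborel. linpart \<nu> \<gamma> \<psi> (\<theta> r) (\<zeta> r))"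
    unfolding weak_form_def Let_def F using H by (simp only: nonlin_def) simp
qed

text \<open>All terms converge uniformly on the time interval: the linear ones because pairings are
  Lipschitz, the nonlinear one because a convergent sequence of paths stays bounded there.\<close>

lemma weak_form_limit:
  assumes \<theta>: "limitin T1.T \<theta>n \<theta> sequentially" and \<zeta>: "limitin T2.T \<zeta>n \<zeta> sequentially"
    and P: "\<And>n :: nat. \<theta>n n \<in> T1.paths" "\<And>n. \<zeta>n n \<in> T2.paths"
    and \<psi>: "\<psi> \<in> smooth_torus" and \<gamma>: "0 \<le> \<gamma>" "\<gamma> \<le> 2"
    and W: "\<And>n. weak_form \<nu> \<gamma> (\<theta>n n) (\<zeta>n n) s t \<psi>"
  shows "weak_form \<nu> \<gamma> \<theta> \<zeta> s t \<psi>"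
proof -
  have lp: "\<theta> \<in> T1.paths" "\<zeta> \<in> T2.paths" using \<theta> \<zeta> by (auto simp: T1.limitin_T T2.limitin_T)
  obtain K0 where K0: "\<forall>f\<in>T1.E. \<forall>g\<in>T1.E. norm (pairing f (fourier \<psi>) - pairing g (fourier \<psi>)) \<le> K0 * T1.rd f g"
    using T1.pairing_Lam_Lipschitz[OF \<psi> order_refl] s1 unfolding Lam_0 by auto
  obtain K1 where K1: "\<forall>f\<in>T1.E. \<forall>g\<in>T1.E. norm (pairing (Lam \<gamma> f) (fourier \<psi>) - pairing (Lam \<gamma> g) (fourier \<psi>)) \<le> K1 * T1.rd f g"
    using T1.pairing_Lam_Lipschitz[OF \<psi> \<gamma>] s1 by auto
  obtain K2 where K2: "\<forall>f\<in>T2.E. \<forall>g\<in>T2.E. norm (pairing f (fourier \<psi>) - pairing g (fourier \<psi>)) \<le> K2 * T2.rd f g"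
    using T2.pairing_Lam_Lipschitz[OF \<psi> order_refl] s2 unfolding Lam_0 by auto
  have u0: "uniform_limit {a..b} (\<lambda>n r. pairing (\<theta>n n r) (fourier \<psi>)) (\<lambda>r. pairing (\<theta> r) (fourier \<psi>)) sequentially" for a b
    using K0 by (intro T1.limitin_uniform_Lipschitz[OF \<theta> P(1), where K = K0]) auto
  have u1: "uniform_limit {a..b} (\<lambda>n r. pairing (Lam \<gamma> (\<theta>n n r)) (fourier \<psi>)) (\<lambda>r. pairing (Lam \<gamma> (\<theta> r)) (fourier \<psi>)) sequentially" for a b
    using K1 by (intro T1.limitin_uniform_Lipschitz[OF \<theta> P(1), where F = "\<lambda>f. pairing (Lam \<gamma> f) (fourier \<psi>)" and K = K1]) auto
  have u2: "uniform_limit {a..b} (\<lambda>n r. pairing (\<zeta>n n r) (fourier \<psi>)) (\<lambda>r. pairing (\<zeta> r) (fourier \<psi>)) sequentially" for a b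
    using K2 by (intro T2.limitin_uniform_Lipschitz[OF \<zeta> P(2), where K = K2]) auto
  have pt: "(\<lambda>n. pairing (\<theta>n n r) (fourier \<psi>)) \<longlonglongrightarrow> pairing (\<theta> r) (fourier \<psi>)" for r
    by (rule tendsto_uniform_limitI[OF u0[of r r]]) simp
  have n: "(\<lambda>n. LINT r:{s..t}|lborel. nonlin \<psi> (\<theta>n n r)) \<longlonglongrightarrow> (LINT r:{s..t}|lborel. nonlin \<psi> (\<theta> r))"
    by (intro set_integral_uniform_limit nonlin_uniform_limit[OF \<theta> P(1) \<psi>] nonlin_continuous P lp \<psi>)
  have "uniform_limit {s..t} (\<lambda>n r. linpart \<nu> \<gamma> \<psi> (\<theta>n n r) (\<zeta>n n r)) (\<lambda>r. linpart \<nu> \<gamma> \<psi> (\<theta> r) (\<zeta> r)) sequentially"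
    unfolding linpart_def
    by (intro uniform_limit_minus u2 bounded_linear.uniform_limit[OF bounded_linear_mult_right] u1)
  then have f: "(\<lambda>n. LINT r:{s..t}|lborel. linpart \<nu> \<gamma> \<psi> (\<theta>n n r) (\<zeta>n n r)) \<longlonglongrightarrow> (LINT r:{s..t}|lborel. linpart \<nu> \<gamma> \<psi> (\<theta> r) (\<zeta> r))"
    by (intro set_integral_uniform_limit weak_form_iff(2) P lp \<psi> \<gamma>)
  have L: "(\<lambda>n. pairing (\<theta>n n t) (fourier \<psi>) + (LINT r:{s..t}|lborel. nonlin \<psi> (\<theta>n n r)))
      \<longlonglongrightarrow> pairing (\<theta> t) (fourier \<psi>) + (LINT r:{s..t}|lborel. nonlin \<psi> (\<theta> r))"
    by (intro tendsto_add pt n)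
  have R: "(\<lambda>n. pairing (\<theta>n n s) (fourier \<psi>) + (LINT r:{s..t}|lborel. linpart \<nu> \<gamma> \<psi> (\<theta>n n r) (\<zeta>n n r)))
      \<longlonglongrightarrow> pairing (\<theta> s) (fourier \<psi>) + (LINT r:{s..t}|lborel. linpart \<nu> \<gamma> \<psi> (\<theta> r) (\<zeta> r))"
    by (intro tendsto_add pt f)
  have "pairing (\<theta>n n t) (fourier \<psi>) + (LINT r:{s..t}|lborel. nonlin \<psi> (\<theta>n n r)) =
      pairing (\<theta>n n s) (fourier \<psi>) + (LINT r:{s..t}|lborel. linpart \<nu> \<gamma> \<psi> (\<theta>n n r) (\<zeta>n n r))" for n
    using W[of n] weak_form_iff(1)[OF P \<psi> \<gamma>] by blast
  then show ?thesis
    using LIMSEQ_unique[OF L] R by (simp add: weak_form_iff(1)[OF lp \<psi> \<gamma>])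
qed

end

section \<open>The trajectory space\<close>

text \<open>A homeomorphism of the line onto the open unit interval, since coded coordinates have to
  lie between 0 and 1.\<close>

definition squash :: "real \<Rightarrow> real" where
  "squash x = 1 / 2 + arctan x / pi"

lemma squash_bounds: "0 < squash x" "squash x < 1"
  using arctan_lbound[of x] arctan_ubound[of x] by (auto simp: squash_def field_simps)

lemma squash_inj: "squash x = squash y \<Longrightarrow> x = y"
  by (simp add: squash_def arctan_eq_iff)

lemma squash_continuous: "continuous_on A squash"
  unfolding squash_def[abs_def] by (intro continuous_intros) auto

definition ev :: "nat \<Rightarrow> trajectory \<times> trajectory \<Rightarrow> real" where
  "ev n w = (case from_nat n :: bool \<times> bool \<times> freq \<times> rat of (c, i, k, x) \<Rightarrow>
     squash ((if i then Re else Im) ((if c then fst w else snd w) (of_rat x) k)))"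

lemma seq_compactin_Times:
  assumes "seq_compactin X A" "seq_compactin Y B"
  shows "seq_compactin (prod_topology X Y) (A \<times> B)"
  unfolding seq_compactin_def
proof (intro conjI allI impI)
  show "A \<times> B \<subseteq> topspace (prod_topology X Y)" using assms by (auto simp: seq_compactin_def)
  fix \<sigma> assume \<sigma>: "\<forall>n :: nat. \<sigma> n \<in> A \<times> B"
  then have "\<forall>n. (fst \<circ> \<sigma>) n \<in> A" by (simp add: mem_Times_iff)
  then obtain a r where a: "a \<in> A" "strict_mono r" "limitin X ((fst \<circ> \<sigma>) \<circ> r) a sequentially"
    using assms(1) unfolding seq_compactin_def by blast
  have "\<forall>n. (snd \<circ> \<sigma> \<circ> r) n \<in> B" using \<sigma> by (simp add: mem_Times_iff)
  then obtain b r' where b: "b \<in> B" "strict_mono r'" "limitin Y ((snd \<circ> \<sigma> \<circ> r) \<circ> r') b sequentially"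
    using assms(2) unfolding seq_compactin_def by blast
  have "limitin X (((fst \<circ> \<sigma>) \<circ> r) \<circ> r') a sequentially" by (rule limitin_subsequence[OF b(2) a(3)])
  then have "limitin (prod_topology X Y) (\<sigma> \<circ> (r \<circ> r')) (a, b) sequentially"
    using b(3) by (simp add: limitin_pairwise o_assoc)
  then show "\<exists>l\<in>A \<times> B. \<exists>r. strict_mono r \<and> limitin (prod_topology X Y) (\<sigma> \<circ> r) l sequentially"
    using a(1,2) b(1,2) strict_mono_o by blast
qed

lemma time_shift_simps [simp]:
  "fst (time_shift t w) = (\<lambda>r. fst w (r + t))" "snd (time_shift t w) = (\<lambda>r. snd w (r + t))"
  by (simp_all add: time_shift_def)

lemma time_shift_add: "time_shift s (time_shift t w) = time_shift (s + t) w"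
  by (simp add: time_shift_def add.assoc)

lemma time_shift_0 [simp]: "time_shift 0 w = w"
  by (simp add: time_shift_def)

lemma set_integral_shift:
  fixes f :: "real \<Rightarrow> complex"
  shows "(LINT r:{s..t}|lborel. f (r + u)) = (LINT r:{s + u..t + u}|lborel. f r)"
proof -
  have "(LINT r:{s + u..t + u}|lborel. f r) = (\<integral>x. indicator {s + u..t + u} (u + 1 * x) *\<^sub>R f (u + 1 * x) \<partial>lborel)"
    unfolding set_lebesgue_integral_def by (subst lborel_integral_real_affine[where c = 1 and t = u]) auto
  also have "\<dots> = (LINT r:{s..t}|lborel. f (r + u))"
    unfolding set_lebesgue_integral_def
    by (intro Bochner_Integration.integral_cong refl) (auto simp: indicator_def add.commute)
  finally show ?thesis ..
qed

lemma weak_form_cong: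
  assumes "s \<le> t" "\<And>r. s \<le> r \<Longrightarrow> r \<le> t \<Longrightarrow> \<theta> r = \<theta>' r \<and> \<zeta> r = \<zeta>' r"
  shows "weak_form \<nu> \<gamma> \<theta> \<zeta> s t \<psi> \<longleftrightarrow> weak_form \<nu> \<gamma> \<theta>' \<zeta>' s t \<psi>"
proof -
  have 1: "set_integrable lborel {s..t} f \<longleftrightarrow> set_integrable lborel {s..t} g"
      "(LINT r:{s..t}|lborel. f r) = (LINT r:{s..t}|lborel. g r)"
    if "\<And>r. s \<le> r \<Longrightarrow> r \<le> t \<Longrightarrow> f r = g r" for f g :: "real \<Rightarrow> complex"
  proof -
    show "set_integrable lborel {s..t} f \<longleftrightarrow> set_integrable lborel {s..t} g"
      by (rule set_integrable_cong) (auto simp: that)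
    show "(LINT r:{s..t}|lborel. f r) = (LINT r:{s..t}|lborel. g r)"
      by (rule set_lebesgue_integral_cong) (auto simp: that)
  qed
  have 2: "(AE r in lborel. r \<in> {s..t} \<longrightarrow> \<theta> r \<in> hdot (- 1 / 2)) \<longleftrightarrow> (AE r in lborel. r \<in> {s..t} \<longrightarrow> \<theta>' r \<in> hdot (- 1 / 2))"
    by (rule eventually_subst, rule always_eventually) (use assms(2) in auto)
  have 3: "\<theta> t = \<theta>' t" "\<theta> s = \<theta>' s" using assms by auto
  let ?N = "\<lambda>\<theta> r. 1 / 2 * pairing (Lam (- 1 / 2) (\<theta> r)) (Lam (1 / 2) (sqg_comm \<psi> (\<theta> r)))"
  let ?F = "\<lambda>\<theta> \<zeta> r. pairing (\<lambda>k. \<zeta> r k - of_real \<nu> * Lam \<gamma> (\<theta> r) k) (fourier \<psi>)"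
  have N: "?N \<theta> r = ?N \<theta>' r" "?F \<theta> \<zeta> r = ?F \<theta>' \<zeta>' r" if "s \<le> r" "r \<le> t" for r
    using assms(2)[OF that] by auto
  have I: "set_integrable lborel {s..t} (?N \<theta>) \<longleftrightarrow> set_integrable lborel {s..t} (?N \<theta>')"
      "set_integrable lborel {s..t} (?F \<theta> \<zeta>) \<longleftrightarrow> set_integrable lborel {s..t} (?F \<theta>' \<zeta>')"
      "(LINT r:{s..t}|lborel. ?N \<theta> r) = (LINT r:{s..t}|lborel. ?N \<theta>' r)"
      "(LINT r:{s..t}|lborel. ?F \<theta> \<zeta> r) = (LINT r:{s..t}|lborel. ?F \<theta>' \<zeta>' r)"
    using N by (intro 1; simp)+
  show ?thesis unfolding weak_form_def Let_def 2 3 I ..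
qed

text \<open>Rounding the time down to multiples of \<open>1 / Suc n\<close> leaves countably many
  measurable sections, and continuity in time gives pointwise convergence of these
  approximations.\<close>

lemma caratheodory_measurable:
  fixes f :: "real \<Rightarrow> 'w \<Rightarrow> real"
  assumes N: "sets N = sets borel" and m: "\<And>t. f t \<in> borel_measurable M"
    and c: "\<And>w. w \<in> space M \<Longrightarrow> continuous_on UNIV (\<lambda>t. f t w)"
  shows "(\<lambda>x. f (fst x) (snd x)) \<in> borel_measurable (N \<Otimes>\<^sub>M M)"
proof -
  let ?g = "\<lambda>n x. f (of_int \<lfloor>fst x * real (Suc n)\<rfloor> / real (Suc n)) (snd x)"
  show ?thesis
  proof (rule borel_measurable_LIMSEQ_metric[where f = ?g])
    fix n
    have fl: "(\<lambda>x :: real \<times> 'w. \<lfloor>fst x * real (Suc n)\<rfloor>) \<in> measurable (N \<Otimes>\<^sub>M M) (count_space UNIV)"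
    proof -
      have "fst \<in> measurable (N \<Otimes>\<^sub>M M) borel" using measurable_fst[of N M] measurable_cong_sets[OF refl N] by blast
      then show ?thesis by measurable
    qed
    show "?g n \<in> borel_measurable (N \<Otimes>\<^sub>M M)"
      by (rule measurable_compose_countable[where f = "\<lambda>i x. f (of_int i / real (Suc n)) (snd x)", OF _ fl])
         (rule measurable_compose[OF measurable_snd m])
  next
    fix x assume "x \<in> space (N \<Otimes>\<^sub>M M)"
    then have w: "snd x \<in> space M" by (auto simp: space_pair_measure)
    have "(\<lambda>n. of_int \<lfloor>fst x * real (Suc n)\<rfloor> / real (Suc n)) \<longlonglongrightarrow> fst x"
    proof (rule real_tendsto_sandwich)
      show "eventually (\<lambda>n. fst x - 1 / real (Suc n) \<le> of_int \<lfloor>fst x * real (Suc n)\<rfloor> / real (Suc n)) sequentially"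
      proof (intro always_eventually allI)
        fix n
        have "fst x * real (Suc n) - 1 \<le> of_int \<lfloor>fst x * real (Suc n)\<rfloor>" by linarith
        then have "(fst x * real (Suc n) - 1) / real (Suc n) \<le> of_int \<lfloor>fst x * real (Suc n)\<rfloor> / real (Suc n)"
          by (rule divide_right_mono) simp
        then show "fst x - 1 / real (Suc n) \<le> of_int \<lfloor>fst x * real (Suc n)\<rfloor> / real (Suc n)"
          by (simp add: diff_divide_distrib del: of_nat_Suc)
      qed
      show "eventually (\<lambda>n. of_int \<lfloor>fst x * real (Suc n)\<rfloor> / real (Suc n) \<le> fst x) sequentially"
        by (intro always_eventually allI) (simp add: pos_divide_le_eq del: of_nat_Suc)
      show "(\<lambda>n. fst x - 1 / real (Suc n)) \<longlonglongrightarrow> fst x"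
        using tendsto_diff[OF tendsto_const LIMSEQ_Suc[OF lim_1_over_n], of "fst x"] by simp
    qed auto
    moreover have "isCont (\<lambda>t. f t (snd x)) (fst x)"
      using c[OF w] by (simp add: continuous_on_eq_continuous_at)
    ultimately show "(\<lambda>n. ?g n x) \<longlonglongrightarrow> f (fst x) (snd x)"
      by (rule isCont_tendsto_compose[rotated])
  qed
qed

context trajectories
begin

declare T1.topspace_T [simp] T2.topspace_T [simp]

abbreviation "XX \<equiv> prod_topology T1.T T2.T"

lemma topspace_XX: "topspace XX = T1.paths \<times> T2.paths"
  by (simp only: topspace_prod_topology T1.topspace_T T2.topspace_T)

lemma coeff_XX: "continuous_map XX euclidean (\<lambda>w. (if c then fst w else snd w) t k)"
proof (cases c)
  case True
  then show ?thesis using continuous_map_compose[OF continuous_map_fst T1.coeff_continuous_map[of t k]] by (simp add: o_def)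
next
  case False
  then show ?thesis using continuous_map_compose[OF continuous_map_snd T2.coeff_continuous_map[of t k]] by (simp add: o_def)
qed

lemma part_XX: "continuous_map XX euclideanreal (\<lambda>w. (if i then Re else Im) ((if c then fst w else snd w) t k))"
proof -
  have "continuous_map euclidean euclideanreal (if i then Re else Im)"
    by (auto intro!: continuous_intros)
  from continuous_map_compose[OF coeff_XX this] show ?thesis by (simp add: o_def)
qed

lemma ev_continuous_map: "continuous_map XX euclideanreal (ev n)"
proof -
  obtain c i k x where n: "(from_nat n :: bool \<times> bool \<times> freq \<times> rat) = (c, i, k, x)" by (metis surj_pair)
  have "continuous_map euclideanreal euclideanreal squash" by (simp add: squash_continuous)
  from continuous_map_compose[OF part_XX[of i c "of_rat x" k] this]
  show ?thesis unfolding ev_def[abs_def] n by (simp add: o_def)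
qed

text \<open>The coefficients of a path are continuous in time, so agreement at rational times
  extends to all times.\<close>

lemma ev_inj:
  assumes "v \<in> topspace XX" "w \<in> topspace XX" "\<And>n. ev n v = ev n w"
  shows "v = w"
proof -
  have *: "(if c then fst v else snd v) (of_rat x) k = (if c then fst w else snd w) (of_rat x) k" for c x k
  proof -
    have "(if i then Re else Im) ((if c then fst v else snd v) (of_rat x) k) = (if i then Re else Im) ((if c then fst w else snd w) (of_rat x) k)" for i
      using assms(3)[of "to_nat (c, i, k, x)"] by (auto simp: ev_def dest: squash_inj)
    from this[of True] this[of False] show ?thesis by (simp add: complex_eq_iff)
  qed
  have cont: "f = g" if c: "\<And>k. continuous_on UNIV (\<lambda>t. f t k)" "\<And>k. continuous_on UNIV (\<lambda>t. g t k)"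
      and eq: "\<And>x k. f (of_rat x) k = g (of_rat x) k" for f g :: trajectory
  proof (intro ext)
    fix t k
    have "closed {t. f t k = g t k}"
      using closed_Collect_eq[OF c] .
    moreover have "\<rat> \<subseteq> {t. f t k = g t k}"
    proof
      fix x :: real assume "x \<in> \<rat>"
      then obtain y where "x = of_rat y" by (auto simp: Rats_def)
      then show "x \<in> {t. f t k = g t k}" using eq[of y k] by simp
    qed
    ultimately have "closure \<rat> \<subseteq> {t. f t k = g t k}" by (rule closure_minimal[rotated])
    then show "f t k = g t k" by (auto simp: Rats_closure_real)
  qed
  have "fst v = fst w"
    using assms(1,2) *[of True] by (intro cont T1.paths_coeff_continuous) (auto simp: topspace_XX)
  moreover have "snd v = snd w"
    using assms(1,2) *[of False] by (intro cont T2.paths_coeff_continuous) (auto simp: topspace_XX)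
  ultimately show ?thesis by (rule prod_eqI)
qed

lemma shift_continuous_XX: "continuous_map XX XX (time_shift t)"
proof -
  have "continuous_map XX T1.T (\<lambda>w r. fst w (r + t))" "continuous_map XX T2.T (\<lambda>w r. snd w (r + t))"
    using continuous_map_compose[OF continuous_map_fst T1.shift_continuous_map]
      continuous_map_compose[OF continuous_map_snd T2.shift_continuous_map] by (auto simp: o_def)
  then show ?thesis unfolding time_shift_def[abs_def] by (rule continuous_map_pairedI)
qed

lemma shift_topspace: "w \<in> topspace XX \<Longrightarrow> time_shift t w \<in> topspace XX"
  using shift_continuous_XX[of t] by (auto simp: continuous_map_def)

lemma weak_form_shift:
  assumes "w \<in> topspace XX" "\<psi> \<in> smooth_torus" "0 \<le> \<gamma>" "\<gamma> \<le> 2"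
  shows "weak_form \<nu> \<gamma> (fst (time_shift u w)) (snd (time_shift u w)) s t \<psi> \<longleftrightarrow> weak_form \<nu> \<gamma> (fst w) (snd w) (s + u) (t + u) \<psi>"
proof -
  have w: "fst w \<in> T1.paths" "snd w \<in> T2.paths" using assms by (auto simp: topspace_XX)
  have v: "fst (time_shift u w) \<in> T1.paths" "snd (time_shift u w) \<in> T2.paths"
    using shift_topspace[OF assms(1), of u] by (auto simp: topspace_XX simp del: time_shift_simps)
  show ?thesis
    unfolding weak_form_iff(1)[OF w assms(2-4)] weak_form_iff(1)[OF v assms(2-4)]
    by (simp add: set_integral_shift[where f = "\<lambda>r. nonlin \<psi> (fst w r)"]
        set_integral_shift[where f = "\<lambda>r. linpart \<nu> \<gamma> \<psi> (fst w r) (snd w r)"])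
qed

lemma path_norm_closed: "closedin T1.T {f \<in> T1.paths. path_norm \<rho> \<delta> f \<le> a}"
proof (rule T1.closedin_T_seq)
  fix \<sigma> l assume \<sigma>: "\<And>n :: nat. \<sigma> n \<in> {f \<in> T1.paths. path_norm \<rho> \<delta> f \<le> a}" and l: "limitin T1.T \<sigma> l sequentially"
  have "path_norm \<rho> \<delta> l \<le> liminf (\<lambda>n. path_norm \<rho> \<delta> (\<sigma> n))"
    by (intro path_norm_lsc T1.limitin_coeff[OF l])
  also have "\<dots> \<le> a" using \<sigma> by (intro liminf_const_le) auto
  finally show "l \<in> {f \<in> T1.paths. path_norm \<rho> \<delta> f \<le> a}" using l by (simp only: T1.limitin_T mem_Collect_eq)
qed auto

lemma path_norm_closed_XX: "closedin XX {w \<in> topspace XX. path_norm \<rho> \<delta> (fst w) \<le> a}"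
  using closedin_continuous_map_preimage[OF continuous_map_fst path_norm_closed[of \<delta> a], of T2.T]
  by (rule back_subst[of "closedin XX"]) (auto simp: topspace_XX)

lemma path_norm_measurable: "(\<lambda>w. path_norm \<rho> \<delta> (fst w)) \<in> borel_measurable (borel_of XX)"
proof (rule borel_measurableI_le)
  fix a
  show "{w \<in> space (borel_of XX). path_norm \<rho> \<delta> (fst w) \<le> a} \<in> sets (borel_of XX)"
    using closedin_borel_of[OF path_norm_closed_XX] by simp
qed

text \<open>The Egorov sets of the forcing: constant in time, with the tail from block
  \<open>J i\<close> on bounded by \<open>b i\<close>.\<close>

definition Zset :: "(nat \<Rightarrow> nat) \<Rightarrow> (nat \<Rightarrow> real) \<Rightarrow> trajectory set" where
  "Zset J b = {f \<in> T2.paths. (\<forall>t. f t = f 0) \<and> (\<forall>i. (\<Sum>j. bpow \<rho> s2 p p (j + J i) (f 0)) \<le> ennreal (b i))}"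

end

section \<open>The exhausting compact sets\<close>

text \<open>Here \<open>m\<close> numbers the compact sets, and \<open>i\<close> numbers the tail
  conditions imposed on the forcing within one of them.\<close>

locale tight_trajectories = trajectories +
  fixes \<delta> :: real and J :: "nat \<Rightarrow> nat \<Rightarrow> nat" and b :: "nat \<Rightarrow> nat \<Rightarrow> real"
  assumes \<delta>: "0 < \<delta>" "\<delta> < 1" and J0: "J m 0 = 0" and b0: "0 \<le> b m i" and b_small: "\<epsilon> > 0 \<Longrightarrow> \<exists>i. b m i < \<epsilon>"
begin

definition K :: "nat \<Rightarrow> (trajectory \<times> trajectory) set" where
  "K m = {f \<in> T1.paths. path_norm \<rho> \<delta> f \<le> ennreal (real m)} \<times> Zset (J m) (b m)"

sublocale coded_space XX ev K
proof
  show "0 \<le> ev i x \<and> ev i x < 1" for i x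
    using squash_bounds by (auto simp: ev_def less_imp_le split: prod.split)
  show "continuous_map XX euclideanreal (ev i)" for i by (rule ev_continuous_map)
  show "x = y" if "x \<in> topspace XX" "y \<in> topspace XX" "\<And>i. ev i x = ev i y" for x y by (rule ev_inj[OF that])
  show "seq_compactin XX (K m)" for m
    unfolding K_def
  proof (rule seq_compactin_Times)
    show "seq_compactin T1.T {f \<in> T1.paths. path_norm \<rho> \<delta> f \<le> ennreal (real m)}"
      using theta_compact[OF p \<delta>, of "real m"] unfolding s1 q1 ennreal_1 by simp
    show "seq_compactin T2.T (Zset (J m) (b m))"
      unfolding Zset_def by (rule zeta_compact[where J = "J m" and b = "b m", OF p s2(2) J0 b0 b_small])
  qed
qed

abbreviation "B \<equiv> borel_of XX"
abbreviation "KK \<equiv> \<Union>m. K m"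

text \<open>The path norm is shift invariant and the forcing is constant. Hence every compact set is
  invariant, and time averages give it the mass it has under the original law.\<close>

lemma shift_K: "w \<in> K m \<Longrightarrow> time_shift t w \<in> K m"
  using T1.shift_paths[of "fst w" t] T2.shift_paths[of "snd w" t]
  by (auto simp: K_def Zset_def mem_Times_iff path_norm_shift)
     (metis (no_types))+

lemma shift_K_iff: "time_shift t w \<in> K m \<longleftrightarrow> w \<in> K m"
  using shift_K[of w m t] shift_K[of "time_shift t w" m "- t"] by (auto simp: time_shift_add)

lemma K_const: "w \<in> KK \<Longrightarrow> snd w t = snd w 0"
  by (auto simp: K_def Zset_def mem_Times_iff)

lemma K_sets: "K m \<in> sets B" by (rule seq_compactin_sets[OF K_comp])

lemma KK_sets: "KK \<in> sets B" using K_sets by auto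

lemma KK_topspace: "KK \<subseteq> topspace XX" using K_topspace by auto

definition Wset :: "real \<Rightarrow> real \<Rightarrow> real \<Rightarrow> (trajectory \<times> trajectory) set" where
  "Wset \<nu> \<gamma> R = {w \<in> KK. \<forall>s t. - R \<le> s \<longrightarrow> s \<le> t \<longrightarrow> (\<forall>\<psi>\<in>smooth_torus. weak_form \<nu> \<gamma> (fst w) (snd w) s t \<psi>)}"

lemma Wset_comp:
  assumes \<gamma>: "0 \<le> \<gamma>" "\<gamma> \<le> 2"
  shows "seq_compactin XX (Wset \<nu> \<gamma> R \<inter> K m)"
  unfolding seq_compactin_def
proof (intro conjI allI impI)
  show "Wset \<nu> \<gamma> R \<inter> K m \<subseteq> topspace XX" using K_topspace by auto
  fix \<sigma> assume \<sigma>: "\<forall>n :: nat. \<sigma> n \<in> Wset \<nu> \<gamma> R \<inter> K m"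
  then obtain l r where l: "l \<in> K m" "strict_mono r" "limitin XX (\<sigma> \<circ> r) l sequentially"
    using K_comp[of m] unfolding seq_compactin_def by blast
  have lim: "limitin T1.T (\<lambda>n. fst (\<sigma> (r n))) (fst l) sequentially" "limitin T2.T (\<lambda>n. snd (\<sigma> (r n))) (snd l) sequentially"
    using l(3) by (simp_all add: limitin_pairwise o_def)
  have P: "fst (\<sigma> (r n)) \<in> T1.paths" "snd (\<sigma> (r n)) \<in> T2.paths" for n
  proof -
    have "\<sigma> (r n) \<in> topspace XX" using \<sigma> K_topspace[of m] by blast
    then show "fst (\<sigma> (r n)) \<in> T1.paths" "snd (\<sigma> (r n)) \<in> T2.paths" by (simp_all add: mem_Times_iff)
  qed
  have "weak_form \<nu> \<gamma> (fst l) (snd l) s t \<psi>" if "- R \<le> s" "s \<le> t" "\<psi> \<in> smooth_torus" for s t \<psi>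
    by (rule weak_form_limit[OF lim P that(3) \<gamma>]) (use \<sigma> that in \<open>auto simp: Wset_def\<close>)
  then have "l \<in> Wset \<nu> \<gamma> R \<inter> K m" using l(1) by (auto simp: Wset_def)
  then show "\<exists>l\<in>Wset \<nu> \<gamma> R \<inter> K m. \<exists>r. strict_mono r \<and> limitin XX (\<sigma> \<circ> r) l sequentially"
    using l by blast
qed

text \<open>The condition ranges over uncountably many times and test functions, so measurability
  does not come from intersecting countably many sets; it comes from compactness of the trace on
  every \<open>K m\<close>.\<close>

lemma Wset_sets: "0 \<le> \<gamma> \<Longrightarrow> \<gamma> \<le> 2 \<Longrightarrow> Wset \<nu> \<gamma> R \<in> sets B"
  by (rule sigma_compact_sets[OF _ Wset_comp]) (auto simp: Wset_def)

lemma path_norm_comp: "seq_compactin XX ({w \<in> KK. path_norm \<rho> \<delta>' (fst w) \<le> a} \<inter> K m)"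
proof -
  have "{w \<in> KK. path_norm \<rho> \<delta>' (fst w) \<le> a} \<inter> K m = K m \<inter> {w \<in> topspace XX. path_norm \<rho> \<delta>' (fst w) \<le> a}"
    using K_topspace by auto
  then show ?thesis using seq_compactin_closedin[OF K_comp path_norm_closed_XX] by simp
qed

end

section \<open>Averaging over a time window\<close>

definition unif :: "real \<Rightarrow> real measure" where
  "unif \<tau> = density lborel (\<lambda>t. ennreal (indicator {0..\<tau>} t / \<tau>))"

lemma sets_unif [simp, measurable_cong]: "sets (unif \<tau>) = sets borel" and space_unif [simp]: "space (unif \<tau>) = UNIV"
  by (simp_all add: unif_def)

lemma nn_integral_unif:
  assumes "0 < \<tau>" "f \<in> borel_measurable borel"
  shows "(\<integral>\<^sup>+t. f t \<partial>unif \<tau>) = (\<integral>\<^sup>+t\<in>{0..\<tau>}. f t \<partial>lborel) / ennreal \<tau>"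
proof -
  have "(\<integral>\<^sup>+t. f t \<partial>unif \<tau>) = (\<integral>\<^sup>+t. ennreal (indicator {0..\<tau>} t / \<tau>) * f t \<partial>lborel)"
    unfolding unif_def using assms(2) by (intro nn_integral_density) auto
  also have "\<dots> = (\<integral>\<^sup>+t. (f t * indicator {0..\<tau>} t) / ennreal \<tau> \<partial>lborel)"
    using assms(1) by (intro nn_integral_cong) (auto simp: indicator_def divide_ennreal_def inverse_ennreal mult.commute divide_inverse)
  also have "\<dots> = (\<integral>\<^sup>+t\<in>{0..\<tau>}. f t \<partial>lborel) / ennreal \<tau>"
    using assms by (intro nn_integral_divide) auto
  finally show ?thesis .
qed

lemma prob_space_unif:
  assumes "0 < \<tau>"
  shows "prob_space (unif \<tau>)"
proof
  have "emeasure (unif \<tau>) (space (unif \<tau>)) = (\<integral>\<^sup>+t. 1 \<partial>unif \<tau>)" by simp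
  also have "\<dots> = (\<integral>\<^sup>+t\<in>{0..\<tau>}. 1 \<partial>lborel) / ennreal \<tau>" by (rule nn_integral_unif[OF assms]) simp
  also have "\<dots> = 1" using assms by (simp add: divide_ennreal)
  finally show "emeasure (unif \<tau>) (space (unif \<tau>)) = 1" .
qed

lemma integral_unif:
  fixes f :: "real \<Rightarrow> real"
  assumes "0 < \<tau>" "f \<in> borel_measurable borel"
  shows "(\<integral>t. f t \<partial>unif \<tau>) = (\<integral>t. indicator {0..\<tau>} t * f t \<partial>lborel) / \<tau>"
proof -
  have "(\<integral>t. f t \<partial>unif \<tau>) = (\<integral>t. (indicator {0..\<tau>} t / \<tau>) *\<^sub>R f t \<partial>lborel)"
    unfolding unif_def using assms by (intro integral_density) auto
  then show ?thesis by simp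
qed

text \<open>The windows \<open>{0..\<tau>}\<close> and \<open>{s..\<tau> + s}\<close> differ only
  near their ends, in two intervals of length at most the absolute value of
  \<open>s\<close>.\<close>

lemma unif_shift_diff:
  fixes \<phi> :: "real \<Rightarrow> real"
  assumes \<tau>: "0 < \<tau>" and m [measurable]: "\<phi> \<in> borel_measurable borel" and H: "\<And>t. \<bar>\<phi> t\<bar> \<le> H"
  shows "\<bar>(\<integral>t. \<phi> (t + s) \<partial>unif \<tau>) - (\<integral>t. \<phi> t \<partial>unif \<tau>)\<bar> \<le> 2 * \<bar>s\<bar> * H / \<tau>"
proof -
  have H0: "0 \<le> H" using H[of 0] by linarith
  have shift: "(\<integral>t. indicator {0..\<tau>} t * \<phi> (t + s) \<partial>lborel) = (\<integral>t. indicator {s..\<tau> + s} t * \<phi> t \<partial>lborel)"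
  proof -
    have "(\<integral>t. indicator {s..\<tau> + s} t * \<phi> t \<partial>lborel) = (\<integral>t. indicator {s..\<tau> + s} (s + 1 * t) * \<phi> (s + 1 * t) \<partial>lborel)"
      by (subst lborel_integral_real_affine[where c = 1 and t = s]) auto
    also have "\<dots> = (\<integral>t. indicator {0..\<tau>} t * \<phi> (t + s) \<partial>lborel)"
      by (intro Bochner_Integration.integral_cong refl) (auto simp: indicator_def add.commute)
    finally show ?thesis ..
  qed
  have int: "integrable lborel (\<lambda>t. indicator {a..c} t * \<phi> t)" for a c
  proof (rule Bochner_Integration.integrable_bound[where f = "\<lambda>t. H * indicator {a..c} t"])
    show "integrable lborel (\<lambda>t. H * indicator {a..c} t)" by (intro integrable_mult_right integrable_real_indicator) (auto simp: emeasure_lborel_Icc_eq)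
    show "AE t in lborel. norm (indicator {a..c} t * \<phi> t) \<le> norm (H * indicator {a..c} t)"
      using H H0 by (intro AE_I2) (auto simp: indicator_def)
  qed measurable
  have iint: "integrable lborel (indicator {a..c} :: real \<Rightarrow> real)" for a c by (intro integrable_real_indicator) (auto simp: emeasure_lborel_Icc_eq)
  \<comment> \<open>With these ends one formula handles both signs of \<open>s\<close>: the interval
    between 0 and \<open>s\<close> and its translate by \<tau> contain the symmetric difference of
    the windows.\<close>
  let ?a = "min 0 s" and ?b = "max 0 s"
  have "(\<integral>t. \<phi> (t + s) \<partial>unif \<tau>) - (\<integral>t. \<phi> t \<partial>unif \<tau>) =
      ((\<integral>t. indicator {s..\<tau> + s} t * \<phi> t \<partial>lborel) - (\<integral>t. indicator {0..\<tau>} t * \<phi> t \<partial>lborel)) / \<tau>"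
    by (simp add: integral_unif[OF \<tau>] shift diff_divide_distrib)
  also have "\<dots> = (\<integral>t. indicator {s..\<tau> + s} t * \<phi> t - indicator {0..\<tau>} t * \<phi> t \<partial>lborel) / \<tau>"
    using int by (subst Bochner_Integration.integral_diff) auto
  finally have 1: "\<bar>(\<integral>t. \<phi> (t + s) \<partial>unif \<tau>) - (\<integral>t. \<phi> t \<partial>unif \<tau>)\<bar> =
      \<bar>\<integral>t. indicator {s..\<tau> + s} t * \<phi> t - indicator {0..\<tau>} t * \<phi> t \<partial>lborel\<bar> / \<tau>" using \<tau> by simp
  have "\<bar>\<integral>t. indicator {s..\<tau> + s} t * \<phi> t - indicator {0..\<tau>} t * \<phi> t \<partial>lborel\<bar> \<le>
      (\<integral>t. H * (indicator {?a..?b} t + indicator {?a + \<tau>..?b + \<tau>} t) \<partial>lborel)"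
  proof (rule order_trans[OF integral_abs_bound integral_mono])
    show "integrable lborel (\<lambda>t. \<bar>indicator {s..\<tau> + s} t * \<phi> t - indicator {0..\<tau>} t * \<phi> t\<bar>)"
      by (intro integrable_abs Bochner_Integration.integrable_diff int)
    show "integrable lborel (\<lambda>t. H * (indicator {?a..?b} t + indicator {?a + \<tau>..?b + \<tau>} t))"
      by (intro integrable_mult_right Bochner_Integration.integrable_add iint)
    show "\<bar>indicator {s..\<tau> + s} t * \<phi> t - indicator {0..\<tau>} t * \<phi> t\<bar> \<le> H * (indicator {?a..?b} t + indicator {?a + \<tau>..?b + \<tau>} t)" for t
      using H[of t] H0 by (auto simp: indicator_def)
  qed
  also have "\<dots> = H * (2 * \<bar>s\<bar>)"
    using iint by (simp add: Bochner_Integration.integral_add) (simp add: max_def min_def abs_if)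
  finally show ?thesis using \<tau> unfolding 1 by (simp add: divide_right_mono mult_ac)
qed

text \<open>A value \<open>y\<close>, possibly infinite, is the length of the set of nonnegative
  \<open>t\<close> below it; Tonelli's theorem exchanges the two integrals. This turns a comparison
  of tail probabilities into one of integrals.\<close>

lemma nn_integral_layer_cake:
  assumes "sigma_finite_measure M" and [measurable]: "g \<in> borel_measurable M"
  shows "(\<integral>\<^sup>+x. g x \<partial>M) = (\<integral>\<^sup>+t. emeasure M {x \<in> space M. ennreal t < g x} * indicator {0..} t \<partial>lborel)"
proof -
  interpret sigma_finite_measure M by fact
  interpret P: pair_sigma_finite M lborel ..
  have y: "(\<integral>\<^sup>+t. indicator {t. 0 \<le> t \<and> ennreal t < y} t \<partial>lborel) = y" for y :: ennreal
  proof (cases y)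
    case (real r)
    then have "{t. 0 \<le> t \<and> ennreal t < y} = {0..<r}" by (auto simp: ennreal_less_iff)
    then show ?thesis using real by simp
  next
    case top
    then have e: "{t. 0 \<le> t \<and> ennreal t < y} = {0..}" by auto
    have "emeasure lborel {0 :: real..} \<ge> ennreal (real n)" for n
    proof -
      have "ennreal (real n) = emeasure lborel {0..real n}" by simp
      also have "\<dots> \<le> emeasure lborel {0 :: real..}" by (rule emeasure_mono) auto
      finally show ?thesis .
    qed
    then have "emeasure lborel {0 :: real..} = top"
      by (metis ennreal_of_nat_eq_real_of_nat ennreal_Ex_less_of_nat less_top linorder_not_less)
    then show ?thesis unfolding e using top by simp
  qed
  have "(\<integral>\<^sup>+x. g x \<partial>M) = (\<integral>\<^sup>+x. \<integral>\<^sup>+t. indicator {t. 0 \<le> t \<and> ennreal t < g x} t \<partial>lborel \<partial>M)"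
    by (simp only: y)
  also have "\<dots> = (\<integral>\<^sup>+x. \<integral>\<^sup>+t. of_bool (0 \<le> t \<and> ennreal t < g x) \<partial>lborel \<partial>M)"
    by (intro nn_integral_cong) (simp add: indicator_def of_bool_def)
  also have "\<dots> = (\<integral>\<^sup>+t. \<integral>\<^sup>+x. of_bool (0 \<le> t \<and> ennreal t < g x) \<partial>M \<partial>lborel)"
    by (rule P.Fubini'[symmetric]) measurable
  also have "\<dots> = (\<integral>\<^sup>+t. emeasure M {x \<in> space M. ennreal t < g x} * indicator {0..} t \<partial>lborel)"
  proof (intro nn_integral_cong)
    fix t :: real
    have "(\<integral>\<^sup>+x. of_bool (0 \<le> t \<and> ennreal t < g x) \<partial>M) = (\<integral>\<^sup>+x. indicator {x \<in> space M. ennreal t < g x} x * indicator {0..} t \<partial>M)"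
      by (intro nn_integral_cong) (auto simp: indicator_def)
    also have "\<dots> = emeasure M {x \<in> space M. ennreal t < g x} * indicator {0..} t"
      by (subst nn_integral_multc) auto
    finally show "(\<integral>\<^sup>+x. of_bool (0 \<le> t \<and> ennreal t < g x) \<partial>M) = emeasure M {x \<in> space M. ennreal t < g x} * indicator {0..} t" .
  qed
  finally show ?thesis .
qed

section \<open>Time averages and their limits\<close>

text \<open>The process takes values in \<open>KK\<close> at every point of the sample space, not
  only almost surely; this lets measurability of the shifted process be checked on the countably
  many coordinates.\<close>

locale averaged = tight_trajectories \<rho> s1 s2 p q1 \<delta> J b + M: prob_space M
  for \<rho> s1 s2 p q1 \<delta> J b and M :: "'w measure" +
  fixes X :: "'w \<Rightarrow> trajectory \<times> trajectory"
  assumes X: "X \<in> measurable M B" and X_KK: "\<omega> \<in> space M \<Longrightarrow> X \<omega> \<in> KK"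
    and tight: "\<epsilon> > 0 \<Longrightarrow> \<exists>m. 1 - \<epsilon> \<le> M.prob {\<omega> \<in> space M. X \<omega> \<in> K m}"
begin

text \<open>The law of the trajectory seen from an independent, uniformly distributed time. In this
  form the average is evidently a probability measure, and Fubini's theorem applies.\<close>

definition avg :: "real \<Rightarrow> (trajectory \<times> trajectory) measure" where
  "avg \<tau> = distr (unif \<tau> \<Otimes>\<^sub>M M) B (\<lambda>x. time_shift (fst x) (X (snd x)))"

lemma sets_avg [simp]: "sets (avg \<tau>) = sets B" and space_avg [simp]: "space (avg \<tau>) = topspace XX"
  by (simp_all add: avg_def)

lemma X_topspace: "\<omega> \<in> space M \<Longrightarrow> X \<omega> \<in> topspace XX"
  using X_KK KK_topspace by blast

lemma shift_X_KK: "\<omega> \<in> space M \<Longrightarrow> time_shift t (X \<omega>) \<in> KK"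
  using X_KK[of \<omega>] by (auto simp: shift_K_iff)

lemma shift_measurable [measurable]: "time_shift t \<in> measurable B B"
  by (rule continuous_map_measurable[OF shift_continuous_XX])

lemma ev_shift_continuous:
  assumes "w \<in> topspace XX"
  shows "continuous_on UNIV (\<lambda>t. ev n (time_shift t w))"
proof -
  obtain c i k x where n: "(from_nat n :: bool \<times> bool \<times> freq \<times> rat) = (c, i, k, x)" by (metis surj_pair)
  have "fst w \<in> T1.paths" "snd w \<in> T2.paths" using assms by (simp_all add: mem_Times_iff)
  then have "continuous_on UNIV (\<lambda>t. (if c then fst w else snd w) t k)"
    using T1.paths_coeff_continuous[of "fst w" k] T2.paths_coeff_continuous[of "snd w" k] by (cases c) simp_all
  then have "continuous_on UNIV (\<lambda>t. (if c then fst w else snd w) (of_rat x + t) k)"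
    by (rule continuous_on_compose2) (auto intro!: continuous_intros)
  then have "continuous_on UNIV (\<lambda>t. (if i then Re else Im) ((if c then fst w else snd w) (of_rat x + t) k))"
    by (cases i) (auto intro!: continuous_intros)
  then have "continuous_on UNIV (\<lambda>t. squash ((if i then Re else Im) ((if c then fst w else snd w) (of_rat x + t) k)))"
    by (rule continuous_on_compose2[OF squash_continuous[of UNIV]]) auto
  then show ?thesis unfolding ev_def n by (cases c) simp_all
qed

text \<open>Each coordinate of the shifted trajectory is continuous in the shift and measurable in
  the sample point, hence jointly measurable; since the values stay in \<open>KK\<close>, the
  coordinates determine measurability.\<close>

lemma joint_measurable [measurable]: "(\<lambda>x. time_shift (fst x) (X (snd x))) \<in> measurable (unif \<tau> \<Otimes>\<^sub>M M) B"
proof (rule measurable_into_K)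
  show "time_shift (fst x) (X (snd x)) \<in> KK" if "x \<in> space (unif \<tau> \<Otimes>\<^sub>M M)" for x
    using that by (intro shift_X_KK) (auto simp: space_pair_measure)
  show "(\<lambda>x. ev n (time_shift (fst x) (X (snd x)))) \<in> borel_measurable (unif \<tau> \<Otimes>\<^sub>M M)" for n
  proof (rule caratheodory_measurable[where f = "\<lambda>t \<omega>. ev n (time_shift t (X \<omega>))"])
    show "(\<lambda>\<omega>. ev n (time_shift t (X \<omega>))) \<in> borel_measurable M" for t
      using continuous_map_borel_measurable[OF ev_continuous_map] X shift_measurable by measurable
    show "continuous_on UNIV (\<lambda>t. ev n (time_shift t (X \<omega>)))" if "\<omega> \<in> space M" for \<omega>
      by (rule ev_shift_continuous[OF X_topspace[OF that]])
  qed simp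
qed

lemma prob_space_avg:
  assumes "0 < \<tau>"
  shows "prob_space (avg \<tau>)"
proof -
  interpret U: prob_space "unif \<tau>" by (rule prob_space_unif[OF assms])
  interpret pair_prob_space "unif \<tau>" M ..
  show ?thesis unfolding avg_def by (rule prob_space_distr[OF joint_measurable])
qed

lemma nn_integral_avg:
  assumes "0 < \<tau>" and [measurable]: "f \<in> borel_measurable B"
  shows "(\<integral>\<^sup>+w. f w \<partial>avg \<tau>) = (\<integral>\<^sup>+t. \<integral>\<^sup>+\<omega>. f (time_shift t (X \<omega>)) \<partial>M \<partial>unif \<tau>)"
proof -
  have "(\<integral>\<^sup>+w. f w \<partial>avg \<tau>) = (\<integral>\<^sup>+x. f (time_shift (fst x) (X (snd x))) \<partial>(unif \<tau> \<Otimes>\<^sub>M M))"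
    unfolding avg_def by (rule nn_integral_distr[OF joint_measurable]) simp
  also have "\<dots> = (\<integral>\<^sup>+t. \<integral>\<^sup>+\<omega>. f (time_shift t (X \<omega>)) \<partial>M \<partial>unif \<tau>)"
    by (subst M.nn_integral_fst[symmetric]) simp_all
  finally show ?thesis .
qed

lemma emeasure_avg:
  assumes "0 < \<tau>" and [measurable]: "A \<in> sets B"
  shows "emeasure (avg \<tau>) A = (\<integral>\<^sup>+t. emeasure M {\<omega> \<in> space M. time_shift t (X \<omega>) \<in> A} \<partial>unif \<tau>)"
proof -
  have "emeasure (avg \<tau>) A = (\<integral>\<^sup>+w. indicator A w \<partial>avg \<tau>)" by simp
  also have "\<dots> = (\<integral>\<^sup>+t. \<integral>\<^sup>+\<omega>. indicator A (time_shift t (X \<omega>)) \<partial>M \<partial>unif \<tau>)"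
    by (rule nn_integral_avg[OF assms(1)]) simp
  also have "\<dots> = (\<integral>\<^sup>+t. emeasure M {\<omega> \<in> space M. time_shift t (X \<omega>) \<in> A} \<partial>unif \<tau>)"
  proof (rule nn_integral_cong)
    fix t
    have [measurable]: "(\<lambda>\<omega>. time_shift t (X \<omega>)) \<in> measurable M B" using X by measurable
    have "(\<integral>\<^sup>+\<omega>. indicator A (time_shift t (X \<omega>)) \<partial>M) = (\<integral>\<^sup>+\<omega>. indicator {\<omega> \<in> space M. time_shift t (X \<omega>) \<in> A} \<omega> \<partial>M)"
      by (intro nn_integral_cong) (auto simp: indicator_def)
    then show "(\<integral>\<^sup>+\<omega>. indicator A (time_shift t (X \<omega>)) \<partial>M) = emeasure M {\<omega> \<in> space M. time_shift t (X \<omega>) \<in> A}"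
      by simp
  qed
  finally show ?thesis .
qed

lemma measure_avg_invariant:
  assumes \<tau>: "0 < \<tau>" and A: "A \<in> sets B" and inv: "\<And>t w. w \<in> KK \<Longrightarrow> time_shift t w \<in> A \<longleftrightarrow> w \<in> A"
  shows "measure (avg \<tau>) A = M.prob {\<omega> \<in> space M. X \<omega> \<in> A}"
proof -
  interpret U: prob_space "unif \<tau>" by (rule prob_space_unif[OF \<tau>])
  have "{\<omega> \<in> space M. time_shift t (X \<omega>) \<in> A} = {\<omega> \<in> space M. X \<omega> \<in> A}" for t
    using inv[OF X_KK] by blast
  then have "emeasure (avg \<tau>) A = emeasure M {\<omega> \<in> space M. X \<omega> \<in> A}"
    unfolding emeasure_avg[OF \<tau> A] using U.emeasure_space_1 by simp
  then show ?thesis by (simp add: measure_def)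
qed

lemma integral_avg:
  fixes h :: "trajectory \<times> trajectory \<Rightarrow> real"
  assumes \<tau>: "0 < \<tau>" and h [measurable]: "h \<in> borel_measurable B" and H: "\<And>w. w \<in> topspace XX \<Longrightarrow> \<bar>h w\<bar> \<le> H"
  shows "(\<integral>w. h w \<partial>avg \<tau>) = (\<integral>t. (\<integral>\<omega>. h (time_shift t (X \<omega>)) \<partial>M) \<partial>unif \<tau>)"
proof -
  interpret U: prob_space "unif \<tau>" by (rule prob_space_unif[OF \<tau>])
  interpret P: pair_prob_space "unif \<tau>" M ..
  have "(\<integral>w. h w \<partial>avg \<tau>) = (\<integral>x. h (time_shift (fst x) (X (snd x))) \<partial>(unif \<tau> \<Otimes>\<^sub>M M))"
    unfolding avg_def by (rule integral_distr[OF joint_measurable h])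
  also have "\<dots> = (\<integral>t. (\<integral>\<omega>. h (time_shift t (X \<omega>)) \<partial>M) \<partial>unif \<tau>)"
  proof -
    have "integrable (unif \<tau> \<Otimes>\<^sub>M M) (\<lambda>x. h (time_shift (fst x) (X (snd x))))"
    proof (rule P.integrable_const_bound[of _ H])
      show "AE x in unif \<tau> \<Otimes>\<^sub>M M. norm (h (time_shift (fst x) (X (snd x)))) \<le> H"
        using H[OF shift_topspace[OF X_topspace]] by (intro AE_I2) (auto simp: space_pair_measure)
    qed measurable
    from P.integral_fst'[OF this] show ?thesis by simp
  qed
  finally show ?thesis .
qed

text \<open>\<open>measure_of\<close> keeps the prescribed values only if they form a measure, which
  is secured by recognising them as those of \<open>avg \<tau>\<close>. \<open>Y\<close> is the
  given trajectory and \<open>X\<close> its version changed on a null set.\<close>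

lemma time_average_eq:
  assumes \<tau>: "0 < \<tau>" and Y: "Y \<in> measurable M B" "AE \<omega> in M. Y \<omega> = X \<omega>"
  shows "time_average B \<tau> (\<lambda>t. distr M B (\<lambda>\<omega>. time_shift t (Y \<omega>))) = avg \<tau>"
proof -
  have "(\<integral>\<^sup>+t\<in>{0..\<tau>}. emeasure (distr M B (\<lambda>\<omega>. time_shift t (Y \<omega>))) A \<partial>lborel) / ennreal \<tau> = emeasure (avg \<tau>) A"
    if A: "A \<in> sets B" for A
  proof -
    have "distr M B (\<lambda>\<omega>. time_shift t (Y \<omega>)) = distr M B (\<lambda>\<omega>. time_shift t (X \<omega>))" for t
      using X Y by (intro distr_cong_AE) auto
    then have eq: "emeasure (distr M B (\<lambda>\<omega>. time_shift t (Y \<omega>))) A = emeasure M {\<omega> \<in> space M. time_shift t (X \<omega>) \<in> A}" for t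
      using A measurable_compose[OF X shift_measurable]
      by (simp add: emeasure_distr vimage_def Int_def conj_commute)
    have m: "(\<lambda>t. emeasure M {\<omega> \<in> space M. time_shift t (X \<omega>) \<in> A}) \<in> borel_measurable borel"
    proof -
      have [measurable]: "A \<in> sets B" by fact
      have "(\<lambda>x. indicator A (time_shift (fst x) (X (snd x))) :: ennreal) \<in> borel_measurable (unif \<tau> \<Otimes>\<^sub>M M)" by measurable
      from M.borel_measurable_nn_integral_fst[OF this]
      have "(\<lambda>t. \<integral>\<^sup>+\<omega>. indicator A (time_shift t (X \<omega>)) \<partial>M) \<in> borel_measurable borel" by simp
      moreover have "(\<integral>\<^sup>+\<omega>. indicator A (time_shift t (X \<omega>)) \<partial>M) = emeasure M {\<omega> \<in> space M. time_shift t (X \<omega>) \<in> A}" for t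
      proof -
        have [measurable]: "(\<lambda>\<omega>. time_shift t (X \<omega>)) \<in> measurable M B" using X by measurable
        have "(\<integral>\<^sup>+\<omega>. indicator A (time_shift t (X \<omega>)) \<partial>M) = (\<integral>\<^sup>+\<omega>. indicator {\<omega> \<in> space M. time_shift t (X \<omega>) \<in> A} \<omega> \<partial>M)"
          by (intro nn_integral_cong) (auto simp: indicator_def)
        then show ?thesis by simp
      qed
      ultimately show ?thesis by simp
    qed
    show ?thesis unfolding eq emeasure_avg[OF \<tau> A] nn_integral_unif[OF \<tau> m] ..
  qed
  then have "time_average B \<tau> (\<lambda>t. distr M B (\<lambda>\<omega>. time_shift t (Y \<omega>))) = measure_of (space B) (sets B) (emeasure (avg \<tau>))"
    unfolding time_average_def by (intro measure_of_eq sets.space_closed) (simp only: sets.sigma_sets_eq)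
  also have "\<dots> = avg \<tau>" using measure_of_of_measure[of "avg \<tau>"] by simp
  finally show ?thesis .
qed

lemma avg_tight:
  assumes "\<epsilon> > 0"
  shows "\<exists>m. \<forall>n. 1 - \<epsilon> \<le> measure (avg (real n + 1)) (K m)"
proof -
  obtain m where m: "1 - \<epsilon> \<le> M.prob {\<omega> \<in> space M. X \<omega> \<in> K m}" using tight[OF assms] by blast
  have "measure (avg (real n + 1)) (K m) = M.prob {\<omega> \<in> space M. X \<omega> \<in> K m}" for n
    by (rule measure_avg_invariant[OF _ K_sets]) (auto simp: shift_K_iff)
  then show ?thesis using m by (intro exI[of _ m]) simp
qed

end

section \<open>Properties inherited by the limit law\<close>

locale averaged_limit = averaged \<rho> s1 s2 p q1 \<delta> J b M X
  for \<rho> s1 s2 p q1 \<delta> J b and M :: "'w measure" and X +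
  fixes r :: "nat \<Rightarrow> nat" and \<mu> :: "(trajectory \<times> trajectory) measure"
  assumes r: "strict_mono r" and P\<mu>: "prob_space \<mu>" and sets_\<mu>: "sets \<mu> = sets B"
    and conv: "weakly_converges XX (\<lambda>n. avg (real (r n) + 1)) \<mu>"
    and closed: "Y \<subseteq> KK \<Longrightarrow> (\<And>m. seq_compactin XX (Y \<inter> K m)) \<Longrightarrow> \<epsilon> > 0 \<Longrightarrow>
       eventually (\<lambda>n. measure (avg (real (r n) + 1)) Y \<le> measure \<mu> Y + \<epsilon>) sequentially"
begin

sublocale \<mu>: prob_space \<mu> by (rule P\<mu>)

lemma space_\<mu>: "space \<mu> = topspace XX"
  using sets_eq_imp_space_eq[OF sets_\<mu>] by simp

lemma measurable_\<mu>: "measurable \<mu> N = measurable B N"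
  by (rule measurable_cong_sets[OF sets_\<mu> refl])

lemma filterlim_T: "filterlim (\<lambda>n. real (r n) + 1) at_top sequentially"
  by (rule filterlim_at_top_mono[OF filterlim_compose[OF filterlim_real_sequentially filterlim_subseq[OF r]] always_eventually]) simp

lemma limit_measure_ge:
  assumes Y: "Y \<subseteq> KK" "\<And>m. seq_compactin XX (Y \<inter> K m)"
    and lim: "(\<lambda>n. c n) \<longlonglongrightarrow> c'" "eventually (\<lambda>n. c n \<le> measure (avg (real (r n) + 1)) Y) sequentially"
  shows "c' \<le> measure \<mu> Y"
proof (rule field_le_epsilon)
  fix \<epsilon> :: real assume "\<epsilon> > 0"
  from closed[OF Y this] lim(2) have "eventually (\<lambda>n. c n \<le> measure \<mu> Y + \<epsilon>) sequentially" by eventually_elim simp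
  from tendsto_upperbound[OF lim(1) this] show "c' \<le> measure \<mu> Y + \<epsilon>" by simp
qed

text \<open>The portmanteau bound cannot lose mass in the limit, so masses tending to 1 along the
  averages force full mass.\<close>

lemma limit_AE:
  assumes Y: "Y \<subseteq> KK" "\<And>m. seq_compactin XX (Y \<inter> K m)"
    and lim: "(\<lambda>n. c n) \<longlonglongrightarrow> 1" "eventually (\<lambda>n. c n \<le> measure (avg (real (r n) + 1)) Y) sequentially"
  shows "AE w in \<mu>. w \<in> Y"
proof -
  have "Y \<in> sets \<mu>" unfolding sets_\<mu> by (rule sigma_compact_sets[OF Y])
  moreover have "\<mu>.prob Y = 1" using limit_measure_ge[OF Y lim] \<mu>.prob_le_1[of Y] by linarith
  ultimately show ?thesis by (simp add: \<mu>.AE_in_set_eq_1)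
qed

lemma KK_comp: "seq_compactin XX (KK \<inter> K m)"
proof -
  have "KK \<inter> K m = K m" by blast
  then show ?thesis using K_comp by simp
qed

lemma AE_KK: "AE w in \<mu>. w \<in> KK"
proof (rule limit_AE[OF order_refl KK_comp tendsto_const always_eventually], intro allI)
  fix n
  have "measure (avg (real (r n) + 1)) KK = M.prob {\<omega> \<in> space M. X \<omega> \<in> KK}"
    by (rule measure_avg_invariant[OF _ KK_sets]) (auto simp: shift_K_iff)
  also have "{\<omega> \<in> space M. X \<omega> \<in> KK} = space M" using X_KK by blast
  finally show "1 \<le> measure (avg (real (r n) + 1)) KK" by (simp add: M.prob_space)
qed

lemma AE_weak_form:
  assumes \<gamma>: "0 \<le> \<gamma>" "\<gamma> \<le> 2"
    and W: "AE \<omega> in M. \<forall>s t. 0 \<le> s \<and> s \<le> t \<longrightarrow> (\<forall>\<psi>\<in>smooth_torus. weak_form \<nu> \<gamma> (fst (X \<omega>)) (snd (X \<omega>)) s t \<psi>)"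
  shows "AE w in \<mu>. \<forall>s t. s \<le> t \<longrightarrow> (\<forall>\<psi>\<in>smooth_torus. weak_form \<nu> \<gamma> (fst w) (snd w) s t \<psi>)"
proof -
  have "AE w in \<mu>. w \<in> Wset \<nu> \<gamma> (real R)" for R :: nat
  proof (rule limit_AE[OF _ Wset_comp[OF \<gamma>]])
    show "Wset \<nu> \<gamma> (real R) \<subseteq> KK" by (auto simp: Wset_def)
    have "(\<lambda>n. real R / (real (r n) + 1)) \<longlonglongrightarrow> 0"
      by (rule real_tendsto_divide_at_top[OF tendsto_const filterlim_T])
    from tendsto_diff[OF tendsto_const[of 1] this] show "(\<lambda>n. 1 - real R / (real (r n) + 1)) \<longlonglongrightarrow> 1" by simp
    have "eventually (\<lambda>n. real R \<le> real (r n) + 1) sequentially"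
      using filterlim_T by (simp add: filterlim_at_top)
    then show "eventually (\<lambda>n. 1 - real R / (real (r n) + 1) \<le> measure (avg (real (r n) + 1)) (Wset \<nu> \<gamma> (real R))) sequentially"
    proof eventually_elim
      case (elim n)
      let ?T = "real (r n) + 1"
      have T: "0 < ?T" by simp
      interpret A: prob_space "avg ?T" by (rule prob_space_avg[OF T])
      \<comment> \<open>Once the shift \<open>t\<close> exceeds \<open>R\<close>, times after
        \<open>- real R\<close> become nonnegative times of the original trajectory, where the
        equation holds.\<close>
      have "indicator {real R..} t \<le> emeasure M {\<omega> \<in> space M. time_shift t (X \<omega>) \<in> Wset \<nu> \<gamma> (real R)}" for t
      proof (cases "real R \<le> t")
        case True
        have "AE \<omega> in M. time_shift t (X \<omega>) \<in> Wset \<nu> \<gamma> (real R)"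
          using W AE_space
        proof eventually_elim
          case (elim \<omega>)
          have "weak_form \<nu> \<gamma> (fst (time_shift t (X \<omega>))) (snd (time_shift t (X \<omega>))) s u \<psi>"
            if "- real R \<le> s" "s \<le> u" "\<psi> \<in> smooth_torus" for s u \<psi>
            unfolding weak_form_shift[OF X_topspace[OF elim(2)] that(3) \<gamma>] using elim(1) that True by simp
          then show ?case using shift_X_KK[OF elim(2)] unfolding Wset_def by blast
        qed
        then have "emeasure M {\<omega> \<in> space M. time_shift t (X \<omega>) \<in> Wset \<nu> \<gamma> (real R)} = 1"
          using measurable_compose[OF X shift_measurable, of t] Wset_sets[OF \<gamma>]
          by (intro M.emeasure_eq_1_AE) (auto intro: measurable_sets_Collect)
        then show ?thesis using True by simp
      qed simp
      then have "(\<integral>\<^sup>+t. indicator {real R..} t \<partial>unif ?T) \<le> emeasure (avg ?T) (Wset \<nu> \<gamma> (real R))"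
        unfolding emeasure_avg[OF T Wset_sets[OF \<gamma>]] by (intro nn_integral_mono)
      moreover have "(\<integral>\<^sup>+t. indicator {real R..} t \<partial>unif ?T) = ennreal (1 - real R / ?T)"
      proof -
        have "(\<integral>\<^sup>+t. indicator {real R..} t \<partial>unif ?T) = (\<integral>\<^sup>+t. indicator {real R..} t * indicator {0..?T} t \<partial>lborel) / ennreal ?T"
          by (rule nn_integral_unif[OF T]) simp
        also have "(\<integral>\<^sup>+t. indicator {real R..} t * indicator {0..?T} t \<partial>lborel) = (\<integral>\<^sup>+t. indicator {real R..?T} t \<partial>lborel)"
          by (intro nn_integral_cong) (auto simp: indicator_def)
        also have "\<dots> = ennreal (?T - real R)" using elim by simp
        also have "\<dots> / ennreal ?T = ennreal (1 - real R / ?T)"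
          using elim by (subst divide_ennreal) (auto simp: field_simps)
        finally show ?thesis .
      qed
      ultimately show ?case by (simp add: A.emeasure_eq_measure)
    qed
  qed
  then have "AE w in \<mu>. \<forall>R :: nat. w \<in> Wset \<nu> \<gamma> (real R)" by (simp add: AE_all_countable)
  then show ?thesis
  proof eventually_elim
    case (elim w)
    show ?case
    proof (intro allI impI ballI)
      fix s t :: real and \<psi> assume "s \<le> t" "\<psi> \<in> smooth_torus"
      moreover obtain R :: nat where "- s \<le> real R" using real_arch_simple by blast
      then have "- real R \<le> s" by simp
      ultimately show "weak_form \<nu> \<gamma> (fst w) (snd w) s t \<psi>"
        using elim[rule_format, of R] unfolding Wset_def by blast
    qed
  qed
qed

text \<open>For an invariant test function all averages have the same integral, so the limit has it
  too. Invariance is asked only on \<open>KK\<close>, which is all that functions of the forcing at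
  a fixed time satisfy.\<close>

lemma integral_limit_invariant:
  assumes h: "continuous_map XX euclideanreal h" and H: "\<And>w. w \<in> topspace XX \<Longrightarrow> \<bar>h w\<bar> \<le> H"
    and inv: "\<And>t w. w \<in> KK \<Longrightarrow> h (time_shift t w) = h w"
  shows "(\<integral>w. h w \<partial>\<mu>) = (\<integral>\<omega>. h (X \<omega>) \<partial>M)"
proof -
  have hm: "h \<in> borel_measurable B" by (rule continuous_map_borel_measurable[OF h])
  have "(\<integral>w. h w \<partial>avg (real (r n) + 1)) = (\<integral>\<omega>. h (X \<omega>) \<partial>M)" for n
  proof -
    interpret U: prob_space "unif (real (r n) + 1)" by (rule prob_space_unif) simp
    have "(\<integral>\<omega>. h (time_shift t (X \<omega>)) \<partial>M) = (\<integral>\<omega>. h (X \<omega>) \<partial>M)" for t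
      using inv[OF X_KK] by (intro Bochner_Integration.integral_cong) auto
    then show ?thesis using integral_avg[OF _ hm H, of "real (r n) + 1"] U.prob_space by simp
  qed
  moreover have "bounded (h ` topspace XX)" unfolding bounded_iff using H by (intro exI[of _ H]) auto
  ultimately have "(\<lambda>n :: nat. \<integral>\<omega>. h (X \<omega>) \<partial>M) \<longlonglongrightarrow> (\<integral>w. h w \<partial>\<mu>)"
    using conv h unfolding weakly_converges_def by auto
  from LIMSEQ_unique[OF this tendsto_const] show ?thesis .
qed

text \<open>On \<open>KK\<close> the forcing is constant in time, so continuous functions of its
  coefficients are shift invariant and keep their expectations exactly; these determine the
  law.\<close>

lemma coeff_law_limit: "coeff_law \<mu> (\<lambda>w. snd w 0) = coeff_law M (\<lambda>\<omega>. snd (X \<omega>) 0)"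
proof -
  \<comment> \<open>The conditional on \<open>False\<close> selects the forcing and gives the term
    the shape of \<open>part_XX\<close>; the Boolean index distinguishes real and imaginary
    parts.\<close>
  define e :: "freq \<times> bool \<Rightarrow> trajectory \<times> trajectory \<Rightarrow> real" where
    "e x w = (if snd x then Re else Im) ((if False then fst w else snd w) 0 (fst x))" for x w
  let ?S = "Pi\<^sub>M UNIV (\<lambda>_. borel) :: (freq \<times> bool \<Rightarrow> real) measure"
  let ?G = "\<lambda>y k. Complex (y (k, True)) (y (k, False)) :: complex"
  have ec: "continuous_map XX euclideanreal (e x)" for x unfolding e_def[abs_def] by (rule part_XX)
  have em: "e x \<in> borel_measurable B" for x by (rule continuous_map_borel_measurable[OF ec])
  have G: "?G \<in> measurable ?S (Pi\<^sub>M UNIV (\<lambda>_. borel))"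
    by (intro measurable_PiM_single') (auto simp: Complex_eq)
  have Ge: "?G (\<lambda>x. e x w) = snd w 0" for w by (auto simp: e_def)
  have law: "coeff_law R (\<lambda>x. snd (Y x) 0) = distr (distr R ?S (\<lambda>x i. e i (Y x))) (Pi\<^sub>M UNIV (\<lambda>_. borel)) ?G"
    if "\<And>i. (\<lambda>x. e i (Y x)) \<in> borel_measurable R" for R :: "'z measure" and Y
  proof -
    have "(\<lambda>x i. e i (Y x)) \<in> measurable R ?S" using that by (auto intro!: measurable_PiM_single')
    from distr_distr[OF G this] show ?thesis by (simp add: coeff_law_def o_def Ge del: distr_distr)
  qed
  have m\<mu>: "(\<lambda>w. e i w) \<in> borel_measurable \<mu>" for i unfolding measurable_\<mu> by (rule em)
  have mX: "(\<lambda>\<omega>. e i (X \<omega>)) \<in> borel_measurable M" for i by (rule measurable_compose[OF X em])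
  have "distr \<mu> ?S (\<lambda>w i. e i w) = distr M ?S (\<lambda>\<omega> i. e i (X \<omega>))"
  proof (rule law_eqI[OF P\<mu> M.prob_space_axioms m\<mu> mX])
    fix J' :: "(freq \<times> bool) set" and a k assume "finite J'"
    show "(\<integral>w. (\<Prod>i\<in>J'. ramp k (a i) (e i w)) \<partial>\<mu>) = (\<integral>\<omega>. (\<Prod>i\<in>J'. ramp k (a i) (e i (X \<omega>))) \<partial>M)"
    proof (rule integral_limit_invariant[where H = 1])
      show "continuous_map XX euclideanreal (\<lambda>w. \<Prod>i\<in>J'. ramp k (a i) (e i w))"
        unfolding ramp_def using \<open>finite J'\<close>
        by (intro continuous_map_prod continuous_map_real_min continuous_map_real_max
            continuous_map_real_mult_left continuous_map_diff ec) auto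
      show "\<bar>\<Prod>i\<in>J'. ramp k (a i) (e i w)\<bar> \<le> 1" for w by (rule ramp_prod_abs)
      show "(\<Prod>i\<in>J'. ramp k (a i) (e i (time_shift t w))) = (\<Prod>i\<in>J'. ramp k (a i) (e i w))" if "w \<in> KK" for t w
        using K_const[OF that, of t] by (simp add: e_def)
    qed
  qed
  then show ?thesis using law[of "\<lambda>w. w", OF m\<mu>] law[of X, OF mX] by simp
qed

text \<open>Shifting by \<open>s\<close> changes the average of a function bounded by
  \<open>H\<close> by at most \<open>2 * \<bar>s\<bar> * H\<close> divided by the averaging time.
  Equality for all bounded continuous functions identifies the measures, since both live on
  \<open>KK\<close>.\<close>

lemma stationary: "distr \<mu> B (time_shift s) = \<mu>"
proof -
  have sm: "time_shift s \<in> measurable \<mu> B" unfolding measurable_\<mu> by (rule shift_measurable)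
  show ?thesis
  proof (rule prob_eqI)
    show "prob_space (distr \<mu> B (time_shift s))" by (rule \<mu>.prob_space_distr[OF sm])
    show "AE w in distr \<mu> B (time_shift s). w \<in> KK"
    proof (subst AE_distr_iff[OF sm])
      have "{w \<in> space B. w \<in> KK} = KK" using KK_topspace by auto
      then show "{w \<in> space B. w \<in> KK} \<in> sets B" using KK_sets by simp
      show "AE w in \<mu>. time_shift s w \<in> KK" using AE_KK by (simp add: shift_K_iff)
    qed
    fix h assume h: "continuous_map XX euclideanreal h" "bounded (h ` topspace XX)"
    obtain H where H: "H > 0" "\<And>w. w \<in> topspace XX \<Longrightarrow> \<bar>h w\<bar> \<le> H"
      using h(2) unfolding bounded_pos by auto
    have hm [measurable]: "h \<in> borel_measurable B" by (rule continuous_map_borel_measurable[OF h(1)])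
    let ?\<phi> = "\<lambda>t. \<integral>\<omega>. h (time_shift t (X \<omega>)) \<partial>M"
    have hs: "continuous_map XX euclideanreal (\<lambda>w. h (time_shift s w))"
      using continuous_map_compose[OF shift_continuous_XX h(1)] by (simp add: o_def)
    have Hs: "\<bar>h (time_shift s w)\<bar> \<le> H" if "w \<in> topspace XX" for w
      by (rule H(2)[OF shift_topspace[OF that]])
    have \<phi>m: "?\<phi> \<in> borel_measurable borel"
    proof -
      have "(\<lambda>x. h (time_shift (fst x) (X (snd x)))) \<in> borel_measurable (unif 1 \<Otimes>\<^sub>M M)" by measurable
      then have "(\<lambda>(t, \<omega>). h (time_shift t (X \<omega>))) \<in> borel_measurable (unif 1 \<Otimes>\<^sub>M M)" by (simp add: case_prod_beta')
      from M.borel_measurable_lebesgue_integral[OF this] show ?thesis by simp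
    qed
    have \<phi>H: "\<bar>?\<phi> t\<bar> \<le> H" for t
    proof -
      have "\<bar>?\<phi> t\<bar> \<le> (\<integral>\<omega>. \<bar>h (time_shift t (X \<omega>))\<bar> \<partial>M)" by (rule integral_abs_bound)
      also have "\<dots> \<le> (\<integral>\<omega>. H \<partial>M)"
      proof (rule integral_mono)
        have "(\<lambda>\<omega>. h (time_shift t (X \<omega>))) \<in> borel_measurable M" using X by measurable
        then show "integrable M (\<lambda>\<omega>. \<bar>h (time_shift t (X \<omega>))\<bar>)"
          using H shift_topspace[OF X_topspace] by (intro integrable_abs M.integrable_const_bound[of _ H]) auto
      qed (use H shift_topspace[OF X_topspace] in auto)
      finally show ?thesis by (simp add: M.prob_space)
    qed
    have "(\<lambda>n. (\<integral>w. h (time_shift s w) \<partial>avg (real (r n) + 1)) - (\<integral>w. h w \<partial>avg (real (r n) + 1))) \<longlonglongrightarrow>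
        (\<integral>w. h (time_shift s w) \<partial>\<mu>) - (\<integral>w. h w \<partial>\<mu>)"
    proof (rule tendsto_diff)
      have "bounded ((\<lambda>w. h (time_shift s w)) ` topspace XX)"
        unfolding bounded_iff using Hs by (intro exI[of _ H]) auto
      then show "(\<lambda>n. \<integral>w. h (time_shift s w) \<partial>avg (real (r n) + 1)) \<longlonglongrightarrow> (\<integral>w. h (time_shift s w) \<partial>\<mu>)"
        using conv hs unfolding weakly_converges_def by blast
      show "(\<lambda>n. \<integral>w. h w \<partial>avg (real (r n) + 1)) \<longlonglongrightarrow> (\<integral>w. h w \<partial>\<mu>)"
        using conv h unfolding weakly_converges_def by blast
    qed
    moreover have "(\<lambda>n. (\<integral>w. h (time_shift s w) \<partial>avg (real (r n) + 1)) - (\<integral>w. h w \<partial>avg (real (r n) + 1))) \<longlonglongrightarrow> 0"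
    proof (rule Lim_null_comparison[OF always_eventually], intro allI)
      fix n
      have T: "0 < real (r n) + 1" by simp
      have "(\<integral>w. h (time_shift s w) \<partial>avg (real (r n) + 1)) = (\<integral>t. ?\<phi> (t + s) \<partial>unif (real (r n) + 1))"
        by (subst integral_avg[OF T continuous_map_borel_measurable[OF hs] Hs]) (simp_all add: time_shift_add add.commute)
      moreover have "(\<integral>w. h w \<partial>avg (real (r n) + 1)) = (\<integral>t. ?\<phi> t \<partial>unif (real (r n) + 1))"
        by (rule integral_avg[OF T hm H(2)])
      ultimately show "norm ((\<integral>w. h (time_shift s w) \<partial>avg (real (r n) + 1)) - (\<integral>w. h w \<partial>avg (real (r n) + 1)))
          \<le> 2 * \<bar>s\<bar> * H / (real (r n) + 1)"
        using unif_shift_diff[OF T \<phi>m \<phi>H, of s] by simp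
    next
      show "(\<lambda>n. 2 * \<bar>s\<bar> * H / (real (r n) + 1)) \<longlonglongrightarrow> 0"
        by (rule real_tendsto_divide_at_top[OF tendsto_const filterlim_T])
    qed
    ultimately have "(\<integral>w. h (time_shift s w) \<partial>\<mu>) - (\<integral>w. h w \<partial>\<mu>) = 0" by (rule LIMSEQ_unique)
    then show "(\<integral>w. h w \<partial>distr \<mu> B (time_shift s)) = (\<integral>w. h w \<partial>\<mu>)"
      by (subst integral_distr[OF sm hm]) simp
  qed (use P\<mu> sets_\<mu> AE_KK in auto)
qed

text \<open>Only lower semicontinuity of the path norm is at hand, so integrals are not passed to
  the limit directly. Sublevel sets are shift invariant and compact within each \<open>K m\<close>;
  the portmanteau bound compares tail probabilities, and the layer cake formula integrates
  them.\<close>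

lemma path_norm_limit:
  "(\<integral>\<^sup>+w. path_norm \<rho> \<delta>' (fst w) \<partial>\<mu>) \<le> (\<integral>\<^sup>+\<omega>. path_norm \<rho> \<delta>' (fst (X \<omega>)) \<partial>M)"
proof -
  let ?g = "\<lambda>w. path_norm \<rho> \<delta>' (fst w)"
  have g: "?g \<in> borel_measurable B" by (rule path_norm_measurable)
  have g\<mu>: "?g \<in> borel_measurable \<mu>" unfolding measurable_\<mu> by (rule g)
  have gX: "(\<lambda>\<omega>. ?g (X \<omega>)) \<in> borel_measurable M" by (rule measurable_compose[OF X g])
  have "emeasure \<mu> {w \<in> space \<mu>. a < ?g w} \<le> emeasure M {\<omega> \<in> space M. a < ?g (X \<omega>)}" for a
  proof -
    let ?Y = "{w \<in> KK. ?g w \<le> a}"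
    have Ys: "?Y \<in> sets B" by (rule sigma_compact_sets[OF _ path_norm_comp]) auto
    have Z: "{w \<in> space \<mu>. a < ?g w} \<in> sets \<mu>" "{\<omega> \<in> space M. a < ?g (X \<omega>)} \<in> sets M"
      using g\<mu> gX by measurable
    have "M.prob {\<omega> \<in> space M. X \<omega> \<in> ?Y} \<le> \<mu>.prob ?Y"
    proof (rule limit_measure_ge[OF _ path_norm_comp tendsto_const])
      have "measure (avg (real (r n) + 1)) ?Y = M.prob {\<omega> \<in> space M. X \<omega> \<in> ?Y}" for n
        by (rule measure_avg_invariant[OF _ Ys]) (auto simp: shift_K_iff path_norm_shift)
      then show "eventually (\<lambda>n. M.prob {\<omega> \<in> space M. X \<omega> \<in> ?Y} \<le> measure (avg (real (r n) + 1)) ?Y) sequentially"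
        by simp
    qed auto
    moreover have "{\<omega> \<in> space M. X \<omega> \<in> ?Y} = space M - {\<omega> \<in> space M. a < ?g (X \<omega>)}"
      using X_KK by (auto simp: not_less)
    moreover have "\<mu>.prob ?Y \<le> \<mu>.prob (space \<mu> - {w \<in> space \<mu>. a < ?g w})"
    proof (rule \<mu>.finite_measure_mono[OF _ sets.compl_sets[OF Z(1)]])
      show "?Y \<subseteq> space \<mu> - {w \<in> space \<mu>. a < ?g w}"
        using KK_topspace unfolding space_\<mu> by (auto simp: not_less)
    qed
    ultimately have "\<mu>.prob {w \<in> space \<mu>. a < ?g w} \<le> M.prob {\<omega> \<in> space M. a < ?g (X \<omega>)}"
      using Z by (simp add: \<mu>.prob_compl M.prob_compl)
    then show ?thesis by (simp add: \<mu>.emeasure_eq_measure M.emeasure_eq_measure)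
  qed
  then show ?thesis
    unfolding nn_integral_layer_cake[OF \<mu>.sigma_finite_measure_axioms g\<mu>] nn_integral_layer_cake[OF M.sigma_finite_measure_axioms gX]
    by (intro nn_integral_mono mult_right_mono) auto
qed

end

section \<open>Tightness\<close>

lemma (in prob_space) prob_decseq_small:
  assumes A: "\<And>n. A n \<in> events" "decseq A" and null: "AE \<omega> in M. \<omega> \<notin> (\<Inter>n. A n)" and \<eta>: "0 < \<eta>"
  shows "\<exists>n. \<forall>k\<ge>n. prob (A k) \<le> \<eta>"
proof -
  have "(\<lambda>n. prob (A n)) \<longlonglongrightarrow> prob (\<Inter>n. A n)"
    using A by (intro finite_Lim_measure_decseq) auto
  moreover have "prob (\<Inter>n. A n) = 0"
    using A null by (subst prob_eq_0) auto
  ultimately have "eventually (\<lambda>n. prob (A n) < \<eta>) sequentially"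
    using \<eta> by (intro order_tendstoD(2)) auto
  then show ?thesis unfolding eventually_sequentially by (meson less_imp_le)
qed

lemma ennreal_tail_decreasing: "(\<Sum>j. f (j + Suc n)) \<le> (\<Sum>j. f (j + n) :: ennreal)"
proof -
  have "(\<Sum>j. f (j + n)) = (\<Sum>j. f (j + Suc n)) + (\<Sum>j<1. f (j + n))"
    using suminf_offset[of "\<lambda>j. f (j + n)" 1] by (simp add: add.commute)
  then show ?thesis by simp
qed

lemma ennreal_tail_tendsto:
  fixes f :: "nat \<Rightarrow> ennreal"
  assumes "(\<Sum>j. f j) < \<infinity>"
  shows "(\<lambda>n. \<Sum>j. f (j + n)) \<longlonglongrightarrow> 0"
proof -
  have "(\<lambda>n. (\<Sum>j. f j) - (\<Sum>j<n. f j)) \<longlonglongrightarrow> (\<Sum>j. f j) - (\<Sum>j. f j)"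
    using assms by (intro tendsto_diff_ennreal tendsto_const summable_LIMSEQ) auto
  moreover have "(\<Sum>j. f j) - (\<Sum>j<n. f j) = (\<Sum>j. f (j + n))" for n
  proof -
    have "(\<Sum>j. f j) = (\<Sum>j<n. f j) + (\<Sum>j. f (j + n))"
      using suminf_offset[of f n] by (simp add: add.commute)
    moreover have "(\<Sum>j<n. f j) \<noteq> top"
    proof -
      have "(\<Sum>j<n. f j) \<le> (\<Sum>j. f j)" by (rule sum_le_suminf) auto
      from le_less_trans[OF this assms] show ?thesis unfolding infinity_ennreal_def by (rule less_imp_neq)
    qed
    ultimately show ?thesis by (simp only: ennreal_add_diff_cancel_left not_False_eq_True)
  qed
  ultimately show ?thesis using assms by (simp add: less_top)
qed

context trajectories
begin

lemma zeta_coeff_measurable: "(\<lambda>w. snd w t k) \<in> borel_measurable (borel_of XX)"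
proof -
  have "(\<lambda>w. (if i then Re else Im) ((if False then fst w else snd w) t k)) \<in> borel_measurable (borel_of XX)" for i
    by (rule continuous_map_borel_measurable[OF part_XX])
  from this[of True] this[of False] show ?thesis by (subst borel_measurable_complex_iff) simp_all
qed

lemma tail_finite:
  assumes "f \<in> T2.E"
  shows "(\<Sum>j. bpow \<rho> s2 p p j f) < \<infinity>"
proof -
  have "T2.N f < \<infinity>" by (rule T2.N_finite[OF assms])
  then show ?thesis using p by (auto simp: besov_norm_bpow ennpowr_def less_top split: if_splits)
qed

text \<open>Egorov's argument: the tails of the forcing decrease to 0 pointwise, so cuts can be
  chosen at which they exceed given bounds with small probability. Together with the finite moment
  of the path norm this makes the sets \<open>K m\<close> carry almost all of the mass.\<close>

lemma exhaustion:
  assumes "prob_space M" and X: "X \<in> measurable M (borel_of XX)"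
    and const: "AE \<omega> in M. \<forall>t. snd (X \<omega>) t = snd (X \<omega>) 0"
    and \<delta>: "0 < \<delta>" "\<delta> < 1" and Q: "(\<integral>\<^sup>+\<omega>. path_norm \<rho> \<delta> (fst (X \<omega>)) \<partial>M) < \<infinity>"
  obtains J b Y where "averaged \<rho> s1 s2 p q1 \<delta> J b M Y" "AE \<omega> in M. Y \<omega> = X \<omega>"
proof -
  interpret M: prob_space M by fact
  have Xt: "X \<omega> \<in> topspace XX" if "\<omega> \<in> space M" for \<omega>
    using measurable_space[OF X that] by simp
  define tail where "tail I \<omega> = (\<Sum>j. bpow \<rho> s2 p p (j + I) (snd (X \<omega>) 0))" for I \<omega>
  have zm [measurable]: "(\<lambda>\<omega>. snd (X \<omega>) 0 k) \<in> borel_measurable M" for k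
    by (rule measurable_compose[OF X zeta_coeff_measurable])
  have tm [measurable]: "tail I \<in> borel_measurable M" for I unfolding tail_def by measurable
  have tail0: "tail 0 \<omega> < \<infinity>" and tail_lim: "(\<lambda>I. tail I \<omega>) \<longlonglongrightarrow> 0" if "\<omega> \<in> space M" for \<omega>
  proof -
    have "snd (X \<omega>) 0 \<in> T2.E" using Xt[OF that] by (intro T2.pathsD) (simp add: mem_Times_iff)
    then show "tail 0 \<omega> < \<infinity>" "(\<lambda>I. tail I \<omega>) \<longlonglongrightarrow> 0"
      unfolding tail_def using tail_finite ennreal_tail_tendsto[OF tail_finite] by simp_all
  qed
  have tail_dec: "decseq (\<lambda>I. tail I \<omega>)" for \<omega>
    unfolding tail_def by (intro decseq_SucI ennreal_tail_decreasing)
  have mono: "m \<le> n \<Longrightarrow> ennreal (real n) < y \<Longrightarrow> ennreal (real m) < y" for m n y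
    by (rule le_less_trans[OF ennreal_leI]) auto
  \<comment> \<open>For \<open>i = 0\<close> the whole series is kept and its bound is taken large;
    for positive \<open>i\<close> the bound is fixed at \<open>1 / real i\<close> and the cut is
    moved out.\<close>
  have "\<exists>J b. (i = 0 \<longrightarrow> J = 0) \<and> 0 \<le> b \<and> (i \<noteq> 0 \<longrightarrow> b = 1 / real i) \<and> M.prob {\<omega> \<in> space M. ennreal b < tail J \<omega>} \<le> \<eta>"
    if \<eta>: "\<eta> > 0" for i \<eta>
  proof (cases "i = 0")
    case True
    have "\<exists>n. \<forall>k\<ge>n. M.prob {\<omega> \<in> space M. ennreal (real k) < tail 0 \<omega>} \<le> \<eta>"
    proof (rule M.prob_decseq_small[OF _ _ _ \<eta>])
      show "decseq (\<lambda>k. {\<omega> \<in> space M. ennreal (real k) < tail 0 \<omega>})"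
        unfolding decseq_def by (blast intro: mono)
      show "AE \<omega> in M. \<omega> \<notin> (\<Inter>k. {\<omega> \<in> space M. ennreal (real k) < tail 0 \<omega>})"
      proof (rule AE_I2, rule notI)
        fix \<omega> assume \<omega>: "\<omega> \<in> space M" "\<omega> \<in> (\<Inter>k. {\<omega> \<in> space M. ennreal (real k) < tail 0 \<omega>})"
        obtain k where "tail 0 \<omega> < of_nat k" using ennreal_Ex_less_of_nat[of "tail 0 \<omega>"] tail0[OF \<omega>(1)] by auto
        then show False using \<omega>(2) by (auto simp: ennreal_of_nat_eq_real_of_nat dest: less_asym)
      qed
    qed measurable
    then obtain k where "M.prob {\<omega> \<in> space M. ennreal (real k) < tail 0 \<omega>} \<le> \<eta>" by blast
    then show ?thesis using True by (intro exI[of _ 0] exI[of _ "real k"]) simp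
  next
    case False
    have "\<exists>n. \<forall>k\<ge>n. M.prob {\<omega> \<in> space M. ennreal (1 / real i) < tail k \<omega>} \<le> \<eta>"
    proof (rule M.prob_decseq_small[OF _ _ _ \<eta>])
      show "decseq (\<lambda>k. {\<omega> \<in> space M. ennreal (1 / real i) < tail k \<omega>})"
        using tail_dec unfolding decseq_def by (blast intro: less_le_trans)
      show "AE \<omega> in M. \<omega> \<notin> (\<Inter>k. {\<omega> \<in> space M. ennreal (1 / real i) < tail k \<omega>})"
      proof (rule AE_I2, rule notI)
        fix \<omega> assume \<omega>: "\<omega> \<in> space M" "\<omega> \<in> (\<Inter>k. {\<omega> \<in> space M. ennreal (1 / real i) < tail k \<omega>})"
        have "0 < ennreal (1 / real i)" using False by simp
        from order_tendstoD(2)[OF tail_lim[OF \<omega>(1)] this]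
        obtain k where "tail k \<omega> < ennreal (1 / real i)" by (auto simp: eventually_sequentially)
        then show False using \<omega>(2) by (auto dest: less_asym)
      qed
    qed measurable
    then obtain k where "M.prob {\<omega> \<in> space M. ennreal (1 / real i) < tail k \<omega>} \<le> \<eta>" by blast
    then show ?thesis using False by (intro exI[of _ k] exI[of _ "1 / real i"]) simp
  qed
  \<comment> \<open>For fixed \<open>m\<close> the allowed failure probabilities sum over
    \<open>i\<close> to \<open>1 / real (Suc m)\<close>, which tends to 0 as \<open>m\<close>
    grows.\<close>
  moreover define R where "R m i J b \<longleftrightarrow> (i = 0 \<longrightarrow> J = 0) \<and> 0 \<le> b \<and> (i \<noteq> 0 \<longrightarrow> b = 1 / real i) \<and>
      M.prob {\<omega> \<in> space M. ennreal b < tail J \<omega>} \<le> 1 / real (Suc m) * (1 / 2) ^ Suc i" for m i J b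
  ultimately have "\<exists>J b. R m i J b" for m i by simp
  then obtain J b where "\<And>m i. R m i (J m i) (b m i)" by metis
  then have J: "\<And>m. J m 0 = 0" and b: "\<And>m i. 0 \<le> b m i" "\<And>m i. i \<noteq> 0 \<Longrightarrow> b m i = 1 / real i"
    and small: "\<And>m i. M.prob {\<omega> \<in> space M. ennreal (b m i) < tail (J m i) \<omega>} \<le> 1 / real (Suc m) * (1 / 2) ^ Suc i"
    unfolding R_def by blast+
  interpret TT: tight_trajectories \<rho> s1 s2 p q1 \<delta> J b
  proof
    show "\<exists>i. b m i < \<epsilon>" if \<epsilon>: "\<epsilon> > 0" for m and \<epsilon> :: real
    proof -
      obtain n where "1 / real (Suc n) < \<epsilon>" using nat_approx_posE[OF \<epsilon>] by auto
      then show ?thesis using b(2)[of "Suc n" m] by (intro exI[of _ "Suc n"]) simp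
    qed
  qed (use \<delta> J b in auto)
  let ?U = "\<lambda>m. {\<omega> \<in> space M. ennreal (real m) < path_norm \<rho> \<delta> (fst (X \<omega>))}"
  let ?V = "\<lambda>m i. {\<omega> \<in> space M. ennreal (b m i) < tail (J m i) \<omega>}"
  have pm [measurable]: "(\<lambda>\<omega>. path_norm \<rho> \<delta> (fst (X \<omega>))) \<in> borel_measurable M"
    by (rule measurable_compose[OF X path_norm_measurable])
  have V: "M.prob (\<Union>i. ?V m i) \<le> 1 / real (Suc m)" for m
  proof -
    have s: "(\<lambda>i. 1 / real (Suc m) * (1 / 2) ^ Suc i) sums (1 / real (Suc m))"
      using sums_mult[OF power_half_series, of "1 / real (Suc m)"] by simp
    have sm: "summable (\<lambda>i. M.prob (?V m i))"
      by (rule summable_comparison_test'[OF sums_summable[OF s], of 0]) (use small in auto)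
    have "M.prob (\<Union>i. ?V m i) \<le> (\<Sum>i. M.prob (?V m i))"
      by (rule M.finite_measure_subadditive_countably[OF _ sm]) auto
    also have "\<dots> \<le> (\<Sum>i. 1 / real (Suc m) * (1 / 2) ^ Suc i)"
      by (rule suminf_le[OF small sm sums_summable[OF s]])
    finally show ?thesis using sums_unique[OF s] by simp
  qed
  have U: "\<exists>n. \<forall>k\<ge>n. M.prob (?U k) \<le> \<eta>" if "0 < \<eta>" for \<eta>
  proof (rule M.prob_decseq_small[OF _ _ _ that])
    show "decseq ?U" unfolding decseq_def by (blast intro: mono)
    have "AE \<omega> in M. path_norm \<rho> \<delta> (fst (X \<omega>)) \<noteq> \<infinity>"
      using Q by (intro nn_integral_noteq_infinite) auto
    then show "AE \<omega> in M. \<omega> \<notin> (\<Inter>k. ?U k)"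
    proof eventually_elim
      case (elim \<omega>)
      then obtain k where "path_norm \<rho> \<delta> (fst (X \<omega>)) < of_nat k"
        using ennreal_Ex_less_of_nat[of "path_norm \<rho> \<delta> (fst (X \<omega>))"] by (auto simp: less_top)
      then have "\<omega> \<notin> ?U k" by (auto simp: ennreal_of_nat_eq_real_of_nat dest: less_asym)
      then show ?case by blast
    qed
  qed measurable
  have pre: "{\<omega> \<in> space M. Z \<omega> \<in> A} \<in> M.events" if "Z \<in> measurable M (borel_of XX)" "A \<in> sets (borel_of XX)" for Z A
  proof -
    have "{\<omega> \<in> space M. Z \<omega> \<in> A} = Z -` A \<inter> space M" by blast
    then show ?thesis using measurable_sets[OF that] by (simp only:)
  qed
  have XK: "{\<omega> \<in> space M. X \<omega> \<in> TT.K m} \<in> M.events" for m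
    by (rule pre[OF X TT.K_sets])
  have tight: "\<exists>m. 1 - \<epsilon> \<le> M.prob {\<omega> \<in> space M. X \<omega> \<in> TT.K m}" if \<epsilon>: "\<epsilon> > 0" for \<epsilon> :: real
  proof -
    obtain n where n: "\<And>k. k \<ge> n \<Longrightarrow> M.prob (?U k) \<le> \<epsilon> / 2" using U[of "\<epsilon> / 2"] \<epsilon> by auto
    obtain n' where n': "1 / real (Suc n') < \<epsilon> / 2" using nat_approx_posE[of "\<epsilon> / 2"] \<epsilon> by auto
    define m where "m = max n n'"
    have "1 / real (Suc m) \<le> 1 / real (Suc n')" by (intro divide_left_mono) (auto simp: m_def)
    then have Vm: "M.prob (\<Union>i. ?V m i) \<le> \<epsilon> / 2" using V[of m] n' by linarith
    have UVs: "?U m \<in> M.events" "(\<Union>i. ?V m i) \<in> M.events" by measurable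
    have "M.prob (space M - {\<omega> \<in> space M. X \<omega> \<in> TT.K m}) \<le> M.prob (?U m \<union> (\<Union>i. ?V m i))"
    proof (rule M.finite_measure_mono_AE)
      show "AE \<omega> in M. \<omega> \<in> space M - {\<omega> \<in> space M. X \<omega> \<in> TT.K m} \<longrightarrow> \<omega> \<in> ?U m \<union> (\<Union>i. ?V m i)"
        using const AE_space
      proof eventually_elim
        case (elim \<omega>)
        have "X \<omega> \<in> TT.K m" if "\<omega> \<notin> ?U m \<union> (\<Union>i. ?V m i)"
        proof -
          have "path_norm \<rho> \<delta> (fst (X \<omega>)) \<le> ennreal (real m)" "\<And>i. tail (J m i) \<omega> \<le> ennreal (b m i)"
            using that elim(2) by (auto simp: not_less)
          then show ?thesis
            using elim(1) Xt[OF elim(2)] unfolding TT.K_def Zset_def tail_def by (simp add: mem_Times_iff)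
        qed
        then show ?case by blast
      qed
    qed (use UVs in auto)
    also have "\<dots> \<le> M.prob (?U m) + M.prob (\<Union>i. ?V m i)" by (rule measure_Un_le[OF UVs])
    also have "\<dots> \<le> \<epsilon> / 2 + \<epsilon> / 2" using n[of m] Vm by (intro add_mono) (auto simp: m_def)
    finally show ?thesis using XK[of m] by (intro exI[of _ m]) (simp add: M.prob_compl)
  qed
  have KKs: "{\<omega> \<in> space M. X \<omega> \<in> TT.KK} \<in> M.events"
    by (rule pre[OF X TT.KK_sets])
  have "1 \<le> M.prob {\<omega> \<in> space M. X \<omega> \<in> TT.KK}"
  proof (rule field_le_epsilon)
    fix \<epsilon> :: real assume "\<epsilon> > 0"
    then obtain m where "1 - \<epsilon> \<le> M.prob {\<omega> \<in> space M. X \<omega> \<in> TT.K m}" using tight by blast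
    also have "\<dots> \<le> M.prob {\<omega> \<in> space M. X \<omega> \<in> TT.KK}" by (intro M.finite_measure_mono[OF _ KKs]) auto
    finally show "1 \<le> M.prob {\<omega> \<in> space M. X \<omega> \<in> TT.KK} + \<epsilon>" by simp
  qed
  then have 1: "M.prob {\<omega> \<in> space M. X \<omega> \<in> TT.KK} = 1" using M.prob_le_1 by (intro antisym) auto
  then have AE: "AE \<omega> in M. X \<omega> \<in> TT.KK" using KKs by (subst (asm) M.prob_eq_1) (auto elim: eventually_mono)
  have "{\<omega> \<in> space M. X \<omega> \<in> TT.KK} \<noteq> {}" using 1 by (metis measure_empty zero_neq_one)
  then obtain \<omega>0 where \<omega>0: "\<omega>0 \<in> space M" "X \<omega>0 \<in> TT.KK" by blast
  \<comment> \<open>Outside the null set where the trajectory leaves the compact sets it is replaced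
    by one fixed trajectory in \<open>KK\<close>, so that the requirement holds at every sample
    point.\<close>
  define Y where "Y \<omega> = (if X \<omega> \<in> TT.KK then X \<omega> else X \<omega>0)" for \<omega>
  have YX: "AE \<omega> in M. Y \<omega> = X \<omega>" using AE by eventually_elim (simp only: Y_def if_True)
  have "averaged \<rho> s1 s2 p q1 \<delta> J b M Y"
  proof
    show Y: "Y \<in> measurable M TT.B"
      unfolding Y_def by (rule measurable_If[OF X measurable_const KKs]) (rule measurable_space[OF X \<omega>0(1)])
    show "Y \<omega> \<in> TT.KK" for \<omega> using \<omega>0(2) by (cases "X \<omega> \<in> TT.KK") (simp_all only: Y_def if_True if_False)
    show "\<exists>m. 1 - \<epsilon> \<le> M.prob {\<omega> \<in> space M. Y \<omega> \<in> TT.K m}" if \<epsilon>: "\<epsilon> > 0" for \<epsilon> :: real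
    proof -
      obtain m where "1 - \<epsilon> \<le> M.prob {\<omega> \<in> space M. X \<omega> \<in> TT.K m}" using tight[OF \<epsilon>] by blast
      also have "\<dots> \<le> M.prob {\<omega> \<in> space M. Y \<omega> \<in> TT.K m}"
        using YX by (intro M.finite_measure_mono_AE pre[OF Y TT.K_sets]) (auto elim: eventually_mono)
      finally show ?thesis by blast
    qed
  qed
  then show ?thesis using YX by (rule that)
qed

theorem stationary_limit:
  assumes "prob_space M" and X: "X \<in> measurable M (borel_of XX)"
    and z: "\<And>k. (\<lambda>\<omega>. z \<omega> k) \<in> borel_measurable M" "AE \<omega> in M. snd (X \<omega>) = (\<lambda>_. z \<omega>)"
    and \<delta>: "0 < \<delta>" "\<delta> < 1" and Q: "(\<integral>\<^sup>+\<omega>. path_norm \<rho> \<delta> (fst (X \<omega>)) \<partial>M) < \<infinity>"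
    and \<gamma>: "0 \<le> \<gamma>" "\<gamma> \<le> 2"
    and W: "AE \<omega> in M. \<forall>s t. 0 \<le> s \<and> s \<le> t \<longrightarrow> (\<forall>\<psi>\<in>smooth_torus. weak_form \<nu> \<gamma> (fst (X \<omega>)) (snd (X \<omega>)) s t \<psi>)"
  obtains r \<mu> where "strict_mono r" "prob_space \<mu>" "sets \<mu> = sets (borel_of XX)"
    "weakly_converges XX (\<lambda>n. time_average (borel_of XX) (real (r n) + 1) (\<lambda>t. distr M (borel_of XX) (\<lambda>\<omega>. time_shift t (X \<omega>)))) \<mu>"
    "AE w in \<mu>. \<forall>t. snd w t = snd w 0" "coeff_law \<mu> (\<lambda>w. snd w 0) = coeff_law M z"
    "AE w in \<mu>. \<forall>s t. s \<le> t \<longrightarrow> (\<forall>\<psi>\<in>smooth_torus. weak_form \<nu> \<gamma> (fst w) (snd w) s t \<psi>)"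
    "\<And>s. distr \<mu> (borel_of XX) (time_shift s) = \<mu>"
    "(\<integral>\<^sup>+w. path_norm \<rho> \<delta> (fst w) \<partial>\<mu>) \<le> (\<integral>\<^sup>+\<omega>. path_norm \<rho> \<delta> (fst (X \<omega>)) \<partial>M)"
proof -
  have "AE \<omega> in M. \<forall>t. snd (X \<omega>) t = snd (X \<omega>) 0" using z(2) by eventually_elim simp
  from exhaustion[OF assms(1) X this \<delta> Q]
  obtain J b Y where "averaged \<rho> s1 s2 p q1 \<delta> J b M Y" and YX: "AE \<omega> in M. Y \<omega> = X \<omega>" by blast
  then interpret Y: averaged \<rho> s1 s2 p q1 \<delta> J b M Y by simp
  \<comment> \<open>Averaging over the times \<open>real n + 1\<close> keeps every window
    nondegenerate, including the one for \<open>n = 0\<close>.\<close>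
  have T: "0 < real n + 1" for n by simp
  obtain r \<mu> where r: "strict_mono r" and \<mu>: "prob_space \<mu>" "sets \<mu> = sets Y.B"
    and wc: "weakly_converges XX (\<lambda>n. Y.avg (real (r n) + 1)) \<mu>"
    and closed: "\<And>Z \<epsilon>. Z \<subseteq> Y.KK \<Longrightarrow> (\<And>m. seq_compactin XX (Z \<inter> Y.K m)) \<Longrightarrow> \<epsilon> > 0 \<Longrightarrow>
       eventually (\<lambda>n. measure (Y.avg (real (r n) + 1)) Z \<le> measure \<mu> Z + \<epsilon>) sequentially"
    using Y.prokhorov[where \<mu> = "\<lambda>n. Y.avg (real n + 1)", OF Y.prob_space_avg[OF T] Y.sets_avg Y.avg_tight] by blast
  interpret L: averaged_limit \<rho> s1 s2 p q1 \<delta> J b M Y r \<mu>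
    by (rule averaged_limit.intro[OF Y.averaged_axioms averaged_limit_axioms.intro[OF r \<mu> wc closed]])
  show ?thesis
  proof (rule that[OF r \<mu>])
    show "weakly_converges XX (\<lambda>n. time_average (borel_of XX) (real (r n) + 1) (\<lambda>t. distr M (borel_of XX) (\<lambda>\<omega>. time_shift t (X \<omega>)))) \<mu>"
      using wc YX by (subst Y.time_average_eq[OF T X]) (auto elim: eventually_mono)
    show "AE w in \<mu>. \<forall>t. snd w t = snd w 0" using L.AE_KK by eventually_elim (blast intro: Y.K_const)
    have "coeff_law M (\<lambda>\<omega>. snd (Y \<omega>) 0) = coeff_law M z"
      unfolding coeff_law_def
    proof (rule distr_cong_AE)
      show "AE \<omega> in M. snd (Y \<omega>) 0 = z \<omega>" using YX z(2) by eventually_elim simp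
      show "(\<lambda>\<omega>. snd (Y \<omega>) 0) \<in> measurable M (Pi\<^sub>M UNIV (\<lambda>_. borel))"
        by (rule measurable_PiM_single') (auto intro: measurable_compose[OF Y.X zeta_coeff_measurable])
      show "z \<in> measurable M (Pi\<^sub>M UNIV (\<lambda>_. borel))"
        by (rule measurable_PiM_single') (auto intro: z(1))
    qed auto
    then show "coeff_law \<mu> (\<lambda>w. snd w 0) = coeff_law M z" using L.coeff_law_limit by simp
    show "AE w in \<mu>. \<forall>s t. s \<le> t \<longrightarrow> (\<forall>\<psi>\<in>smooth_torus. weak_form \<nu> \<gamma> (fst w) (snd w) s t \<psi>)"
    proof (rule L.AE_weak_form[OF \<gamma>])
      show "AE \<omega> in M. \<forall>s t. 0 \<le> s \<and> s \<le> t \<longrightarrow> (\<forall>\<psi>\<in>smooth_torus. weak_form \<nu> \<gamma> (fst (Y \<omega>)) (snd (Y \<omega>)) s t \<psi>)"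
        using W YX by eventually_elim simp
    qed
    show "distr \<mu> (borel_of XX) (time_shift s) = \<mu>" for s by (rule L.stationary)
    have "(\<integral>\<^sup>+\<omega>. path_norm \<rho> \<delta> (fst (Y \<omega>)) \<partial>M) = (\<integral>\<^sup>+\<omega>. path_norm \<rho> \<delta> (fst (X \<omega>)) \<partial>M)"
      using YX by (intro nn_integral_cong_AE) (auto elim: eventually_mono)
    then show "(\<integral>\<^sup>+w. path_norm \<rho> \<delta> (fst w) \<partial>\<mu>) \<le> (\<integral>\<^sup>+\<omega>. path_norm \<rho> \<delta> (fst (X \<omega>)) \<partial>M)"
      using L.path_norm_limit[of \<delta>] by simp
  qed
qed

end

theorem theorem4p2:
  fixes \<rho> :: "nat \<Rightarrow> point \<Rightarrow> real" and \<nu> \<gamma> \<kappa> \<alpha> p \<eta> c \<delta> :: real and m :: nat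
  assumes "dyadic_partition \<rho>"
    and "0 \<le> \<nu>" and "0 \<le> \<gamma>" and "\<gamma> < 3 / 2" and "0 < \<kappa>" and "0 < \<alpha>" and "\<alpha> < 1 - 3 * \<kappa>"
    and "2 \<le> p" and "1 / 2 < \<eta>"
    and "0 < c" and "0 < \<delta>" and "\<delta> < 1"
  shows "\<exists>C>0. \<exists>\<delta>'\<in>{0<..<1}. \<exists>m'.
    \<forall>(M :: 'a measure) \<xi> S \<theta>\<^sub>0 \<theta> X.
      prob_space M \<and> white_noise M \<xi> \<and> 4 \<le> S \<and>
      (\<forall>k. (\<lambda>\<omega>. \<theta>\<^sub>0 \<omega> k) \<in> borel_measurable M) \<and>
      (AE \<omega> in M. \<theta>\<^sub>0 \<omega> \<in> besov \<rho> \<eta> \<infinity> \<infinity> \<and> \<theta>\<^sub>0 \<omega> 0 = 0) \<and>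
      (\<forall>l\<ge>1. (\<integral>\<^sup>+\<omega>. (besov_norm \<rho> \<eta> \<infinity> \<infinity> (\<theta>\<^sub>0 \<omega>)) ^ l \<partial>M) < \<infinity>) \<and>
      solution_class \<rho> \<nu> \<gamma> \<kappa> \<alpha> p \<eta> c \<delta> m M \<xi> S \<theta>\<^sub>0 \<theta> X \<longrightarrow>
      (\<exists>(T :: nat \<Rightarrow> real) (M' :: (trajectory \<times> trajectory) measure) \<theta>' \<zeta>'.
        (\<forall>n. 0 < T n) \<and> filterlim T at_top sequentially \<and>
        stationary_solution \<rho> \<nu> \<gamma> \<kappa> p (coeff_law M (\<lambda>\<omega>. Lam \<alpha> (\<xi> \<omega>))) M' \<theta>' \<zeta>' \<and>
        (\<exists>\<tau>\<ge>0. let B = borel_of (trajectory_space \<rho> \<kappa> p) in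
          weakly_converges (trajectory_space \<rho> \<kappa> p)
            (\<lambda>n. time_average B (T n) (\<lambda>t. distr M B (\<lambda>\<omega>. time_shift (t + \<tau>) (X \<omega>))))
            (distr M' B (\<lambda>\<omega>. (\<theta>' \<omega>, \<zeta>' \<omega>)))) \<and>
        (\<integral>\<^sup>+\<omega>. path_norm \<rho> \<delta>' (\<theta>' \<omega>) \<partial>M')
          \<le> ennreal C * (1 + (\<integral>\<^sup>+\<omega>. (besov_norm \<rho> \<eta> \<infinity> \<infinity> (\<theta>\<^sub>0 \<omega>)) ^ m' \<partial>M)))"
proof -
  interpret trajectories \<rho> "- 1 / 2" "- 2 + \<kappa>" p 1
    using assms by unfold_locales auto
  have TS: "trajectory_space \<rho> \<kappa> p = XX" unfolding trajectory_space_def ennreal_1 ..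
  show ?thesis
    unfolding TS
  \<comment> \<open>The moment of the path norm does not increase in the limit, so the constants of
    the solution class serve unchanged, independently of the probability space.\<close>
  proof (intro exI[of _ c] conjI bexI[of _ \<delta>] exI[of _ m] allI impI)
    show "0 < c" "\<delta> \<in> {0<..<1}" using assms by auto
    fix M :: "'a measure" and \<xi> S \<theta>\<^sub>0 \<theta> X
    let ?Z = "\<lambda>l. \<integral>\<^sup>+\<omega>. (besov_norm \<rho> \<eta> \<infinity> \<infinity> (\<theta>\<^sub>0 \<omega>)) ^ l \<partial>M"
    assume H: "prob_space M \<and> white_noise M \<xi> \<and> 4 \<le> S \<and>
      (\<forall>k. (\<lambda>\<omega>. \<theta>\<^sub>0 \<omega> k) \<in> borel_measurable M) \<and>
      (AE \<omega> in M. \<theta>\<^sub>0 \<omega> \<in> besov \<rho> \<eta> \<infinity> \<infinity> \<and> \<theta>\<^sub>0 \<omega> 0 = 0) \<and>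
      (\<forall>l\<ge>1. ?Z l < \<infinity>) \<and> solution_class \<rho> \<nu> \<gamma> \<kappa> \<alpha> p \<eta> c \<delta> m M \<xi> S \<theta>\<^sub>0 \<theta> X"
    have M: "prob_space M" and wn: "white_noise M \<xi>" and S: "4 \<le> S" and Z: "\<forall>l\<ge>1. ?Z l < \<infinity>"
      and sc: "solution_class \<rho> \<nu> \<gamma> \<kappa> \<alpha> p \<eta> c \<delta> m M \<xi> S \<theta>\<^sub>0 \<theta> X"
      using H by - (elim conjE, assumption)+
    have \<xi>: "(\<lambda>\<omega>. \<xi> \<omega> k) \<in> borel_measurable M" for k using wn unfolding white_noise_def by blast
    have X: "X \<in> measurable M (borel_of XX)"
      and sol: "AE \<omega> in M. \<theta> \<omega> (- S) = \<theta>\<^sub>0 \<omega> \<and> (\<forall>t\<ge>-S. \<theta> \<omega> t \<in> distributions) \<and>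
        (\<forall>s t. -S \<le> s \<and> s \<le> t \<longrightarrow> (\<forall>\<psi>\<in>smooth_torus. weak_form \<nu> \<gamma> (\<theta> \<omega>) (\<lambda>_. Lam \<alpha> (\<xi> \<omega>)) s t \<psi>))"
      and X_eq: "AE \<omega> in M. X \<omega> = ((\<lambda>t. \<theta> \<omega> (max t (- S + 4))), (\<lambda>_. Lam \<alpha> (\<xi> \<omega>)))"
      and bound: "(\<integral>\<^sup>+\<omega>. path_norm \<rho> \<delta> (fst (X \<omega>)) \<partial>M) \<le> ennreal c * (1 + ?Z m)"
      using sc unfolding solution_class_def TS by - (elim conjE, assumption)+
    interpret M: prob_space M by fact
    \<comment> \<open>The moments are assumed finite from order 1 on; for \<open>m = 0\<close> the
      integrand is 1.\<close>
    have "?Z m < \<infinity>"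
      using Z[rule_format, of m] M.emeasure_space_1 by (cases "m = 0") auto
    then have Q: "(\<integral>\<^sup>+\<omega>. path_norm \<rho> \<delta> (fst (X \<omega>)) \<partial>M) < \<infinity>"
      using bound by (elim le_less_trans) (simp add: ennreal_mult_less_top less_top)
    have z: "(\<lambda>\<omega>. Lam \<alpha> (\<xi> \<omega>) k) \<in> borel_measurable M" for k
      unfolding Lam_def using \<xi>[of k] by measurable
    have zX: "AE \<omega> in M. snd (X \<omega>) = (\<lambda>_. Lam \<alpha> (\<xi> \<omega>))" using X_eq by eventually_elim simp
    have W: "AE \<omega> in M. \<forall>s t. 0 \<le> s \<and> s \<le> t \<longrightarrow> (\<forall>\<psi>\<in>smooth_torus. weak_form \<nu> \<gamma> (fst (X \<omega>)) (snd (X \<omega>)) s t \<psi>)"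
      using sol X_eq
    proof eventually_elim
      case (elim \<omega>)
      show ?case
      proof (intro allI impI ballI, elim conjE)
        fix s t :: real and \<psi> assume st: "0 \<le> s" "s \<le> t" and \<psi>: "\<psi> \<in> smooth_torus"
        have "weak_form \<nu> \<gamma> (\<theta> \<omega>) (\<lambda>_. Lam \<alpha> (\<xi> \<omega>)) s t \<psi>" using elim(1) st S \<psi> by auto
        moreover have "weak_form \<nu> \<gamma> (fst (X \<omega>)) (snd (X \<omega>)) s t \<psi> = weak_form \<nu> \<gamma> (\<theta> \<omega>) (\<lambda>_. Lam \<alpha> (\<xi> \<omega>)) s t \<psi>"
        proof (rule weak_form_cong[OF st(2)])
          fix r assume "s \<le> r"
          \<comment> \<open>As \<open>4 \<le> S\<close>, the trajectory is frozen only before time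
            0. On nonnegative times it is the solution itself, and \<tau> can be taken to be
            0.\<close>
          then have "max r (- S + 4) = r" using st S by simp
          then show "fst (X \<omega>) r = \<theta> \<omega> r \<and> snd (X \<omega>) r = Lam \<alpha> (\<xi> \<omega>)" using elim(2) by simp
        qed
        ultimately show "weak_form \<nu> \<gamma> (fst (X \<omega>)) (snd (X \<omega>)) s t \<psi>" by simp
      qed
    qed
    have "\<gamma> \<le> 2" using assms(4) by simp
    from stationary_limit[OF M X z zX assms(11,12) Q assms(3) this W]
    obtain r \<mu> where r: "strict_mono r" and \<mu>: "prob_space \<mu>" "sets \<mu> = sets (borel_of XX)"
      and wc: "weakly_converges XX (\<lambda>n. time_average (borel_of XX) (real (r n) + 1)
        (\<lambda>t. distr M (borel_of XX) (\<lambda>\<omega>. time_shift t (X \<omega>)))) \<mu>"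
      and const: "AE w in \<mu>. \<forall>t. snd w t = snd w 0"
      and law: "coeff_law \<mu> (\<lambda>w. snd w 0) = coeff_law M (\<lambda>\<omega>. Lam \<alpha> (\<xi> \<omega>))"
      and W': "AE w in \<mu>. \<forall>s t. s \<le> t \<longrightarrow> (\<forall>\<psi>\<in>smooth_torus. weak_form \<nu> \<gamma> (fst w) (snd w) s t \<psi>)"
      and stat: "\<And>s. distr \<mu> (borel_of XX) (time_shift s) = \<mu>"
      and norm: "(\<integral>\<^sup>+w. path_norm \<rho> \<delta> (fst w) \<partial>\<mu>) \<le> (\<integral>\<^sup>+\<omega>. path_norm \<rho> \<delta> (fst (X \<omega>)) \<partial>M)" by blast
    have id: "distr \<mu> (borel_of XX) (\<lambda>w. w) = \<mu>" using \<mu>(2) by (simp add: distr_id2)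
    show "\<exists>(T :: nat \<Rightarrow> real) (M' :: (trajectory \<times> trajectory) measure) \<theta>' \<zeta>'.
        (\<forall>n. 0 < T n) \<and> filterlim T at_top sequentially \<and>
        stationary_solution \<rho> \<nu> \<gamma> \<kappa> p (coeff_law M (\<lambda>\<omega>. Lam \<alpha> (\<xi> \<omega>))) M' \<theta>' \<zeta>' \<and>
        (\<exists>\<tau>\<ge>0. let B = borel_of XX in
          weakly_converges XX
            (\<lambda>n. time_average B (T n) (\<lambda>t. distr M B (\<lambda>\<omega>. time_shift (t + \<tau>) (X \<omega>))))
            (distr M' B (\<lambda>\<omega>. (\<theta>' \<omega>, \<zeta>' \<omega>)))) \<and>
        (\<integral>\<^sup>+\<omega>. path_norm \<rho> \<delta> (\<theta>' \<omega>) \<partial>M') \<le> ennreal c * (1 + ?Z m)"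
    \<comment> \<open>The stationary solution is the canonical process: the probability space is the
      trajectory space with the limit law, and the processes are the two projections.\<close>
    proof (rule exI[of _ "\<lambda>n. real (r n) + 1"], rule exI[of _ \<mu>], rule exI[of _ fst], rule exI[of _ snd],
        intro exI[of _ 0] conjI allI)
      show "filterlim (\<lambda>n. real (r n) + 1) at_top sequentially"
        by (rule filterlim_at_top_mono[OF filterlim_compose[OF filterlim_real_sequentially filterlim_subseq[OF r]] always_eventually]) simp
      show "stationary_solution \<rho> \<nu> \<gamma> \<kappa> p (coeff_law M (\<lambda>\<omega>. Lam \<alpha> (\<xi> \<omega>))) \<mu> fst snd"
        unfolding stationary_solution_def Let_def TS prod.collapse
        using \<mu> const law W' stat id by (simp add: measurable_ident_sets)
      show "let B = borel_of XX in weakly_converges XX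
            (\<lambda>n. time_average B (real (r n) + 1) (\<lambda>t. distr M B (\<lambda>\<omega>. time_shift (t + 0) (X \<omega>))))
            (distr \<mu> B (\<lambda>\<omega>. (fst \<omega>, snd \<omega>)))"
        unfolding Let_def prod.collapse add_0_right id by (rule wc)
      show "(\<integral>\<^sup>+\<omega>. path_norm \<rho> \<delta> (fst \<omega>) \<partial>\<mu>) \<le> ennreal c * (1 + ?Z m)"
        by (rule order_trans[OF norm bound])
    qed auto
  qed
qed

end
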